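(* Let $\mathbb{B}=\mathcal{C}([0,1])$ be the space of continuous real-valued functions on $[0,1]$ with the supremum norm $\|\cdot\|$. Let $(\varepsilon_n)_{n\in\mathbb{N}}$ be a (not necessarily stationary) time series of centered random elements $\varepsilon_n=\{\varepsilon_n(s):s\in[0,1]\}$ of $\mathcal{C}([0,1])$, possibly a triangular array $\varepsilon_n=\varepsilon_{n,N}$. Let $q$ be an even integer and $p>q$ a real number, and assume: (i) for some $r\in(0,1/2)$ with $q>1+1/r$, $$\sup_n\mathbb{E}\big[\|\varepsilon_n\|^p\big]<\infty,\qquad \sup_n\mathbb{E}\Big[\Big(\sup_{0<s<t<1}\frac{|\varepsilon_n(s)-\varepsilon_n(t)|}{|s-t|^r}\Big)^p\Big]<\infty;$$ (ii) $(\varepsilon_n)_{n\in\mathbb{N}}$ is $\alpha$-mixing with mixing coefficients satisfying $\alpha(n)\le a\,b^{n}$ for some constants $a>0$ and $b\in(0,1)$; (iii) there is a continuous function $c^\varepsilon:[0,1]^4\to\mathbb{R}$ such that $$c^\varepsilon(x,y,s,t)=\lim_{N\to\infty}\mathbb{E}\big[P_N(x,s)P_N(y,t)\big],\qquad x,y,s,t\in[0,1],$$ where $P_N(x,s)=P_N(x)(s)$ and $P_N$ is the partial sum process of the context. Let $\rho(x)=x^\beta$ with $\beta\in[0,1/2)$ be the polynomial weight function, with $q>(1/2-\beta)^{-1}$. Then $$\{P_N(x):x\in[0,1]\}\overset{d}{\to}\{W(x):x\in[0,1]\}$$ in the Hölder space $\mathcal{C}^\rho([0,1],\mathcal{C}([0,1]))$,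 where $W$ is the centered Gaussian process characterized by the covariance function $c^\varepsilon$, i.e. $\mathbb{E}[W(x)(s)\,W(y)(t)]=c^\varepsilon(x,y,s,t)$.
   Context: Partial sum process: $P_N(x)=N^{-1/2}\sum_{i=1}^{\lfloor xN\rfloor}\varepsilon_i+N^{-1/2}(Nx-\lfloor Nx\rfloor)\varepsilon_{\lfloor Nx\rfloor+1}$ for $x\in[0,1]$, a continuous $\mathcal{C}([0,1])$-valued function of $x$. Hölder space: for a Banach space $(\mathbb{B},\|\cdot\|)$ and $\rho(x)=x^\beta$ (equal to $1$ on $(0,1]$ if $\beta=0$), $\|f\|_\rho=\sup_{x\in[0,1]}\|f(x)\|+\sup_{0\le x<y\le1}\|f(y)-f(x)\|/\rho(y-x)$, and $\mathcal{C}^\rho([0,1],\mathbb{B})$ is the space of continuous $f:[0,1]\to\mathbb{B}$ with $\|f\|_\rho<\infty$ and $\lim_{\delta\downarrow0}\sup_{0\le x<y\le x+\delta\le1}\|f(y)-f(x)\|/\rho(y-x)=0$, normed by $\|\cdot\|_\rho$. $\overset{d}{\to}$ denotes weak convergence in this space as $N\to\infty$. $\alpha$-mixing is in the usual sense: $\alpha(n)=\sup_k\sup\{|\mathbb{P}(A\cap B)-\mathbb{P}(A)\mathbb{P}(B)|:A\in\sigma(\varepsilon_i,i\le k),\,B\in\sigma(\varepsilon_i,i\ge k+n)\}$. In the triangular array case the moment and mixing bounds are uniform in $N$. *)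

theory Defs
  imports "HOL-Probability.Probability"
begin

section \<open>The Banach space of continuous functions on the unit interval\<close>

text \<open>
  The interval is made a type of its own, so that \<open>unit_interval \<Rightarrow>\<^sub>C real\<close> with the library's
  supremum norm is the space of all continuous real functions on it
  (by compactness, boundedness is automatic; see \<open>bcontfun_unit_interval\<close>).
\<close>

typedef unit_interval = "{0..1::real}"
  morphisms real_of_ui ui_of_real
  by (rule exI[of _ 0]) simp

declare [[coercion real_of_ui]]

setup_lifting type_definition_unit_interval

instantiation unit_interval :: metric_space
begin

definition dist_unit_interval :: "unit_interval \<Rightarrow> unit_interval \<Rightarrow> real" where
  "dist_unit_interval x y = \<bar>real_of_ui x - real_of_ui y\<bar>"

definition uniformity_unit_interval :: "(unit_interval \<times> unit_interval) filter" where
  "uniformity_unit_interval = (INF e\<in>{0<..}. principal {(x, y). dist x y < e})"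

definition open_unit_interval :: "unit_interval set \<Rightarrow> bool" where
  "open_unit_interval U \<longleftrightarrow> (\<forall>x\<in>U. \<forall>\<^sub>F (x', y) in uniformity. x' = x \<longrightarrow> y \<in> U)"

instance
proof
  show "(dist x y = 0) = (x = y)" for x y :: unit_interval
    by (simp add: dist_unit_interval_def real_of_ui_inject)
  show "dist x y \<le> dist x z + dist y z" for x y z :: unit_interval
    by (simp add: dist_unit_interval_def)
qed (simp_all add: uniformity_unit_interval_def open_unit_interval_def)

end

lemma compact_UNIV_unit_interval: "compact (UNIV :: unit_interval set)"
proof -
  have "continuous_on {0..1} ui_of_real"
    unfolding continuous_on_iff
    by (auto simp: dist_unit_interval_def ui_of_real_inverse dist_real_def)
  then have "compact (ui_of_real ` {0..1})"
    by (rule compact_continuous_image) simp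
  moreover have "ui_of_real ` {0..1} = UNIV"
    using type_definition.Abs_image[OF type_definition_unit_interval] .
  ultimately show ?thesis by simp
qed

lemma bcontfun_unit_interval:
  "(bcontfun :: (unit_interval \<Rightarrow> 'b::metric_space) set) = {f. continuous_on UNIV f}"
  using compact_continuous_image[OF _ compact_UNIV_unit_interval]
  by (auto simp: bcontfun_def intro: compact_imp_bounded)


section \<open>Hoelder spaces of functions on the unit interval\<close>

text \<open>
  The weight is \<open>\<rho> x = x powr \<beta>\<close>; it is evaluated only at \<open>x > 0\<close>, so \<open>\<beta> = 0\<close> gives \<open>\<rho> = 1\<close>.
  Suprema are formed in \<^typ>\<open>ennreal\<close>, where they may be infinite.
\<close>

definition hoelder_enorm :: "real \<Rightarrow> (unit_interval \<Rightarrow> 'b::real_normed_vector) \<Rightarrow> ennreal" where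
  "hoelder_enorm \<beta> f =
     (SUP x. ennreal (norm (f x))) +
     (SUP (x, y) \<in> {(x, y). real_of_ui x < real_of_ui y}.
        ennreal (norm (f y - f x) / (real_of_ui y - real_of_ui x) powr \<beta>))"

definition hoelder_modulus ::
  "real \<Rightarrow> (unit_interval \<Rightarrow> 'b::real_normed_vector) \<Rightarrow> real \<Rightarrow> ennreal" where
  "hoelder_modulus \<beta> f \<delta> =
     (SUP (x, y) \<in> {(x, y). real_of_ui x < real_of_ui y \<and> real_of_ui y \<le> real_of_ui x + \<delta>
                            \<and> real_of_ui x + \<delta> \<le> 1}.
        ennreal (norm (f y - f x) / (real_of_ui y - real_of_ui x) powr \<beta>))"

definition hoelder_space :: "real \<Rightarrow> (unit_interval \<Rightarrow> 'b::real_normed_vector) set" where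
  "hoelder_space \<beta> =
     {f. continuous_on UNIV f \<and> hoelder_enorm \<beta> f < \<infinity> \<and>
         (hoelder_modulus \<beta> f \<longlongrightarrow> 0) (at_right 0)}"

definition hoelder_norm :: "real \<Rightarrow> (unit_interval \<Rightarrow> 'b::real_normed_vector) \<Rightarrow> real" where
  "hoelder_norm \<beta> f = enn2real (hoelder_enorm \<beta> f)"

definition hoelder_metric :: "real \<Rightarrow> (unit_interval \<Rightarrow> 'b::real_normed_vector) metric" where
  "hoelder_metric \<beta> = metric (hoelder_space \<beta>, \<lambda>f g. hoelder_norm \<beta> (\<lambda>x. f x - g x))"

lemma hoelder_enorm_diff_le:
  fixes f g :: "unit_interval \<Rightarrow> 'b::real_normed_vector"
  shows "hoelder_enorm \<beta> (\<lambda>x. f x - g x) \<le> hoelder_enorm \<beta> f + hoelder_enorm \<beta> g"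
proof -
  let ?S = "{(x, y). real_of_ui x < real_of_ui y}"
  let ?q = "\<lambda>h::unit_interval \<Rightarrow> 'b. \<lambda>(x, y).
    ennreal (norm (h y - h x) / (real_of_ui y - real_of_ui x) powr \<beta>)"
  have sup: "(SUP x. ennreal (norm (f x - g x)))
      \<le> (SUP x. ennreal (norm (f x))) + (SUP x. ennreal (norm (g x)))"
  proof (rule SUP_least)
    fix x
    have "ennreal (norm (f x - g x)) \<le> ennreal (norm (f x)) + ennreal (norm (g x))"
      by (simp add: norm_triangle_ineq4 flip: ennreal_plus)
    also have "\<dots> \<le> (SUP x. ennreal (norm (f x))) + (SUP x. ennreal (norm (g x)))"
      by (intro add_mono SUP_upper) auto
    finally show "ennreal (norm (f x - g x)) \<le> \<dots>" .
  qed
  have "(SUP z\<in>?S. ?q (\<lambda>x. f x - g x) z) \<le> (SUP z\<in>?S. ?q f z) + (SUP z\<in>?S. ?q g z)"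
  proof (rule SUP_least)
    fix z assume z: "z \<in> ?S"
    obtain x y where xy: "z = (x, y)" by (cases z)
    have "norm ((f y - g y) - (f x - g x)) \<le> norm (f y - f x) + norm (g y - g x)"
      using norm_triangle_ineq4[of "f y - f x" "g y - g x"] by (simp add: algebra_simps)
    then have "?q (\<lambda>x. f x - g x) z \<le> ?q f z + ?q g z"
      by (simp add: xy divide_right_mono flip: ennreal_plus add_divide_distrib)
    also have "\<dots> \<le> (SUP z\<in>?S. ?q f z) + (SUP z\<in>?S. ?q g z)"
      by (intro add_mono SUP_upper z)
    finally show "?q (\<lambda>x. f x - g x) z \<le> \<dots>" .
  qed
  from add_mono[OF sup this] show ?thesis
    unfolding hoelder_enorm_def by (simp only: ac_simps)
qed

lemma Metric_space_hoelder:
  "Metric_space (hoelder_space \<beta> :: (unit_interval \<Rightarrow> 'b::real_normed_vector) set)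
     (\<lambda>f g. hoelder_norm \<beta> (\<lambda>x. f x - g x))"
proof
  fix f g h :: "unit_interval \<Rightarrow> 'b"
  show "0 \<le> hoelder_norm \<beta> (\<lambda>x. f x - g x)"
    by (simp add: hoelder_norm_def)
  show "hoelder_norm \<beta> (\<lambda>x. f x - g x) = hoelder_norm \<beta> (\<lambda>x. g x - f x)"
  proof -
    have "norm (f y - g y - (f x - g x)) = norm (g y - f y - (g x - f x))" for x y
      using norm_minus_cancel[of "f y - g y - (f x - g x)"] by (simp add: algebra_simps)
    then show ?thesis by (simp add: hoelder_norm_def hoelder_enorm_def norm_minus_commute)
  qed
  assume f: "f \<in> hoelder_space \<beta>" and g: "g \<in> hoelder_space \<beta>"
  have fin: "hoelder_enorm \<beta> (\<lambda>x. u x - v x) < \<infinity>"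
    if "u \<in> hoelder_space \<beta>" "v \<in> hoelder_space \<beta>" for u v :: "unit_interval \<Rightarrow> 'b"
    using that hoelder_enorm_diff_le[of \<beta> u v]
    by (auto simp: hoelder_space_def intro: le_less_trans)
  show "hoelder_norm \<beta> (\<lambda>x. f x - g x) = 0 \<longleftrightarrow> f = g"
  proof
    assume "hoelder_norm \<beta> (\<lambda>x. f x - g x) = 0"
    with fin[OF f g] have "hoelder_enorm \<beta> (\<lambda>x. f x - g x) = 0"
      by (auto simp: hoelder_norm_def enn2real_eq_0_iff)
    then have "(SUP x. ennreal (norm (f x - g x))) = 0"
      by (simp add: hoelder_enorm_def)
    then have "ennreal (norm (f x - g x)) \<le> 0" for x
      by (metis SUP_upper UNIV_I)
    then show "f = g" by (auto simp: ennreal_eq_0_iff)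
  next
    assume "f = g"
    then show "hoelder_norm \<beta> (\<lambda>x. f x - g x) = 0"
      by (simp add: hoelder_norm_def hoelder_enorm_def case_prod_unfold SUP_constant bot_ennreal)
  qed
  assume h: "h \<in> hoelder_space \<beta>"
  have "hoelder_enorm \<beta> (\<lambda>x. f x - h x)
      \<le> hoelder_enorm \<beta> (\<lambda>x. f x - g x) + hoelder_enorm \<beta> (\<lambda>x. h x - g x)"
    using hoelder_enorm_diff_le[of \<beta> "\<lambda>x. f x - g x" "\<lambda>x. h x - g x"] by simp
  then have "hoelder_norm \<beta> (\<lambda>x. f x - h x)
      \<le> hoelder_norm \<beta> (\<lambda>x. f x - g x) + hoelder_norm \<beta> (\<lambda>x. h x - g x)"
    using fin[OF f g] fin[OF h g] unfolding hoelder_norm_def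
    by (subst enn2real_plus[symmetric]) (auto intro!: enn2real_mono)
  also have "hoelder_norm \<beta> (\<lambda>x. h x - g x) = hoelder_norm \<beta> (\<lambda>x. g x - h x)"
  proof -
    have "norm (h y - g y - (h x - g x)) = norm (g y - h y - (g x - h x))" for x y
      using norm_minus_cancel[of "h y - g y - (h x - g x)"] by (simp add: algebra_simps)
    then show ?thesis by (simp add: hoelder_norm_def hoelder_enorm_def norm_minus_commute)
  qed
  finally show "hoelder_norm \<beta> (\<lambda>x. f x - h x)
      \<le> hoelder_norm \<beta> (\<lambda>x. f x - g x) + hoelder_norm \<beta> (\<lambda>x. g x - h x)" .
qed

lemma mspace_hoelder_metric [simp]: "mspace (hoelder_metric \<beta>) = hoelder_space \<beta>"
  by (simp add: hoelder_metric_def Metric_space.mspace_metric[OF Metric_space_hoelder])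

lemma mdist_hoelder_metric [simp]:
  "mdist (hoelder_metric \<beta>) = (\<lambda>f g. hoelder_norm \<beta> (\<lambda>x. f x - g x))"
  by (simp add: hoelder_metric_def Metric_space.mdist_metric[OF Metric_space_hoelder])


section \<open>Weak convergence in metric spaces\<close>

definition borel_of_metric :: "'s metric \<Rightarrow> 's measure" where
  "borel_of_metric S = sigma (mspace S) {U. openin (mtopology_of S) U}"

definition converges_in_distribution ::
  "'s metric \<Rightarrow> 'a measure \<Rightarrow> (nat \<Rightarrow> 'a \<Rightarrow> 's) \<Rightarrow> 'b measure \<Rightarrow> ('b \<Rightarrow> 's) \<Rightarrow> bool" where
  "converges_in_distribution S M X M' Y \<longleftrightarrow>
     (\<forall>n. X n \<in> measurable M (borel_of_metric S)) \<and>
     Y \<in> measurable M' (borel_of_metric S) \<and>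
     (\<forall>\<Phi>. continuous_map (mtopology_of S) euclideanreal \<Phi> \<longrightarrow>
          (\<exists>B. \<forall>z\<in>mspace S. \<bar>\<Phi> z\<bar> \<le> B) \<longrightarrow>
          (\<lambda>n. \<integral>\<omega>. \<Phi> (X n \<omega>) \<partial>M) \<longlonglongrightarrow> (\<integral>\<omega>. \<Phi> (Y \<omega>) \<partial>M'))"


section \<open>Gaussian processes\<close>

text \<open>The normal law with mean \<open>m\<close> and variance \<open>v \<ge> 0\<close>, degenerate if \<open>v = 0\<close>.\<close>

definition normal_law :: "real \<Rightarrow> real \<Rightarrow> real measure" where
  "normal_law m v =
     (if v = 0 then return borel m
      else density lborel (\<lambda>x. ennreal (normal_density m (sqrt v) x)))"

definition gaussian_process :: "'a measure \<Rightarrow> ('i \<Rightarrow> 'a \<Rightarrow> real) \<Rightarrow> bool" where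
  "gaussian_process M X \<longleftrightarrow>
     (\<forall>t. X t \<in> borel_measurable M) \<and>
     (\<forall>F a. finite F \<longrightarrow>
        (\<exists>m v. v \<ge> 0 \<and> distr M borel (\<lambda>\<omega>. \<Sum>t\<in>F. a t * X t \<omega>) = normal_law m v))"

definition centered_gaussian_process_with_covariance ::
  "'a measure \<Rightarrow> ('i \<Rightarrow> 'a \<Rightarrow> real) \<Rightarrow> ('i \<Rightarrow> 'i \<Rightarrow> real) \<Rightarrow> bool" where
  "centered_gaussian_process_with_covariance M X K \<longleftrightarrow>
     gaussian_process M X \<and>
     (\<forall>t. (\<integral>\<omega>. X t \<omega> \<partial>M) = 0) \<and>
     (\<forall>t u. (\<integral>\<omega>. X t \<omega> * X u \<omega> \<partial>M) = K t u)"


section \<open>Mixing, moments and partial sums\<close>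

text \<open>Sequences are indexed from 1; the value of a sequence at index 0 is never used.\<close>

definition generated_events ::
  "'a measure \<Rightarrow> (nat \<Rightarrow> 'a \<Rightarrow> 'b::topological_space) \<Rightarrow> nat set \<Rightarrow> 'a set set" where
  "generated_events M X I =
     sigma_sets (space M) (\<Union>i\<in>I. {X i -` A \<inter> space M | A. A \<in> sets borel})"

definition alpha_mixing_coeff ::
  "'a measure \<Rightarrow> (nat \<Rightarrow> 'a \<Rightarrow> 'b::topological_space) \<Rightarrow> nat \<Rightarrow> real" where
  "alpha_mixing_coeff M X n =
     (SUP (k, A, B) \<in> {(k, A, B). k \<ge> 1 \<and> A \<in> generated_events M X {1..k}
                                   \<and> B \<in> generated_events M X {k + n..}}.
        \<bar>measure M (A \<inter> B) - measure M A * measure M B\<bar>)"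

text \<open>The \<open>r\<close>-Hoelder seminorm over the open interval, possibly infinite.\<close>

definition hoelder_seminorm :: "real \<Rightarrow> (unit_interval \<Rightarrow>\<^sub>C real) \<Rightarrow> ennreal" where
  "hoelder_seminorm r f =
     (SUP (s, t) \<in> {(s, t). 0 < real_of_ui s \<and> real_of_ui s < real_of_ui t \<and> real_of_ui t < 1}.
        ennreal (\<bar>f s - f t\<bar> / \<bar>real_of_ui s - real_of_ui t\<bar> powr r))"

definition enn_powr :: "ennreal \<Rightarrow> real \<Rightarrow> ennreal" where
  "enn_powr x p = (if x = \<infinity> then \<infinity> else ennreal (enn2real x powr p))"

text \<open>For \<open>N = 0\<close> the process is \<open>0\<close>, because \<open>0 powr (-1/2) = 0\<close>.\<close>

definition partial_sum_process ::
  "nat \<Rightarrow> (nat \<Rightarrow> 'b::real_normed_vector) \<Rightarrow> unit_interval \<Rightarrow> 'b" where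
  "partial_sum_process N e x =
     (real N powr (-1/2)) *\<^sub>R (\<Sum>i = 1..nat \<lfloor>x * real N\<rfloor>. e i) +
     (real N powr (-1/2) * (real N * x - \<lfloor>real N * x\<rfloor>)) *\<^sub>R e (nat \<lfloor>real N * x\<rfloor> + 1)"

end

theory Submission
  imports Defs "HOL-Probability.Probability" "HOL-Combinatorics.Multiset_Permutations" "HOL-Real_Asymp.Real_Asymp"
begin

text \<open>
  The Hoelder space is never treated as a Banach space. With \<open>\<theta> < 1/2 - 1/q\<close> and \<open>\<gamma> < r - 1/q\<close>, both
  the \<open>P\<^sub>N\<close> and the limit are shown to lie, outside an event of small probability uniform in \<open>N\<close>, in
  a set of functions vanishing at \<open>0\<close> that are \<open>\<theta>\<close>-Hoelder in the time \<open>x\<close> and \<open>\<gamma>\<close>-Hoelder in the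
  space variable \<open>s\<close>. Such a set is compact for pointwise convergence and, as \<open>\<beta> < \<theta>\<close>, pointwise
  convergence on it implies convergence in the \<open>\<beta>\<close>-norm. By Stone-Weierstrass a continuous functional is
  uniformly approximated there by trigonometric polynomials in finitely many values, which
  reduces the claim to convergence of characteristic functions.

  The uniform bound comes from the \<open>q\<close>-th moments of the increments of \<open>P\<^sub>N\<close> over dyadic rectangles, by a
  two-parameter chaining. Geometric mixing bounds the \<open>q\<close>-th moment of a sum of \<open>m\<close> terms by a multiple of \<open>m\<close>
  to the power \<open>q/2\<close> when moments of order \<open>p > q\<close> exist: split the index tuple of a mixed
  moment at its largest gap. Characteristic functions converge by Bernstein's method of big and small
  blocks. The limit exists since its covariance, being a limit of covariances, is positive
  semidefinite: a Cholesky factorisation gives a Gaussian process on the dyadics, to which the same chaining applies.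
\<close>

section \<open>Covariance inequalities for mixing arrays\<close>

text \<open>The thresholds for \<theta> and \<gamma> are those at which Markov's inequality survives
  a union bound. The increment of the process over a dyadic time interval of level \<open>m\<close>
  has a \<open>q\<close>-th moment of order \<open>2 powr (- m * q / 2)\<close>, there are
  \<open>2 ^ m\<close> such intervals, and the bounds for exceeding
  \<open>2 powr (- m * \<theta>)\<close> are summable in \<open>m\<close> exactly if
  \<open>\<theta> < 1/2 - 1/q\<close>; the condition \<open>\<gamma> < r - 1/q\<close> arises in the
  same way. The hypotheses on \<open>q\<close> leave room for \<beta> < \<theta> and \<gamma> > 0.
  The Borel sets of the Hoelder space are reached from point evaluations by piecewise linear
  interpolation, which converges in the \<beta>-norm because the modulus in the definition of the
  space vanishes. Sums with deterministic weights depending on time and row are again adapted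
  arrays, so a single moment bound, uniform in the row, serves time increments, rectangles and
  blocks, and a single limit theorem serves all finite-dimensional laws.\<close>

locale mixing_array = prob_space M for M :: "'a measure" +
  fixes lo hi :: "'r \<Rightarrow> nat \<Rightarrow> 'a measure" and a b :: real
  assumes subalg_lo: "subalgebra M (lo N k)"
    and subalg_hi: "subalgebra M (hi N k)"
    and lo_mono: "k \<le> l \<Longrightarrow> sets (lo N k) \<subseteq> sets (lo N l)"
    and hi_anti: "k \<le> l \<Longrightarrow> sets (hi N l) \<subseteq> sets (hi N k)"
    and a_pos: "0 < a" and b_pos: "0 < b" and b_less: "b < 1"
    and mixing: "A \<in> sets (lo N k) \<Longrightarrow> B \<in> sets (hi N (k + n)) \<Longrightarrow>
      \<bar>prob (A \<inter> B) - prob A * prob B\<bar> \<le> a * b ^ n"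
begin

lemma space_lo [simp]: "space (lo N k) = space M"
  using subalg_lo by (simp add: subalgebra_def)

lemma space_hi [simp]: "space (hi N k) = space M"
  using subalg_hi by (simp add: subalgebra_def)

lemma measurable_lo_M: "X \<in> measurable (lo N k) L \<Longrightarrow> X \<in> measurable M L"
  using measurable_from_subalg[OF subalg_lo] .

lemma measurable_hi_M: "X \<in> measurable (hi N k) L \<Longrightarrow> X \<in> measurable M L"
  using measurable_from_subalg[OF subalg_hi] .

lemma measurable_lo_mono:
  assumes "X \<in> measurable (lo N k) L" "k \<le> l" shows "X \<in> measurable (lo N l) L"
  by (rule measurable_from_subalg[OF _ assms(1)]) (use lo_mono assms(2) in \<open>auto simp: subalgebra_def\<close>)

lemma measurable_hi_anti:
  assumes "X \<in> measurable (hi N l) L" "k \<le> l" shows "X \<in> measurable (hi N k) L"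
  by (rule measurable_from_subalg[OF _ assms(1)]) (use hi_anti assms(2) in \<open>auto simp: subalgebra_def\<close>)

definition cov :: "('a \<Rightarrow> real) \<Rightarrow> ('a \<Rightarrow> real) \<Rightarrow> real" where
  "cov X Z = expectation (\<lambda>\<omega>. X \<omega> * Z \<omega>) - expectation X * expectation Z"

lemma integrable_bounded:
  fixes X :: "'a \<Rightarrow> real"
  assumes "X \<in> borel_measurable M" "\<And>\<omega>. \<omega> \<in> space M \<Longrightarrow> \<bar>X \<omega>\<bar> \<le> A"
  shows "integrable M X"
  by (rule integrable_const_bound[of _ A]) (use assms in auto)

lemma abs_expectation_le:
  fixes X :: "'a \<Rightarrow> real"
  assumes "X \<in> borel_measurable M" "\<And>\<omega>. \<omega> \<in> space M \<Longrightarrow> \<bar>X \<omega>\<bar> \<le> A"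
  shows "\<bar>expectation X\<bar> \<le> A"
proof -
  have i: "integrable M X" by (rule integrable_bounded[OF assms])
  have "\<bar>expectation X\<bar> \<le> expectation (\<lambda>\<omega>. \<bar>X \<omega>\<bar>)" by (rule integral_abs_bound)
  also have "\<dots> \<le> expectation (\<lambda>_. A)"
    by (rule integral_mono) (use i assms in auto)
  finally show ?thesis by (simp add: prob_space)
qed

lemma abs_expectation_mono:
  fixes X :: "'a \<Rightarrow> real"
  assumes "integrable M X" "integrable M Y" "\<And>\<omega>. \<omega> \<in> space M \<Longrightarrow> \<bar>X \<omega>\<bar> \<le> Y \<omega>"
  shows "\<bar>expectation X\<bar> \<le> expectation Y"
  by (rule order_trans[OF integral_abs_bound integral_mono]) (use assms in auto)

text \<open>On the unit interval this rounds down to a multiple of \<open>1 / m\<close>. Written as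
  an average of indicators of superlevel sets, it turns covariances of rounded variables into
  averages of the event differences that the mixing condition controls.\<close>

definition level_floor :: "nat \<Rightarrow> real \<Rightarrow> real" where
  "level_floor m x = (1 / real m) * (\<Sum>k=1..m. if real k / real m \<le> x then 1 else 0)"

lemma level_floor:
  assumes "m > 0" "0 \<le> x" "x \<le> 1"
  shows "0 \<le> level_floor m x" "level_floor m x \<le> 1" "\<bar>x - level_floor m x\<bar> \<le> 1 / real m"
proof -
  define j where "j = nat \<lfloor>real m * x\<rfloor>"
  have jj: "real j \<le> real m * x" "real m * x < real j + 1"
    using assms unfolding j_def by simp_all
  have "j \<le> m" using jj(1) mult_left_le[of x "real m"] assms by linarith
  have "{k\<in>{1..m}. real k / real m \<le> x} = {1..j}"
  proof (rule set_eqI, rule iffI)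
    fix k assume k: "k \<in> {k\<in>{1..m}. real k / real m \<le> x}"
    hence "real k \<le> real m * x" using assms by (simp add: field_simps)
    hence "real k < real j + 1" using jj by linarith
    thus "k \<in> {1..j}" using k by simp
  next
    fix k assume k: "k \<in> {1..j}"
    hence "real k \<le> real m * x" using jj(1) by (meson atLeastAtMost_iff of_nat_le_iff order_trans)
    thus "k \<in> {k\<in>{1..m}. real k / real m \<le> x}" using k \<open>j \<le> m\<close> assms by (simp add: field_simps)
  qed
  hence "(\<Sum>k=1..m. if real k / real m \<le> x then 1 else 0) = real j"
    by (simp add: sum.If_cases Int_def conj_commute)
  hence eq: "level_floor m x = real j / real m" by (simp add: level_floor_def)
  show "0 \<le> level_floor m x" "level_floor m x \<le> 1" unfolding eq using \<open>j \<le> m\<close> assms by simp_all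
  have "x - real j / real m = (real m * x - real j) / real m" using assms by (simp add: field_simps)
  moreover have "\<bar>(real m * x - real j) / real m\<bar> \<le> 1 / real m"
    unfolding abs_divide using jj assms by (intro frac_le) (auto simp: abs_le_iff)
  ultimately show "\<bar>x - level_floor m x\<bar> \<le> 1 / real m" using eq by simp
qed

lemma level_floor_measurable [measurable]: "level_floor m \<in> borel_measurable borel"
  unfolding level_floor_def[abs_def] by measurable

text \<open>Both variables are averages of \<open>m\<close> indicators, so bilinearity expresses the
  covariance as an average over \<open>m * m\<close> pairs of events. Averaging instead of summing
  keeps the bound independent of \<open>m\<close>.\<close>

lemma cov_level_floor_le:
  assumes X: "X \<in> borel_measurable (lo N k)" and Z: "Z \<in> borel_measurable (hi N (k + n))" and m: "m > 0"
  shows "\<bar>cov (\<lambda>\<omega>. level_floor m (X \<omega>)) (\<lambda>\<omega>. level_floor m (Z \<omega>))\<bar> \<le> a * b ^ n"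
proof -
  define A where "A i = {\<omega> \<in> space M. real i / real m \<le> X \<omega>}" for i
  define B where "B i = {\<omega> \<in> space M. real i / real m \<le> Z \<omega>}" for i
  have A: "A i \<in> sets (lo N k)" for i
    unfolding A_def using borel_measurable_le[OF borel_measurable_const X, of "real i / real m"] by simp
  have B: "B i \<in> sets (hi N (k + n))" for i
    unfolding B_def using borel_measurable_le[OF borel_measurable_const Z, of "real i / real m"] by simp
  have AM [measurable]: "A i \<in> sets M" for i using A subalg_lo by (auto simp: subalgebra_def)
  have BM [measurable]: "B i \<in> sets M" for i using B subalg_hi by (auto simp: subalgebra_def)
  have e1: "expectation (\<lambda>\<omega>. level_floor m (Y \<omega>)) = (1 / m) * (\<Sum>i=1..m. prob {\<omega> \<in> space M. real i / real m \<le> Y \<omega>})"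
    if [measurable]: "Y \<in> borel_measurable M" for Y
  proof -
    let ?D = "\<lambda>i. {\<omega> \<in> space M. real i / real m \<le> Y \<omega>}"
    have "expectation (\<lambda>\<omega>. level_floor m (Y \<omega>)) = expectation (\<lambda>\<omega>. (1/m) * (\<Sum>i=1..m. indicator (?D i) \<omega>))"
      unfolding level_floor_def
      by (intro Bochner_Integration.integral_cong refl arg_cong2[where f="(*)"] sum.cong) auto
    thus ?thesis by (simp add: Bochner_Integration.integral_sum integrable_bounded[where A=1])
  qed
  have ex: "expectation (\<lambda>\<omega>. level_floor m (X \<omega>)) = (1 / m) * (\<Sum>i=1..m. prob (A i))"
    unfolding A_def by (rule e1[OF measurable_lo_M[OF X]])
  have ez: "expectation (\<lambda>\<omega>. level_floor m (Z \<omega>)) = (1 / m) * (\<Sum>i=1..m. prob (B i))"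
    unfolding B_def by (rule e1[OF measurable_hi_M[OF Z]])
  have exz: "expectation (\<lambda>\<omega>. level_floor m (X \<omega>) * level_floor m (Z \<omega>))
      = (1/m)*(1/m) * (\<Sum>i=1..m. \<Sum>j=1..m. prob (A i \<inter> B j))"
  proof -
    have "expectation (\<lambda>\<omega>. level_floor m (X \<omega>) * level_floor m (Z \<omega>))
       = expectation (\<lambda>\<omega>. (1/m)*(1/m) * (\<Sum>i=1..m. \<Sum>j=1..m. indicator (A i \<inter> B j) \<omega>))"
    proof (rule Bochner_Integration.integral_cong, simp)
      fix \<omega> assume w: "\<omega> \<in> space M"
      have 1: "level_floor m (X \<omega>) = (1/m) * (\<Sum>i=1..m. indicator (A i) \<omega>)"
        unfolding level_floor_def using w by (intro arg_cong2[where f="(*)"] sum.cong) (auto simp: A_def)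
      have 2: "level_floor m (Z \<omega>) = (1/m) * (\<Sum>i=1..m. indicator (B i) \<omega>)"
        unfolding level_floor_def using w by (intro arg_cong2[where f="(*)"] sum.cong) (auto simp: B_def)
      show "level_floor m (X \<omega>) * level_floor m (Z \<omega>) = (1/m)*(1/m) * (\<Sum>i=1..m. \<Sum>j=1..m. indicator (A i \<inter> B j) \<omega>)"
        unfolding 1 2 by (simp add: sum_product indicator_inter_arith)
    qed
    thus ?thesis using AM BM by (simp add: Bochner_Integration.integral_sum integrable_bounded[where A=1])
  qed
  have "cov (\<lambda>\<omega>. level_floor m (X \<omega>)) (\<lambda>\<omega>. level_floor m (Z \<omega>))
     = (1/m)*(1/m) * (\<Sum>i=1..m. \<Sum>j=1..m. prob (A i \<inter> B j) - prob (A i) * prob (B j))"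
    unfolding cov_def ex ez exz by (simp add: sum_subtractf sum_product right_diff_distrib diff_divide_distrib)
  also have "\<bar>\<dots>\<bar> \<le> (1/m)*(1/m) * (\<Sum>i=1..m. \<Sum>j=1..m. a * b ^ n)"
    unfolding abs_mult by (intro mult_mono order_trans[OF sum_abs] sum_mono mixing[OF A B]) auto
  also have "\<dots> = a * b ^ n" using m by simp
  finally show ?thesis .
qed

text \<open>\<open>level_floor\<close> is uniformly \<open>1 / m\<close> close to the identity on
  the unit interval, so the bound for rounded variables survives the limit of large \<open>m\<close>
  without loss.\<close>

lemma cov_unit_bounded:
  assumes X: "X \<in> borel_measurable (lo N k)" and Z: "Z \<in> borel_measurable (hi N (k + n))"
    and X01: "\<And>\<omega>. \<omega> \<in> space M \<Longrightarrow> 0 \<le> X \<omega> \<and> X \<omega> \<le> 1"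
    and Z01: "\<And>\<omega>. \<omega> \<in> space M \<Longrightarrow> 0 \<le> Z \<omega> \<and> Z \<omega> \<le> 1"
  shows "\<bar>cov X Z\<bar> \<le> a * b ^ n"
proof (rule field_le_epsilon)
  fix e :: real assume e: "e > 0"
  \<comment> \<open>The mean of the product and the product of the means each change by at most
    \<open>2 / m\<close> under rounding, in total by \<open>4 / m\<close>.\<close>
  obtain m :: nat where m: "4 / e < real m" using reals_Archimedean2 by blast
  hence m0: "m > 0" using e by (metis divide_pos_pos gr0I not_numeral_less_zero of_nat_0 order.asym zero_less_numeral)
  define X' where "X' \<omega> = level_floor m (X \<omega>)" for \<omega>
  define Z' where "Z' \<omega> = level_floor m (Z \<omega>)" for \<omega>
  have [measurable]: "X \<in> borel_measurable M" "Z \<in> borel_measurable M"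
    using measurable_lo_M[OF X] measurable_hi_M[OF Z] by auto
  have [measurable]: "X' \<in> borel_measurable M" "Z' \<in> borel_measurable M"
    unfolding X'_def[abs_def] Z'_def[abs_def] by measurable
  have bx: "0 \<le> X' \<omega>" "X' \<omega> \<le> 1" "\<bar>X \<omega> - X' \<omega>\<bar> \<le> 1/m" if "\<omega> \<in> space M" for \<omega>
    using level_floor[OF m0, of "X \<omega>"] X01[OF that] unfolding X'_def by auto
  have bz: "0 \<le> Z' \<omega>" "Z' \<omega> \<le> 1" "\<bar>Z \<omega> - Z' \<omega>\<bar> \<le> 1/m" if "\<omega> \<in> space M" for \<omega>
    using level_floor[OF m0, of "Z \<omega>"] Z01[OF that] unfolding Z'_def by auto
  have diff: "\<bar>u * v - u' * v'\<bar> \<le> 2 / m" if "\<bar>u - u'\<bar> \<le> 1/m" "\<bar>v - v'\<bar> \<le> 1/m" "\<bar>v\<bar> \<le> 1" "\<bar>u'\<bar> \<le> 1" for u v u' v' :: real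
  proof -
    have "u * v - u' * v' = (u - u') * v + u' * (v - v')" by (simp add: algebra_simps)
    also have "\<bar>\<dots>\<bar> \<le> \<bar>u - u'\<bar> * \<bar>v\<bar> + \<bar>u'\<bar> * \<bar>v - v'\<bar>" by (metis abs_mult abs_triangle_ineq)
    also have "\<dots> \<le> (1/m) * 1 + 1 * (1/m)" using that by (intro add_mono mult_mono) auto
    finally show ?thesis by simp
  qed
  have iX: "integrable M X" "integrable M X'" "integrable M Z" "integrable M Z'"
    using X01 Z01 bx bz by (auto intro!: integrable_bounded[where A=1] simp: abs_le_iff intro: order_trans[of _ 0])
  have b1: "\<bar>X \<omega> * Z \<omega>\<bar> \<le> 1" "\<bar>X' \<omega> * Z' \<omega>\<bar> \<le> 1" if "\<omega> \<in> space M" for \<omega>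
    using X01[OF that] Z01[OF that] bx[OF that] bz[OF that] by (auto simp: abs_mult intro!: mult_le_one)
  have iXZ: "integrable M (\<lambda>\<omega>. X \<omega> * Z \<omega>)" "integrable M (\<lambda>\<omega>. X' \<omega> * Z' \<omega>)"
    by (rule integrable_bounded[where A=1]; use b1 in auto)+
  have "\<bar>expectation (\<lambda>\<omega>. X \<omega> * Z \<omega> - X' \<omega> * Z' \<omega>)\<bar> \<le> 2/m"
  proof (rule abs_expectation_le)
    fix \<omega> assume w: "\<omega> \<in> space M"
    show "\<bar>X \<omega> * Z \<omega> - X' \<omega> * Z' \<omega>\<bar> \<le> 2 / m"
      using bx[OF w] bz[OF w] Z01[OF w] by (intro diff) auto
  qed simp
  hence 1: "\<bar>expectation (\<lambda>\<omega>. X \<omega> * Z \<omega>) - expectation (\<lambda>\<omega>. X' \<omega> * Z' \<omega>)\<bar> \<le> 2/m" using iXZ by simp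
  have "\<bar>expectation (\<lambda>\<omega>. X \<omega> - X' \<omega>)\<bar> \<le> 1/m" "\<bar>expectation (\<lambda>\<omega>. Z \<omega> - Z' \<omega>)\<bar> \<le> 1/m"
    by (rule abs_expectation_le; use bx bz in auto)+
  hence 2: "\<bar>expectation X - expectation X'\<bar> \<le> 1/m" "\<bar>expectation Z - expectation Z'\<bar> \<le> 1/m" using iX by auto
  have "\<bar>expectation Z\<bar> \<le> 1" "\<bar>expectation X'\<bar> \<le> 1"
    by (rule abs_expectation_le; use bx Z01 in \<open>auto simp: abs_le_iff intro: order_trans[of _ 0]\<close>)+
  with 2 have 3: "\<bar>expectation X * expectation Z - expectation X' * expectation Z'\<bar> \<le> 2/m" by (intro diff) auto
  have 4: "\<bar>cov X' Z'\<bar> \<le> a * b ^ n" unfolding X'_def[abs_def] Z'_def[abs_def] by (rule cov_level_floor_le[OF X Z m0])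
  have "4 / real m \<le> e" using m e m0 by (simp add: field_simps)
  with 1 3 4 show "\<bar>cov X Z\<bar> \<le> a * b ^ n + e" unfolding cov_def by (simp add: abs_le_iff)
qed

text \<open>The affine maps from \<open>{-A..A}\<close> and \<open>{-B..B}\<close> onto the unit
  interval contract by \<open>2 * A\<close> and \<open>2 * B\<close>; this is the origin of the
  factor \<open>4 * A * B\<close>.\<close>

lemma cov_bounded:
  assumes X: "X \<in> borel_measurable (lo N k)" and Z: "Z \<in> borel_measurable (hi N (k + n))"
    and XA: "\<And>\<omega>. \<omega> \<in> space M \<Longrightarrow> \<bar>X \<omega>\<bar> \<le> A" and ZB: "\<And>\<omega>. \<omega> \<in> space M \<Longrightarrow> \<bar>Z \<omega>\<bar> \<le> B"
    and A: "A > 0" and B: "B > 0"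
  shows "\<bar>cov X Z\<bar> \<le> 4 * A * B * (a * b ^ n)"
proof -
  define X' where "X' \<omega> = (X \<omega> + A) / (2 * A)" for \<omega>
  define Z' where "Z' \<omega> = (Z \<omega> + B) / (2 * B)" for \<omega>
  have [measurable]: "X \<in> borel_measurable M" "Z \<in> borel_measurable M"
    using measurable_lo_M[OF X] measurable_hi_M[OF Z] by auto
  have iX: "integrable M X" "integrable M Z" using XA ZB by (auto intro!: integrable_bounded)
  have iXZ: "integrable M (\<lambda>\<omega>. X \<omega> * Z \<omega>)"
    by (rule integrable_bounded[where A="A*B"]) (use XA ZB A B in \<open>auto simp: abs_mult intro!: mult_mono\<close>)
  have "\<bar>cov X' Z'\<bar> \<le> a * b ^ n"
  proof (rule cov_unit_bounded)
    show "X' \<in> borel_measurable (lo N k)" "Z' \<in> borel_measurable (hi N (k + n))"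
      unfolding X'_def[abs_def] Z'_def[abs_def] using X Z by auto
    show "0 \<le> X' \<omega> \<and> X' \<omega> \<le> 1" if "\<omega> \<in> space M" for \<omega>
      using XA[OF that] A by (auto simp: X'_def abs_le_iff field_simps)
    show "0 \<le> Z' \<omega> \<and> Z' \<omega> \<le> 1" if "\<omega> \<in> space M" for \<omega>
      using ZB[OF that] B by (auto simp: Z'_def abs_le_iff field_simps)
  qed
  moreover have "cov X' Z' = cov X Z / (4 * A * B)"
  proof -
    have 1: "X' \<omega> * Z' \<omega> = (X \<omega> * Z \<omega> + B * X \<omega> + A * Z \<omega> + A * B) / (4 * A * B)" for \<omega>
      using A B by (simp add: X'_def Z'_def field_simps)
    have "expectation (\<lambda>\<omega>. X' \<omega> * Z' \<omega>) = (expectation (\<lambda>\<omega>. X \<omega> * Z \<omega>) + B * expectation X + A * expectation Z + A * B) / (4 * A * B)"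
      unfolding 1 using iX iXZ by (simp add: prob_space)
    moreover have "expectation X' = (expectation X + A) / (2 * A)" "expectation Z' = (expectation Z + B) / (2 * B)"
      unfolding X'_def Z'_def using iX by (simp_all add: prob_space)
    moreover have "(u + B * x + A * z + A * B) / (4 * A * B) - ((x + A) / (2 * A)) * ((z + B) / (2 * B))
        = (u - x * z) / (4 * A * B)" for u x z :: real
      using A B by (simp add: divide_simps) (simp add: algebra_simps)
    ultimately show ?thesis unfolding cov_def by simp
  qed
  ultimately show ?thesis using A B by (simp add: abs_mult pos_divide_le_eq mult.commute)
qed

text \<open>A covariance inequality of Davydov type, proved by truncation. \<open>X\<close> and
  \<open>Z\<close> are to be thought of as products of \<open>m\<close> and \<open>m'\<close>
  factors with \<open>p\<close>-th moments, hence are cut at \<open>T powr m\<close> and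
  \<open>T powr m'\<close>. The bounded parts contribute a multiple of
  \<open>T powr (m + m') * b ^ n\<close>, the tails a multiple of
  \<open>T powr (m + m' - p)\<close>.\<close>

lemma cov_moment_bounded:
  fixes p m m' D :: real
  assumes X: "X \<in> borel_measurable (lo N k)" and Z: "Z \<in> borel_measurable (hi N (k + n))"
    and m: "m \<ge> 1" "m' \<ge> 1" "m + m' < p" and D: "D \<ge> 1"
    and iX: "integrable M (\<lambda>\<omega>. \<bar>X \<omega>\<bar> powr (p / m))" and EX: "expectation (\<lambda>\<omega>. \<bar>X \<omega>\<bar> powr (p / m)) \<le> D"
    and iZ: "integrable M (\<lambda>\<omega>. \<bar>Z \<omega>\<bar> powr (p / m'))" and EZ: "expectation (\<lambda>\<omega>. \<bar>Z \<omega>\<bar> powr (p / m')) \<le> D"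
  shows "integrable M (\<lambda>\<omega>. X \<omega> * Z \<omega>)"
    and "\<bar>cov X Z\<bar> \<le> (4 * a + 8 * D * D) * (b powr (1 - (m + m') / p)) ^ n"
proof -
  \<comment> \<open>Chosen so that \<open>T powr p * b ^ n = 1\<close>; the truncated parts and the
    tails then have the same order \<open>E\<close>.\<close>
  define T where "T = b powr (- real n / p)"
  have p: "p > 2" using m by linarith
  have T1: "T \<ge> 1"
  proof -
    have "b powr 0 \<le> b powr (- real n / p)"
      by (rule powr_mono') (use b_pos b_less p in auto)
    thus ?thesis using b_pos by (simp add: T_def)
  qed
  define F where "F \<omega> = \<bar>X \<omega>\<bar> powr (p / m)" for \<omega>
  define G where "G \<omega> = \<bar>Z \<omega>\<bar> powr (p / m')" for \<omega>
  have [measurable]: "X \<in> borel_measurable M" "Z \<in> borel_measurable M"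
    using measurable_lo_M[OF X] measurable_hi_M[OF Z] by auto
  define X1 where "X1 \<omega> = (if \<bar>X \<omega>\<bar> \<le> T powr m then X \<omega> else 0)" for \<omega>
  define Z1 where "Z1 \<omega> = (if \<bar>Z \<omega>\<bar> \<le> T powr m' then Z \<omega> else 0)" for \<omega>
  have X1m: "X1 \<in> borel_measurable (lo N k)" unfolding X1_def[abs_def] using X by measurable
  have Z1m: "Z1 \<in> borel_measurable (hi N (k + n))" unfolding Z1_def[abs_def] using Z by measurable
  have [measurable]: "X1 \<in> borel_measurable M" "Z1 \<in> borel_measurable M"
    using measurable_lo_M[OF X1m] measurable_hi_M[OF Z1m] by auto
  define E where "E = T powr (m + m' - p)"
  have tail: "\<bar>x\<bar> \<le> T powr (l - p) * \<bar>x\<bar> powr (p / l)" if "\<bar>x\<bar> > T powr l" "1 \<le> l" "l < p" for x l :: real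
  proof -
    have Tl: "T powr l > 0" using T1 by simp
    have x0: "\<bar>x\<bar> > 0" using that Tl by linarith
    have "\<bar>x\<bar> = \<bar>x\<bar> powr (1 - p / l) * \<bar>x\<bar> powr (p / l)" using x0 by (simp flip: powr_add)
    also have "\<bar>x\<bar> powr (1 - p / l) \<le> (T powr l) powr (1 - p / l)"
      by (rule powr_mono2') (use that Tl in auto)
    also have "(T powr l) powr (1 - p / l) = T powr (l - p)"
      using that by (simp add: powr_powr right_diff_distrib)
    finally show ?thesis by (simp add: mult_right_mono)
  qed
  have Ele: "T powr (l - p) \<le> E" if "l \<le> m + m'" for l
    unfolding E_def using T1 that by (intro powr_mono) auto
  have E0: "E > 0" using T1 by (simp add: E_def)
  have mp: "m < p" "m' < p" using m by auto
  have dX: "\<bar>X \<omega> - X1 \<omega>\<bar> \<le> E * F \<omega>" for \<omega>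
  proof (cases "\<bar>X \<omega>\<bar> \<le> T powr m")
    case False
    hence "\<bar>X \<omega>\<bar> \<le> T powr (m - p) * F \<omega>" unfolding F_def using tail m mp by simp
    also have "\<dots> \<le> E * F \<omega>" by (intro mult_right_mono Ele) (use m in \<open>auto simp: F_def\<close>)
    finally show ?thesis using False by (simp add: X1_def)
  qed (use E0 in \<open>simp add: X1_def F_def\<close>)
  have dZ: "\<bar>Z \<omega> - Z1 \<omega>\<bar> \<le> E * G \<omega>" for \<omega>
  proof (cases "\<bar>Z \<omega>\<bar> \<le> T powr m'")
    case False
    hence "\<bar>Z \<omega>\<bar> \<le> T powr (m' - p) * G \<omega>" unfolding G_def using tail m mp by simp
    also have "\<dots> \<le> E * G \<omega>" by (intro mult_right_mono Ele) (use m in \<open>auto simp: G_def\<close>)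
    finally show ?thesis using False by (simp add: Z1_def)
  qed (use E0 in \<open>simp add: Z1_def G_def\<close>)
  have prod_tail: "\<bar>X \<omega> * Z \<omega>\<bar> \<le> E * (F \<omega> + G \<omega>)"
    if "\<not> (\<bar>X \<omega>\<bar> \<le> T powr m \<and> \<bar>Z \<omega>\<bar> \<le> T powr m')" for \<omega>
  proof -
    \<comment> \<open>A common scale: \<open>\<bar>X \<omega>\<bar> \<le> L powr m\<close> and
      \<open>\<bar>Z \<omega>\<bar> \<le> L powr m'\<close>, while \<open>L > T\<close> makes
      \<open>L powr (m + m' - p)\<close> at most \<open>E\<close>. The remaining
      \<open>L powr p\<close> equals \<open>F \<omega>\<close> or \<open>G \<omega>\<close>.\<close>
    define L where "L = max (\<bar>X \<omega>\<bar> powr (1/m)) (\<bar>Z \<omega>\<bar> powr (1/m'))"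
    have L0: "L \<ge> 0" unfolding L_def by (simp add: le_max_iff_disj)
    have inv: "(T < \<bar>x\<bar> powr (1/l))" if "\<bar>x\<bar> > T powr l" "1 \<le> l" for x l :: real
    proof -
      have "(T powr l) powr (1/l) < \<bar>x\<bar> powr (1/l)" using that T1 by (intro powr_less_mono2) auto
      thus ?thesis using T1 that by (simp add: powr_powr)
    qed
    have LT: "L > T" using that inv[of m "X \<omega>"] inv[of m' "Z \<omega>"] m by (auto simp: L_def less_max_iff_disj)
    have L1: "L > 0" using LT T1 by linarith
    have "\<bar>X \<omega>\<bar> = (\<bar>X \<omega>\<bar> powr (1/m)) powr m" using m by (simp add: powr_powr)
    also have "\<dots> \<le> L powr m" by (rule powr_mono2) (use m in \<open>auto simp: L_def\<close>)
    finally have a1: "\<bar>X \<omega>\<bar> \<le> L powr m" .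
    have "\<bar>Z \<omega>\<bar> = (\<bar>Z \<omega>\<bar> powr (1/m')) powr m'" using m by (simp add: powr_powr)
    also have "\<dots> \<le> L powr m'" by (rule powr_mono2) (use m in \<open>auto simp: L_def\<close>)
    finally have a2: "\<bar>Z \<omega>\<bar> \<le> L powr m'" .
    have "\<bar>X \<omega> * Z \<omega>\<bar> \<le> L powr m * L powr m'" unfolding abs_mult using a1 a2 by (intro mult_mono) auto
    also have "\<dots> = L powr (m + m' - p) * L powr p" by (simp flip: powr_add)
    also have "\<dots> \<le> E * L powr p" unfolding E_def
      by (intro mult_right_mono powr_mono2') (use m LT T1 in auto)
    also have "L powr p \<le> F \<omega> + G \<omega>"
      using m by (auto simp: L_def max_def F_def G_def powr_powr)
    finally show ?thesis using E0 by simp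
  qed
  have dXZ: "\<bar>X \<omega> * Z \<omega> - X1 \<omega> * Z1 \<omega>\<bar> \<le> E * (F \<omega> + G \<omega>)" for \<omega>
  proof (cases "\<bar>X \<omega>\<bar> \<le> T powr m \<and> \<bar>Z \<omega>\<bar> \<le> T powr m'")
    case False
    thus ?thesis using prod_tail[OF False] by (auto simp: X1_def Z1_def)
  qed (use E0 in \<open>simp add: X1_def Z1_def F_def G_def\<close>)
  have iF: "integrable M F" "integrable M G" unfolding F_def[abs_def] G_def[abs_def] by (rule iX iZ)+
  have EF: "expectation F \<le> D" "expectation G \<le> D" unfolding F_def[abs_def] G_def[abs_def] by (rule EX EZ)+
  have Tm: "T powr m > 0" "T powr m' > 0" using T1 by auto
  have bX1: "\<bar>X1 \<omega>\<bar> \<le> T powr m" and bZ1: "\<bar>Z1 \<omega>\<bar> \<le> T powr m'" for \<omega> using Tm by (auto simp: X1_def Z1_def)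
  have iX1: "integrable M X1" "integrable M Z1" by (rule integrable_bounded; use bX1 bZ1 in auto)+
  have iXZ1: "integrable M (\<lambda>\<omega>. X1 \<omega> * Z1 \<omega>)"
    by (rule integrable_bounded[where A="T powr m * T powr m'"]) (use bX1 bZ1 in \<open>auto simp: abs_mult intro!: mult_mono\<close>)
  have idX: "integrable M (\<lambda>\<omega>. X \<omega> - X1 \<omega>)"
    by (rule Bochner_Integration.integrable_bound[where f="\<lambda>\<omega>. E * F \<omega>"]) (use iF dX in \<open>auto intro: order_trans[OF _ abs_ge_self]\<close>)
  have idZ: "integrable M (\<lambda>\<omega>. Z \<omega> - Z1 \<omega>)"
    by (rule Bochner_Integration.integrable_bound[where f="\<lambda>\<omega>. E * G \<omega>"]) (use iF dZ in \<open>auto intro: order_trans[OF _ abs_ge_self]\<close>)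
  have idXZ: "integrable M (\<lambda>\<omega>. X \<omega> * Z \<omega> - X1 \<omega> * Z1 \<omega>)"
    by (rule Bochner_Integration.integrable_bound[where f="\<lambda>\<omega>. E * (F \<omega> + G \<omega>)"]) (use iF dXZ in \<open>auto intro: order_trans[OF _ abs_ge_self]\<close>)
  have iX': "integrable M X" using Bochner_Integration.integrable_add[OF idX iX1(1)] by simp
  have iZ': "integrable M Z" using Bochner_Integration.integrable_add[OF idZ iX1(2)] by simp
  show iXZ: "integrable M (\<lambda>\<omega>. X \<omega> * Z \<omega>)" using Bochner_Integration.integrable_add[OF idXZ iXZ1] by simp
  have 1: "\<bar>expectation X - expectation X1\<bar> \<le> E * D"
  proof -
    have "\<bar>expectation X - expectation X1\<bar> = \<bar>expectation (\<lambda>\<omega>. X \<omega> - X1 \<omega>)\<bar>" using iX' iX1 by simp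
    also have "\<dots> \<le> expectation (\<lambda>\<omega>. E * F \<omega>)"
      by (rule abs_expectation_mono) (use idX iF dX in auto)
    also have "\<dots> \<le> E * D" using EF E0 by simp
    finally show ?thesis .
  qed
  have 2: "\<bar>expectation Z - expectation Z1\<bar> \<le> E * D"
  proof -
    have "\<bar>expectation Z - expectation Z1\<bar> = \<bar>expectation (\<lambda>\<omega>. Z \<omega> - Z1 \<omega>)\<bar>" using iZ' iX1 by simp
    also have "\<dots> \<le> expectation (\<lambda>\<omega>. E * G \<omega>)"
      by (rule abs_expectation_mono) (use idZ iF dZ in auto)
    also have "\<dots> \<le> E * D" using EF E0 by simp
    finally show ?thesis .
  qed
  have 3: "\<bar>expectation (\<lambda>\<omega>. X \<omega> * Z \<omega>) - expectation (\<lambda>\<omega>. X1 \<omega> * Z1 \<omega>)\<bar> \<le> 2 * E * D"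
  proof -
    have "\<bar>expectation (\<lambda>\<omega>. X \<omega> * Z \<omega>) - expectation (\<lambda>\<omega>. X1 \<omega> * Z1 \<omega>)\<bar>
        = \<bar>expectation (\<lambda>\<omega>. X \<omega> * Z \<omega> - X1 \<omega> * Z1 \<omega>)\<bar>" using iXZ iXZ1 by simp
    also have "\<dots> \<le> expectation (\<lambda>\<omega>. E * (F \<omega> + G \<omega>))"
      by (rule abs_expectation_mono) (use idXZ iF dXZ in auto)
    also have "\<dots> \<le> E * (D + D)" using EF E0 iF by simp
    finally show ?thesis by simp
  qed
  have le1: "\<bar>x\<bar> \<le> 1 + \<bar>x\<bar> powr l" if "l \<ge> 1" for x l :: real
  proof (cases "\<bar>x\<bar> \<le> 1")
    case False
    hence "\<bar>x\<bar> powr 1 \<le> \<bar>x\<bar> powr l" using that by (intro powr_mono) auto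
    thus ?thesis using False by simp
  qed (simp add: add_increasing2)
  have pm: "p / m \<ge> 1" "p / m' \<ge> 1" using mp m by auto
  have 4: "\<bar>expectation Z\<bar> \<le> 1 + D"
  proof -
    have "\<bar>expectation Z\<bar> \<le> expectation (\<lambda>\<omega>. 1 + G \<omega>)"
      by (rule abs_expectation_mono) (use iZ' iF le1[OF pm(2), of "Z _", folded G_def] in auto)
    thus ?thesis using EF iF by (simp add: prob_space)
  qed
  have 5: "\<bar>expectation X1\<bar> \<le> 1 + D"
  proof -
    have "\<bar>X1 \<omega>\<bar> \<le> 1 + F \<omega>" for \<omega> using le1[OF pm(1), of "X \<omega>"] by (auto simp: X1_def F_def)
    hence "\<bar>expectation X1\<bar> \<le> expectation (\<lambda>\<omega>. 1 + F \<omega>)"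
      by (intro abs_expectation_mono) (use iX1 iF in auto)
    thus ?thesis using EF iF by (simp add: prob_space)
  qed
  have 6: "\<bar>expectation X * expectation Z - expectation X1 * expectation Z1\<bar> \<le> 2 * (E * D) * (1 + D)"
  proof -
    have "expectation X * expectation Z - expectation X1 * expectation Z1
       = (expectation X - expectation X1) * expectation Z + expectation X1 * (expectation Z - expectation Z1)"
      by (simp add: algebra_simps)
    also have "\<bar>\<dots>\<bar> \<le> \<bar>expectation X - expectation X1\<bar> * \<bar>expectation Z\<bar> + \<bar>expectation X1\<bar> * \<bar>expectation Z - expectation Z1\<bar>"
      by (metis abs_mult abs_triangle_ineq)
    also have "\<dots> \<le> (E * D) * (1 + D) + (1 + D) * (E * D)"
      by (intro add_mono mult_mono 1 2 4 5) (use E0 D in auto)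
    finally show ?thesis by (simp add: algebra_simps)
  qed
  have 7: "\<bar>cov X1 Z1\<bar> \<le> 4 * T powr m * T powr m' * (a * b ^ n)"
    by (rule cov_bounded[OF X1m Z1m bX1 bZ1 Tm])
  have e1: "E = (b powr (1 - (m + m') / p)) ^ n"
  proof -
    have "E = b powr ((- real n / p) * (m + m' - p))" by (simp add: E_def T_def powr_powr)
    also have "(- real n / p) * (m + m' - p) = (1 - (m + m') / p) * real n" using p by (simp add: field_simps)
    finally show ?thesis using b_pos by (simp add: powr_powr flip: powr_realpow)
  qed
  have e2: "T powr m * T powr m' * b ^ n = E"
  proof -
    have "T powr p = b powr (- real n)" using p by (simp add: T_def powr_powr)
    hence "b ^ n = T powr (- p)" using b_pos T1 by (simp add: powr_minus flip: powr_realpow)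
    thus ?thesis by (simp add: E_def flip: powr_add)
  qed
  have "\<bar>cov X Z\<bar> \<le> \<bar>cov X1 Z1\<bar> + 2 * E * D + 2 * (E * D) * (1 + D)"
    using 3 6 unfolding cov_def by linarith
  also have "\<dots> \<le> 4 * a * E + 2 * E * D + 2 * (E * D) * (1 + D)"
  proof -
    have "4 * T powr m * T powr m' * (a * b ^ n) = 4 * a * (T powr m * T powr m' * b ^ n)"
      by (simp only: mult_ac)
    thus ?thesis using 7 unfolding e2 by linarith
  qed
  also have "\<dots> = E * (4 * a + 4 * D + 2 * D * D)" by (simp add: algebra_simps)
  also have "\<dots> \<le> E * (4 * a + 8 * D * D)"
  proof (rule mult_left_mono)
    have "D \<le> D * D" using D by simp
    thus "4 * a + 4 * D + 2 * D * D \<le> 4 * a + 8 * D * D"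
      unfolding mult.assoc using D by linarith
  qed (use E0 in simp)
  finally show "\<bar>cov X Z\<bar> \<le> (4 * a + 8 * D * D) * (b powr (1 - (m + m') / p)) ^ n"
    by (simp add: e1 mult.commute)
qed

end

section \<open>Moments of sums of mixing arrays\<close>

lemma abs_prod_list_le_power:
  fixes y :: "'b \<Rightarrow> real"
  assumes "\<And>i. i \<in> set l \<Longrightarrow> \<bar>y i\<bar> \<le> m"
  shows "\<bar>prod_list (map y l)\<bar> \<le> m ^ length l"
  using assms
proof (induction l)
  case (Cons x l)
  have "\<bar>y x\<bar> * \<bar>prod_list (map y l)\<bar> \<le> m * m ^ length l"
    using Cons by (intro mult_mono) (auto intro: order_trans[OF abs_ge_zero])
  thus ?case by (simp add: abs_mult)
qed simp

text \<open>The product is at most the power of order \<open>length l\<close> of the largest factor,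
  so the left side is at most that factor to the power \<open>p\<close>, which is one of the
  summands.\<close>

lemma abs_prod_list_powr_le:
  fixes y :: "'b \<Rightarrow> real"
  assumes "l \<noteq> []" "p > 0"
  shows "\<bar>prod_list (map y l)\<bar> powr (p / real (length l)) \<le> (\<Sum>i\<leftarrow>l. \<bar>y i\<bar> powr p)"
proof -
  define m where "m = Max ((\<lambda>i. \<bar>y i\<bar>) ` set l)"
  have "m \<in> (\<lambda>i. \<bar>y i\<bar>) ` set l" unfolding m_def using assms by (intro Max_in) auto
  then obtain i where i: "i \<in> set l" "m = \<bar>y i\<bar>" by auto
  have "\<bar>prod_list (map y l)\<bar> \<le> m ^ length l"
    by (rule abs_prod_list_le_power) (auto simp: m_def)
  hence "\<bar>prod_list (map y l)\<bar> powr (p / length l) \<le> (m ^ length l) powr (p / length l)"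
    using assms by (intro powr_mono2) auto
  also have "\<dots> = m powr p"
  proof (cases "m = 0")
    case False
    hence "m > 0" using i by auto
    thus ?thesis using assms by (simp add: powr_powr flip: powr_realpow)
  qed (use assms in auto)
  also have "\<dots> \<le> (\<Sum>i\<leftarrow>l. \<bar>y i\<bar> powr p)"
  proof -
    obtain u v where "l = u @ i # v" using split_list[OF i(1)] by blast
    moreover have "0 \<le> (\<Sum>i\<leftarrow>u. \<bar>y i\<bar> powr p)" "0 \<le> (\<Sum>i\<leftarrow>v. \<bar>y i\<bar> powr p)"
      by (auto intro!: sum_list_nonneg)
    ultimately show ?thesis using i by simp
  qed
  finally show ?thesis .
qed

lemma borel_measurable_prod_list_map:
  fixes Y :: "'i \<Rightarrow> 'a \<Rightarrow> real"
  assumes "\<And>i. i \<in> set l \<Longrightarrow> Y i \<in> borel_measurable L"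
  shows "(\<lambda>\<omega>. prod_list (map (\<lambda>i. Y i \<omega>) l)) \<in> borel_measurable L"
  using assms by (induction l) auto

text \<open>Sorted lists represent multisets of indices; differences of consecutive entries are the
  gaps to which mixing is applied.\<close>

definition sorted_lists :: "nat \<Rightarrow> nat set \<Rightarrow> nat list set" where
  "sorted_lists q I = {l. sorted l \<and> length l = q \<and> set l \<subseteq> I}"

lemma finite_sorted_lists: "finite I \<Longrightarrow> finite (sorted_lists q I)"
  unfolding sorted_lists_def
  by (rule finite_subset[OF _ finite_lists_length_eq[of I q]]) auto

lemma sum_power_diff_le:
  fixes \<theta> :: real assumes "0 < \<theta>" "\<theta> < 1"
  shows "(\<Sum>x\<le>h. \<theta> ^ (h - x)) \<le> 1 / (1 - \<theta>)"
proof (induction h)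
  case (Suc h)
  have "(\<Sum>x\<le>Suc h. \<theta> ^ (Suc h - x)) = \<theta> * (\<Sum>x\<le>h. \<theta> ^ (h - x)) + 1"
    by (simp add: sum_distrib_left Suc_diff_le)
  also have "\<dots> \<le> \<theta> * (1 / (1 - \<theta>)) + 1"
    using Suc assms by (intro add_mono mult_left_mono) auto
  also have "\<dots> = 1 / (1 - \<theta>)" using assms by (simp add: field_simps)
  finally show ?case .
qed (use assms in \<open>simp add: field_simps\<close>)

lemma sorted_lists_Suc:
  "sorted_lists (Suc (Suc q)) I = (\<lambda>(l, x). x # l) ` (SIGMA l:sorted_lists (Suc q) I. {x\<in>I. x \<le> hd l})"
proof (intro equalityI subsetI)
  fix l assume "l \<in> sorted_lists (Suc (Suc q)) I"
  then obtain x y l' where "l = x # y # l'" "sorted (x # y # l')" "length l' = q" "set l \<subseteq> I"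
    by (auto simp: sorted_lists_def length_Suc_conv)
  thus "l \<in> (\<lambda>(l, x). x # l) ` (SIGMA l:sorted_lists (Suc q) I. {x\<in>I. x \<le> hd l})"
    by (auto simp: sorted_lists_def image_iff intro!: bexI[of _ "(y # l', x)"])
next
  fix l assume "l \<in> (\<lambda>(l, x). x # l) ` (SIGMA l:sorted_lists (Suc q) I. {x\<in>I. x \<le> hd l})"
  then obtain x l' where *: "l = x # l'" "l' \<in> sorted_lists (Suc q) I" "x \<in> I" "x \<le> hd l'" by auto
  then obtain y l'' where "l' = y # l''" by (auto simp: sorted_lists_def length_Suc_conv)
  thus "l \<in> sorted_lists (Suc (Suc q)) I" using * by (auto simp: sorted_lists_def)
qed

text \<open>Prepending an index \<open>x\<close> below the current head multiplies the weight by
  \<open>\<theta> ^ (hd l - x)\<close>, and these factors sum to at most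
  \<open>1 / (1 - \<theta>)\<close>. Only one index stays free, hence the single factor
  \<open>card I\<close>.\<close>

lemma sum_sorted_lists_range_le:
  fixes \<theta> :: real assumes \<theta>: "0 < \<theta>" "\<theta> < 1" and I: "finite I"
  shows "(\<Sum>l\<in>sorted_lists (Suc q) I. \<theta> ^ (last l - hd l)) \<le> real (card I) * (1 / (1 - \<theta>)) ^ q"
proof (induction q)
  case 0
  have "sorted_lists (Suc 0) I = (\<lambda>x. [x]) ` I" by (auto simp: sorted_lists_def length_Suc_conv)
  thus ?case by (simp add: sum.reindex inj_on_def)
next
  case (Suc q)
  have "(\<Sum>l\<in>sorted_lists (Suc (Suc q)) I. \<theta> ^ (last l - hd l))
      = (\<Sum>(l, x)\<in>(SIGMA l:sorted_lists (Suc q) I. {x\<in>I. x \<le> hd l}). \<theta> ^ (last (x # l) - x))"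
    unfolding sorted_lists_Suc by (subst sum.reindex) (auto simp: inj_on_def case_prod_unfold)
  also have "\<dots> = (\<Sum>l\<in>sorted_lists (Suc q) I. \<Sum>x\<in>{x\<in>I. x \<le> hd l}. \<theta> ^ (last (x # l) - x))"
    using I by (subst sum.Sigma) (auto simp: finite_sorted_lists)
  also have "\<dots> \<le> (\<Sum>l\<in>sorted_lists (Suc q) I. \<theta> ^ (last l - hd l) * (1 / (1 - \<theta>)))"
  proof (rule sum_mono)
    fix l assume "l \<in> sorted_lists (Suc q) I"
    then obtain y l' where l: "l = y # l'" "sorted l" by (auto simp: sorted_lists_def length_Suc_conv)
    have le: "hd l \<le> last l" using l by (cases l' rule: rev_cases) auto
    have "(\<Sum>x\<in>{x\<in>I. x \<le> hd l}. \<theta> ^ (last (x # l) - x))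
        = (\<Sum>x\<in>{x\<in>I. x \<le> hd l}. \<theta> ^ (last l - hd l) * \<theta> ^ (hd l - x))"
      using le l by (intro sum.cong) (auto simp flip: power_add)
    also have "\<dots> \<le> \<theta> ^ (last l - hd l) * (\<Sum>x\<le>hd l. \<theta> ^ (hd l - x))"
      unfolding sum_distrib_left using \<theta> by (intro sum_mono2) auto
    also have "\<dots> \<le> \<theta> ^ (last l - hd l) * (1 / (1 - \<theta>))"
      using \<theta> by (intro mult_left_mono sum_power_diff_le) auto
    finally show "(\<Sum>x\<in>{x\<in>I. x \<le> hd l}. \<theta> ^ (last (x # l) - x)) \<le> \<theta> ^ (last l - hd l) * (1 / (1 - \<theta>))" .
  qed
  also have "\<dots> = (\<Sum>l\<in>sorted_lists (Suc q) I. \<theta> ^ (last l - hd l)) * (1 / (1 - \<theta>))"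
    by (rule sum_distrib_right[symmetric])
  also have "\<dots> \<le> real (card I) * (1 / (1 - \<theta>)) ^ q * (1 / (1 - \<theta>))"
    using Suc \<theta> by (intro mult_right_mono) auto
  finally show ?case by (simp add: mult.assoc mult.commute)
qed

lemma sorted_range_le_gaps:
  fixes l :: "nat list"
  assumes "l \<noteq> []" "\<And>k. 0 < k \<Longrightarrow> k < length l \<Longrightarrow> l ! k - l ! (k - 1) \<le> G"
  shows "last l \<le> hd l + (length l - 1) * G"
  using assms
proof (induction l)
  case (Cons x l)
  show ?case
  proof (cases l)
    case (Cons y l')
    have "last l \<le> hd l + (length l - 1) * G"
    proof (rule Cons.IH)
      show "l ! k - l ! (k - 1) \<le> G" if "0 < k" "k < length l" for k
        using Cons.prems(2)[of "Suc k"] that by (cases k) auto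
    qed (use Cons in simp)
    moreover have "y - x \<le> G" using Cons.prems(2)[of 1] Cons by simp
    ultimately show ?thesis using Cons by simp
  qed simp
qed simp

text \<open>The range is at most the sum of the \<open>length l - 1\<close> gaps, so it is at most
  that number times the largest of them.\<close>

lemma exists_large_gap:
  fixes l :: "nat list"
  assumes "length l \<ge> 2"
  obtains k where "0 < k" "k < length l" "last l - hd l \<le> (length l - 1) * (l ! k - l ! (k - 1))"
proof -
  define S where "S = (\<lambda>k. l ! k - l ! (k - 1)) ` {1..<length l}"
  have "Max S \<in> S" unfolding S_def using assms by (intro Max_in) auto
  then obtain k where "k \<in> {1..<length l}" "Max S = l ! k - l ! (k - 1)"
    unfolding S_def by (elim imageE)
  hence k: "0 < k" "k < length l" "Max S = l ! k - l ! (k - 1)" by simp_all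
  have "last l \<le> hd l + (length l - 1) * Max S"
    by (rule sorted_range_le_gaps) (use assms in \<open>auto simp: S_def intro!: Max_ge\<close>)
  with k show thesis by (intro that[of k]) simp_all
qed

lemma sum_power_eq_sum_lists:
  fixes y :: "'i \<Rightarrow> real" assumes "finite I"
  shows "(\<Sum>i\<in>I. y i) ^ q = (\<Sum>l\<in>{l. set l \<subseteq> I \<and> length l = q}. prod_list (map y l))"
proof (induction q)
  case 0
  have "{l. set l \<subseteq> I \<and> length l = 0} = {[]}" by auto
  thus ?case by simp
next
  case (Suc q)
  have "{l. set l \<subseteq> I \<and> length l = Suc q} = (\<lambda>(x, l). x # l) ` (I \<times> {l. set l \<subseteq> I \<and> length l = q})"
    by (auto simp: length_Suc_conv image_iff)
  hence "(\<Sum>l\<in>{l. set l \<subseteq> I \<and> length l = Suc q}. prod_list (map y l))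
     = (\<Sum>(x, l)\<in>I \<times> {l. set l \<subseteq> I \<and> length l = q}. y x * prod_list (map y l))"
    by (simp add: sum.reindex inj_on_def case_prod_unfold)
  also have "\<dots> = (\<Sum>i\<in>I. y i) * (\<Sum>i\<in>I. y i) ^ q"
    unfolding Suc sum_product by (simp add: sum.cartesian_product)
  finally show ?case by simp
qed

text \<open>A fibre of \<open>sort\<close> consists of rearrangements of one multiset of size
  \<open>q\<close>, of which there are at most \<open>fact q\<close>.\<close>

lemma sum_lists_sort_le:
  fixes f :: "nat list \<Rightarrow> real"
  assumes I: "finite I" and f: "\<And>l. f l \<ge> 0"
  shows "(\<Sum>l\<in>{l. set l \<subseteq> I \<and> length l = q}. f (sort l)) \<le> fact q * (\<Sum>l\<in>sorted_lists q I. f l)"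
proof -
  let ?S = "{l. set l \<subseteq> I \<and> length l = q}"
  have fin: "finite ?S" using finite_lists_length_eq[OF I] by simp
  have img: "sort ` ?S \<subseteq> sorted_lists q I" by (auto simp: sorted_lists_def)
  have "(\<Sum>l\<in>?S. f (sort l)) = (\<Sum>l'\<in>sort ` ?S. \<Sum>l\<in>{l\<in>?S. sort l = l'}. f (sort l))"
    by (rule sum.image_gen[OF fin])
  also have "\<dots> \<le> (\<Sum>l'\<in>sorted_lists q I. \<Sum>l\<in>{l\<in>?S. sort l = l'}. f (sort l))"
    using img f by (intro sum_mono2 finite_sorted_lists I) (auto intro: sum_nonneg)
  also have "\<dots> \<le> (\<Sum>l'\<in>sorted_lists q I. fact q * f l')"
  proof (rule sum_mono)
    fix l' assume l': "l' \<in> sorted_lists q I"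
    have sub: "{l\<in>?S. sort l = l'} \<subseteq> permutations_of_multiset (mset l')"
    proof
      fix l assume "l \<in> {l\<in>?S. sort l = l'}"
      hence "mset (sort l) = mset l'" by simp
      hence "mset l = mset l'" by simp
      thus "l \<in> permutations_of_multiset (mset l')" by (simp add: permutations_of_multiset_def)
    qed
    have "card (permutations_of_multiset (mset l')) \<le> fact q"
      using l' by (simp add: card_permutations_of_multiset(1) sorted_lists_def)
    hence "card {l\<in>?S. sort l = l'} \<le> fact q"
      using card_mono[OF finite_permutations_of_multiset sub] by linarith
    hence "real (card {l\<in>?S. sort l = l'}) \<le> real (fact q)" by (rule of_nat_mono)
    moreover have "(\<Sum>l\<in>{l\<in>?S. sort l = l'}. f (sort l)) = real (card {l\<in>?S. sort l = l'}) * f l'"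
      by simp
    ultimately show "(\<Sum>l\<in>{l\<in>?S. sort l = l'}. f (sort l)) \<le> fact q * f l'"
      using f[of l'] by (simp only: of_nat_fact mult_right_mono)
  qed
  finally show ?thesis by (simp add: sum_distrib_left)
qed

section \<open>Mixed moments of an adapted sequence\<close>

context mixing_array
begin

text \<open>The typical instance is a function of the element at time \<open>i\<close> alone. Being
  measurable for both sigma-algebras, \<open>Y i\<close> may serve as the end of a past block or as
  the start of a future block.\<close>

definition adapted :: "'r \<Rightarrow> (nat \<Rightarrow> 'a \<Rightarrow> real) \<Rightarrow> bool" where
  "adapted N Y \<longleftrightarrow> (\<forall>i. Y i \<in> borel_measurable (lo N i) \<and> Y i \<in> borel_measurable (hi N i))"

text \<open>Written with \<open>\<kappa> powr p\<close> so that \<kappa> bounds the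
  \<open>p\<close>-norm and scales linearly with \<open>Y\<close>. Centering is part of the
  condition.\<close>

definition moments_le :: "real \<Rightarrow> real \<Rightarrow> (nat \<Rightarrow> 'a \<Rightarrow> real) \<Rightarrow> bool" where
  "moments_le p \<kappa> Y \<longleftrightarrow> (\<forall>i. integrable M (\<lambda>\<omega>. \<bar>Y i \<omega>\<bar> powr p) \<and>
     expectation (\<lambda>\<omega>. \<bar>Y i \<omega>\<bar> powr p) \<le> \<kappa> powr p \<and> expectation (Y i) = 0)"

definition mixed_moment :: "(nat \<Rightarrow> 'a \<Rightarrow> real) \<Rightarrow> nat list \<Rightarrow> real" where
  "mixed_moment Y l = expectation (\<lambda>\<omega>. prod_list (map (\<lambda>i. Y i \<omega>) l))"

lemma adapted_measurable: "adapted N Y \<Longrightarrow> Y i \<in> borel_measurable M"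
  unfolding adapted_def using measurable_lo_M by blast

text \<open>Supplies the moment hypotheses of \<open>cov_moment_bounded\<close>, where a product of
  \<open>m\<close> factors enters with its moment of order \<open>p / m\<close>.\<close>

lemma product_moment:
  assumes Y: "adapted N Y" "moments_le p 1 Y" and l: "l \<noteq> []" and p: "p > 0"
  shows "integrable M (\<lambda>\<omega>. \<bar>prod_list (map (\<lambda>i. Y i \<omega>) l)\<bar> powr (p / real (length l)))"
    and "expectation (\<lambda>\<omega>. \<bar>prod_list (map (\<lambda>i. Y i \<omega>) l)\<bar> powr (p / real (length l))) \<le> real (length l)"
proof -
  have [measurable]: "(\<lambda>\<omega>. prod_list (map (\<lambda>i. Y i \<omega>) l)) \<in> borel_measurable M"
    by (intro borel_measurable_prod_list_map adapted_measurable[OF Y(1)])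
  have i: "integrable M (\<lambda>\<omega>. \<Sum>i\<leftarrow>l. \<bar>Y i \<omega>\<bar> powr p)" for l
    using Y(2) by (induction l) (auto simp: moments_le_def)
  have e: "expectation (\<lambda>\<omega>. \<Sum>i\<leftarrow>l. \<bar>Y i \<omega>\<bar> powr p) \<le> real (length l)" for l
  proof (induction l)
    case (Cons x l)
    have "expectation (\<lambda>\<omega>. \<Sum>i\<leftarrow>x # l. \<bar>Y i \<omega>\<bar> powr p)
       = expectation (\<lambda>\<omega>. \<bar>Y x \<omega>\<bar> powr p) + expectation (\<lambda>\<omega>. \<Sum>i\<leftarrow>l. \<bar>Y i \<omega>\<bar> powr p)"
      using i[of l] Y(2) by (simp add: moments_le_def)
    moreover have "expectation (\<lambda>\<omega>. \<bar>Y x \<omega>\<bar> powr p) \<le> 1" using Y(2) by (simp add: moments_le_def)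
    ultimately show ?case using Cons by simp
  qed simp
  show int: "integrable M (\<lambda>\<omega>. \<bar>prod_list (map (\<lambda>i. Y i \<omega>) l)\<bar> powr (p / real (length l)))"
  proof (rule Bochner_Integration.integrable_bound[OF i[of l]])
    show "AE \<omega> in M. norm (\<bar>prod_list (map (\<lambda>i. Y i \<omega>) l)\<bar> powr (p / real (length l))) \<le> norm (\<Sum>i\<leftarrow>l. \<bar>Y i \<omega>\<bar> powr p)"
      using abs_prod_list_powr_le[OF l p] by (intro AE_I2) (auto intro: order_trans[OF _ abs_ge_self])
  qed simp
  have "expectation (\<lambda>\<omega>. \<bar>prod_list (map (\<lambda>i. Y i \<omega>) l)\<bar> powr (p / real (length l)))
     \<le> expectation (\<lambda>\<omega>. \<Sum>i\<leftarrow>l. \<bar>Y i \<omega>\<bar> powr p)"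
    by (rule integral_mono[OF int i]) (rule abs_prod_list_powr_le[OF l p])
  with e[of l] show "expectation (\<lambda>\<omega>. \<bar>prod_list (map (\<lambda>i. Y i \<omega>) l)\<bar> powr (p / real (length l))) \<le> real (length l)"
    by linarith
qed

lemma integrable_powr_imp_integrable:
  fixes X :: "'a \<Rightarrow> real"
  assumes "X \<in> borel_measurable M" "integrable M (\<lambda>\<omega>. \<bar>X \<omega>\<bar> powr s)" "s \<ge> 1"
  shows "integrable M X"
proof (rule Bochner_Integration.integrable_bound[of M "\<lambda>\<omega>. 1 + \<bar>X \<omega>\<bar> powr s"])
  have "\<bar>x\<bar> \<le> 1 + \<bar>x\<bar> powr s" for x :: real
  proof (cases "\<bar>x\<bar> \<le> 1")
    case False
    hence "\<bar>x\<bar> powr 1 \<le> \<bar>x\<bar> powr s" using assms by (intro powr_mono) auto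
    thus ?thesis using False by simp
  qed (simp add: add_increasing2)
  thus "AE \<omega> in M. norm (X \<omega>) \<le> norm (1 + \<bar>X \<omega>\<bar> powr s)"
    by (auto intro: order_trans[OF _ abs_ge_self])
qed (use assms in auto)

lemma integrable_product:
  assumes Y: "adapted N Y" "moments_le p 1 Y" and p: "real (length l) < p"
  shows "integrable M (\<lambda>\<omega>. prod_list (map (\<lambda>i. Y i \<omega>) l))"
proof (cases "l = []")
  case False
  thus ?thesis
    using p by (intro integrable_powr_imp_integrable[OF _ product_moment(1)[OF Y False]])
      (auto intro!: borel_measurable_prod_list_map adapted_measurable[OF Y(1)] simp: le_divide_eq)
qed simp

text \<open>Cut between positions \<open>k - 1\<close> and \<open>k\<close>, a sorted tuple
  separates into a product measurable for the past of \<open>l ! (k - 1)\<close> and one measurable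
  for the future of \<open>l ! k\<close>. The decay rate is stated with a fixed bound
  \<open>Q\<close> on the length, so that the recursion over shorter tuples keeps one rate.\<close>

lemma mixed_moment_split:
  assumes Y: "adapted N Y" "moments_le p 1 Y" and l: "sorted l" "length l \<le> Q" and Q: "real Q < p"
    and k: "0 < k" "k < length l"
  shows "\<bar>mixed_moment Y l - mixed_moment Y (take k l) * mixed_moment Y (drop k l)\<bar>
     \<le> (4 * a + 8 * real Q * real Q) * (b powr (1 - real Q / p)) ^ (l ! k - l ! (k - 1))"
proof -
  define X where "X \<omega> = prod_list (map (\<lambda>i. Y i \<omega>) (take k l))" for \<omega>
  define Z where "Z \<omega> = prod_list (map (\<lambda>i. Y i \<omega>) (drop k l))" for \<omega>
  let ?n = "l ! k - l ! (k - 1)"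
  have le: "l ! (k - 1) \<le> l ! k" using l k by (intro sorted_nth_mono) auto
  have X: "X \<in> borel_measurable (lo N (l ! (k - 1)))"
    unfolding X_def[abs_def]
  proof (rule borel_measurable_prod_list_map)
    fix i assume "i \<in> set (take k l)"
    then obtain j where "i = l ! j" "j < k" using k by (auto simp: in_set_conv_nth)
    hence "i \<le> l ! (k - 1)" using l k by (auto intro!: sorted_nth_mono)
    thus "Y i \<in> borel_measurable (lo N (l ! (k - 1)))" using Y(1) measurable_lo_mono[of "Y i" N i] by (simp add: adapted_def)
  qed
  have Z: "Z \<in> borel_measurable (hi N (l ! (k - 1) + ?n))"
    unfolding Z_def[abs_def]
  proof (rule borel_measurable_prod_list_map)
    fix i assume "i \<in> set (drop k l)"
    then obtain j where "i = l ! j" "k \<le> j" "j < length l"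
      using k by (auto simp: in_set_conv_nth)
    hence "l ! k \<le> i" using l k by (auto intro!: sorted_nth_mono)
    thus "Y i \<in> borel_measurable (hi N (l ! (k - 1) + ?n))" using Y(1) measurable_hi_anti[of "Y i" N i] le by (simp add: adapted_def)
  qed
  have ne: "take k l \<noteq> []" "drop k l \<noteq> []" using k by auto
  have p0: "p > 0" using Q by linarith
  have len: "length (take k l) = k" "length (drop k l) = length l - k" using k by auto
  have sum: "real k + real (length l - k) = real (length l)" using k by simp
  have "\<bar>cov X Z\<bar> \<le> (4 * a + 8 * real Q * real Q) * (b powr (1 - (real k + real (length l - k)) / p)) ^ ?n"
  proof (rule cov_moment_bounded(2)[OF X Z])
    show "integrable M (\<lambda>\<omega>. \<bar>X \<omega>\<bar> powr (p / real k))" "integrable M (\<lambda>\<omega>. \<bar>Z \<omega>\<bar> powr (p / real (length l - k)))"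
      using product_moment(1)[OF Y ne(1) p0] product_moment(1)[OF Y ne(2) p0] unfolding X_def Z_def len by auto
    show "expectation (\<lambda>\<omega>. \<bar>X \<omega>\<bar> powr (p / real k)) \<le> real Q"
      using product_moment(2)[OF Y ne(1) p0] l k unfolding X_def len by linarith
    show "expectation (\<lambda>\<omega>. \<bar>Z \<omega>\<bar> powr (p / real (length l - k))) \<le> real Q"
      using product_moment(2)[OF Y ne(2) p0] l k unfolding Z_def len by linarith
  qed (use k l Q in auto)
  also have "\<dots> \<le> (4 * a + 8 * real Q * real Q) * (b powr (1 - real Q / p)) ^ ?n"
    unfolding sum using a_pos b_pos b_less l p0
    by (intro mult_left_mono power_mono powr_mono') (auto simp: divide_right_mono)
  finally have "\<bar>cov X Z\<bar> \<le> (4 * a + 8 * real Q * real Q) * (b powr (1 - real Q / p)) ^ ?n" .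
  moreover have "X \<omega> * Z \<omega> = prod_list (map (\<lambda>i. Y i \<omega>) l)" for \<omega>
    unfolding X_def Z_def by (metis append_take_drop_id map_append prod_list.append)
  ultimately show ?thesis unfolding cov_def mixed_moment_def X_def[symmetric] Z_def[symmetric] by simp
qed

text \<open>As \<open>\<theta> ^ Q\<close> is the decay rate, a cut at the largest gap costs at most
  a multiple of \<open>\<theta> ^ (last l - hd l)\<close>, because the range is at most
  \<open>Q\<close> times that gap; summed over tuples this is linear in \<open>card I\<close>. The
  position of the largest gap varies with the tuple, therefore the product terms of all positions
  \<open>k\<close> are added up.\<close>

lemma sum_mixed_moment_recursion:
  assumes Y: "adapted N Y" "moments_le p 1 Y" and I: "finite I" and Q: "real Q < p" "2 \<le> q" "q \<le> Q"
  defines "\<theta> \<equiv> (b powr (1 - real Q / p)) powr (1 / real Q)"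
  shows "(\<Sum>l\<in>sorted_lists q I. \<bar>mixed_moment Y l\<bar>) \<le>
     (\<Sum>k\<in>{1..<q}. (\<Sum>l\<in>sorted_lists k I. \<bar>mixed_moment Y l\<bar>) * (\<Sum>l\<in>sorted_lists (q - k) I. \<bar>mixed_moment Y l\<bar>))
     + (4 * a + 8 * real Q * real Q) * (real (card I) * (1 / (1 - \<theta>)) ^ (q - 1))"
proof -
  let ?m = "mixed_moment Y"
  define c where "c = b powr (1 - real Q / p)"
  define K where "K = 4 * a + 8 * real Q * real Q"
  have p0: "p > 0" using Q by linarith
  have K0: "K > 0" unfolding K_def using a_pos by (simp add: add_pos_nonneg)
  have "b powr (1 - real Q / p) < b powr 0" by (rule powr_less_mono') (use b_pos b_less Q p0 in auto)
  hence c: "0 < c" "c < 1" using b_pos by (auto simp: c_def)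
  have \<theta>: "0 < \<theta>" "\<theta> < 1" "\<theta> ^ Q = c"
  proof -
    show "0 < \<theta>" unfolding \<theta>_def c_def[symmetric] using c by simp
    have "c powr (1 / real Q) < 1 powr (1 / real Q)" using c Q by (intro powr_less_mono2) auto
    thus "\<theta> < 1" unfolding \<theta>_def c_def[symmetric] by simp
    show "\<theta> ^ Q = c" unfolding \<theta>_def c_def[symmetric] using c Q by (simp add: powr_powr flip: powr_realpow)
  qed
  have one: "\<bar>?m l\<bar> \<le> (\<Sum>k\<in>{1..<q}. \<bar>?m (take k l)\<bar> * \<bar>?m (drop k l)\<bar>) + K * \<theta> ^ (last l - hd l)"
    if l: "l \<in> sorted_lists q I" for l
  proof -
    have ll: "sorted l" "length l = q" using l by (auto simp: sorted_lists_def)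
    obtain k where k: "0 < k" "k < length l" "last l - hd l \<le> (length l - 1) * (l ! k - l ! (k - 1))"
      using exists_large_gap[of l] ll Q by auto
    have "\<bar>?m l - ?m (take k l) * ?m (drop k l)\<bar> \<le> K * c ^ (l ! k - l ! (k - 1))"
      unfolding K_def c_def by (rule mixed_moment_split[OF Y ll(1) _ Q(1) k(1,2)]) (use ll Q in simp)
    also have "c ^ (l ! k - l ! (k - 1)) = \<theta> ^ (Q * (l ! k - l ! (k - 1)))"
      by (simp add: power_mult \<theta>)
    also have "K * \<dots> \<le> K * \<theta> ^ (last l - hd l)"
    proof (intro mult_left_mono power_decreasing)
      show "last l - hd l \<le> Q * (l ! k - l ! (k - 1))"
        by (rule order_trans[OF k(3)]) (use ll Q in \<open>intro mult_le_mono1, linarith\<close>)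
    qed (use \<theta> K0 in auto)
    finally have "\<bar>?m l\<bar> \<le> \<bar>?m (take k l)\<bar> * \<bar>?m (drop k l)\<bar> + K * \<theta> ^ (last l - hd l)"
      unfolding abs_mult[symmetric] by linarith
    moreover have "\<bar>?m (take k l)\<bar> * \<bar>?m (drop k l)\<bar> \<le> (\<Sum>k\<in>{1..<q}. \<bar>?m (take k l)\<bar> * \<bar>?m (drop k l)\<bar>)"
      using k ll by (intro member_le_sum[of k "{1..<q}" "\<lambda>k. \<bar>?m (take k l)\<bar> * \<bar>?m (drop k l)\<bar>"]) auto
    ultimately show ?thesis by linarith
  qed
  have "(\<Sum>l\<in>sorted_lists q I. \<bar>?m l\<bar>)
      \<le> (\<Sum>l\<in>sorted_lists q I. (\<Sum>k\<in>{1..<q}. \<bar>?m (take k l)\<bar> * \<bar>?m (drop k l)\<bar>) + K * \<theta> ^ (last l - hd l))"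
    by (intro sum_mono one)
  also have "\<dots> = (\<Sum>k\<in>{1..<q}. \<Sum>l\<in>sorted_lists q I. \<bar>?m (take k l)\<bar> * \<bar>?m (drop k l)\<bar>)
      + K * (\<Sum>l\<in>sorted_lists q I. \<theta> ^ (last l - hd l))"
    by (simp add: sum.distrib sum_distrib_left sum.swap[of _ "sorted_lists q I"])
  also have "\<dots> \<le> (\<Sum>k\<in>{1..<q}. (\<Sum>l\<in>sorted_lists k I. \<bar>?m l\<bar>) * (\<Sum>l\<in>sorted_lists (q - k) I. \<bar>?m l\<bar>))
     + K * (real (card I) * (1 / (1 - \<theta>)) ^ (q - 1))"
  proof (intro add_mono sum_mono mult_left_mono)
    fix k assume k: "k \<in> {1..<q}"
    \<comment> \<open>A tuple is determined by its two pieces, so the sum over tuples is dominated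
      by the sum over all pairs of pieces.\<close>
    have inj: "inj_on (\<lambda>l. (take k l, drop k l)) (sorted_lists q I)"
      by (intro inj_onI) (metis append_take_drop_id prod.inject)
    have "(\<Sum>l\<in>sorted_lists q I. \<bar>?m (take k l)\<bar> * \<bar>?m (drop k l)\<bar>)
       = (\<Sum>(u, v)\<in>(\<lambda>l. (take k l, drop k l)) ` sorted_lists q I. \<bar>?m u\<bar> * \<bar>?m v\<bar>)"
      by (simp add: sum.reindex[OF inj])
    also have "\<dots> \<le> (\<Sum>(u, v)\<in>sorted_lists k I \<times> sorted_lists (q - k) I. \<bar>?m u\<bar> * \<bar>?m v\<bar>)"
    proof (rule sum_mono2)
      show "(\<lambda>l. (take k l, drop k l)) ` sorted_lists q I \<subseteq> sorted_lists k I \<times> sorted_lists (q - k) I"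
        using k by (auto simp: sorted_lists_def sorted_wrt_take sorted_wrt_drop dest: in_set_takeD in_set_dropD)
    qed (use I in \<open>auto simp: finite_sorted_lists\<close>)
    also have "\<dots> = (\<Sum>l\<in>sorted_lists k I. \<bar>?m l\<bar>) * (\<Sum>l\<in>sorted_lists (q - k) I. \<bar>?m l\<bar>)"
      by (simp add: sum_product sum.cartesian_product)
    finally show "(\<Sum>l\<in>sorted_lists q I. \<bar>?m (take k l)\<bar> * \<bar>?m (drop k l)\<bar>)
      \<le> (\<Sum>l\<in>sorted_lists k I. \<bar>?m l\<bar>) * (\<Sum>l\<in>sorted_lists (q - k) I. \<bar>?m l\<bar>)" .
  next
    show "(\<Sum>l\<in>sorted_lists q I. \<theta> ^ (last l - hd l)) \<le> real (card I) * (1 / (1 - \<theta>)) ^ (q - 1)"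
      using sum_sorted_lists_range_le[OF \<theta>(1,2) I, of "q - 1"] Q by simp
  qed (use K0 in auto)
  finally show ?thesis unfolding K_def .
qed

text \<open>Centering kills the tuples of length one, and this is what halves the exponent: the
  products in the recursion have order \<open>k div 2 + (q - k) div 2\<close>, which is at most
  \<open>q div 2\<close>, and the remainder, linear in \<open>card I\<close>, is absorbed since
  \<open>q div 2\<close> is at least one for \<open>q \<ge> 2\<close>.\<close>

lemma sum_mixed_moment_le:
  assumes Q: "real Q < p" "q \<le> Q"
  shows "\<exists>C\<ge>0. \<forall>N Y I. adapted N Y \<longrightarrow> moments_le p 1 Y \<longrightarrow> finite I \<longrightarrow>
    (\<Sum>l\<in>sorted_lists q I. \<bar>mixed_moment Y l\<bar>) \<le> C * real (card I) ^ (q div 2)"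
  using Q(2)
proof (induction q rule: less_induct)
  case (less q)
  consider "q = 0" | "q = 1" | "q \<ge> 2" by linarith
  thus ?case
  proof cases
    case 1
    have "sorted_lists 0 I = {[]}" for I by (auto simp: sorted_lists_def)
    thus ?thesis using 1 by (intro exI[of _ 1]) (auto simp: mixed_moment_def prob_space)
  next
    case 2
    have "mixed_moment Y l = 0" if "l \<in> sorted_lists (Suc 0) I" "moments_le p 1 Y" for l I Y
      using that by (auto simp: sorted_lists_def length_Suc_conv mixed_moment_def moments_le_def)
    thus ?thesis using 2 by (intro exI[of _ 0]) simp
  next
    case 3
    have "\<forall>k\<in>{1..<q}. \<exists>C\<ge>0. \<forall>N Y I. adapted N Y \<longrightarrow> moments_le p 1 Y \<longrightarrow> finite I \<longrightarrow>
      (\<Sum>l\<in>sorted_lists k I. \<bar>mixed_moment Y l\<bar>) \<le> C * real (card I) ^ (k div 2)"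
      using less by auto
    then obtain C where C: "\<And>k. k \<in> {1..<q} \<Longrightarrow> C k \<ge> 0"
      "\<And>k N Y I. k \<in> {1..<q} \<Longrightarrow> adapted N Y \<Longrightarrow> moments_le p 1 Y \<Longrightarrow> finite I \<Longrightarrow>
        (\<Sum>l\<in>sorted_lists k I. \<bar>mixed_moment Y l\<bar>) \<le> C k * real (card I) ^ (k div 2)"
      by (subst (asm) bchoice_iff) blast
    define \<theta> where "\<theta> = (b powr (1 - real Q / p)) powr (1 / real Q)"
    define K where "K = (4 * a + 8 * real Q * real Q) * (1 / (1 - \<theta>)) ^ (q - 1)"
    have p0: "p > 0" using Q by linarith
    have "b powr (1 - real Q / p) < b powr 0" by (rule powr_less_mono') (use b_pos b_less Q p0 in auto)
    hence "\<theta> < 1 powr (1 / real Q)" unfolding \<theta>_def using 3 less.prems b_pos by (intro powr_less_mono2) auto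
    hence K0: "K \<ge> 0" unfolding K_def using a_pos by (auto intro!: mult_nonneg_nonneg)
    show ?thesis
    proof (intro exI[of _ "(\<Sum>k\<in>{1..<q}. C k * C (q - k)) + K"] conjI allI impI)
      show "0 \<le> (\<Sum>k\<in>{1..<q}. C k * C (q - k)) + K"
        using K0 C(1) by (intro add_nonneg_nonneg sum_nonneg mult_nonneg_nonneg) auto
      fix N Y I assume Y: "adapted N Y" "moments_le p 1 Y" and I: "finite (I :: nat set)"
      show "(\<Sum>l\<in>sorted_lists q I. \<bar>mixed_moment Y l\<bar>) \<le> ((\<Sum>k\<in>{1..<q}. C k * C (q - k)) + K) * real (card I) ^ (q div 2)"
      proof (cases "I = {}")
        case True
        hence "sorted_lists q I = {}" using 3 by (auto simp: sorted_lists_def)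
        thus ?thesis using \<open>0 \<le> _ + K\<close> by simp
      next
        case False
        define n where "n = real (card I)"
        have n: "n \<ge> 1" using False I by (simp add: n_def Suc_leI card_gt_0_iff)
        have "(\<Sum>l\<in>sorted_lists q I. \<bar>mixed_moment Y l\<bar>) \<le>
           (\<Sum>k\<in>{1..<q}. (\<Sum>l\<in>sorted_lists k I. \<bar>mixed_moment Y l\<bar>) * (\<Sum>l\<in>sorted_lists (q - k) I. \<bar>mixed_moment Y l\<bar>))
           + (4 * a + 8 * real Q * real Q) * (n * (1 / (1 - \<theta>)) ^ (q - 1))"
          unfolding \<theta>_def n_def by (rule sum_mixed_moment_recursion[OF Y I Q(1) 3 less.prems])
        also have "\<dots> \<le> (\<Sum>k\<in>{1..<q}. C k * C (q - k) * n ^ (q div 2)) + K * n ^ (q div 2)"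
        proof (intro add_mono sum_mono)
          fix k assume k: "k \<in> {1..<q}"
          hence k': "q - k \<in> {1..<q}" by auto
          have "(\<Sum>l\<in>sorted_lists k I. \<bar>mixed_moment Y l\<bar>) * (\<Sum>l\<in>sorted_lists (q - k) I. \<bar>mixed_moment Y l\<bar>)
             \<le> (C k * n ^ (k div 2)) * (C (q - k) * n ^ ((q - k) div 2))"
            unfolding n_def using C k k' n Y I by (intro mult_mono sum_nonneg) auto
          also have "\<dots> = C k * C (q - k) * n ^ (k div 2 + (q - k) div 2)" by (simp add: power_add)
          also have "\<dots> \<le> C k * C (q - k) * n ^ (q div 2)"
            using n k k' C(1) by (intro mult_left_mono power_increasing mult_nonneg_nonneg) auto
          finally show "(\<Sum>l\<in>sorted_lists k I. \<bar>mixed_moment Y l\<bar>) * (\<Sum>l\<in>sorted_lists (q - k) I. \<bar>mixed_moment Y l\<bar>)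
            \<le> C k * C (q - k) * n ^ (q div 2)" .
        next
          have "n ^ 1 \<le> n ^ (q div 2)" using n 3 by (intro power_increasing) auto
          thus "(4 * a + 8 * real Q * real Q) * (n * (1 / (1 - \<theta>)) ^ (q - 1)) \<le> K * n ^ (q div 2)"
            using mult_left_mono[OF _ K0, of "n ^ 1" "n ^ (q div 2)"] by (simp add: K_def mult_ac)
        qed
        also have "\<dots> = ((\<Sum>k\<in>{1..<q}. C k * C (q - k)) + K) * n ^ (q div 2)"
          by (simp add: sum_distrib_right distrib_right)
        finally show ?thesis unfolding n_def .
      qed
    qed
  qed
qed

lemma integrable_sum_power:
  assumes Y: "adapted N Y" "moments_le p 1 Y" and q: "real q < p" and I: "finite I"
  shows "integrable M (\<lambda>\<omega>. (\<Sum>i\<in>I. Y i \<omega>) ^ q)"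
  unfolding sum_power_eq_sum_lists[OF I]
  using q by (intro Bochner_Integration.integrable_sum integrable_product[OF Y]) auto

text \<open>Expanding the power produces all tuples of indices. A mixed moment does not depend on
  the order of its indices, so a reduction to sorted tuples costs only the factor
  \<open>fact q\<close>.\<close>

lemma moment_sum_le_unit:
  assumes q: "real q < p"
  shows "\<exists>C\<ge>0. \<forall>N Y I. adapted N Y \<longrightarrow> moments_le p 1 Y \<longrightarrow> finite I \<longrightarrow>
    expectation (\<lambda>\<omega>. (\<Sum>i\<in>I. Y i \<omega>) ^ q) \<le> C * real (card I) ^ (q div 2)"
proof -
  from sum_mixed_moment_le[OF q order_refl] obtain C where C: "C \<ge> 0"
    "\<And>N Y I. adapted N Y \<Longrightarrow> moments_le p 1 Y \<Longrightarrow> finite I \<Longrightarrow>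
       (\<Sum>l\<in>sorted_lists q I. \<bar>mixed_moment Y l\<bar>) \<le> C * real (card I) ^ (q div 2)" by blast
  show ?thesis
  proof (intro exI[of _ "fact q * C"] conjI allI impI)
    fix N Y I assume Y: "adapted N Y" "moments_le p 1 Y" and I: "finite (I :: nat set)"
    let ?S = "{l. set l \<subseteq> I \<and> length l = q}"
    have "expectation (\<lambda>\<omega>. (\<Sum>i\<in>I. Y i \<omega>) ^ q) = (\<Sum>l\<in>?S. mixed_moment Y l)"
      unfolding sum_power_eq_sum_lists[OF I] mixed_moment_def
      using q by (intro Bochner_Integration.integral_sum integrable_product[OF Y]) auto
    also have "\<dots> = (\<Sum>l\<in>?S. mixed_moment Y (sort l))"
    proof (rule sum.cong[OF refl])
      fix l
      have "prod_list (map f (sort l)) = prod_list (map f l)" for f :: "nat \<Rightarrow> real"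
        by (metis mset_map mset_sort prod_mset_prod_list)
      thus "mixed_moment Y l = mixed_moment Y (sort l)" by (simp add: mixed_moment_def)
    qed
    also have "\<dots> \<le> (\<Sum>l\<in>?S. \<bar>mixed_moment Y (sort l)\<bar>)" by (intro sum_mono) auto
    also have "\<dots> \<le> fact q * (\<Sum>l\<in>sorted_lists q I. \<bar>mixed_moment Y l\<bar>)"
      by (rule sum_lists_sort_le[OF I]) auto
    also have "\<dots> \<le> fact q * (C * real (card I) ^ (q div 2))"
      by (intro mult_left_mono C(2)[OF Y I]) auto
    finally show "expectation (\<lambda>\<omega>. (\<Sum>i\<in>I. Y i \<omega>) ^ q) \<le> fact q * C * real (card I) ^ (q div 2)"
      by simp
  qed (use C in auto)
qed

lemma moments_le_scale:
  assumes "adapted N Y" "moments_le p \<kappa> Y" "\<kappa> > 0"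
  shows "adapted N (\<lambda>i \<omega>. Y i \<omega> / \<kappa>)" "moments_le p 1 (\<lambda>i \<omega>. Y i \<omega> / \<kappa>)"
  using assms by (auto simp: adapted_def moments_le_def powr_divide intro!: borel_measurable_divide)

text \<open>Division by \<kappa> reduces to the normalised case. The constant depends neither on the
  row nor on the array or the index set, and the uniformity of tightness in \<open>N\<close> rests
  on this.\<close>

theorem moment_sum_le:
  assumes q: "real q < p"
  obtains C where "C \<ge> 0"
    "\<And>N Y I \<kappa>. adapted N Y \<Longrightarrow> moments_le p \<kappa> Y \<Longrightarrow> \<kappa> > 0 \<Longrightarrow> finite I \<Longrightarrow>
      integrable M (\<lambda>\<omega>. (\<Sum>i\<in>I. Y i \<omega>) ^ q) \<and>
      expectation (\<lambda>\<omega>. (\<Sum>i\<in>I. Y i \<omega>) ^ q) \<le> C * \<kappa> ^ q * real (card I) ^ (q div 2)"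
proof -
  from moment_sum_le_unit[OF q] obtain C where C: "C \<ge> 0"
    "\<And>N Y I. adapted N Y \<Longrightarrow> moments_le p 1 Y \<Longrightarrow> finite I \<Longrightarrow>
      expectation (\<lambda>\<omega>. (\<Sum>i\<in>I. Y i \<omega>) ^ q) \<le> C * real (card I) ^ (q div 2)" by blast
  show thesis
  proof (rule that[OF C(1)])
    fix N Y I and \<kappa> :: real assume Y: "adapted N Y" "moments_le p \<kappa> Y" "\<kappa> > 0" and I: "finite (I :: nat set)"
    note Y' = moments_le_scale[OF Y]
    have eq: "(\<Sum>i\<in>I. Y i \<omega>) ^ q = \<kappa> ^ q * (\<Sum>i\<in>I. Y i \<omega> / \<kappa>) ^ q" for \<omega>
      using Y(3) by (simp add: power_divide flip: sum_divide_distrib)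
    have "expectation (\<lambda>\<omega>. (\<Sum>i\<in>I. Y i \<omega> / \<kappa>) ^ q) \<le> C * real (card I) ^ (q div 2)"
      by (rule C(2)[OF Y' I])
    thus "integrable M (\<lambda>\<omega>. (\<Sum>i\<in>I. Y i \<omega>) ^ q) \<and>
      expectation (\<lambda>\<omega>. (\<Sum>i\<in>I. Y i \<omega>) ^ q) \<le> C * \<kappa> ^ q * real (card I) ^ (q div 2)"
      unfolding eq using integrable_sum_power[OF Y' q I] Y(3)
      by (auto intro!: mult_left_mono simp: mult.assoc mult.left_commute)
  qed
qed

end

section \<open>A central limit theorem for mixing arrays\<close>

lemma abs_le_amgm: "\<bar>x\<bar> \<le> (\<delta> + x\<^sup>2 / \<delta>) / 2" if "\<delta> > 0" for x \<delta> :: real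
proof -
  have "0 \<le> (\<bar>x\<bar> - \<delta>)\<^sup>2" by simp
  hence "2 * (\<bar>x\<bar> * \<delta>) \<le> x\<^sup>2 + \<delta>\<^sup>2" by (simp add: power2_diff algebra_simps)
  thus ?thesis using that by (simp add: field_simps power2_eq_square)
qed

lemma exp_minus_diff_le: "\<bar>exp (- x) - exp (- y)\<bar> \<le> \<bar>x - y\<bar>" if "x \<ge> 0" "y \<ge> 0" for x y :: real
proof -
  have *: "exp (- u) - exp (- w) \<le> w - u" if "0 \<le> u" "u \<le> w" for u w :: real
  proof -
    have "exp (- u) - exp (- w) = exp (- u) * (1 - exp (- (w - u)))" by (simp add: algebra_simps flip: exp_add)
    also have "\<dots> \<le> 1 * (w - u)"
      using exp_ge_add_one_self[of "u - w"] that by (intro mult_mono) (simp_all add: algebra_simps)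
    finally show ?thesis by simp
  qed
  show ?thesis
  proof (cases "x \<le> y")
    case True
    moreover have "exp (- y) \<le> exp (- x)" using True by simp
    ultimately show ?thesis using *[of x y] that by simp
  next
    case False
    moreover have "exp (- x) \<le> exp (- y)" using False by simp
    ultimately show ?thesis using *[of y x] that by simp
  qed
qed

lemma exp_minus_approx: "\<bar>exp (- x) - (1 - x)\<bar> \<le> x\<^sup>2" if "x \<ge> 0" for x :: real
proof -
  have 1: "1 - x \<le> exp (- x)" using exp_ge_add_one_self[of "- x"] by simp
  have "exp (- x) \<le> 1 / (1 + x)"
    unfolding exp_minus inverse_eq_divide
    by (rule divide_left_mono) (use exp_ge_add_one_self[of x] that in auto)
  also have "\<dots> \<le> 1 - x + x\<^sup>2"
  proof -
    have "(1 - x + x\<^sup>2) * (1 + x) = 1 + x ^ 3" by (simp add: power2_eq_square eval_nat_numeral algebra_simps)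
    moreover have "x ^ 3 \<ge> 0" using that by simp
    ultimately have "1 \<le> (1 - x + x\<^sup>2) * (1 + x)" by linarith
    thus ?thesis using that by (simp only: pos_divide_le_eq)
  qed
  finally show ?thesis using 1 by (simp add: abs_le_iff)
qed

lemma norm_cis_approx: "cmod (cis x - (1 + \<i> * x - x\<^sup>2 / 2)) \<le> \<bar>x\<bar> ^ 3 / 6"
proof -
  have "cmod (iexp x - (\<Sum>k\<le>2. (\<i> * x) ^ k / fact k)) \<le> \<bar>x\<bar> ^ Suc 2 / fact (Suc 2)"
    by (rule iexp_approx1)
  moreover have "(\<Sum>k\<le>2. (\<i> * x) ^ k / fact k) = 1 + \<i> * x - x\<^sup>2 / 2"
    by (simp add: eval_nat_numeral power_mult_distrib algebra_simps)
  ultimately show ?thesis by (simp add: cis_conv_exp fact_numeral eval_nat_numeral)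
qed

lemma norm_cis_diff_le: "cmod (cis x - cis y) \<le> \<bar>x - y\<bar>"
proof -
  have "cmod (iexp (x - y) - (\<Sum>k\<le>0. (\<i> * (x - y)) ^ k / fact k)) \<le> \<bar>x - y\<bar> ^ Suc 0 / fact (Suc 0)"
    using iexp_approx1[of "x - y" 0] by simp
  hence "cmod (cis (x - y) - 1) \<le> \<bar>x - y\<bar>" by (simp add: cis_conv_exp)
  moreover have "cis x - cis y = cis y * (cis (x - y) - 1)" by (simp add: algebra_simps cis_mult)
  ultimately show ?thesis by (simp add: norm_mult)
qed

context prob_space
begin

lemma integrable_cis:
  assumes [measurable]: "X \<in> borel_measurable M"
  shows "integrable M (\<lambda>\<omega>. cis (X \<omega>))"
  by (rule integrable_const_bound[of _ 1]) (auto simp: cis_conv_exp)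

lemma expectation_cis:
  assumes X: "X \<in> borel_measurable M"
  shows "expectation (\<lambda>\<omega>. cis (X \<omega>)) = Complex (expectation (\<lambda>\<omega>. cos (X \<omega>))) (expectation (\<lambda>\<omega>. sin (X \<omega>)))"
  using integral_Re[OF integrable_cis[OF X]] integral_Im[OF integrable_cis[OF X]]
  by (intro complex_eqI) simp_all

lemma norm_expectation_cis_le_1: "cmod (expectation (\<lambda>\<omega>. cis (X \<omega>))) \<le> 1"
proof -
  have "cmod (expectation (\<lambda>\<omega>. cis (X \<omega>))) \<le> expectation (\<lambda>\<omega>. 1)"
    by (rule order_trans[OF integral_norm_bound]) (simp add: prob_space)
  thus ?thesis by (simp add: prob_space)
qed

text \<open>Taylor expansion leaves a third absolute moment. It is split into second and fourth
  moments with weight \<eta>, because the moment bounds for sums concern powers without absolute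
  values and so control absolute moments only for even exponents.\<close>

lemma expectation_cis_quadratic:
  fixes X :: "'a \<Rightarrow> real"
  assumes X [measurable]: "X \<in> borel_measurable M"
    and i2: "integrable M (\<lambda>\<omega>. (X \<omega>)\<^sup>2)" and i4: "integrable M (\<lambda>\<omega>. X \<omega> ^ 4)" and i1: "integrable M X"
    and mean: "expectation X = 0" and \<eta>: "\<eta> > 0"
  shows "cmod (expectation (\<lambda>\<omega>. cis (X \<omega>)) - (1 - expectation (\<lambda>\<omega>. (X \<omega>)\<^sup>2) / 2))
    \<le> (\<eta> * expectation (\<lambda>\<omega>. (X \<omega>)\<^sup>2) + expectation (\<lambda>\<omega>. X \<omega> ^ 4) / \<eta>) / 12"
proof -
  have c3: "\<bar>x\<bar> ^ 3 \<le> (\<eta> * x\<^sup>2 + x ^ 4 / \<eta>) / 2" for x :: real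
  proof -
    have "\<bar>x\<bar> ^ 3 = x\<^sup>2 * \<bar>x\<bar>" by (simp add: power2_eq_square eval_nat_numeral)
    also have "\<dots> \<le> x\<^sup>2 * ((\<eta> + x\<^sup>2 / \<eta>) / 2)" by (intro mult_left_mono abs_le_amgm \<eta>) auto
    also have "\<dots> = (\<eta> * x\<^sup>2 + x ^ 4 / \<eta>) / 2" by (simp add: eval_nat_numeral algebra_simps)
    finally show ?thesis .
  qed
  have ic: "integrable M (\<lambda>\<omega>. complex_of_real (X \<omega>))" "integrable M (\<lambda>\<omega>. complex_of_real ((X \<omega>)\<^sup>2))"
    by (rule integrable_of_real[OF i1], rule integrable_of_real[OF i2])
  have "expectation (\<lambda>\<omega>. cis (X \<omega>) - (1 + \<i> * X \<omega> - complex_of_real ((X \<omega>)\<^sup>2) / 2))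
     = expectation (\<lambda>\<omega>. cis (X \<omega>)) - (1 + \<i> * expectation X - expectation (\<lambda>\<omega>. (X \<omega>)\<^sup>2) / 2)"
    using ic integrable_cis[OF X] by (simp add: prob_space del: of_real_power)
  hence "cmod (expectation (\<lambda>\<omega>. cis (X \<omega>)) - (1 - expectation (\<lambda>\<omega>. (X \<omega>)\<^sup>2) / 2))
     = cmod (expectation (\<lambda>\<omega>. cis (X \<omega>) - (1 + \<i> * X \<omega> - complex_of_real ((X \<omega>)\<^sup>2) / 2)))"
    by (simp add: mean)
  also have "\<dots> \<le> expectation (\<lambda>\<omega>. (\<eta> * (X \<omega>)\<^sup>2 + X \<omega> ^ 4 / \<eta>) / 12)"
  proof (rule order_trans[OF integral_norm_bound integral_mono])
    show "cmod (cis (X \<omega>) - (1 + \<i> * X \<omega> - complex_of_real ((X \<omega>)\<^sup>2) / 2)) \<le> (\<eta> * (X \<omega>)\<^sup>2 + X \<omega> ^ 4 / \<eta>) / 12" for \<omega>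
      using norm_cis_approx[of "X \<omega>"] c3[of "X \<omega>"] by simp
  qed (use ic i2 i4 integrable_cis[OF X] in auto)
  finally show ?thesis using i2 i4 by simp
qed

end

text \<open>Used with period \<open>t = l + s\<close>: the first \<open>l\<close> residues of each
  period form a big block, the others a gap. The last of the \<open>K\<close> periods may be cut off
  by \<open>n\<close>.\<close>

lemma sum_blocks:
  fixes f :: "nat \<Rightarrow> 'b::comm_monoid_add"
  assumes "t > 0" "n \<le> K * t"
  shows "(\<Sum>i<n. f i) = (\<Sum>j<K. \<Sum>i\<in>{i. i < n \<and> i div t = j \<and> i mod t < l}. f i) + (\<Sum>i\<in>{i. i < n \<and> \<not> i mod t < l}. f i)"
proof -
  have "(\<Sum>i<n. f i) = (\<Sum>i\<in>{i. i < n \<and> i mod t < l}. f i) + (\<Sum>i\<in>{i. i < n \<and> \<not> i mod t < l}. f i)"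
  proof -
    have "{..<n} = {i. i < n \<and> i mod t < l} \<union> {i. i < n \<and> \<not> i mod t < l}" by auto
    thus ?thesis by (simp only:) (rule sum.union_disjoint, auto)
  qed
  also have "(\<Sum>i\<in>{i. i < n \<and> i mod t < l}. f i) = (\<Sum>j<K. \<Sum>i\<in>{i \<in> {i. i < n \<and> i mod t < l}. i div t = j}. f i)"
  proof (rule sum.group[symmetric])
    show "(\<lambda>i. i div t) ` {i. i < n \<and> i mod t < l} \<subseteq> {..<K}"
    proof safe
      fix i assume "i < n"
      hence "i < K * t" using assms by linarith
      thus "i div t < K" by (rule less_mult_imp_div_less)
    qed
  qed auto
  also have "\<dots> = (\<Sum>j<K. \<Sum>i\<in>{i. i < n \<and> i div t = j \<and> i mod t < l}. f i)"
    by (intro sum.cong refl) auto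
  finally show ?thesis .
qed

lemma card_big_block: "card {i. i < n \<and> i div t = j \<and> i mod t < l} \<le> l" for n t j l :: nat
proof -
  have "inj_on (\<lambda>i. i mod t) {i. i < n \<and> i div t = j \<and> i mod t < l}"
  proof (rule inj_onI)
    fix x y assume "x \<in> {i. i < n \<and> i div t = j \<and> i mod t < l}" "y \<in> {i. i < n \<and> i div t = j \<and> i mod t < l}" "x mod t = y mod t"
    hence eqs: "x div t = y div t" "x mod t = y mod t" by auto
    have "x = x div t * t + x mod t" by (rule div_mult_mod_eq[symmetric])
    also have "\<dots> = y div t * t + y mod t" unfolding eqs ..
    also have "\<dots> = y" by (rule div_mult_mod_eq)
    finally show "x = y" .
  qed
  hence "card {i. i < n \<and> i div t = j \<and> i mod t < l} \<le> card {..<l}"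
    by (rule card_inj_on_le) auto
  thus ?thesis by simp
qed

lemma card_small_blocks: "card {i. i < n \<and> \<not> i mod (l + s) < l} \<le> K * s" if "n \<le> K * (l + s)" "s > 0" for n K l s :: nat
proof -
  have "inj_on (\<lambda>i. (i div (l + s), i mod (l + s))) {i. i < n \<and> \<not> i mod (l + s) < l}"
  proof (rule inj_onI)
    fix x y assume "(x div (l + s), x mod (l + s)) = (y div (l + s), y mod (l + s))"
    hence eqs: "x div (l + s) = y div (l + s)" "x mod (l + s) = y mod (l + s)" by auto
    have "x = x div (l + s) * (l + s) + x mod (l + s)" by (rule div_mult_mod_eq[symmetric])
    also have "\<dots> = y div (l + s) * (l + s) + y mod (l + s)" unfolding eqs ..
    also have "\<dots> = y" by (rule div_mult_mod_eq)
    finally show "x = y" .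
  qed
  hence "card {i. i < n \<and> \<not> i mod (l + s) < l} \<le> card ({..<K} \<times> {l..<l + s})"
  proof (rule card_inj_on_le)
    show "(\<lambda>i. (i div (l + s), i mod (l + s))) ` {i. i < n \<and> \<not> i mod (l + s) < l} \<subseteq> {..<K} \<times> {l..<l + s}"
    proof safe
      fix i assume i: "i < n" "\<not> i mod (l + s) < l"
      hence "i < K * (l + s)" using that by linarith
      thus "i div (l + s) < K" by (rule less_mult_imp_div_less)
      show "i mod (l + s) \<in> {l..<l + s}" using i that by simp
    qed
  qed simp
  thus ?thesis by simp
qed

section \<open>Bernstein blocks\<close>

context mixing_array
begin

text \<open>By the addition formulas, real and imaginary part of the difference are each a
  combination of two covariances of sines and cosines, every one bounded by
  \<open>4 * (a * b ^ n)\<close>.\<close>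

lemma cov_cis_le:
  assumes T: "T \<in> borel_measurable (lo N k)" and X: "X \<in> borel_measurable (hi N (k + n))"
  shows "cmod (expectation (\<lambda>\<omega>. cis (T \<omega> + X \<omega>)) - expectation (\<lambda>\<omega>. cis (T \<omega>)) * expectation (\<lambda>\<omega>. cis (X \<omega>)))
    \<le> 16 * (a * b ^ n)"
proof -
  have [measurable]: "T \<in> borel_measurable M" "X \<in> borel_measurable M"
    using measurable_lo_M[OF T] measurable_hi_M[OF X] by auto
  have c: "\<bar>cov (\<lambda>\<omega>. f (T \<omega>)) (\<lambda>\<omega>. g (X \<omega>))\<bar> \<le> 4 * (a * b ^ n)"
    if "f \<in> {cos, sin}" "g \<in> {cos, sin}" for f g
  proof -
    have [measurable]: "f \<in> borel_measurable borel" "g \<in> borel_measurable borel" using that by auto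
    have "\<bar>cov (\<lambda>\<omega>. f (T \<omega>)) (\<lambda>\<omega>. g (X \<omega>))\<bar> \<le> 4 * 1 * 1 * (a * b ^ n)"
      by (rule cov_bounded) (use that T X in \<open>auto intro: measurable_compose\<close>)
    thus ?thesis by simp
  qed
  have i: "integrable M (\<lambda>\<omega>. f (T \<omega>) * g (X \<omega>))" if "f \<in> {cos, sin}" "g \<in> {cos, sin}" for f g
    by (rule integrable_bounded[where A=1]) (use that in \<open>auto simp: abs_mult intro!: mult_le_one\<close>)
  let ?D = "expectation (\<lambda>\<omega>. cis (T \<omega> + X \<omega>)) - expectation (\<lambda>\<omega>. cis (T \<omega>)) * expectation (\<lambda>\<omega>. cis (X \<omega>))"
  have re: "Re ?D = cov (\<lambda>\<omega>. cos (T \<omega>)) (\<lambda>\<omega>. cos (X \<omega>)) - cov (\<lambda>\<omega>. sin (T \<omega>)) (\<lambda>\<omega>. sin (X \<omega>))"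
    using i by (simp add: expectation_cis cov_def cos_add)
  have im: "Im ?D = cov (\<lambda>\<omega>. sin (T \<omega>)) (\<lambda>\<omega>. cos (X \<omega>)) + cov (\<lambda>\<omega>. cos (T \<omega>)) (\<lambda>\<omega>. sin (X \<omega>))"
    using i by (simp add: expectation_cis cov_def sin_add)
  have "cmod ?D \<le> \<bar>Re ?D\<bar> + \<bar>Im ?D\<bar>" by (rule cmod_le)
  also have "\<dots> \<le> 16 * (a * b ^ n)"
    unfolding re im using c[of cos cos] c[of sin sin] c[of sin cos] c[of cos sin] by simp
  finally show ?thesis .
qed

lemma sum_measurable_lo:
  assumes "adapted N Y" "\<And>i. i \<in> I \<Longrightarrow> i \<le> k"
  shows "(\<lambda>\<omega>. \<Sum>i\<in>I. Y i \<omega>) \<in> borel_measurable (lo N k)"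
proof (rule borel_measurable_sum)
  fix i assume "i \<in> I"
  thus "Y i \<in> borel_measurable (lo N k)"
    using assms measurable_lo_mono[of "Y i" N i borel k] by (simp add: adapted_def)
qed

lemma sum_measurable_hi:
  assumes "adapted N Y" "\<And>i. i \<in> I \<Longrightarrow> k \<le> i"
  shows "(\<lambda>\<omega>. \<Sum>i\<in>I. Y i \<omega>) \<in> borel_measurable (hi N k)"
proof (rule borel_measurable_sum)
  fix i assume "i \<in> I"
  thus "Y i \<in> borel_measurable (hi N k)"
    using assms measurable_hi_anti[of "Y i" N i borel k] by (simp add: adapted_def)
qed

text \<open>Blocks are split off one at a time. Each split costs the covariance bound at distance
  \<open>s\<close>, and since all factors have modulus at most one the errors add up.\<close>

lemma cis_blocks_le:
  assumes Y: "adapted N Y" and l: "l > 0"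
    and B: "\<And>j i. i \<in> B j \<Longrightarrow> j * (l + s) \<le> i \<and> i < j * (l + s) + l"
  shows "cmod (expectation (\<lambda>\<omega>. cis (\<Sum>j<J. \<Sum>i\<in>B j. Y i \<omega>)) - (\<Prod>j<J. expectation (\<lambda>\<omega>. cis (\<Sum>i\<in>B j. Y i \<omega>))))
    \<le> real J * (16 * (a * b ^ s))"
proof (induction J)
  case (Suc J)
  let ?X = "\<lambda>j \<omega>. \<Sum>i\<in>B j. Y i \<omega>"
  let ?e = "\<lambda>X. expectation (\<lambda>\<omega>. cis (X \<omega>))"
  have "cmod (?e (\<lambda>\<omega>. (\<Sum>j<J. ?X j \<omega>) + ?X J \<omega>) - ?e (\<lambda>\<omega>. \<Sum>j<J. ?X j \<omega>) * ?e (?X J)) \<le> 16 * (a * b ^ s)"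
  proof (cases "J = 0")
    case True
    thus ?thesis using a_pos b_pos by (simp add: prob_space)
  next
    case False
    \<comment> \<open>The last index of big block \<open>J - 1\<close>; the next block starts at
      \<open>J * (l + s)\<close>, at distance at least \<open>s\<close>. For \<open>J = 0\<close>
      there is no previous block, whence the case distinction.\<close>
    define k where "k = (J - 1) * (l + s) + l - 1"
    have ks: "k + s \<le> J * (l + s)" using False l by (cases J) (auto simp: k_def)
    show ?thesis
    proof (rule cov_cis_le)
      show "(\<lambda>\<omega>. \<Sum>j<J. ?X j \<omega>) \<in> borel_measurable (lo N k)"
      proof (rule borel_measurable_sum, rule sum_measurable_lo[OF Y])
        fix j i assume "j \<in> {..<J}" "i \<in> B j"
        hence 1: "i < j * (l + s) + l" and "j \<le> J - 1" using B by auto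
        from this(2) have "j * (l + s) \<le> (J - 1) * (l + s)" by (rule mult_le_mono1)
        with 1 show "i \<le> k" unfolding k_def by linarith
      qed
      show "?X J \<in> borel_measurable (hi N (k + s))"
      proof (rule sum_measurable_hi[OF Y])
        fix i assume "i \<in> B J"
        hence "J * (l + s) \<le> i" using B by blast
        thus "k + s \<le> i" using ks by linarith
      qed
    qed
  qed
  moreover have "cmod (?e (\<lambda>\<omega>. \<Sum>j<J. ?X j \<omega>) * ?e (?X J) - (\<Prod>j<J. ?e (?X j)) * ?e (?X J)) \<le> real J * (16 * (a * b ^ s)) * 1"
    unfolding left_diff_distrib[symmetric] norm_mult
    using Suc a_pos b_pos by (intro mult_mono norm_expectation_cis_le_1) auto
  ultimately have "cmod (?e (\<lambda>\<omega>. (\<Sum>j<J. ?X j \<omega>) + ?X J \<omega>) - (\<Prod>j<J. ?e (?X j)) * ?e (?X J))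
     \<le> 16 * (a * b ^ s) + real J * (16 * (a * b ^ s)) * 1"
    by (rule norm_diff_triangle_le)
  thus ?case by (simp add: algebra_simps)
qed (simp add: prob_space)


lemma adapted_scale: "adapted N Y \<Longrightarrow> adapted N (\<lambda>i \<omega>. c * Y i \<omega>)"
  unfolding adapted_def by (intro allI conjI borel_measurable_times borel_measurable_const) auto

lemma moments_le_integrable:
  assumes "adapted N Y" "moments_le p \<kappa> Y" "p \<ge> 1" shows "integrable M (Y i)"
  by (rule integrable_powr_imp_integrable[of _ p])
    (use assms adapted_measurable[OF assms(1)] in \<open>auto simp: moments_le_def\<close>)

text \<open>
  Bernstein's method: blocks of length \<open>l\<close>, separated by gaps of length \<open>s\<close>, are treated as if
  independent.
\<close>

lemma char_sum_approx:
  assumes p: "p > 4"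
  shows "\<exists>C>0. \<forall>N Y (n::nat) (K::nat) (l::nat) (s::nat). adapted N Y \<longrightarrow> moments_le p \<kappa> Y \<longrightarrow> \<kappa> > 0 \<longrightarrow> 0 < n \<longrightarrow> 0 < l \<longrightarrow> l \<le> n \<longrightarrow> 0 < s \<longrightarrow> 0 < K \<longrightarrow>
    n \<le> K * (l + s) \<longrightarrow>
    cmod (expectation (\<lambda>\<omega>. cis ((\<Sum>i<n. Y i \<omega>) / sqrt n)) - exp (- expectation (\<lambda>\<omega>. ((\<Sum>i<n. Y i \<omega>) / sqrt n)\<^sup>2) / 2))
    \<le> C * (sqrt (real K * real s / real n) + real K * real s / real n + K * b ^ s + K * (l / n * sqrt (l / n)) + K * (l / n)\<^sup>2 + (real K)\<^sup>2 * (b powr (1/2)) ^ s)"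
proof (cases "\<kappa> > 0")
  case False
  thus ?thesis by (intro exI[of _ 1]) auto
next
  case \<kappa>: True
  obtain C2 where C2: "C2 \<ge> 0" and m2: "\<And>N Y I \<kappa>. adapted N Y \<Longrightarrow> moments_le p \<kappa> Y \<Longrightarrow> \<kappa> > 0 \<Longrightarrow> finite I \<Longrightarrow>
      integrable M (\<lambda>\<omega>. (\<Sum>i\<in>I. Y i \<omega>) ^ 2) \<and>
      expectation (\<lambda>\<omega>. (\<Sum>i\<in>I. Y i \<omega>) ^ 2) \<le> C2 * \<kappa> ^ 2 * real (card I) ^ (2 div 2)"
    by (rule moment_sum_le[of 2 p]) (use p in auto)
  obtain C4 where C4: "C4 \<ge> 0" and m4: "\<And>N Y I \<kappa>. adapted N Y \<Longrightarrow> moments_le p \<kappa> Y \<Longrightarrow> \<kappa> > 0 \<Longrightarrow> finite I \<Longrightarrow>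
      integrable M (\<lambda>\<omega>. (\<Sum>i\<in>I. Y i \<omega>) ^ 4) \<and>
      expectation (\<lambda>\<omega>. (\<Sum>i\<in>I. Y i \<omega>) ^ 4) \<le> C4 * \<kappa> ^ 4 * real (card I) ^ (4 div 2)"
    by (rule moment_sum_le[of 4 p]) (use p in auto)
  \<comment> \<open>The added ones give \<open>A \<ge> 1\<close> and \<open>B \<ge> 1\<close>, which
    is used for \<open>sqrt A \<le> A\<close> and keeps \<open>d\<close> positive.\<close>
  define A where "A = 1 + C2 * \<kappa>\<^sup>2"
  define B where "B = 1 + C4 * \<kappa> ^ 4"
  define C where "C = 16 * a + (A + B) + A\<^sup>2 + (4 * a + 8 * B * B) + 4 * A"
  have AB: "A \<ge> 1" "B \<ge> 1" using C2 C4 by (auto simp: A_def B_def)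
  have C: "C > 0" unfolding C_def using a_pos AB by (simp add: add_pos_nonneg)
  show ?thesis
  proof (intro exI[of _ C] conjI allI impI C)
    fix N Y and n K l s :: nat
    assume Y: "adapted N Y" "moments_le p \<kappa> Y" and n: "0 < n" and l: "0 < l" "l \<le> n" and s: "0 < s" and K: "0 < K"
      and nK: "n \<le> K * (l + s)"
    define y where "y i \<omega> = Y i \<omega> / sqrt n" for i \<omega>
    define Bl where "Bl j = {i. i < n \<and> i div (l + s) = j \<and> i mod (l + s) < l}" for j
    define Sm where "Sm = {i. i < n \<and> \<not> i mod (l + s) < l}"
    define \<xi> where "\<xi> j \<omega> = (\<Sum>i\<in>Bl j. y i \<omega>)" for j \<omega>
    define S where "S \<omega> = (\<Sum>i<n. y i \<omega>)" for \<omega>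
    define S' where "S' \<omega> = (\<Sum>j<K. \<xi> j \<omega>)" for \<omega>
    define D where "D \<omega> = (\<Sum>i\<in>Sm. y i \<omega>)" for \<omega>
    define v where "v j = expectation (\<lambda>\<omega>. (\<xi> j \<omega>)\<^sup>2)" for j
    \<comment> \<open>\<open>h\<close> is the share of the \<open>n\<close> indices in one big
      block; \<open>d\<close> will bound the second moment of the part of the sum that lies in the
      gaps.\<close>
    define h where "h = real l / real n"
    define d where "d = A * (real K * real s / real n)"
    have h: "0 < h" "h \<le> 1" using l n by (auto simp: h_def)
    have d: "d > 0" using AB K s n by (simp add: d_def)
    have ya: "adapted N y" using adapted_scale[OF Y(1), of "1 / sqrt n"] by (simp add: y_def[abs_def])
    have ym [measurable]: "y i \<in> borel_measurable M" for i by (rule adapted_measurable[OF ya])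
    have yi: "integrable M (y i)" for i
      using moments_le_integrable[OF Y, of i] p by (simp add: y_def[abs_def])
    have y0: "expectation (y i) = 0" for i
      using Y(2) by (simp add: y_def[abs_def] moments_le_def)
    have [measurable]: "\<xi> j \<in> borel_measurable M" "S \<in> borel_measurable M" "S' \<in> borel_measurable M" "D \<in> borel_measurable M" for j
      unfolding \<xi>_def[abs_def] S_def[abs_def] S'_def[abs_def] D_def[abs_def] by measurable
    have fin: "finite (Bl j)" "finite Sm" for j by (auto simp: Bl_def Sm_def)
    have y2: "integrable M (\<lambda>\<omega>. (\<Sum>i\<in>I. y i \<omega>)\<^sup>2)" "expectation (\<lambda>\<omega>. (\<Sum>i\<in>I. y i \<omega>)\<^sup>2) \<le> A * (card I / n)" if "finite I" for I
    proof -
      have eq: "(\<Sum>i\<in>I. y i \<omega>)\<^sup>2 = (\<Sum>i\<in>I. Y i \<omega>)\<^sup>2 / n" for \<omega>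
        by (simp add: y_def power_divide flip: sum_divide_distrib)
      show "integrable M (\<lambda>\<omega>. (\<Sum>i\<in>I. y i \<omega>)\<^sup>2)" unfolding eq using m2[OF Y \<kappa> that] by simp
      have "expectation (\<lambda>\<omega>. (\<Sum>i\<in>I. y i \<omega>)\<^sup>2) \<le> (C2 * \<kappa>\<^sup>2) * (card I / n)"
        unfolding eq using m2[OF Y \<kappa> that] n by (simp add: divide_right_mono)
      also have "\<dots> \<le> A * (card I / n)" unfolding A_def by (intro mult_right_mono) auto
      finally show "expectation (\<lambda>\<omega>. (\<Sum>i\<in>I. y i \<omega>)\<^sup>2) \<le> A * (card I / n)" .
    qed
    have y4: "integrable M (\<lambda>\<omega>. (\<Sum>i\<in>I. y i \<omega>) ^ 4)" "expectation (\<lambda>\<omega>. (\<Sum>i\<in>I. y i \<omega>) ^ 4) \<le> B * (card I / n)\<^sup>2" if "finite I" for I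
    proof -
      have "sqrt n ^ 4 = (real n)\<^sup>2" using power_mult[of "sqrt n" 2 2] by simp
      hence eq: "(\<Sum>i\<in>I. y i \<omega>) ^ 4 = (\<Sum>i\<in>I. Y i \<omega>) ^ 4 / (real n)\<^sup>2" for \<omega>
        by (simp add: y_def power_divide flip: sum_divide_distrib)
      show "integrable M (\<lambda>\<omega>. (\<Sum>i\<in>I. y i \<omega>) ^ 4)" unfolding eq using m4[OF Y \<kappa> that] by simp
      have "expectation (\<lambda>\<omega>. (\<Sum>i\<in>I. y i \<omega>) ^ 4) \<le> (C4 * \<kappa> ^ 4) * (card I / n)\<^sup>2"
        unfolding eq using m4[OF Y \<kappa> that] n by (simp add: divide_right_mono power_divide)
      also have "\<dots> \<le> B * (card I / n)\<^sup>2" unfolding B_def by (intro mult_right_mono) auto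
      finally show "expectation (\<lambda>\<omega>. (\<Sum>i\<in>I. y i \<omega>) ^ 4) \<le> B * (card I / n)\<^sup>2" .
    qed
    have cl: "real (card (Bl j)) / n \<le> h" for j
      unfolding h_def Bl_def using card_big_block by (intro divide_right_mono) auto
    have \<xi>2: "integrable M (\<lambda>\<omega>. (\<xi> j \<omega>)\<^sup>2)" "v j \<le> A * h" for j
    proof -
      show "integrable M (\<lambda>\<omega>. (\<xi> j \<omega>)\<^sup>2)" using y2(1)[OF fin(1)] by (simp add: \<xi>_def)
      have "v j \<le> A * (card (Bl j) / n)" using y2(2)[OF fin(1)] by (simp add: \<xi>_def v_def)
      also have "\<dots> \<le> A * h" using cl AB by (intro mult_left_mono) auto
      finally show "v j \<le> A * h" .
    qed
    have \<xi>4: "integrable M (\<lambda>\<omega>. \<xi> j \<omega> ^ 4)" "expectation (\<lambda>\<omega>. \<xi> j \<omega> ^ 4) \<le> B * h\<^sup>2" for j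
    proof -
      show "integrable M (\<lambda>\<omega>. \<xi> j \<omega> ^ 4)" using y4(1)[OF fin(1)] by (simp add: \<xi>_def)
      have "expectation (\<lambda>\<omega>. \<xi> j \<omega> ^ 4) \<le> B * (card (Bl j) / n)\<^sup>2" using y4(2)[OF fin(1)] by (simp add: \<xi>_def)
      also have "\<dots> \<le> B * h\<^sup>2" using cl AB by (intro mult_left_mono power_mono) auto
      finally show "expectation (\<lambda>\<omega>. \<xi> j \<omega> ^ 4) \<le> B * h\<^sup>2" .
    qed
    have \<xi>1: "integrable M (\<xi> j)" "expectation (\<xi> j) = 0" for j
      unfolding \<xi>_def[abs_def] using yi y0 by simp_all
    have v0: "v j \<ge> 0" for j by (simp add: v_def)
    have SD: "S \<omega> = S' \<omega> + D \<omega>" for \<omega>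
      unfolding S_def S'_def D_def \<xi>_def Bl_def Sm_def
      by (rule sum_blocks) (use l nK in auto)
    have D2: "integrable M (\<lambda>\<omega>. (D \<omega>)\<^sup>2)" "expectation (\<lambda>\<omega>. (D \<omega>)\<^sup>2) \<le> d"
    proof -
      show "integrable M (\<lambda>\<omega>. (D \<omega>)\<^sup>2)" using y2(1)[OF fin(2)] by (simp add: D_def)
      have "card Sm \<le> K * s" unfolding Sm_def by (rule card_small_blocks[OF nK s])
      hence "real (card Sm) \<le> real K * real s" by (metis of_nat_le_iff of_nat_mult)
      hence "A * (card Sm / n) \<le> d" unfolding d_def using AB by (intro mult_left_mono divide_right_mono) auto
      thus "expectation (\<lambda>\<omega>. (D \<omega>)\<^sup>2) \<le> d" using y2(2)[OF fin(2)] by (simp add: D_def)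
    qed
    have iD: "integrable M D" unfolding D_def[abs_def] using yi by simp
    have S2: "integrable M (\<lambda>\<omega>. (S \<omega>)\<^sup>2)" using y2(1)[of "{..<n}"] by (simp add: S_def)
    have S'2: "integrable M (\<lambda>\<omega>. (S' \<omega>)\<^sup>2)" "expectation (\<lambda>\<omega>. (S' \<omega>)\<^sup>2) \<le> A"
    proof -
      have eq: "S' \<omega> = (\<Sum>i\<in>{i. i < n \<and> i mod (l + s) < l}. y i \<omega>)" for \<omega>
      proof -
        have "S \<omega> = (\<Sum>i\<in>{i. i < n \<and> i mod (l + s) < l}. y i \<omega>) + D \<omega>"
          unfolding S_def D_def Sm_def
          by (subst sum.union_disjoint[symmetric]) (auto intro!: sum.cong)
        thus ?thesis using SD[of \<omega>] by simp
      qed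
      show "integrable M (\<lambda>\<omega>. (S' \<omega>)\<^sup>2)" unfolding eq by (rule y2(1)) simp
      have "card {i. i < n \<and> i mod (l + s) < l} \<le> card {..<n}" by (rule card_mono) auto
      hence "A * (card {i. i < n \<and> i mod (l + s) < l} / n) \<le> A * 1"
        using AB n by (intro mult_left_mono) auto
      thus "expectation (\<lambda>\<omega>. (S' \<omega>)\<^sup>2) \<le> A"
        unfolding eq using y2(2)[of "{i. i < n \<and> i mod (l + s) < l}"] by simp
    qed
    \<comment> \<open>The weight that balances the two terms of
      \<open>(\<delta> + d / \<delta>) / 2\<close>.\<close>
    define \<delta> where "\<delta> = sqrt d"
    have \<delta>: "\<delta> > 0" "\<delta>\<^sup>2 = d" using d by (auto simp: \<delta>_def)
    have e1: "cmod (expectation (\<lambda>\<omega>. cis (S \<omega>)) - expectation (\<lambda>\<omega>. cis (S' \<omega>))) \<le> \<delta>"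
    proof -
      have "cmod (expectation (\<lambda>\<omega>. cis (S \<omega>)) - expectation (\<lambda>\<omega>. cis (S' \<omega>)))
         = cmod (expectation (\<lambda>\<omega>. cis (S \<omega>) - cis (S' \<omega>)))"
        by (simp add: integrable_cis)
      also have "\<dots> \<le> expectation (\<lambda>\<omega>. (\<delta> + (D \<omega>)\<^sup>2 / \<delta>) / 2)"
      proof (rule order_trans[OF integral_norm_bound integral_mono])
        show "cmod (cis (S \<omega>) - cis (S' \<omega>)) \<le> (\<delta> + (D \<omega>)\<^sup>2 / \<delta>) / 2" for \<omega>
          using norm_cis_diff_le[of "S \<omega>" "S' \<omega>"] abs_le_amgm[OF \<delta>(1), of "D \<omega>"] SD[of \<omega>] by simp
      qed (use D2 in \<open>auto simp: integrable_cis\<close>)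
      also have "\<dots> = (\<delta> + expectation (\<lambda>\<omega>. (D \<omega>)\<^sup>2) / \<delta>) / 2" using D2 by (simp add: prob_space)
      also have "\<dots> \<le> (\<delta> + d / \<delta>) / 2"
        using D2 \<delta> by (intro divide_right_mono add_left_mono) auto
      also have "d / \<delta> = \<delta>" using \<delta> by (simp add: power2_eq_square field_simps flip: \<delta>(2))
      finally show ?thesis by simp
    qed
    have e2: "cmod (expectation (\<lambda>\<omega>. cis (S' \<omega>)) - (\<Prod>j<K. expectation (\<lambda>\<omega>. cis (\<xi> j \<omega>)))) \<le> K * (16 * (a * b ^ s))"
      unfolding S'_def \<xi>_def
    proof (rule cis_blocks_le[OF ya l(1)])
      fix j i assume "i \<in> Bl j"
      thus "j * (l + s) \<le> i \<and> i < j * (l + s) + l"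
        using div_mult_mod_eq[of i "l + s"] unfolding Bl_def by auto
    qed
    \<comment> \<open>With this weight \<open>\<eta> * h\<close> and
      \<open>h\<^sup>2 / \<eta>\<close> coincide.\<close>
    define \<eta> where "\<eta> = sqrt h"
    have \<eta>: "\<eta> > 0" "\<eta>\<^sup>2 = h" using h by (auto simp: \<eta>_def)
    have e3: "cmod (expectation (\<lambda>\<omega>. cis (\<xi> j \<omega>)) - exp (- (v j / 2))) \<le> (A + B) * (h * \<eta>) + A\<^sup>2 * h\<^sup>2" for j
    proof -
      have 1: "cmod (expectation (\<lambda>\<omega>. cis (\<xi> j \<omega>)) - (1 - v j / 2)) \<le> (A + B) * (h * \<eta>)"
      proof -
        have "cmod (expectation (\<lambda>\<omega>. cis (\<xi> j \<omega>)) - (1 - v j / 2)) \<le> (\<eta> * v j + expectation (\<lambda>\<omega>. \<xi> j \<omega> ^ 4) / \<eta>) / 12"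
          unfolding v_def by (rule expectation_cis_quadratic[OF _ \<xi>2(1) \<xi>4(1) \<xi>1 \<eta>(1)]) simp
        also have "\<dots> \<le> (\<eta> * (A * h) + (B * h\<^sup>2) / \<eta>) / 12"
          using \<xi>2(2)[of j] \<xi>4(2)[of j] \<eta> by (intro divide_right_mono add_mono mult_left_mono) auto
        also have "(B * h\<^sup>2) / \<eta> = B * (h * \<eta>)"
          using \<eta>(1) by (simp add: power2_eq_square flip: \<eta>(2))
        also have "(\<eta> * (A * h) + B * (h * \<eta>)) / 12 = ((A + B) * (h * \<eta>)) / 12" by (simp add: algebra_simps)
        also have "\<dots> \<le> (A + B) * (h * \<eta>)" using AB h \<eta> by simp
        finally show ?thesis .
      qed
      have "\<bar>exp (- (v j / 2)) - (1 - v j / 2)\<bar> \<le> (v j / 2)\<^sup>2" by (rule exp_minus_approx) (use v0 in simp)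
      also have "\<dots> \<le> (A * h)\<^sup>2" using \<xi>2(2)[of j] v0[of j] by (intro power_mono) auto
      finally have 2: "\<bar>(1 - v j / 2) - exp (- (v j / 2))\<bar> \<le> A\<^sup>2 * h\<^sup>2"
        by (simp add: power_mult_distrib abs_minus_commute)
      have "cmod (complex_of_real (1 - v j / 2) - complex_of_real (exp (- (v j / 2)))) \<le> A\<^sup>2 * h\<^sup>2"
        unfolding of_real_diff[symmetric] norm_of_real by (rule 2)
      with 1 show ?thesis by (intro norm_diff_triangle_le[OF 1]) simp
    qed
    have e3': "cmod ((\<Prod>j<K. expectation (\<lambda>\<omega>. cis (\<xi> j \<omega>))) - exp (- ((\<Sum>j<K. v j) / 2)))
        \<le> K * ((A + B) * (h * \<eta>) + A\<^sup>2 * h\<^sup>2)"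
    proof -
      have "complex_of_real (exp (- ((\<Sum>j<K. v j) / 2))) = (\<Prod>j<K. complex_of_real (exp (- (v j / 2))))"
        by (simp add: exp_sum sum_divide_distrib flip: sum_negf of_real_prod)
      moreover have "cmod ((\<Prod>j<K. expectation (\<lambda>\<omega>. cis (\<xi> j \<omega>))) - (\<Prod>j<K. complex_of_real (exp (- (v j / 2)))))
         \<le> (\<Sum>j<K. cmod (expectation (\<lambda>\<omega>. cis (\<xi> j \<omega>)) - complex_of_real (exp (- (v j / 2)))))"
        by (rule norm_prod_diff) (use v0 in \<open>auto simp: norm_expectation_cis_le_1\<close>)
      moreover have "\<dots> \<le> (\<Sum>j<K. (A + B) * (h * \<eta>) + A\<^sup>2 * h\<^sup>2)" by (intro sum_mono e3)
      ultimately show ?thesis by simp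
    qed
    \<comment> \<open>Fourth moments of the blocks allow the covariance bound with
      \<open>m = m' = 1\<close> and \<open>p = 4\<close>, hence the rate
      \<open>b powr (1/2)\<close>.\<close>
    have c\<xi>: "\<bar>expectation (\<lambda>\<omega>. \<xi> i \<omega> * \<xi> j \<omega>)\<bar> \<le> (4 * a + 8 * B * B) * (b powr (1/2)) ^ s"
      "integrable M (\<lambda>\<omega>. \<xi> i \<omega> * \<xi> j \<omega>)" if ij: "i < j" for i j
    proof -
      define k where "k = i * (l + s) + l - 1"
      have "Suc i * (l + s) \<le> j * (l + s)" using ij by (intro mult_le_mono1) simp
      hence ks: "k + s \<le> j * (l + s)" using l by (simp add: k_def)
      have m1: "\<xi> i \<in> borel_measurable (lo N k)" unfolding \<xi>_def[abs_def]
      proof (rule sum_measurable_lo[OF ya])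
        fix u assume "u \<in> Bl i"
        thus "u \<le> k" using div_mult_mod_eq[of u "l + s"] unfolding Bl_def k_def by auto
      qed
      have m2: "\<xi> j \<in> borel_measurable (hi N (k + s))" unfolding \<xi>_def[abs_def]
      proof (rule sum_measurable_hi[OF ya])
        fix u assume "u \<in> Bl j"
        thus "k + s \<le> u" using div_mult_mod_eq[of u "l + s"] ks unfolding Bl_def by auto
      qed
      have p4: "\<bar>x\<bar> powr (4 / 1) = x ^ 4" for x :: real
        by (cases "x = 0") (auto simp: powr_numeral)
      have b4: "integrable M (\<lambda>\<omega>. \<bar>\<xi> j \<omega>\<bar> powr (4 / 1)) \<and> expectation (\<lambda>\<omega>. \<bar>\<xi> j \<omega>\<bar> powr (4 / 1)) \<le> B" for j
      proof -
        have "B * h\<^sup>2 \<le> B * 1" using AB h by (intro mult_left_mono) (auto simp: power_le_one)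
        thus ?thesis unfolding p4 using \<xi>4[of j] by simp
      qed
      note cm = cov_moment_bounded[OF m1 m2, of 1 1 4 B]
      show "integrable M (\<lambda>\<omega>. \<xi> i \<omega> * \<xi> j \<omega>)" by (rule cm(1)) (use b4 AB in auto)
      have "\<bar>cov (\<xi> i) (\<xi> j)\<bar> \<le> (4 * a + 8 * B * B) * (b powr (1 - (1 + 1) / 4)) ^ s"
        by (rule cm(2)) (use b4 AB in auto)
      thus "\<bar>expectation (\<lambda>\<omega>. \<xi> i \<omega> * \<xi> j \<omega>)\<bar> \<le> (4 * a + 8 * B * B) * (b powr (1/2)) ^ s"
        by (simp add: cov_def \<xi>1)
    qed
    \<comment> \<open>The diagonal of the squared sum gives the block variances; every off-diagonal
      term is a covariance across at least one gap.\<close>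
    have e4: "\<bar>expectation (\<lambda>\<omega>. (S' \<omega>)\<^sup>2) - (\<Sum>j<K. v j)\<bar> \<le> (real K)\<^sup>2 * ((4 * a + 8 * B * B) * (b powr (1/2)) ^ s)"
    proof -
      let ?c = "(4 * a + 8 * B * B) * (b powr (1/2)) ^ s"
      have c0: "?c \<ge> 0" using a_pos AB by simp
      have i: "integrable M (\<lambda>\<omega>. \<xi> i \<omega> * \<xi> j \<omega>)" for i j
        using c\<xi>(2)[of i j] c\<xi>(2)[of j i] \<xi>2(1)[of i] by (cases i j rule: linorder_cases) (auto simp: power2_eq_square mult.commute)
      have e: "\<bar>expectation (\<lambda>\<omega>. \<xi> i \<omega> * \<xi> j \<omega>) - (if i = j then v i else 0)\<bar> \<le> ?c" for i j
        using c\<xi>(1)[of i j] c\<xi>(1)[of j i] c0 by (cases i j rule: linorder_cases) (auto simp: power2_eq_square v_def mult.commute)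
      have "expectation (\<lambda>\<omega>. (S' \<omega>)\<^sup>2) = (\<Sum>i<K. \<Sum>j<K. expectation (\<lambda>\<omega>. \<xi> i \<omega> * \<xi> j \<omega>))"
        using i by (simp add: S'_def power2_eq_square sum_product)
      moreover have "(\<Sum>j<K. v j) = (\<Sum>i<K. \<Sum>j<K. if i = j then v i else 0)" by simp
      ultimately have "expectation (\<lambda>\<omega>. (S' \<omega>)\<^sup>2) - (\<Sum>j<K. v j)
         = (\<Sum>i<K. \<Sum>j<K. expectation (\<lambda>\<omega>. \<xi> i \<omega> * \<xi> j \<omega>) - (if i = j then v i else 0))"
        by (simp only: sum_subtractf)
      also have "\<bar>\<dots>\<bar> \<le> (\<Sum>i<K. \<Sum>j<K. ?c)"
        by (intro order_trans[OF sum_abs] sum_mono e)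
      finally show ?thesis by (simp add: power2_eq_square)
    qed
    \<comment> \<open>The mixed term \<open>2 * D * S'\<close> is split with weight \<delta>, so
      that the second moment of \<open>S'\<close>, merely bounded, enters with a small
      factor.\<close>
    have e5: "\<bar>expectation (\<lambda>\<omega>. (S \<omega>)\<^sup>2) - expectation (\<lambda>\<omega>. (S' \<omega>)\<^sup>2)\<bar> \<le> d + \<delta> + \<delta> * A"
    proof -
      have pt: "\<bar>(S \<omega>)\<^sup>2 - (S' \<omega>)\<^sup>2\<bar> \<le> (1 + 1 / \<delta>) * (D \<omega>)\<^sup>2 + \<delta> * (S' \<omega>)\<^sup>2" for \<omega>
      proof -
        have "(S \<omega>)\<^sup>2 - (S' \<omega>)\<^sup>2 = (D \<omega>)\<^sup>2 + 2 * (D \<omega> * S' \<omega>)"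
          unfolding SD by (simp add: power2_eq_square algebra_simps)
        moreover have "\<bar>2 * (D \<omega> * S' \<omega>)\<bar> \<le> (D \<omega>)\<^sup>2 / \<delta> + \<delta> * (S' \<omega>)\<^sup>2"
        proof -
          have "0 \<le> (\<bar>D \<omega>\<bar> - \<delta> * \<bar>S' \<omega>\<bar>)\<^sup>2 / \<delta>" using \<delta> by simp
          also have "\<dots> = (D \<omega>)\<^sup>2 / \<delta> + \<delta> * (S' \<omega>)\<^sup>2 - 2 * (\<bar>D \<omega>\<bar> * \<bar>S' \<omega>\<bar>)"
            using \<delta>(1) by (simp add: power2_diff power_mult_distrib diff_divide_distrib add_divide_distrib) (simp add: power2_eq_square)
          finally show ?thesis by (simp add: abs_mult)
        qed
        moreover have "(1 + 1 / \<delta>) * (D \<omega>)\<^sup>2 = (D \<omega>)\<^sup>2 + (D \<omega>)\<^sup>2 / \<delta>" by (simp add: distrib_right)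
        moreover have "0 \<le> (D \<omega>)\<^sup>2" by simp
        ultimately show ?thesis by linarith
      qed
      have "\<bar>expectation (\<lambda>\<omega>. (S \<omega>)\<^sup>2) - expectation (\<lambda>\<omega>. (S' \<omega>)\<^sup>2)\<bar> = \<bar>expectation (\<lambda>\<omega>. (S \<omega>)\<^sup>2 - (S' \<omega>)\<^sup>2)\<bar>"
        using S2 S'2 by simp
      also have "\<dots> \<le> expectation (\<lambda>\<omega>. (1 + 1 / \<delta>) * (D \<omega>)\<^sup>2 + \<delta> * (S' \<omega>)\<^sup>2)"
        by (rule abs_expectation_mono) (use S2 S'2 D2 pt in auto)
      also have "\<dots> = (1 + 1 / \<delta>) * expectation (\<lambda>\<omega>. (D \<omega>)\<^sup>2) + \<delta> * expectation (\<lambda>\<omega>. (S' \<omega>)\<^sup>2)"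
        using S'2 D2 by simp
      also have "\<dots> \<le> (1 + 1 / \<delta>) * d + \<delta> * A"
        using S'2 D2 \<delta> by (intro add_mono mult_left_mono) auto
      also have "(1 + 1 / \<delta>) * d = d + \<delta>" using \<delta>(1) by (simp add: power2_eq_square distrib_right flip: \<delta>(2))
      finally show ?thesis .
    qed
    have e6: "cmod (complex_of_real (exp (- ((\<Sum>j<K. v j) / 2))) - complex_of_real (exp (- (expectation (\<lambda>\<omega>. (S \<omega>)\<^sup>2) / 2))))
      \<le> ((real K)\<^sup>2 * ((4 * a + 8 * B * B) * (b powr (1/2)) ^ s) + (d + \<delta> + \<delta> * A)) / 2"
    proof -
      have "cmod (complex_of_real (exp (- ((\<Sum>j<K. v j) / 2))) - complex_of_real (exp (- (expectation (\<lambda>\<omega>. (S \<omega>)\<^sup>2) / 2))))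
        = \<bar>exp (- ((\<Sum>j<K. v j) / 2)) - exp (- (expectation (\<lambda>\<omega>. (S \<omega>)\<^sup>2) / 2))\<bar>"
        unfolding of_real_diff[symmetric] norm_of_real ..
      also have "\<dots> \<le> \<bar>(\<Sum>j<K. v j) / 2 - expectation (\<lambda>\<omega>. (S \<omega>)\<^sup>2) / 2\<bar>"
        using v0 by (intro exp_minus_diff_le) (auto intro!: sum_nonneg)
      also have "\<dots> \<le> ((real K)\<^sup>2 * ((4 * a + 8 * B * B) * (b powr (1/2)) ^ s) + (d + \<delta> + \<delta> * A)) / 2"
      proof -
        have "\<bar>x / 2 - z / 2\<bar> \<le> (r + t) / 2" if "\<bar>y - x\<bar> \<le> r" "\<bar>z - y\<bar> \<le> t" for x y z r t :: real
          using that by (simp add: abs_le_iff field_simps)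
        from this[OF e4 e5] show ?thesis .
      qed
      finally show ?thesis .
    qed
    \<comment> \<open>The four links of the chain: the gaps are dropped, the blocks decoupled, each
      block replaced by its Gaussian value, and the sum of block variances replaced by the full
      variance.\<close>
    have tri: "cmod (x - u) \<le> r1 + r2 + r3 + r4" if "cmod (x - y) \<le> r1" "cmod (y - z) \<le> r2" "cmod (z - w) \<le> r3" "cmod (w - u) \<le> r4" for x y z w u r1 r2 r3 r4
      using that by (intro norm_diff_triangle_le[of x w _ u]) (auto intro: norm_diff_triangle_le)
    have main: "cmod (expectation (\<lambda>\<omega>. cis (S \<omega>)) - complex_of_real (exp (- (expectation (\<lambda>\<omega>. (S \<omega>)\<^sup>2) / 2))))
      \<le> \<delta> + K * (16 * (a * b ^ s)) + K * ((A + B) * (h * \<eta>) + A\<^sup>2 * h\<^sup>2)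
        + ((real K)\<^sup>2 * ((4 * a + 8 * B * B) * (b powr (1/2)) ^ s) + (d + \<delta> + \<delta> * A)) / 2"
      by (rule tri[OF e1 e2 e3' e6])
    define w where "w = real K * real s / real n"
    have w0: "w \<ge> 0" by (simp add: w_def)
    have dw: "d = A * w" by (simp add: d_def w_def)
    have \<delta>le: "\<delta> \<le> A * sqrt w"
    proof -
      have "\<delta> = sqrt A * sqrt w" unfolding \<delta>_def dw by (rule real_sqrt_mult)
      also have "sqrt A \<le> A" using AB by (simp add: real_le_lsqrt self_le_power)
      finally show ?thesis using w0 by (simp add: mult_right_mono)
    qed
    have C': "16 * a \<le> C" "A + B \<le> C" "A\<^sup>2 \<le> C" "4 * a + 8 * B * B \<le> C" "2 * A + A\<^sup>2 \<le> C" "A \<le> C"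
      unfolding C_def using a_pos AB by (auto simp: algebra_simps intro!: add_nonneg_nonneg)
    have t1: "\<delta> + (\<delta> + \<delta> * A) / 2 \<le> C * sqrt w"
    proof -
      have "\<delta> + (\<delta> + \<delta> * A) / 2 \<le> \<delta> * (2 + A)" using \<delta> AB by (simp add: field_simps)
      also have "\<dots> \<le> A * sqrt w * (2 + A)" using \<delta>le AB by (intro mult_right_mono) auto
      also have "\<dots> = (2 * A + A\<^sup>2) * sqrt w" by (simp add: power2_eq_square algebra_simps)
      also have "\<dots> \<le> C * sqrt w" using C'(5) w0 by (intro mult_right_mono) auto
      finally show ?thesis .
    qed
    have t2: "d / 2 \<le> C * w"
    proof -
      have "d / 2 \<le> A * w" unfolding dw using AB w0 by simp
      also have "\<dots> \<le> C * w" by (rule mult_right_mono[OF C'(6) w0])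
      finally show ?thesis .
    qed
    have t3: "K * (16 * (a * b ^ s)) \<le> C * (K * b ^ s)"
    proof -
      have "(16 * a) * (K * b ^ s) \<le> C * (K * b ^ s)" by (rule mult_right_mono[OF C'(1)]) (use b_pos in simp)
      thus ?thesis by (simp add: mult_ac)
    qed
    have t4: "K * ((A + B) * (h * \<eta>) + A\<^sup>2 * h\<^sup>2) \<le> C * (K * (h * \<eta>)) + C * (K * h\<^sup>2)"
    proof -
      have "(A + B) * (K * (h * \<eta>)) \<le> C * (K * (h * \<eta>))" by (rule mult_right_mono[OF C'(2)]) (use h \<eta> in simp)
      moreover have "A\<^sup>2 * (K * h\<^sup>2) \<le> C * (K * h\<^sup>2)" by (rule mult_right_mono[OF C'(3)]) simp
      ultimately show ?thesis by (simp add: algebra_simps)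
    qed
    have t5: "(real K)\<^sup>2 * ((4 * a + 8 * B * B) * (b powr (1/2)) ^ s) / 2 \<le> C * ((real K)\<^sup>2 * (b powr (1/2)) ^ s)"
    proof -
      have "(4 * a + 8 * B * B) * ((real K)\<^sup>2 * (b powr (1/2)) ^ s) \<le> C * ((real K)\<^sup>2 * (b powr (1/2)) ^ s)"
        by (rule mult_right_mono[OF C'(4)]) simp
      moreover have "0 \<le> (4 * a + 8 * B * B) * ((real K)\<^sup>2 * (b powr (1/2)) ^ s)" using a_pos AB by simp
      ultimately show ?thesis by (simp add: mult_ac)
    qed
    have "cmod (expectation (\<lambda>\<omega>. cis (S \<omega>)) - complex_of_real (exp (- (expectation (\<lambda>\<omega>. (S \<omega>)\<^sup>2) / 2))))
      \<le> C * sqrt w + C * w + C * (K * b ^ s) + (C * (K * (h * \<eta>)) + C * (K * h\<^sup>2)) + C * ((real K)\<^sup>2 * (b powr (1/2)) ^ s)"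
      using main t1 t2 t3 t4 t5 by (simp only: add_divide_distrib)
    also have "\<dots> = C * (sqrt w + w + K * b ^ s + K * (h * \<eta>) + K * h\<^sup>2 + (real K)\<^sup>2 * (b powr (1/2)) ^ s)"
      by (simp add: distrib_left)
    finally show "cmod (expectation (\<lambda>\<omega>. cis ((\<Sum>i<n. Y i \<omega>) / sqrt n)) - exp (- expectation (\<lambda>\<omega>. ((\<Sum>i<n. Y i \<omega>) / sqrt n)\<^sup>2) / 2))
    \<le> C * (sqrt (real K * real s / real n) + real K * real s / real n + K * b ^ s + K * (l / n * sqrt (l / n)) + K * (l / n)\<^sup>2 + (real K)\<^sup>2 * (b powr (1/2)) ^ s)"
      unfolding S_def y_def w_def h_def \<eta>_def by (simp add: sum_divide_distrib)
  qed
qed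


text \<open>For each \<open>n\<close> the comparison is with the Gaussian value at the actual
  variance, by which nothing is ever divided; a degenerate limit \<open>v = 0\<close> is therefore
  covered.\<close>

theorem central_limit_mixing:
  fixes row :: "nat \<Rightarrow> 'r"
  assumes Y: "\<And>n. adapted (row n) (Y n)" "\<And>n. moments_le p \<kappa> (Y n)" and p: "p > 4" and \<kappa>: "\<kappa> > 0"
    and var: "(\<lambda>n. expectation (\<lambda>\<omega>. ((\<Sum>i<n. Y n i \<omega>) / sqrt n)\<^sup>2)) \<longlonglongrightarrow> v"
  shows "(\<lambda>n. expectation (\<lambda>\<omega>. cis ((\<Sum>i<n. Y n i \<omega>) / sqrt n))) \<longlonglongrightarrow> exp (- v / 2)"
proof -
  obtain C where C: "C > 0" and bd: "\<And>N Y (n::nat) (K::nat) (l::nat) (s::nat). adapted N Y \<Longrightarrow> moments_le p \<kappa> Y \<Longrightarrow> \<kappa> > 0 \<Longrightarrow> 0 < n \<Longrightarrow> 0 < l \<Longrightarrow> l \<le> n \<Longrightarrow> 0 < s \<Longrightarrow> 0 < K \<Longrightarrow>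
    n \<le> K * (l + s) \<Longrightarrow>
    cmod (expectation (\<lambda>\<omega>. cis ((\<Sum>i<n. Y i \<omega>) / sqrt n)) - exp (- expectation (\<lambda>\<omega>. ((\<Sum>i<n. Y i \<omega>) / sqrt n)\<^sup>2) / 2))
    \<le> C * (sqrt (real K * real s / real n) + real K * real s / real n + K * b ^ s + K * (l / n * sqrt (l / n)) + K * (l / n)\<^sup>2 + (real K)\<^sup>2 * (b powr (1/2)) ^ s)"
    using char_sum_approx[OF p, of \<kappa>] by blast
  \<comment> \<open>Blocks of length about \<open>sqrt n\<close>, gaps of length about
    \<open>n powr (1/4)\<close>, and as many periods as the block length: the gaps fill a share of
    order \<open>n powr (-1/4)\<close>, the term \<open>K * (l / n * sqrt (l / n))\<close> has the
    same order, and the mixing errors decay faster than any power of \<open>n\<close>.\<close>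
  define l where "l n = nat \<lceil>sqrt (real n)\<rceil>" for n
  define s where "s n = nat \<lceil>real n powr (1/4)\<rceil>" for n
  let ?x = "\<lambda>n. expectation (\<lambda>\<omega>. cis ((\<Sum>i<n. Y n i \<omega>) / sqrt n))"
  let ?v = "\<lambda>n. expectation (\<lambda>\<omega>. ((\<Sum>i<n. Y n i \<omega>) / sqrt n)\<^sup>2)"
  define L where "L n = sqrt (real n) + 1" for n
  define S where "S n = real n powr (1/4) + 1" for n
  define g where "g n = C * (sqrt (L n * S n / n) + L n * S n / n + L n * b powr (real n powr (1/4)) + L n * (L n / n * sqrt (L n / n)) + L n * (L n / n)\<^sup>2
    + (L n)\<^sup>2 * (b powr (1/2)) powr (real n powr (1/4)))" for n
  have le: "cmod (?x n - exp (- ?v n / 2)) \<le> g n" if n: "n \<ge> 1" for n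
  proof -
    have sq: "1 \<le> sqrt n" using n by simp
    have l: "0 < l n" "real (l n) \<le> L n" "sqrt n \<le> real (l n)"
    proof -
      have eq: "real (l n) = of_int \<lceil>sqrt n\<rceil>" using sq by (simp add: l_def)
      show l1: "sqrt n \<le> real (l n)" unfolding eq by linarith
      show "real (l n) \<le> L n" unfolding eq L_def by linarith
      show "0 < l n" using l1 sq by linarith
    qed
    have ln: "l n \<le> n"
    proof -
      have "sqrt n \<le> n" using n by (simp add: real_le_lsqrt self_le_power)
      thus ?thesis unfolding l_def by (simp add: nat_le_iff ceiling_le_iff)
    qed
    have "1 \<le> real n powr (1/4)" using n by (simp add: ge_one_powr_ge_zero)
    hence s: "0 < s n" "real (s n) \<le> S n" "real n powr (1/4) \<le> real (s n)"
    proof -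
      assume 1: "1 \<le> real n powr (1/4)"
      have eq: "real (s n) = of_int \<lceil>real n powr (1/4)\<rceil>" by (simp add: s_def)
      show s1: "real n powr (1/4) \<le> real (s n)" unfolding eq by linarith
      show "real (s n) \<le> S n" unfolding eq S_def by linarith
      show "0 < s n" using s1 1 by linarith
    qed
    define K where "K = l n"
    have nK: "n \<le> K * (l n + s n)"
    proof -
      have "real n = sqrt n * sqrt n" by simp
      also have "\<dots> \<le> real (l n) * real (l n)" using l sq by (intro mult_mono) auto
      finally have "n \<le> l n * l n" by (simp only: of_nat_mult[symmetric] of_nat_le_iff)
      thus ?thesis unfolding K_def by (simp add: distrib_left)
    qed
    have "cmod (?x n - exp (- ?v n / 2)) \<le> C * (sqrt (real K * real (s n) / real n) + real K * real (s n) / real n + K * b ^ s n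
      + K * (l n / n * sqrt (l n / n)) + K * (l n / n)\<^sup>2 + (real K)\<^sup>2 * (b powr (1/2)) ^ s n)"
      by (rule bd[OF Y(1)[of n] Y(2)[of n] \<kappa>]) (use n l ln s nK in \<open>auto simp: K_def\<close>)
    also have "\<dots> \<le> g n"
    proof -
      have b2: "0 < b powr (1/2)" "b powr (1/2) < 1"
        using b_pos b_less powr_less_mono2[of "1/2" b 1] by auto
      have pw: "x ^ s n \<le> x powr (real n powr (1/4))" if "0 < x" "x < 1" for x :: real
        using powr_mono'[OF s(3), of x] that by (simp add: powr_realpow)
      have L0: "0 \<le> L n" "0 \<le> S n" by (auto simp: L_def S_def)
      have Kle: "real K \<le> L n" using l by (simp add: K_def)
      show ?thesis unfolding g_def
        using C L0 Kle l s b_pos b_less b2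
        by (intro mult_left_mono add_mono real_sqrt_le_mono divide_right_mono mult_mono power_mono pw order_refl) auto
    qed
    finally show ?thesis .
  qed
  have "(\<lambda>n. ?x n - exp (- ?v n / 2)) \<longlonglongrightarrow> 0"
  proof (rule Lim_null_comparison)
    show "eventually (\<lambda>n. norm (?x n - exp (- ?v n / 2)) \<le> g n) sequentially"
      using le by (auto simp: eventually_sequentially intro!: exI[of _ 1])
    have bb: "0 < b" "b < 1" by (rule b_pos b_less)+
    have b2: "0 < b powr (1/2)" "b powr (1/2) < 1"
      using b_pos b_less powr_less_mono2[of "1/2" b 1] by auto
    have r1: "((\<lambda>n::nat. sqrt ((sqrt n + 1) * (real n powr (1/4) + 1) / n)) \<longlongrightarrow> 0) at_top" by real_asymp
    have r2: "((\<lambda>n::nat. (sqrt n + 1) * (real n powr (1/4) + 1) / n) \<longlongrightarrow> 0) at_top" by real_asymp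
    have r3: "((\<lambda>n::nat. (sqrt n + 1) * b powr (real n powr (1/4))) \<longlongrightarrow> 0) at_top"
      using bb by real_asymp
    have r4: "((\<lambda>n::nat. (sqrt n + 1) * ((sqrt n + 1) / n * sqrt ((sqrt n + 1) / n))) \<longlongrightarrow> 0) at_top" by real_asymp
    have r5: "((\<lambda>n::nat. (sqrt n + 1) * ((sqrt n + 1) / n)\<^sup>2) \<longlongrightarrow> 0) at_top" by real_asymp
    have r6: "((\<lambda>n::nat. (sqrt n + 1)\<^sup>2 * c powr (real n powr (1/4))) \<longlongrightarrow> 0) at_top" if "0 < c" "c < 1" for c
      using that by real_asymp
    have "(\<lambda>n. C * (sqrt (L n * S n / n) + L n * S n / n + L n * b powr (real n powr (1/4)) + L n * (L n / n * sqrt (L n / n)) + L n * (L n / n)\<^sup>2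
      + (L n)\<^sup>2 * (b powr (1/2)) powr (real n powr (1/4)))) \<longlonglongrightarrow> C * (0 + 0 + 0 + 0 + 0 + 0)"
      unfolding L_def S_def by (intro tendsto_intros r1 r2 r3 r4 r5 r6 b2)
    thus "g \<longlonglongrightarrow> 0" unfolding g_def[abs_def] by simp
  qed
  moreover have "(\<lambda>n. complex_of_real (exp (- ?v n / 2))) \<longlonglongrightarrow> complex_of_real (exp (- v / 2))"
    by (intro tendsto_intros var) simp
  ultimately have "(\<lambda>n. (?x n - exp (- ?v n / 2)) + complex_of_real (exp (- ?v n / 2))) \<longlonglongrightarrow> 0 + complex_of_real (exp (- v / 2))"
    by (rule tendsto_add)
  thus ?thesis by simp
qed

end

section \<open>Dyadic chaining\<close>

definition dyadics :: "real set" where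
  "dyadics = {real i / 2 ^ n | i n. i \<le> 2 ^ n}"

lemma dyadics_I: "i \<le> 2 ^ n \<Longrightarrow> real i / 2 ^ n \<in> dyadics"
  unfolding dyadics_def by blast

lemma zero_in_dyadics [simp]: "0 \<in> dyadics"
  using dyadics_I[of 0 0] by simp

lemma dyadics_unit: "x \<in> dyadics \<Longrightarrow> 0 \<le> x \<and> x \<le> 1"
  using of_nat_mono[of _ "2 ^ _", where 'a=real] unfolding dyadics_def by fastforce

lemma countable_dyadics: "countable dyadics"
proof -
  have "dyadics \<subseteq> (\<lambda>(i, n). real i / 2 ^ n) ` (UNIV :: (nat \<times> nat) set)"
    unfolding dyadics_def by auto
  thus ?thesis by (rule countable_subset) auto
qed

lemma dyadics_common_level:
  assumes "x \<in> dyadics" "y \<in> dyadics"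
  obtains i j n where "i \<le> 2 ^ n" "j \<le> 2 ^ n" "x = real i / 2 ^ n" "y = real j / 2 ^ n"
proof -
  obtain i m where x: "i \<le> 2 ^ m" "x = real i / 2 ^ m" using assms(1) by (auto simp: dyadics_def)
  obtain j n where y: "j \<le> 2 ^ n" "y = real j / 2 ^ n" using assms(2) by (auto simp: dyadics_def)
  show thesis
  proof (rule that)
    show "i * 2 ^ n \<le> 2 ^ (m + n)" using x(1) by (simp add: power_add)
    show "j * 2 ^ m \<le> 2 ^ (m + n)" using y(1) by (simp add: power_add mult.commute)
    show "x = real (i * 2 ^ n) / 2 ^ (m + n)" unfolding x(2) by (simp add: power_add)
    show "y = real (j * 2 ^ m) / 2 ^ (m + n)" unfolding y(2) by (simp add: power_add)
  qed
qed

definition dyadic_floor :: "nat \<Rightarrow> real \<Rightarrow> real" where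
  "dyadic_floor n x = real (nat \<lfloor>2 ^ n * x\<rfloor>) / 2 ^ n"

lemma dyadic_floor_in_dyadics:
  assumes "0 \<le> x" "x \<le> 1" shows "dyadic_floor n x \<in> dyadics"
  unfolding dyadic_floor_def
proof (rule dyadics_I)
  have "real (nat \<lfloor>2 ^ n * x\<rfloor>) \<le> 2 ^ n * x" using assms by simp
  also have "\<dots> \<le> 2 ^ n" using assms by (simp add: mult_left_le)
  finally have "real (nat \<lfloor>2 ^ n * x\<rfloor>) \<le> real (2 ^ n)" by simp
  thus "nat \<lfloor>2 ^ n * x\<rfloor> \<le> 2 ^ n" by (simp only: of_nat_le_iff)
qed

lemma dyadic_floor_tendsto:
  assumes "0 \<le> x" shows "(\<lambda>n. dyadic_floor n x) \<longlonglongrightarrow> x"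
proof (rule real_tendsto_sandwich)
  have *: "real (nat \<lfloor>2 ^ n * x\<rfloor>) = of_int \<lfloor>2 ^ n * x\<rfloor>" for n using assms by simp
  show "eventually (\<lambda>n. x - (1/2) ^ n \<le> dyadic_floor n x) sequentially"
  proof (intro always_eventually allI)
    fix n
    have "2 ^ n * x - 1 \<le> of_int \<lfloor>2 ^ n * x\<rfloor>" by linarith
    hence "(2 ^ n * x - 1) / 2 ^ n \<le> dyadic_floor n x"
      unfolding dyadic_floor_def * by (intro divide_right_mono) auto
    thus "x - (1/2) ^ n \<le> dyadic_floor n x" by (simp add: diff_divide_distrib power_one_over)
  qed
  show "eventually (\<lambda>n. dyadic_floor n x \<le> x) sequentially"
  proof (intro always_eventually allI)
    fix n
    have "of_int \<lfloor>2 ^ n * x\<rfloor> / 2 ^ n \<le> (2 ^ n * x) / 2 ^ n"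
      by (intro divide_right_mono) auto
    thus "dyadic_floor n x \<le> x" unfolding dyadic_floor_def * by simp
  qed
  have "(\<lambda>n. x - (1/2) ^ n) \<longlonglongrightarrow> x - 0" by (intro tendsto_intros LIMSEQ_realpow_zero) auto
  thus "(\<lambda>n. x - (1/2) ^ n) \<longlonglongrightarrow> x" by simp
qed simp

text \<open>Passing from \<open>i\<close> to \<open>i div 2\<close> leads to the parent point one
  level up. For even \<open>i\<close> the point is unchanged, for odd \<open>i\<close> the move is
  exactly one increment of the finer level.\<close>

lemma chain_to_coarser:
  fixes f :: "real \<Rightarrow> real"
  assumes inc: "\<And>m i. i < 2 ^ m \<Longrightarrow> \<bar>f (real (Suc i) / 2 ^ m) - f (real i / 2 ^ m)\<bar> \<le> A * \<rho> ^ m"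
    and A: "A \<ge> 0" "0 < \<rho>"
  shows "i \<le> 2 ^ (m + k) \<Longrightarrow>
    \<bar>f (real i / 2 ^ (m + k)) - f (real (i div 2 ^ k) / 2 ^ m)\<bar> \<le> (\<Sum>j<k. A * \<rho> ^ (m + 1 + j))"
proof (induction k arbitrary: i)
  case (Suc k)
  define h where "h = i div 2"
  have hle: "h \<le> 2 ^ (m + k)" using Suc.prems by (auto simp: h_def)
  have div: "h div 2 ^ k = i div 2 ^ Suc k" by (simp add: h_def div_mult2_eq)
  have step: "\<bar>f (real i / 2 ^ (m + Suc k)) - f (real h / 2 ^ (m + k))\<bar> \<le> A * \<rho> ^ (m + 1 + k)"
  proof -
    have eq: "real h / 2 ^ (m + k) = real (2 * h) / 2 ^ (m + Suc k)" by simp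
    show ?thesis
    proof (cases "even i")
      case True
      hence "i = 2 * h" by (simp add: h_def)
      thus ?thesis unfolding eq using A by simp
    next
      case False
      hence i: "i = Suc (2 * h)" by (simp add: h_def)
      hence "2 * h < 2 ^ (m + Suc k)" using Suc.prems by simp
      from inc[OF this] show ?thesis unfolding eq i by simp
    qed
  qed
  have "\<bar>f (real h / 2 ^ (m + k)) - f (real (h div 2 ^ k) / 2 ^ m)\<bar> \<le> (\<Sum>j<k. A * \<rho> ^ (m + 1 + j))"
    by (rule Suc.IH[OF hle])
  with step show ?case unfolding div by simp
qed simp

text \<open>At the finest level whose mesh is still at least the distance of the two points, their
  ancestors coincide or are neighbours. Two geometric chains and at most one increment connect the
  points, all of the order of the distance to the power \<theta>.\<close>

lemma dyadic_chaining_level: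
  fixes f :: "real \<Rightarrow> real"
  assumes inc: "\<And>m i. i < 2 ^ m \<Longrightarrow> \<bar>f (real (Suc i) / 2 ^ m) - f (real i / 2 ^ m)\<bar> \<le> A * (2 powr - \<theta>) ^ m"
    and A: "A \<ge> 0" and \<theta>: "\<theta> > 0" and ij: "i < j" "j \<le> 2 ^ n"
  defines "\<rho> \<equiv> 2 powr - \<theta>"
  shows "\<bar>f (real i / 2 ^ n) - f (real j / 2 ^ n)\<bar> \<le> (1 + 2 / (1 - \<rho>)) / \<rho> * A * \<bar>real i / 2 ^ n - real j / 2 ^ n\<bar> powr \<theta>"
proof -
  have \<rho>: "0 < \<rho>" "\<rho> < 1" using \<theta> powr_less_mono[of "- \<theta>" 0 2] by (auto simp: \<rho>_def)
  \<comment> \<open>The levels \<open>m\<close> whose mesh \<open>1 / 2 ^ m\<close> is at least the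
    distance of the two points.\<close>
  define S where "S = {m. m \<le> n \<and> (j - i) * 2 ^ m \<le> 2 ^ n}"
  have "0 \<in> S" using ij by (simp add: S_def)
  have "finite S" by (simp add: S_def)
  define m where "m = Max S"
  have "m \<in> S" unfolding m_def using \<open>0 \<in> S\<close> \<open>finite S\<close> by (intro Max_in) auto
  hence m: "m \<le> n" "(j - i) * 2 ^ m \<le> 2 ^ n" by (auto simp: S_def)
  have big: "2 ^ n < (j - i) * 2 ^ Suc m"
  proof (rule ccontr)
    assume neg: "\<not> ?thesis"
    have "m \<noteq> n"
    proof
      assume "m = n"
      with neg have "(j - i) * 2 * 2 ^ n \<le> 1 * (2 ^ n :: nat)" by (simp add: mult.assoc)
      hence "(j - i) * 2 \<le> 1" by (simp only: mult_le_cancel2) auto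
      thus False using ij by simp
    qed
    hence "Suc m \<in> S" using neg m by (simp add: S_def)
    hence "Suc m \<le> m" unfolding m_def using \<open>finite S\<close> by (intro Max_ge)
    thus False by simp
  qed
  define k where "k = n - m"
  have n: "n = m + k" using m by (simp add: k_def)
  have ji: "j - i \<le> 2 ^ k" using m(2) unfolding n by (simp add: power_add mult.commute)
  define i1 where "i1 = i div 2 ^ k"
  define j1 where "j1 = j div 2 ^ k"
  have "j div 2 ^ k \<le> (i + 2 ^ k) div 2 ^ k" using ji by (intro div_le_mono) simp
  hence j1: "i1 \<le> j1" "j1 \<le> Suc i1" using ij by (auto simp: i1_def j1_def div_le_mono)
  have "j1 \<le> (2 ^ m * 2 ^ k) div 2 ^ k"
    using ij(2) unfolding j1_def n power_add by (rule div_le_mono)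
  hence "j1 \<le> 2 ^ m" by simp
  hence mid: "\<bar>f (real i1 / 2 ^ m) - f (real j1 / 2 ^ m)\<bar> \<le> A * \<rho> ^ m"
  proof (cases "j1 = i1")
    case False
    hence "j1 = Suc i1" using j1 by simp
    thus ?thesis using inc[of i1 m] \<open>j1 \<le> 2 ^ m\<close> by (simp add: \<rho>_def abs_minus_commute)
  qed (use A \<rho> in simp)
  have geo: "(\<Sum>j<k. A * \<rho> ^ (m + 1 + j)) \<le> A * \<rho> ^ m / (1 - \<rho>)"
  proof -
    have "(\<Sum>j<k. A * \<rho> ^ (m + 1 + j)) = A * \<rho> ^ m * \<rho> * (\<Sum>j<k. \<rho> ^ j)"
      by (simp add: sum_distrib_left power_add mult_ac)
    also have "(\<Sum>j<k. \<rho> ^ j) = (1 - \<rho> ^ k) / (1 - \<rho>)" using \<rho> by (simp add: sum_gp_strict)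
    also have "A * \<rho> ^ m * \<rho> * ((1 - \<rho> ^ k) / (1 - \<rho>)) \<le> A * \<rho> ^ m * 1 * (1 / (1 - \<rho>))"
      using \<rho> A by (intro mult_mono divide_right_mono divide_nonneg_pos) (auto simp: power_le_one)
    finally show ?thesis by simp
  qed
  have ci: "\<bar>f (real i / 2 ^ n) - f (real i1 / 2 ^ m)\<bar> \<le> A * \<rho> ^ m / (1 - \<rho>)"
    unfolding n i1_def using ij
    by (intro order_trans[OF chain_to_coarser[OF inc[folded \<rho>_def] A \<rho>(1)] geo]) (auto simp: n)
  have cj: "\<bar>f (real j / 2 ^ n) - f (real j1 / 2 ^ m)\<bar> \<le> A * \<rho> ^ m / (1 - \<rho>)"
    unfolding n j1_def using ij
    by (intro order_trans[OF chain_to_coarser[OF inc[folded \<rho>_def] A \<rho>(1)] geo]) (auto simp: n)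
  define d where "d = \<bar>real i / 2 ^ n - real j / 2 ^ n\<bar>"
  have d: "d = real (j - i) / 2 ^ n" using ij by (simp add: d_def of_nat_diff field_simps)
  have "real (2 ^ n) < real ((j - i) * 2 ^ Suc m)" using big by (simp only: of_nat_less_iff)
  hence "1 / 2 ^ Suc m < d" unfolding d by (simp add: field_simps)
  hence "(1 / 2 ^ Suc m) powr \<theta> \<le> d powr \<theta>" using \<theta> by (intro powr_mono2) auto
  moreover have "(1 / 2 ^ Suc m) powr \<theta> = \<rho> ^ Suc m"
  proof -
    have "1 / 2 ^ Suc m = (2::real) powr (- real (Suc m))"
      by (simp only: powr_minus powr_realpow inverse_eq_divide zero_less_numeral)
    moreover have "\<rho> ^ Suc m = \<rho> powr real (Suc m)" using \<rho> by (simp only: powr_realpow)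
    ultimately show ?thesis by (simp only: \<rho>_def powr_powr) (simp add: algebra_simps)
  qed
  ultimately have dd: "\<rho> ^ Suc m \<le> d powr \<theta>" by simp
  have "\<bar>f (real i / 2 ^ n) - f (real j / 2 ^ n)\<bar> \<le> A * \<rho> ^ m * (1 + 2 / (1 - \<rho>))"
  proof -
    have "A * \<rho> ^ m * (1 + 2 / (1 - \<rho>)) = A * \<rho> ^ m + 2 * (A * \<rho> ^ m / (1 - \<rho>))"
      by (simp add: distrib_left)
    thus ?thesis using ci cj mid by linarith
  qed
  also have "\<dots> = (1 + 2 / (1 - \<rho>)) / \<rho> * A * \<rho> ^ Suc m" using \<rho> by simp
  also have "\<dots> \<le> (1 + 2 / (1 - \<rho>)) / \<rho> * A * d powr \<theta>"
    using dd \<rho> A by (intro mult_left_mono) auto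
  finally show ?thesis by (simp add: d_def)
qed

lemma dyadic_chaining:
  assumes "\<theta> > 0"
  shows "\<exists>C\<ge>0. \<forall>(f :: real \<Rightarrow> real) A. A \<ge> 0 \<longrightarrow>
      (\<forall>m i. i < 2 ^ m \<longrightarrow> \<bar>f (real (Suc i) / 2 ^ m) - f (real i / 2 ^ m)\<bar> \<le> A * (2 powr - \<theta>) ^ m) \<longrightarrow>
      (\<forall>x\<in>dyadics. \<forall>y\<in>dyadics. \<bar>f x - f y\<bar> \<le> C * A * \<bar>x - y\<bar> powr \<theta>)"
proof -
  define \<rho> where "\<rho> = 2 powr - \<theta>"
  define C where "C = (1 + 2 / (1 - \<rho>)) / \<rho>"
  have \<rho>: "0 < \<rho>" "\<rho> < 1" using assms powr_less_mono[of "- \<theta>" 0 2] by (auto simp: \<rho>_def)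
  show ?thesis
  proof (intro exI[of _ C] conjI allI impI ballI)
    show "C \<ge> 0" using \<rho> by (simp add: C_def)
    fix f :: "real \<Rightarrow> real" and A x y
    assume A: "A \<ge> 0" and inc: "\<forall>m i. i < 2 ^ m \<longrightarrow> \<bar>f (real (Suc i) / 2 ^ m) - f (real i / 2 ^ m)\<bar> \<le> A * (2 powr - \<theta>) ^ m"
      and xy: "x \<in> dyadics" "y \<in> dyadics"
    from xy obtain i n j where ij: "i \<le> 2 ^ n" "j \<le> 2 ^ n" "x = real i / 2 ^ n" "y = real j / 2 ^ n"
      by (rule dyadics_common_level)
    note lev = dyadic_chaining_level[OF inc[rule_format] A assms, folded \<rho>_def, folded C_def]
    consider "i < j" | "i = j" | "j < i" by linarith
    thus "\<bar>f x - f y\<bar> \<le> C * A * \<bar>x - y\<bar> powr \<theta>"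
    proof cases
      case 1
      thus ?thesis using lev[of i j n] ij by simp
    next
      case 3
      thus ?thesis using lev[of j i n] ij by (simp add: abs_minus_commute)
    qed (use ij in simp)
  qed
qed

text \<open>Chaining in space is applied to the time increments over dyadic intervals, then chaining
  in time to the difference of the functions at \<open>s\<close> and \<open>t\<close>. The edge
  bound at the space point \<open>0\<close> turns differences in space into bounds on the time
  increments themselves, and \<open>g 0 s = 0\<close> anchors the second conclusion.\<close>

lemma dyadic_chaining2:
  assumes \<theta>: "\<theta> > 0" and \<gamma>: "\<gamma> > 0"
  obtains C where "C \<ge> 0" and
    "\<And>g :: real \<Rightarrow> real \<Rightarrow> real. \<And>R x y s t. R \<ge> 0 \<Longrightarrow>
      (\<And>s. s \<in> dyadics \<Longrightarrow> g 0 s = 0) \<Longrightarrow>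
      (\<And>m i. i < 2 ^ m \<Longrightarrow> \<bar>g (real (Suc i) / 2 ^ m) 0 - g (real i / 2 ^ m) 0\<bar> \<le> R * (2 powr - \<theta>) ^ m) \<Longrightarrow>
      (\<And>m i n j. i < 2 ^ m \<Longrightarrow> j < 2 ^ n \<Longrightarrow>
         \<bar>(g (real (Suc i) / 2 ^ m) (real (Suc j) / 2 ^ n) - g (real i / 2 ^ m) (real (Suc j) / 2 ^ n))
          - (g (real (Suc i) / 2 ^ m) (real j / 2 ^ n) - g (real i / 2 ^ m) (real j / 2 ^ n))\<bar>
         \<le> R * (2 powr - \<theta>) ^ m * (2 powr - \<gamma>) ^ n) \<Longrightarrow>
      x \<in> dyadics \<Longrightarrow> y \<in> dyadics \<Longrightarrow> s \<in> dyadics \<Longrightarrow> t \<in> dyadics \<Longrightarrow>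
      \<bar>g x s - g y s\<bar> \<le> C * R * \<bar>x - y\<bar> powr \<theta> \<and> \<bar>g x s - g x t\<bar> \<le> C * R * \<bar>s - t\<bar> powr \<gamma>"
proof -
  obtain C1 where C1: "C1 \<ge> 0" and ch1':
    "\<forall>(f :: real \<Rightarrow> real) A. A \<ge> 0 \<longrightarrow>
      (\<forall>m i. i < 2 ^ m \<longrightarrow> \<bar>f (real (Suc i) / 2 ^ m) - f (real i / 2 ^ m)\<bar> \<le> A * (2 powr - \<theta>) ^ m) \<longrightarrow>
      (\<forall>x\<in>dyadics. \<forall>y\<in>dyadics. \<bar>f x - f y\<bar> \<le> C1 * A * \<bar>x - y\<bar> powr \<theta>)"
    using dyadic_chaining[OF \<theta>] by blast
  note ch1 = ch1'[rule_format]
  obtain C2 where C2: "C2 \<ge> 0" and ch2':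
    "\<forall>(f :: real \<Rightarrow> real) A. A \<ge> 0 \<longrightarrow>
      (\<forall>m i. i < 2 ^ m \<longrightarrow> \<bar>f (real (Suc i) / 2 ^ m) - f (real i / 2 ^ m)\<bar> \<le> A * (2 powr - \<gamma>) ^ m) \<longrightarrow>
      (\<forall>x\<in>dyadics. \<forall>y\<in>dyadics. \<bar>f x - f y\<bar> \<le> C2 * A * \<bar>x - y\<bar> powr \<gamma>)"
    using dyadic_chaining[OF \<gamma>] by blast
  note ch2 = ch2'[rule_format]
  show thesis
  proof (rule that[of "C1 * (1 + C2)"])
    show "0 \<le> C1 * (1 + C2)" using C1 C2 by simp
    fix g :: "real \<Rightarrow> real \<Rightarrow> real" and R x y s t
    assume R: "R \<ge> 0" and g0: "\<And>s. s \<in> dyadics \<Longrightarrow> g 0 s = 0"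
      and e: "\<And>m i. i < 2 ^ m \<Longrightarrow> \<bar>g (real (Suc i) / 2 ^ m) 0 - g (real i / 2 ^ m) 0\<bar> \<le> R * (2 powr - \<theta>) ^ m"
      and rect: "\<And>m i n j. i < 2 ^ m \<Longrightarrow> j < 2 ^ n \<Longrightarrow>
         \<bar>(g (real (Suc i) / 2 ^ m) (real (Suc j) / 2 ^ n) - g (real i / 2 ^ m) (real (Suc j) / 2 ^ n))
          - (g (real (Suc i) / 2 ^ m) (real j / 2 ^ n) - g (real i / 2 ^ m) (real j / 2 ^ n))\<bar>
         \<le> R * (2 powr - \<theta>) ^ m * (2 powr - \<gamma>) ^ n"
      and x: "x \<in> dyadics" and y: "y \<in> dyadics" and s: "s \<in> dyadics" and t: "t \<in> dyadics"
    have inc: "\<bar>(g (real (Suc i) / 2 ^ m) s - g (real i / 2 ^ m) s) - (g (real (Suc i) / 2 ^ m) t - g (real i / 2 ^ m) t)\<bar>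
       \<le> C2 * (R * (2 powr - \<theta>) ^ m) * \<bar>s - t\<bar> powr \<gamma>" if "i < 2 ^ m" "s \<in> dyadics" "t \<in> dyadics" for i m s t
      by (rule ch2[of "R * (2 powr - \<theta>) ^ m" "\<lambda>s. g (real (Suc i) / 2 ^ m) s - g (real i / 2 ^ m) s"])
        (use that R rect in auto)
    have inc0: "\<bar>g (real (Suc i) / 2 ^ m) s - g (real i / 2 ^ m) s\<bar> \<le> ((1 + C2) * R) * (2 powr - \<theta>) ^ m"
      if i: "i < 2 ^ m" for i m
    proof -
      have "\<bar>s - 0\<bar> powr \<gamma> \<le> 1" using dyadics_unit[OF s] \<gamma> by (simp add: powr_le1)
      hence "C2 * (R * (2 powr - \<theta>) ^ m) * \<bar>s - 0\<bar> powr \<gamma> \<le> C2 * (R * (2 powr - \<theta>) ^ m) * 1"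
        using C2 R by (intro mult_left_mono) auto
      thus ?thesis using inc[OF i s, of 0] e[OF i] by (simp add: algebra_simps)
    qed
    have 1: "\<bar>g x s - g y s\<bar> \<le> C1 * ((1 + C2) * R) * \<bar>x - y\<bar> powr \<theta>"
      by (rule ch1[of "(1 + C2) * R" "\<lambda>x. g x s"]) (use inc0 x y C2 R in auto)
    have "\<bar>(g x s - g x t) - (g 0 s - g 0 t)\<bar> \<le> C1 * (C2 * R * \<bar>s - t\<bar> powr \<gamma>) * \<bar>x - 0\<bar> powr \<theta>"
    proof (rule ch1[of "C2 * R * \<bar>s - t\<bar> powr \<gamma>" "\<lambda>x. g x s - g x t"])
      fix m i :: nat assume "i < 2 ^ m"
      from inc[OF this s t]
      show "\<bar>g (real (Suc i) / 2 ^ m) s - g (real (Suc i) / 2 ^ m) t - (g (real i / 2 ^ m) s - g (real i / 2 ^ m) t)\<bar>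
         \<le> C2 * R * \<bar>s - t\<bar> powr \<gamma> * (2 powr - \<theta>) ^ m"
        by (simp add: algebra_simps)
    qed (use x C2 R in auto)
    also have "\<dots> \<le> C1 * (C2 * R * \<bar>s - t\<bar> powr \<gamma>) * 1"
      using dyadics_unit[OF x] \<theta> C1 C2 R by (intro mult_left_mono) (auto simp: powr_le1)
    also have "\<dots> \<le> C1 * (1 + C2) * R * \<bar>s - t\<bar> powr \<gamma>"
      using C1 R by (simp add: algebra_simps)
    finally have 2: "\<bar>g x s - g x t\<bar> \<le> C1 * (1 + C2) * R * \<bar>s - t\<bar> powr \<gamma>"
      using g0[OF s] g0[OF t] by simp
    from 1 2 show "\<bar>g x s - g y s\<bar> \<le> C1 * (1 + C2) * R * \<bar>x - y\<bar> powr \<theta> \<and>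
       \<bar>g x s - g x t\<bar> \<le> C1 * (1 + C2) * R * \<bar>s - t\<bar> powr \<gamma>"
      by (simp add: mult.assoc)
  qed
qed

section \<open>Gaussian processes with a given covariance\<close>

definition psd_kernel :: "('i \<Rightarrow> 'i \<Rightarrow> real) \<Rightarrow> bool" where
  "psd_kernel K \<longleftrightarrow> (\<forall>s t. K s t = K t s) \<and> (\<forall>F a. finite F \<longrightarrow> 0 \<le> (\<Sum>s\<in>F. \<Sum>t\<in>F. a s * a t * K s t))"

lemma quadratic_form_insert:
  fixes K :: "'i \<Rightarrow> 'i \<Rightarrow> real"
  assumes F: "finite F" "m \<notin> F" and sym: "\<And>s t. K s t = K t s"
  shows "(\<Sum>s\<in>insert m F. \<Sum>t\<in>insert m F. a s * a t * K s t)
    = (\<Sum>s\<in>F. \<Sum>t\<in>F. a s * a t * K s t) + 2 * a m * (\<Sum>s\<in>F. a s * K s m) + (a m)\<^sup>2 * K m m"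
proof -
  have "(\<Sum>s\<in>insert m F. \<Sum>t\<in>insert m F. a s * a t * K s t)
     = a m * a m * K m m + (\<Sum>t\<in>F. a m * a t * K m t) + ((\<Sum>s\<in>F. a s * a m * K s m) + (\<Sum>s\<in>F. \<Sum>t\<in>F. a s * a t * K s t))"
    using F by (simp add: sum.distrib)
  moreover have "(\<Sum>t\<in>F. a m * a t * K m t) = a m * (\<Sum>s\<in>F. a s * K s m)"
    by (simp add: sum_distrib_left sym[of m] mult.assoc)
  moreover have "(\<Sum>s\<in>F. a s * a m * K s m) = a m * (\<Sum>s\<in>F. a s * K s m)"
    by (simp add: sum_distrib_left mult_ac)
  ultimately show ?thesis by (simp add: power2_eq_square)
qed

lemma psd_kernel_diag: "psd_kernel K \<Longrightarrow> 0 \<le> K m m"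
  unfolding psd_kernel_def by (drule conjunct2, drule spec[of _ "{m}"], drule spec[of _ "\<lambda>_. 1"]) simp

text \<open>For coefficient \<open>1\<close> at \<open>i\<close> and \<open>t\<close> at
  \<open>m\<close> the form is affine in \<open>t\<close>, and an affine function that is
  nonnegative everywhere is constant.\<close>

lemma psd_kernel_zero_diag:
  assumes K: "psd_kernel K" and m: "K m m = 0" shows "K i m = 0"
proof (cases "i = m")
  case False
  have *: "0 \<le> K i i + 2 * t * K i m" for t
  proof -
    define a where "a j = (if j = m then t else 1)" for j
    have "0 \<le> (\<Sum>s\<in>insert m {i}. \<Sum>u\<in>insert m {i}. a s * a u * K s u)"
      using K unfolding psd_kernel_def by blast
    also have "\<dots> = K i i + 2 * t * K i m"
      using False m K by (subst quadratic_form_insert) (auto simp: a_def psd_kernel_def)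
    finally show ?thesis .
  qed
  show ?thesis
  proof (rule ccontr)
    assume nz: "K i m \<noteq> 0"
    have "0 \<le> K i i + 2 * (- (K i i + 1) / (2 * K i m)) * K i m" by (rule *)
    moreover have "2 * (- (K i i + 1) / (2 * K i m)) * K i m = - (K i i + 1)" using nz by (simp add: field_simps)
    ultimately show False by linarith
  qed
qed (use m in simp)

text \<open>The covariance after subtracting the best linear prediction from the variable
  \<open>m\<close>. If \<open>K m m = 0\<close>, division by zero makes the correction vanish, in
  accordance with the fact that a positive semidefinite kernel then has zero column
  \<open>m\<close>.\<close>

definition schur_complement :: "'i \<Rightarrow> ('i \<Rightarrow> 'i \<Rightarrow> real) \<Rightarrow> 'i \<Rightarrow> 'i \<Rightarrow> real" where
  "schur_complement m K s t = K s t - K s m * K t m / K m m"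

lemma schur_complement_zero:
  assumes "psd_kernel K" shows "schur_complement m K m t = 0" "schur_complement m K s m = 0"
proof -
  have sym: "K s t = K t s" for s t using assms by (simp add: psd_kernel_def)
  show "schur_complement m K m t = 0" "schur_complement m K s m = 0"
    using psd_kernel_zero_diag[OF assms, of m] sym[of m t] unfolding schur_complement_def
    by (cases "K m m = 0"; simp)+
qed

text \<open>The quadratic form of the complement is that of \<open>K\<close> minimised over the
  coefficient of \<open>m\<close>.\<close>

lemma psd_schur_complement:
  fixes K :: "'i \<Rightarrow> 'i \<Rightarrow> real"
  assumes K: "psd_kernel K" shows "psd_kernel (schur_complement m K)"
  unfolding psd_kernel_def
proof (intro conjI allI impI)
  have sym: "K s t = K t s" for s t using K by (simp add: psd_kernel_def)
  show "schur_complement m K s t = schur_complement m K t s" for s t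
    by (simp add: schur_complement_def sym[of s t] mult.commute)
  fix F :: "'i set" and a assume F: "finite F"
  define F0 where "F0 = F - {m}"
  have F0: "finite F0" "m \<notin> F0" using F by (auto simp: F0_def)
  define u where "u = (\<Sum>s\<in>F0. a s * K s m)"
  \<comment> \<open>The minimiser of the quadratic polynomial in the coefficient of
    \<open>m\<close>; it evaluates to \<open>0\<close> if \<open>K m m = 0\<close>.\<close>
  define a' where "a' = a(m := - u / K m m)"
  have "0 \<le> (\<Sum>s\<in>insert m F0. \<Sum>t\<in>insert m F0. a' s * a' t * K s t)"
    using K F0 by (auto simp: psd_kernel_def simp del: sum.insert)
  also have "\<dots> = (\<Sum>s\<in>F0. \<Sum>t\<in>F0. a' s * a' t * K s t) + 2 * a' m * (\<Sum>s\<in>F0. a' s * K s m) + (a' m)\<^sup>2 * K m m"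
    by (rule quadratic_form_insert[OF F0 sym])
  finally have 0: "0 \<le> (\<Sum>s\<in>F0. \<Sum>t\<in>F0. a' s * a' t * K s t) + 2 * a' m * (\<Sum>s\<in>F0. a' s * K s m) + (a' m)\<^sup>2 * K m m" .
  have 1: "(\<Sum>s\<in>F0. \<Sum>t\<in>F0. a' s * a' t * K s t) = (\<Sum>s\<in>F0. \<Sum>t\<in>F0. a s * a t * K s t)"
    using F0 by (intro sum.cong) (auto simp: a'_def)
  have 2: "(\<Sum>s\<in>F0. a' s * K s m) = u"
    unfolding u_def using F0 by (intro sum.cong) (auto simp: a'_def)
  have 3: "2 * a' m * u + (a' m)\<^sup>2 * K m m = - (u\<^sup>2 / K m m)"
    by (cases "K m m = 0") (auto simp: a'_def power2_eq_square field_simps)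
  have nonneg: "0 \<le> (\<Sum>s\<in>F0. \<Sum>t\<in>F0. a s * a t * K s t) - u\<^sup>2 / K m m"
    using 0 3 unfolding 1 2 by linarith
  have "(\<Sum>s\<in>F. \<Sum>t\<in>F. a s * a t * schur_complement m K s t) = (\<Sum>s\<in>F0. \<Sum>t\<in>F0. a s * a t * schur_complement m K s t)"
  proof -
    have "(\<Sum>t\<in>F. a s * a t * schur_complement m K s t) = (\<Sum>t\<in>F0. a s * a t * schur_complement m K s t)" for s
      using F schur_complement_zero[OF K] by (intro sum.mono_neutral_right) (auto simp: F0_def)
    thus ?thesis using F schur_complement_zero[OF K] by (simp, intro sum.mono_neutral_right) (auto simp: F0_def)
  qed
  also have "\<dots> = (\<Sum>s\<in>F0. \<Sum>t\<in>F0. a s * a t * K s t) - (\<Sum>s\<in>F0. \<Sum>t\<in>F0. (a s * K s m) * (a t * K t m) / K m m)"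
    by (simp add: schur_complement_def sum_subtractf right_diff_distrib mult_ac)
  also have "(\<Sum>s\<in>F0. \<Sum>t\<in>F0. (a s * K s m) * (a t * K t m) / K m m) = u\<^sup>2 / K m m"
    by (simp add: u_def power2_eq_square sum_product sum_divide_distrib)
  finally show "0 \<le> (\<Sum>s\<in>F. \<Sum>t\<in>F. a s * a t * schur_complement m K s t)" using nonneg by simp
qed

text \<open>The covariance left after the variables with index less than \<open>m\<close> have been
  projected off, one after the other.\<close>

primrec residual_kernel :: "(nat \<Rightarrow> nat \<Rightarrow> real) \<Rightarrow> nat \<Rightarrow> nat \<Rightarrow> nat \<Rightarrow> real" where
  "residual_kernel K 0 = K"
| "residual_kernel K (Suc m) = schur_complement m (residual_kernel K m)"

lemma psd_residual: "psd_kernel K \<Longrightarrow> psd_kernel (residual_kernel K m)"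
  by (induction m) (auto simp: psd_schur_complement)

lemma residual_zero:
  assumes K: "psd_kernel K" shows "i < m \<Longrightarrow> residual_kernel K m i j = 0 \<and> residual_kernel K m j i = 0"
proof (induction m arbitrary: j)
  case (Suc m)
  show ?case
  proof (cases "i = m")
    case True
    thus ?thesis using schur_complement_zero[OF psd_residual[OF K]] by simp
  next
    case False
    hence "residual_kernel K m i u = 0 \<and> residual_kernel K m u i = 0" for u
      using Suc.prems by (intro Suc.IH) simp
    thus ?thesis by (simp add: schur_complement_def)
  qed
qed simp

text \<open>Each Schur step removes the rank-one term \<open>L i m * L j m\<close>, and after
  \<open>n\<close> steps every row with index less than \<open>n\<close> has vanished. Triangularity
  makes each variable a finite combination of independent normals although there are infinitely many
  variables.\<close>

lemma cholesky:
  assumes K: "psd_kernel (K :: nat \<Rightarrow> nat \<Rightarrow> real)"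
  shows "\<exists>L. (\<forall>i j n. i < n \<longrightarrow> K i j = (\<Sum>m<n. L i m * L j m)) \<and> (\<forall>i m. i < m \<longrightarrow> L i m = 0)"
proof -
  define R where "R = residual_kernel K"
  define L where "L i m = R m i m / sqrt (R m m m)" for i m
  have eq: "K i j = (\<Sum>m<n. L i m * L j m) + R n i j" for i j n
  proof (induction n)
    case (Suc n)
    have "R n n n \<ge> 0" unfolding R_def by (rule psd_kernel_diag[OF psd_residual[OF K]])
    hence "L i n * L j n = R n i n * R n j n / R n n n"
      by (simp add: L_def)
    thus ?case using Suc by (simp add: R_def schur_complement_def)
  qed (simp add: R_def)
  moreover have z: "R n i j = 0" if "i < n" for i j n
    using residual_zero[OF K that] by (simp add: R_def)
  moreover have "L i m = 0" if "i < m" for i m using z[OF that] by (simp add: L_def)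
  moreover have "K i j = (\<Sum>m<n. L i m * L j m)" if "i < n" for i j n
    using eq[of i j n] z[OF that, of j] by linarith
  ultimately show ?thesis by blast
qed

section \<open>Linear combinations and quadratic forms over finite lists\<close>

text \<open>A list of coefficient-point pairs may repeat points. Scaling, concatenation and moving
  the points to approximating ones, where distinct points may merge, then stay within the
  format.\<close>

definition lincomb :: "(real \<times> 'i) list \<Rightarrow> ('i \<Rightarrow> real) \<Rightarrow> real" where
  "lincomb xs g = (\<Sum>(a, t)\<leftarrow>xs. a * g t)"

definition quadform :: "('i \<Rightarrow> 'i \<Rightarrow> real) \<Rightarrow> (real \<times> 'i) list \<Rightarrow> real" where
  "quadform K xs = (\<Sum>(a, s)\<leftarrow>xs. \<Sum>(b, t)\<leftarrow>xs. a * b * K s t)"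

lemma lincomb_simps [simp]:
  "lincomb [] g = 0" "lincomb ((a, t) # xs) g = a * g t + lincomb xs g"
  "lincomb (xs @ ys) g = lincomb xs g + lincomb ys g"
  by (auto simp: lincomb_def)

lemma lincomb_measurable [measurable]:
  assumes "\<And>t. t \<in> snd ` set xs \<Longrightarrow> (\<lambda>\<omega>. X \<omega> t) \<in> borel_measurable M"
  shows "(\<lambda>\<omega>. lincomb xs (X \<omega>)) \<in> borel_measurable M"
  using assms
proof (induction xs)
  case (Cons x xs)
  obtain a t where x: "x = (a, t)" by (cases x)
  have "(\<lambda>\<omega>. X \<omega> t) \<in> borel_measurable M" "(\<lambda>\<omega>. lincomb xs (X \<omega>)) \<in> borel_measurable M"
    using Cons.prems by (auto simp: x intro!: Cons.IH)
  thus ?case by (simp add: x)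
qed simp

lemma lincomb_cong:
  "(\<And>t. t \<in> snd ` set xs \<Longrightarrow> g t = h t) \<Longrightarrow> lincomb xs g = lincomb xs h"
  unfolding lincomb_def by (intro arg_cong[where f=sum_list] map_cong) force+

lemma lincomb_sum: "lincomb xs (\<lambda>t. \<Sum>m<n. f t m * w m) = (\<Sum>m<n. lincomb xs (\<lambda>t. f t m) * w m)"
  for n :: nat
  by (induction xs) (auto simp: sum_distrib_left sum.distrib distrib_right mult.assoc)

lemma lincomb_map_scale: "lincomb (map (\<lambda>(a, t). (u * a, t)) xs) g = u * lincomb xs g"
  by (induction xs) (auto simp: algebra_simps)

lemma lincomb_eq_sum:
  assumes "distinct l" shows "lincomb (map (\<lambda>t. (a t, t)) l) g = (\<Sum>t\<in>set l. a t * g t)"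
  using assms by (induction l) auto

text \<open>If \<open>K\<close> is a Gram kernel of the rows of \<open>L\<close>, the form is the
  squared length of the combined row, with one square for each independent normal.\<close>

lemma quadform_gram:
  fixes L :: "'i \<Rightarrow> nat \<Rightarrow> real"
  assumes "\<And>s t. s \<in> snd ` set xs \<Longrightarrow> t \<in> snd ` set xs \<Longrightarrow> K s t = (\<Sum>m<n. L s m * L t m)"
  shows "quadform K xs = (\<Sum>m<n. (lincomb xs (\<lambda>t. L t m))\<^sup>2)"
proof -
  have "quadform K xs = (\<Sum>(a, s)\<leftarrow>xs. \<Sum>(b, t)\<leftarrow>xs. \<Sum>m<n. (a * L s m) * (b * L t m))"
    unfolding quadform_def case_prod_unfold
  proof (intro arg_cong[where f=sum_list] map_cong refl)
    fix x y assume "x \<in> set xs" "y \<in> set xs"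
    hence "K (snd x) (snd y) = (\<Sum>m<n. L (snd x) m * L (snd y) m)" by (intro assms) auto
    thus "fst x * fst y * K (snd x) (snd y) = (\<Sum>m<n. fst x * L (snd x) m * (fst y * L (snd y) m))"
      by (simp add: sum_distrib_left mult_ac)
  qed
  also have "\<dots> = (\<Sum>m<n. (\<Sum>(a, s)\<leftarrow>xs. \<Sum>(b, t)\<leftarrow>xs. (a * L s m) * (b * L t m)))"
  proof -
    have *: "(\<Sum>x\<leftarrow>zs. \<Sum>m<n. f x m) = (\<Sum>m<n. \<Sum>x\<leftarrow>zs. f x m)" for zs :: "'b list" and f :: "'b \<Rightarrow> nat \<Rightarrow> real"
      by (induction zs) (auto simp: sum.distrib)
    show ?thesis unfolding case_prod_unfold * ..
  qed
  also have "\<dots> = (\<Sum>m<n. (lincomb xs (\<lambda>t. L t m))\<^sup>2)"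
    by (simp add: lincomb_def power2_eq_square case_prod_unfold sum_list_const_mult sum_list_mult_const)
  finally show ?thesis .
qed

lemma quadform_scale: "quadform K (map (\<lambda>(a, t). (u * a, t)) xs) = u\<^sup>2 * quadform K xs"
proof -
  have "quadform K (map (\<lambda>(a, t). (u * a, t)) xs) = (\<Sum>(a, s)\<leftarrow>xs. \<Sum>(b, t)\<leftarrow>xs. u\<^sup>2 * (a * b * K s t))"
    unfolding quadform_def by (simp add: case_prod_unfold comp_def power2_eq_square mult_ac)
  thus ?thesis by (simp add: quadform_def case_prod_unfold sum_list_const_mult)
qed

section \<open>Centred normal laws\<close>

text \<open>As a scaled image of the standard normal law the degenerate case \<open>v = 0\<close> is
  treated together with the others in moments and characteristic functions.\<close>

lemma normal_law_eq_distr: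
  assumes "v \<ge> 0" shows "normal_law 0 v = distr std_normal_distribution borel (\<lambda>x. sqrt v * x)"
proof (cases "v = 0")
  case True
  interpret S: prob_space std_normal_distribution by (rule prob_space_normal_density) simp
  show ?thesis using True S.distr_const[of "0::real" borel] by (simp add: normal_law_def)
next
  case False
  hence v: "sqrt v > 0" using assms by simp
  interpret S: prob_space std_normal_distribution by (rule prob_space_normal_density) simp
  have "distributed std_normal_distribution lborel (\<lambda>x. x) (\<lambda>x. ennreal (std_normal_density x))"
    by (auto simp: distributed_def distr_id2)
  hence "distributed std_normal_distribution lborel (\<lambda>x. 0 + sqrt v * x) (\<lambda>x. ennreal (normal_density (0 + sqrt v * 0) (\<bar>sqrt v\<bar> * 1) x))"
    using v by (intro S.normal_density_affine) auto
  hence "distributed std_normal_distribution lborel (\<lambda>x. sqrt v * x) (\<lambda>x. ennreal (normal_density 0 (sqrt v) x))"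
    using v by simp
  hence "distr std_normal_distribution lborel (\<lambda>x. sqrt v * x) = density lborel (\<lambda>x. ennreal (normal_density 0 (sqrt v) x))"
    by (auto simp: distributed_def)
  moreover have "distr std_normal_distribution borel (\<lambda>x. sqrt v * x) = distr std_normal_distribution lborel (\<lambda>x. sqrt v * x)"
    by (rule distr_cong) auto
  ultimately show ?thesis using False by (simp add: normal_law_def)
qed

lemma real_distribution_normal_law: "v \<ge> 0 \<Longrightarrow> real_distribution (normal_law 0 v)"
proof -
  assume v: "v \<ge> 0"
  interpret S: prob_space std_normal_distribution by (rule prob_space_normal_density) simp
  show ?thesis unfolding normal_law_eq_distr[OF v] by (rule S.real_distribution_distr) simp
qed

lemma char_normal_law:
  assumes "v \<ge> 0" shows "char (normal_law 0 v) u = exp (- (u\<^sup>2 * v) / 2)"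
proof -
  have "char (normal_law 0 v) u = char std_normal_distribution (u * sqrt v)"
    unfolding normal_law_eq_distr[OF assms] by (simp add: char_def integral_distr mult.assoc)
  also have "\<dots> = exp (- ((u * sqrt v)\<^sup>2) / 2)" by (simp add: char_std_normal_distribution)
  finally show ?thesis using assms by (simp add: power_mult_distrib)
qed

lemma (in prob_space) normal_law_moments:
  assumes X [measurable]: "X \<in> borel_measurable M" and law: "distr M borel X = normal_law 0 v" and v: "v \<ge> 0"
  shows "integrable M (\<lambda>\<omega>. X \<omega> ^ k)" "expectation X = 0"
    "expectation (\<lambda>\<omega>. X \<omega> ^ (2 * k)) = v ^ k * (fact (2 * k) / (2 ^ k * fact k))"
proof -
  have law': "distr M borel X = distr std_normal_distribution borel (\<lambda>x. sqrt v * x)"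
    unfolding law normal_law_eq_distr[OF v] ..
  have "integrable (distr M borel X) (\<lambda>x. x ^ k)"
    unfolding law' using integrable_std_normal_distribution_moment[of k]
    by (simp add: integrable_distr_eq power_mult_distrib)
  thus "integrable M (\<lambda>\<omega>. X \<omega> ^ k)" by (simp add: integrable_distr_eq)
  have "expectation X = integral\<^sup>L (distr M borel X) (\<lambda>x. x ^ 1)" by (simp add: integral_distr)
  also have "\<dots> = sqrt v * integral\<^sup>L std_normal_distribution (\<lambda>x. x ^ 1)" unfolding law' by (simp add: integral_distr)
  also have "\<dots> = 0" using integral_std_normal_distribution_moment_odd[of 1] by simp
  finally show "expectation X = 0" .
  have "expectation (\<lambda>\<omega>. X \<omega> ^ (2 * k)) = integral\<^sup>L (distr M borel X) (\<lambda>x. x ^ (2 * k))" by (simp add: integral_distr)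
  also have "\<dots> = sqrt v ^ (2 * k) * integral\<^sup>L std_normal_distribution (\<lambda>x. x ^ (2 * k))"
    unfolding law' by (simp add: integral_distr power_mult_distrib)
  finally show "expectation (\<lambda>\<omega>. X \<omega> ^ (2 * k)) = v ^ k * (fact (2 * k) / (2 ^ k * fact k))"
    unfolding std_normal_distribution_even_moments(1) using v by (simp add: power_mult)
qed

text \<open>A characteristic function has modulus at most one, which forces
  \<open>v \<ge> 0\<close>; the law then follows from Levy's uniqueness theorem.\<close>

lemma (in prob_space) normal_law_of_cis:
  assumes X [measurable]: "X \<in> borel_measurable M"
    and cis: "\<And>u. expectation (\<lambda>\<omega>. cis (u * X \<omega>)) = exp (- (u\<^sup>2 * v) / 2)"
  shows "v \<ge> 0" "distr M borel X = normal_law 0 v"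
proof -
  have "cmod (expectation (\<lambda>\<omega>. cis (1 * X \<omega>))) \<le> expectation (\<lambda>\<omega>. 1)"
    by (rule order_trans[OF integral_norm_bound]) (simp add: prob_space)
  hence "exp (- v / 2) \<le> 1" unfolding cis by (simp add: prob_space)
  thus v: "v \<ge> 0" by simp
  show "distr M borel X = normal_law 0 v"
  proof (rule Levy_uniqueness)
    show "real_distribution (distr M borel X)" by (rule real_distribution_distr) simp
    show "char (distr M borel X) = char (normal_law 0 v)"
    proof
      fix u
      have "char (distr M borel X) u = expectation (\<lambda>\<omega>. cis (u * X \<omega>))"
        by (simp add: char_def integral_distr cis_conv_exp)
      thus "char (distr M borel X) u = char (normal_law 0 v) u" by (simp only: cis char_normal_law[OF v])
    qed
  qed (rule real_distribution_normal_law[OF v])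
qed

text \<open>Scaling the list by \<open>u\<close> turns the hypothesis into the whole characteristic
  function of each linear combination. Covariances are recovered by polarisation from the variance
  of a sum of two variables.\<close>

lemma (in prob_space) centered_gaussian_of_cis:
  fixes X :: "'i \<Rightarrow> 'a \<Rightarrow> real"
  assumes X: "\<And>t. X t \<in> borel_measurable M" and sym: "\<And>s t. K s t = K t s"
    and cis: "\<And>xs. expectation (\<lambda>\<omega>. cis (lincomb xs (\<lambda>t. X t \<omega>))) = exp (- quadform K xs / 2)"
  shows "centered_gaussian_process_with_covariance M X K"
    and "distr M borel (\<lambda>\<omega>. lincomb xs (\<lambda>t. X t \<omega>)) = normal_law 0 (quadform K xs)" "quadform K xs \<ge> 0"
proof -
  have m [measurable]: "(\<lambda>\<omega>. lincomb xs (\<lambda>t. X t \<omega>)) \<in> borel_measurable M" for xs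
    by (rule lincomb_measurable) (rule X)
  have law: "quadform K xs \<ge> 0" "distr M borel (\<lambda>\<omega>. lincomb xs (\<lambda>t. X t \<omega>)) = normal_law 0 (quadform K xs)" for xs
  proof -
    have "expectation (\<lambda>\<omega>. cis (u * lincomb xs (\<lambda>t. X t \<omega>))) = exp (- (u\<^sup>2 * quadform K xs) / 2)" for u
      using cis[of "map (\<lambda>(a, t). (u * a, t)) xs"] by (simp add: lincomb_map_scale quadform_scale)
    from normal_law_of_cis[OF m this]
    show "quadform K xs \<ge> 0" "distr M borel (\<lambda>\<omega>. lincomb xs (\<lambda>t. X t \<omega>)) = normal_law 0 (quadform K xs)" by auto
  qed
  show "distr M borel (\<lambda>\<omega>. lincomb xs (\<lambda>t. X t \<omega>)) = normal_law 0 (quadform K xs)" "quadform K xs \<ge> 0" by (rule law)+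
  note mom = normal_law_moments[OF m law(2) law(1)]
  have sq: "expectation (\<lambda>\<omega>. (lincomb xs (\<lambda>t. X t \<omega>))\<^sup>2) = quadform K xs" for xs
    using mom(3)[of xs 1] by simp
  have i1: "integrable M (\<lambda>\<omega>. X t \<omega> ^ k)" for t k using mom(1)[of "[(1, t)]" k] by simp
  show "centered_gaussian_process_with_covariance M X K"
    unfolding centered_gaussian_process_with_covariance_def gaussian_process_def
  proof (intro conjI allI impI)
    fix F :: "'i set" and a assume "finite F"
    then obtain l where l: "set l = F" "distinct l" using finite_distinct_list by auto
    show "\<exists>m v. 0 \<le> v \<and> distr M borel (\<lambda>\<omega>. \<Sum>t\<in>F. a t * X t \<omega>) = normal_law m v"
      using law[of "map (\<lambda>t. (a t, t)) l"] unfolding lincomb_eq_sum[OF l(2)] l(1) by blast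
  next
    show "expectation (X t) = 0" for t using mom(2)[of "[(1, t)]"] by simp
    fix t u
    have [measurable]: "X t \<in> borel_measurable M" "X u \<in> borel_measurable M" by (rule X)+
    have ip: "integrable M (\<lambda>\<omega>. X t \<omega> * X u \<omega>)"
    proof (rule Bochner_Integration.integrable_bound)
      show "integrable M (\<lambda>\<omega>. X t \<omega> ^ 2 + X u \<omega> ^ 2)" using i1 by simp
      have "\<bar>x * y\<bar> \<le> x\<^sup>2 + y\<^sup>2" for x y :: real
        using sum_squares_bound[of "\<bar>x\<bar>" "\<bar>y\<bar>"] mult_nonneg_nonneg[OF abs_ge_zero[of x] abs_ge_zero[of y]]
        unfolding abs_mult power2_abs by linarith
      thus "AE \<omega> in M. norm (X t \<omega> * X u \<omega>) \<le> norm (X t \<omega> ^ 2 + X u \<omega> ^ 2)" by auto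
    qed simp
    have "expectation (\<lambda>\<omega>. (X t \<omega> + X u \<omega>)\<^sup>2) = K t t + 2 * K t u + K u u"
      using sq[of "[(1, t), (1, u)]"] sym[of u t] by (simp add: quadform_def)
    moreover have "expectation (\<lambda>\<omega>. (X t \<omega> + X u \<omega>)\<^sup>2)
       = expectation (\<lambda>\<omega>. (X t \<omega>)\<^sup>2) + 2 * expectation (\<lambda>\<omega>. X t \<omega> * X u \<omega>) + expectation (\<lambda>\<omega>. (X u \<omega>)\<^sup>2)"
      using i1[of t 2] i1[of u 2] ip by (simp add: power2_sum mult.assoc)
    ultimately show "expectation (\<lambda>\<omega>. X t \<omega> * X u \<omega>) = K t u"
      using sq[of "[(1, t)]"] sq[of "[(1, u)]"] by (simp add: quadform_def)
  qed (rule X)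
qed

section \<open>Gaussian variables on a countable index set\<close>

abbreviation gauss_seq :: "(nat \<Rightarrow> real) measure" where
  "gauss_seq \<equiv> PiM UNIV (\<lambda>_. std_normal_distribution)"

lemma prob_space_gauss_seq: "prob_space gauss_seq"
  by (intro prob_space_PiM prob_space_normal_density) simp

lemma cis_gauss_seq:
  "integral\<^sup>L gauss_seq (\<lambda>\<omega>. cis (\<Sum>m<n. c m * \<omega> m)) = exp (- (\<Sum>m<n. (c m)\<^sup>2) / 2)"
proof -
  interpret S: prob_space std_normal_distribution by (rule prob_space_normal_density) simp
  interpret P: product_prob_space "\<lambda>_. std_normal_distribution" "UNIV :: nat set" ..
  have [measurable]: "(\<lambda>\<omega>. \<omega> m) \<in> borel_measurable gauss_seq" for m
    using measurable_component_singleton[of m UNIV "\<lambda>_. std_normal_distribution"] by simp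
  have ind: "P.indep_vars (\<lambda>_. std_normal_distribution) (\<lambda>m \<omega>. \<omega> m) UNIV"
  proof (subst P.indep_vars_iff_distr_eq_PiM')
    have "distr gauss_seq std_normal_distribution (\<lambda>\<omega>. \<omega> m) = std_normal_distribution" for m
      using P.PiM_component[of m] by simp
    thus "distr gauss_seq gauss_seq (\<lambda>x. \<lambda>i\<in>UNIV. x i) = (\<Pi>\<^sub>M i\<in>UNIV. distr gauss_seq std_normal_distribution (\<lambda>\<omega>. \<omega> i))"
      by (simp add: distr_id2 restrict_def)
  qed auto
  have ind2: "P.indep_vars (\<lambda>_. borel) (\<lambda>m \<omega>. c m * \<omega> m) {..<n}"
    using P.indep_vars_compose2[OF P.indep_vars_subset[OF ind, of "{..<n}"], of "\<lambda>m x. c m * x" "\<lambda>_. borel"] by simp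
  have "integral\<^sup>L gauss_seq (\<lambda>\<omega>. cis (\<Sum>m<n. c m * \<omega> m)) = char (distr gauss_seq borel (\<lambda>\<omega>. \<Sum>m<n. c m * \<omega> m)) 1"
    by (simp add: char_def integral_distr cis_conv_exp)
  also have "\<dots> = (\<Prod>m<n. char (distr gauss_seq borel (\<lambda>\<omega>. c m * \<omega> m)) 1)"
    by (rule P.char_distr_sum[OF ind2])
  also have "\<dots> = (\<Prod>m<n. complex_of_real (exp (- (c m)\<^sup>2 / 2)))"
  proof (rule prod.cong[OF refl])
    fix m
    have "char (distr gauss_seq borel (\<lambda>\<omega>. c m * \<omega> m)) 1 = char (distr gauss_seq std_normal_distribution (\<lambda>\<omega>. \<omega> m)) (c m)"
      by (simp add: char_def integral_distr)
    also have "\<dots> = char std_normal_distribution (c m)" using P.PiM_component[of m] by simp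
    finally show "char (distr gauss_seq borel (\<lambda>\<omega>. c m * \<omega> m)) 1 = complex_of_real (exp (- (c m)\<^sup>2 / 2))"
      by (simp add: char_std_normal_distribution)
  qed
  also have "\<dots> = exp (- (\<Sum>m<n. (c m)\<^sup>2) / 2)"
    by (simp add: exp_sum sum_divide_distrib flip: sum_negf of_real_prod)
  finally show ?thesis .
qed

text \<open>After an enumeration of \<open>T\<close>, the rows of a Cholesky factor are the
  coefficients of the variables \<open>G t\<close> in a sequence of independent standard
  normals.\<close>

lemma exists_gaussian_countable:
  fixes K :: "'i \<Rightarrow> 'i \<Rightarrow> real"
  assumes K: "psd_kernel K" and T: "countable T"
  obtains G :: "'i \<Rightarrow> (nat \<Rightarrow> real) \<Rightarrow> real" where
    "\<And>t. G t \<in> borel_measurable gauss_seq"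
    "\<And>xs. snd ` set xs \<subseteq> T \<Longrightarrow> integral\<^sup>L gauss_seq (\<lambda>\<omega>. cis (lincomb xs (\<lambda>t. G t \<omega>))) = exp (- quadform K xs / 2)"
proof -
  define e where "e = to_nat_on T"
  define f where "f = from_nat_into T"
  define K' where "K' i j = K (f i) (f j)" for i j
  have "psd_kernel K'"
    unfolding psd_kernel_def
  proof (intro conjI allI impI)
    show "K' s t = K' t s" for s t using K by (simp add: K'_def psd_kernel_def)
    fix F :: "nat set" and a :: "nat \<Rightarrow> real" assume F: "finite F"
    \<comment> \<open>The enumeration \<open>f\<close> need not be injective, for instance if
      \<open>T\<close> is finite; coefficients are therefore collected over its fibres.\<close>
    define A where "A u = (\<Sum>i\<in>{i\<in>F. f i = u}. a i)" for u
    have grp: "(\<Sum>i\<in>F. a i * h (f i)) = (\<Sum>u\<in>f ` F. A u * h u)" for h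
    proof -
      have "(\<Sum>i\<in>F. a i * h (f i)) = (\<Sum>u\<in>f ` F. \<Sum>i\<in>{i\<in>F. f i = u}. a i * h (f i))"
        by (rule sum.image_gen[OF F])
      also have "\<dots> = (\<Sum>u\<in>f ` F. A u * h u)"
        unfolding A_def sum_distrib_right by (intro sum.cong) auto
      finally show ?thesis .
    qed
    have "(\<Sum>s\<in>F. \<Sum>t\<in>F. a s * a t * K' s t) = (\<Sum>s\<in>F. a s * (\<Sum>t\<in>F. a t * K (f s) (f t)))"
      by (simp add: K'_def sum_distrib_left mult.assoc)
    also have "\<dots> = (\<Sum>u\<in>f ` F. A u * (\<Sum>t\<in>F. a t * K u (f t)))" by (rule grp)
    also have "\<dots> = (\<Sum>u\<in>f ` F. A u * (\<Sum>w\<in>f ` F. A w * K u w))" by (simp add: grp)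
    also have "\<dots> = (\<Sum>u\<in>f ` F. \<Sum>w\<in>f ` F. A u * A w * K u w)" by (simp add: sum_distrib_left mult.assoc)
    also have "\<dots> \<ge> 0" using K F by (simp add: psd_kernel_def)
    finally show "0 \<le> (\<Sum>s\<in>F. \<Sum>t\<in>F. a s * a t * K' s t)" .
  qed
  then obtain L where L: "\<And>i j n. i < n \<Longrightarrow> K' i j = (\<Sum>m<n. L i m * L j m)"
    and L0: "\<And>i m. i < m \<Longrightarrow> L i m = 0" using cholesky by blast
  have [measurable]: "(\<lambda>\<omega>. \<omega> m) \<in> borel_measurable gauss_seq" for m
    using measurable_component_singleton[of m UNIV "\<lambda>_. std_normal_distribution"] by simp
  define G where "G t \<omega> = (\<Sum>m<Suc (e t). L (e t) m * \<omega> m)" for t and \<omega> :: "nat \<Rightarrow> real"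
  show thesis
  proof (rule that[of G])
    show "G t \<in> borel_measurable gauss_seq" for t unfolding G_def[abs_def] by measurable
    fix xs :: "(real \<times> 'i) list" assume xs: "snd ` set xs \<subseteq> T"
    have "finite (e ` snd ` set xs)" by simp
    then obtain n where n: "\<And>t. t \<in> snd ` set xs \<Longrightarrow> e t < n"
      unfolding finite_nat_set_iff_bounded by blast
    have G: "G t \<omega> = (\<Sum>m<n. L (e t) m * \<omega> m)" if "t \<in> snd ` set xs" for t \<omega>
      unfolding G_def using n[OF that] by (intro sum.mono_neutral_left) (auto simp: L0)
    have lc: "lincomb xs (\<lambda>t. G t \<omega>) = (\<Sum>m<n. lincomb xs (\<lambda>t. L (e t) m) * \<omega> m)" for \<omega>
    proof -
      have "lincomb xs (\<lambda>t. G t \<omega>) = lincomb xs (\<lambda>t. \<Sum>m<n. L (e t) m * \<omega> m)"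
        by (rule lincomb_cong) (rule G)
      thus ?thesis by (simp add: lincomb_sum)
    qed
    have fe: "f (e t) = t" if "t \<in> snd ` set xs" for t
      unfolding e_def f_def using T xs that by (intro from_nat_into_to_nat_on) auto
    have "quadform K xs = (\<Sum>m<n. (lincomb xs (\<lambda>t. L (e t) m))\<^sup>2)"
    proof (rule quadform_gram)
      fix s t assume st: "s \<in> snd ` set xs" "t \<in> snd ` set xs"
      have "K s t = K' (e s) (e t)" unfolding K'_def by (simp add: fe st)
      also have "\<dots> = (\<Sum>m<n. L (e s) m * L (e t) m)" by (rule L[OF n[OF st(1)]])
      finally show "K s t = (\<Sum>m<n. L (e s) m * L (e t) m)" .
    qed
    thus "integral\<^sup>L gauss_seq (\<lambda>\<omega>. cis (lincomb xs (\<lambda>t. G t \<omega>))) = exp (- quadform K xs / 2)"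
      unfolding lc by (simp add: cis_gauss_seq)
  qed
qed

section \<open>Hoelder functions on the unit interval\<close>

lemma real_of_ui_bounds [simp]: "0 \<le> real_of_ui x" "real_of_ui x \<le> 1"
  using real_of_ui[of x] by auto

lemma real_of_ui_of_real: "0 \<le> x \<Longrightarrow> x \<le> 1 \<Longrightarrow> real_of_ui (ui_of_real x) = x"
  by (simp add: ui_of_real_inverse)

lemma hoelder_enorm_le:
  fixes f :: "unit_interval \<Rightarrow> 'b::real_normed_vector"
  assumes A: "\<And>x. norm (f x) \<le> A"
    and L: "\<And>x y. real_of_ui x < real_of_ui y \<Longrightarrow> norm (f y - f x) \<le> L * (real_of_ui y - real_of_ui x) powr \<beta>"
    and nn: "A \<ge> 0" "L \<ge> 0"
  shows "hoelder_enorm \<beta> f \<le> ennreal (A + L)" and "hoelder_norm \<beta> f \<le> A + L"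
proof -
  have "(SUP x. ennreal (norm (f x))) \<le> ennreal A" by (intro SUP_least ennreal_leI A)
  moreover have "(SUP (x, y) \<in> {(x, y). real_of_ui x < real_of_ui y}.
        ennreal (norm (f y - f x) / (real_of_ui y - real_of_ui x) powr \<beta>)) \<le> ennreal L"
    using L by (intro SUP_least) (auto intro!: ennreal_leI simp: pos_divide_le_eq)
  ultimately show e: "hoelder_enorm \<beta> f \<le> ennreal (A + L)"
    unfolding hoelder_enorm_def using nn by (simp add: ennreal_plus add_mono)
  have "hoelder_norm \<beta> f \<le> enn2real (ennreal (A + L))"
    unfolding hoelder_norm_def by (rule enn2real_mono[OF e]) simp
  also have "\<dots> = A + L" by (rule enn2real_ennreal) (use nn in simp)
  finally show "hoelder_norm \<beta> f \<le> A + L" .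
qed

lemma hoelder_norm_bounds:
  fixes f :: "unit_interval \<Rightarrow> 'b::real_normed_vector"
  assumes fin: "hoelder_enorm \<beta> f < \<infinity>"
  shows "norm (f x) \<le> hoelder_norm \<beta> f"
    and "real_of_ui x < real_of_ui y \<Longrightarrow> norm (f y - f x) \<le> hoelder_norm \<beta> f * (real_of_ui y - real_of_ui x) powr \<beta>"
proof -
  have eq: "ennreal (hoelder_norm \<beta> f) = hoelder_enorm \<beta> f"
    using fin unfolding hoelder_norm_def by (simp add: less_top)
  have nn: "0 \<le> hoelder_norm \<beta> f" by (simp add: hoelder_norm_def)
  have "ennreal (norm (f x)) \<le> (SUP x. ennreal (norm (f x)))" by (intro SUP_upper) simp
  also have "\<dots> \<le> ennreal (hoelder_norm \<beta> f)" unfolding eq hoelder_enorm_def by simp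
  finally show "norm (f x) \<le> hoelder_norm \<beta> f" using nn by simp
  assume xy: "real_of_ui x < real_of_ui y"
  have "ennreal (norm (f y - f x) / (real_of_ui y - real_of_ui x) powr \<beta>)
     \<le> (SUP (x, y) \<in> {(x, y). real_of_ui x < real_of_ui y}.
        ennreal (norm (f y - f x) / (real_of_ui y - real_of_ui x) powr \<beta>))"
    by (rule SUP_upper2[of "(x, y)"]) (use xy in auto)
  also have "\<dots> \<le> ennreal (hoelder_norm \<beta> f)" unfolding eq hoelder_enorm_def by simp
  finally have "norm (f y - f x) / (real_of_ui y - real_of_ui x) powr \<beta> \<le> hoelder_norm \<beta> f" using nn by simp
  thus "norm (f y - f x) \<le> hoelder_norm \<beta> f * (real_of_ui y - real_of_ui x) powr \<beta>"
    using xy by (simp add: pos_divide_le_eq)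
qed

lemma hoelder_space_modulus:
  fixes f :: "unit_interval \<Rightarrow> 'b::real_normed_vector"
  assumes f: "f \<in> hoelder_space \<beta>" and e: "e > 0"
  obtains \<delta> where "\<delta> > 0" "\<And>x y. real_of_ui x < real_of_ui y \<Longrightarrow> real_of_ui y - real_of_ui x < \<delta> \<Longrightarrow>
    norm (f y - f x) \<le> e * (real_of_ui y - real_of_ui x) powr \<beta>"
proof -
  have "(hoelder_modulus \<beta> f \<longlongrightarrow> 0) (at_right 0)" using f by (simp add: hoelder_space_def)
  hence "eventually (\<lambda>d. hoelder_modulus \<beta> f d < ennreal e) (at_right 0)"
    by (rule order_tendstoD) (use e in simp)
  then obtain \<delta> where \<delta>: "\<delta> > 0" "\<And>d. 0 < d \<Longrightarrow> d < \<delta> \<Longrightarrow> hoelder_modulus \<beta> f d < ennreal e"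
    unfolding eventually_at_right_field by auto
  show thesis
  proof (rule that[OF \<delta>(1)])
    fix x y assume xy: "real_of_ui x < real_of_ui y" "real_of_ui y - real_of_ui x < \<delta>"
    define d where "d = real_of_ui y - real_of_ui x"
    have "ennreal (norm (f y - f x) / (real_of_ui y - real_of_ui x) powr \<beta>) \<le> hoelder_modulus \<beta> f d"
      unfolding hoelder_modulus_def by (rule SUP_upper2[of "(x, y)"]) (use xy in \<open>auto simp: d_def\<close>)
    also have "\<dots> < ennreal e" using xy by (intro \<delta>) (auto simp: d_def)
    finally have "norm (f y - f x) / (real_of_ui y - real_of_ui x) powr \<beta> \<le> e"
      by (simp add: ennreal_less_iff)
    thus "norm (f y - f x) \<le> e * (real_of_ui y - real_of_ui x) powr \<beta>"
      using xy by (simp add: pos_divide_le_eq)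
  qed
qed

text \<open>On pairs at distance at most \<open>d\<close>, a \<theta>-Hoelder bound improves the
  \<beta>-quotient by the factor \<open>d powr (\<theta> - \<beta>)\<close>, which makes the modulus
  vanish.\<close>

lemma hoelder_spaceI:
  fixes f :: "unit_interval \<Rightarrow> 'b::real_normed_vector"
  assumes L: "\<And>x y. real_of_ui x < real_of_ui y \<Longrightarrow> norm (f y - f x) \<le> L * (real_of_ui y - real_of_ui x) powr \<theta>"
    and nn: "L \<ge> 0" and \<beta>: "0 \<le> \<beta>" "\<beta> < \<theta>"
  shows "f \<in> hoelder_space \<beta>"
proof -
  define z where "z = ui_of_real 0"
  have z: "real_of_ui z = 0" by (simp add: z_def real_of_ui_of_real)
  have L': "norm (f y - f x) \<le> L * \<bar>real_of_ui y - real_of_ui x\<bar> powr \<theta>" for x y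
    using L[of x y] L[of y x] by (cases "real_of_ui x" "real_of_ui y" rule: linorder_cases)
      (auto simp: norm_minus_commute real_of_ui_inject)
  have "continuous_on UNIV f"
    unfolding continuous_on_iff
  proof (intro ballI allI impI)
    fix x and e :: real assume e: "e > 0"
    define d where "d = (e / (L + 1)) powr (1 / \<theta>)"
    have d: "d > 0" "d powr \<theta> = e / (L + 1)" using e nn \<beta> by (auto simp: d_def powr_powr)
    show "\<exists>d>0. \<forall>x'\<in>UNIV. dist x' x < d \<longrightarrow> dist (f x') (f x) < e"
    proof (intro exI[of _ d] conjI d ballI impI)
      fix y assume "dist y x < d"
      hence "\<bar>real_of_ui y - real_of_ui x\<bar> powr \<theta> \<le> d powr \<theta>"
        using \<beta> by (intro powr_mono2) (auto simp: dist_unit_interval_def)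
      hence "dist (f y) (f x) \<le> L * (e / (L + 1))"
        unfolding dist_norm using L'[of y x] nn by (metis d(2) mult_left_mono order_trans)
      also have "\<dots> < e" using e nn by (simp add: field_simps)
      finally show "dist (f y) (f x) < e" .
    qed
  qed
  moreover have pw: "(real_of_ui y - real_of_ui x) powr \<theta> \<le> d powr (\<theta> - \<beta>) * (real_of_ui y - real_of_ui x) powr \<beta>"
    if "real_of_ui x < real_of_ui y" "real_of_ui y - real_of_ui x \<le> d" for x y d
  proof -
    have "(real_of_ui y - real_of_ui x) powr \<theta> = (real_of_ui y - real_of_ui x) powr (\<theta> - \<beta>) * (real_of_ui y - real_of_ui x) powr \<beta>"
      by (simp flip: powr_add)
    also have "\<dots> \<le> d powr (\<theta> - \<beta>) * (real_of_ui y - real_of_ui x) powr \<beta>"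
      using that \<beta> by (intro mult_right_mono powr_mono2) auto
    finally show ?thesis .
  qed
  have "hoelder_enorm \<beta> f \<le> ennreal ((norm (f z) + L) + L)"
  proof (rule hoelder_enorm_le(1))
    fix x
    have "norm (f x) \<le> norm (f z) + norm (f x - f z)" by (metis add.commute diff_add_cancel norm_triangle_ineq)
    also have "norm (f x - f z) \<le> L * 1"
      using L'[of x z] nn z \<beta> by (intro order_trans[OF L'] mult_left_mono) (auto simp: powr_le1)
    finally show "norm (f x) \<le> norm (f z) + L" by simp
  next
    fix x y assume xy: "real_of_ui x < real_of_ui y"
    have "real_of_ui y - real_of_ui x \<le> 1" using real_of_ui_bounds(1)[of x] real_of_ui_bounds(2)[of y] by linarith
    from mult_left_mono[OF pw[OF xy this] nn] show "norm (f y - f x) \<le> L * (real_of_ui y - real_of_ui x) powr \<beta>"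
      using L[OF xy] by simp
  qed (use nn in auto)
  hence "hoelder_enorm \<beta> f < \<infinity>" by (metis ennreal_less_top infinity_ennreal_def le_less_trans)
  moreover have "(hoelder_modulus \<beta> f \<longlongrightarrow> 0) (at_right 0)"
  proof (rule tendsto_sandwich[of "\<lambda>_. 0" _ _ "\<lambda>d. ennreal (L * d powr (\<theta> - \<beta>))"])
    show "\<forall>\<^sub>F d in at_right 0. hoelder_modulus \<beta> f d \<le> ennreal (L * d powr (\<theta> - \<beta>))"
      using eventually_at_right_less[of "0::real"]
    proof (rule eventually_mono)
      fix d :: real assume d: "0 < d"
      show "hoelder_modulus \<beta> f d \<le> ennreal (L * d powr (\<theta> - \<beta>))"
        unfolding hoelder_modulus_def
      proof (rule SUP_least, clarsimp, rule ennreal_leI)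
        fix x y assume xy: "real_of_ui x < real_of_ui y" "real_of_ui y \<le> real_of_ui x + d"
        have "norm (f y - f x) \<le> L * (d powr (\<theta> - \<beta>) * (real_of_ui y - real_of_ui x) powr \<beta>)"
          using mult_left_mono[OF pw[OF xy(1), of d] nn] L[OF xy(1)] xy by simp
        thus "norm (f y - f x) / (real_of_ui y - real_of_ui x) powr \<beta> \<le> L * d powr (\<theta> - \<beta>)"
          using xy by (simp add: pos_divide_le_eq mult.assoc)
      qed
    qed
    have "((\<lambda>d. d powr (\<theta> - \<beta>)) \<longlongrightarrow> 0) (at_right (0::real))"
      using \<beta> by (intro tendsto_zero_powrI[of "\<lambda>d. d" _ "\<lambda>_. \<theta> - \<beta>" "\<theta> - \<beta>"])
        (auto intro: eventually_mono[OF eventually_at_right_less])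
    hence "((\<lambda>d. ennreal (L * d powr (\<theta> - \<beta>))) \<longlongrightarrow> ennreal (L * 0)) (at_right 0)"
      by (intro tendsto_ennrealI tendsto_mult tendsto_const)
    thus "((\<lambda>d. ennreal (L * d powr (\<theta> - \<beta>))) \<longlongrightarrow> 0) (at_right 0)" by simp
  qed auto
  ultimately show ?thesis by (simp add: hoelder_space_def)
qed

lemma lipschitz_hoelder:
  fixes f :: "unit_interval \<Rightarrow> 'b::real_normed_vector"
  assumes A: "\<And>x. norm (f x) \<le> A" and L: "\<And>x y. norm (f y - f x) \<le> L * \<bar>real_of_ui y - real_of_ui x\<bar>"
    and nn: "A \<ge> 0" "L \<ge> 0" and \<beta>: "0 \<le> \<beta>" "\<beta> < 1"
  shows "f \<in> hoelder_space \<beta>" "hoelder_norm \<beta> f \<le> A + L"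
proof -
  show "f \<in> hoelder_space \<beta>"
    by (rule hoelder_spaceI[where L=L and \<theta>=1]) (use L nn \<beta> in \<open>auto intro: order_trans[OF L]\<close>)
  show "hoelder_norm \<beta> f \<le> A + L"
  proof (rule hoelder_enorm_le(2)[OF A _ nn])
    fix x y assume xy: "real_of_ui x < real_of_ui y"
    have "real_of_ui y - real_of_ui x \<le> 1" using real_of_ui_bounds(1)[of x] real_of_ui_bounds(2)[of y] by linarith
    hence "(real_of_ui y - real_of_ui x) powr 1 \<le> (real_of_ui y - real_of_ui x) powr \<beta>"
      using xy \<beta> by (intro powr_mono') auto
    hence "L * (real_of_ui y - real_of_ui x) \<le> L * (real_of_ui y - real_of_ui x) powr \<beta>"
      using xy nn by (intro mult_left_mono) auto
    thus "norm (f y - f x) \<le> L * (real_of_ui y - real_of_ui x) powr \<beta>" using L[of y x] xy by simp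
  qed
qed

section \<open>Piecewise linear interpolation\<close>

definition clamp01 :: "real \<Rightarrow> real" where "clamp01 z = max 0 (min 1 z)"

lemma clamp01_bounds: "0 \<le> clamp01 z" "clamp01 z \<le> 1" by (auto simp: clamp01_def)

lemma clamp01_mono: "u \<le> v \<Longrightarrow> clamp01 u \<le> clamp01 v" by (auto simp: clamp01_def)

lemma clamp01_lipschitz: "\<bar>clamp01 u - clamp01 v\<bar> \<le> \<bar>u - v\<bar>" by (auto simp: clamp01_def)

text \<open>\<open>clamp01 (x - real i)\<close> is \<open>1\<close> for \<open>i\<close> below the
  integer part \<open>k\<close> of \<open>x\<close>, the fractional part at \<open>k\<close>, and
  \<open>0\<close> above. The same identity governs interpolation on a grid and the partial sum
  process.\<close>

lemma sum_clamp01: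
  fixes d :: "nat \<Rightarrow> 'b::real_vector"
  assumes x: "0 \<le> x" "x \<le> real n" and k: "k = nat \<lfloor>x\<rfloor>"
  shows "(\<Sum>i<n. clamp01 (x - real i) *\<^sub>R d i) = (\<Sum>i<k. d i) + (if k < n then (x - real k) *\<^sub>R d k else 0)"
proof -
  have kx: "real k \<le> x" "x < real k + 1" unfolding k using x by (simp_all add: of_nat_nat)
  have kn: "k \<le> n"
  proof -
    have "real k \<le> real n" using kx x by linarith
    thus ?thesis by simp
  qed
  have "(\<Sum>i<n. clamp01 (x - real i) *\<^sub>R d i) = (\<Sum>i\<in>{..<k} \<union> {k..<n}. clamp01 (x - real i) *\<^sub>R d i)"
    using kn by (intro sum.cong) auto
  also have "\<dots> = (\<Sum>i<k. clamp01 (x - real i) *\<^sub>R d i) + (\<Sum>i\<in>{k..<n}. clamp01 (x - real i) *\<^sub>R d i)"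
    by (intro sum.union_disjoint) auto
  also have "(\<Sum>i<k. clamp01 (x - real i) *\<^sub>R d i) = (\<Sum>i<k. d i)"
  proof (rule sum.cong[OF refl])
    fix i assume "i \<in> {..<k}"
    hence "real i + 1 \<le> real k" by (simp add: nat_less_real_le)
    hence "clamp01 (x - real i) = 1" using kx by (simp add: clamp01_def)
    thus "clamp01 (x - real i) *\<^sub>R d i = d i" by simp
  qed
  also have "(\<Sum>i\<in>{k..<n}. clamp01 (x - real i) *\<^sub>R d i) = (\<Sum>i\<in>{k..<n}. if i = k then (x - real k) *\<^sub>R d k else 0)"
  proof (rule sum.cong[OF refl])
    fix i assume i: "i \<in> {k..<n}"
    show "clamp01 (x - real i) *\<^sub>R d i = (if i = k then (x - real k) *\<^sub>R d k else 0)"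
    proof (cases "i = k")
      case True
      thus ?thesis using kx by (simp add: clamp01_def)
    next
      case False
      hence "real k + 1 \<le> real i" using i by (simp add: nat_less_real_le)
      hence "clamp01 (x - real i) = 0" using kx by (simp add: clamp01_def)
      thus ?thesis using False by simp
    qed
  qed
  also have "\<dots> = (if k < n then (x - real k) *\<^sub>R d k else 0)" by (simp add: sum.delta)
  finally show ?thesis .
qed

lemma sum_clamp01_one: "0 \<le> x \<Longrightarrow> x \<le> real n \<Longrightarrow> (\<Sum>i<n. clamp01 (x - real i)) = x"
proof -
  assume x: "0 \<le> x" "x \<le> real n"
  define k where "k = nat \<lfloor>x\<rfloor>"
  have "(\<Sum>i<n. clamp01 (x - real i) *\<^sub>R (1::real)) = (\<Sum>i<k. 1) + (if k < n then (x - real k) *\<^sub>R 1 else 0)"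
    by (rule sum_clamp01[OF x k_def])
  moreover have "real k \<le> x" "x < real k + 1" unfolding k_def using x by (simp_all add: of_nat_nat)
  ultimately show ?thesis using x by (auto simp: not_less)
qed

definition grid_point :: "nat \<Rightarrow> nat \<Rightarrow> unit_interval" where
  "grid_point m i = ui_of_real (real i / real m)"

lemma real_of_grid_point: "i \<le> m \<Longrightarrow> m > 0 \<Longrightarrow> real_of_ui (grid_point m i) = real i / real m"
  by (simp add: grid_point_def real_of_ui_of_real)

text \<open>
  The interpolation at the grid \<open>i / m\<close> is written in the basis of the constant function (index 0)
  and the ramps \<open>clamp01 (m x - i)\<close> (index \<open>Suc i\<close>).
\<close>

definition ramp :: "nat \<Rightarrow> nat \<Rightarrow> unit_interval \<Rightarrow> real" where
  "ramp m i x = (case i of 0 \<Rightarrow> 1 | Suc j \<Rightarrow> clamp01 (real m * real_of_ui x - real j))"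

definition ramp_coeff :: "nat \<Rightarrow> (unit_interval \<Rightarrow> 'b::real_vector) \<Rightarrow> nat \<Rightarrow> 'b" where
  "ramp_coeff m f i = (case i of 0 \<Rightarrow> f (grid_point m 0) | Suc j \<Rightarrow> f (grid_point m (Suc j)) - f (grid_point m j))"

definition interpolate :: "nat \<Rightarrow> (unit_interval \<Rightarrow> 'b::real_vector) \<Rightarrow> unit_interval \<Rightarrow> 'b" where
  "interpolate m f x = (\<Sum>i\<le>m. ramp m i x *\<^sub>R ramp_coeff m f i)"

lemma ramp_bounds: "0 \<le> ramp m i x" "ramp m i x \<le> 1"
  by (auto simp: ramp_def clamp01_bounds split: nat.split)

lemma ramp_lipschitz: "\<bar>ramp m i x - ramp m i y\<bar> \<le> real m * \<bar>real_of_ui x - real_of_ui y\<bar>"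
proof (cases i)
  case (Suc j)
  have "\<bar>ramp m i x - ramp m i y\<bar> \<le> \<bar>(real m * real_of_ui x - real j) - (real m * real_of_ui y - real j)\<bar>"
    unfolding Suc ramp_def by (simp only: nat.case clamp01_lipschitz)
  also have "\<dots> = real m * \<bar>real_of_ui x - real_of_ui y\<bar>"
    by (simp add: abs_mult flip: right_diff_distrib)
  finally show ?thesis .
qed (simp add: ramp_def)

lemma interpolate_alt:
  "interpolate m f x = f (grid_point m 0) + (\<Sum>i<m. clamp01 (real m * real_of_ui x - real i) *\<^sub>R (f (grid_point m (Suc i)) - f (grid_point m i)))"
  unfolding interpolate_def lessThan_Suc_atMost[symmetric]
  by (subst sum.lessThan_Suc_shift) (simp add: ramp_def ramp_coeff_def)

lemma interpolate_cell:
  fixes f :: "unit_interval \<Rightarrow> 'b::real_vector"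
  assumes m: "m > 0"
  obtains k t where "k < m" "0 \<le> t" "t \<le> 1" "real_of_ui x = (real k + t) / real m"
    "interpolate m f x = (1 - t) *\<^sub>R f (grid_point m k) + t *\<^sub>R f (grid_point m (Suc k))"
proof -
  define y where "y = real m * real_of_ui x"
  have y: "0 \<le> y" "y \<le> real m" using m by (auto simp: y_def mult_left_le)
  define k where "k = nat \<lfloor>y\<rfloor>"
  have ky: "real k \<le> y" "y < real k + 1" unfolding k_def using y by (simp_all add: of_nat_nat)
  have tel: "(\<Sum>i<k. f (grid_point m (Suc i)) - f (grid_point m i)) = f (grid_point m k) - f (grid_point m 0)" for k
    by (rule sum_lessThan_telescope)
  have eq: "interpolate m f x = f (grid_point m k) + (if k < m then (y - real k) *\<^sub>R (f (grid_point m (Suc k)) - f (grid_point m k)) else 0)"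
    unfolding interpolate_alt y_def[symmetric] sum_clamp01[OF y k_def] tel by simp
  have xy: "real_of_ui x = y / real m" using m by (simp add: y_def)
  show thesis
  proof (cases "k < m")
    case True
    show thesis
      by (rule that[of k "y - real k"]) (use True ky xy eq in \<open>auto simp: algebra_simps\<close>)
  next
    case False
    \<comment> \<open>The right endpoint has integer part \<open>m\<close>, which numbers no cell;
      it is assigned to the last cell with \<open>t = 1\<close>.\<close>
    hence km: "k = m" "y = real m" using ky y by auto
    obtain j where j: "m = Suc j" using m by (cases m) auto
    show thesis
      by (rule that[of j 1]) (use km xy eq j in auto)
  qed
qed

text \<open>Increments over a distance \<open>D\<close> of at least \<open>h = 1 / m\<close> are
  controlled by the uniform error \<open>e * h powr \<beta>\<close>. For shorter ones the
  interpolation has slope at most \<open>e * h powr (\<beta> - 1)\<close>, and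
  \<open>D / h \<le> (D / h) powr \<beta>\<close>. In the bound, one \<open>e\<close> comes from the
  supremum and two from the quotients.\<close>

lemma interpolate_error:
  fixes f :: "unit_interval \<Rightarrow> 'b::real_normed_vector"
  assumes m: "m > 0" and e: "e \<ge> 0" and \<beta>: "0 \<le> \<beta>" "\<beta> \<le> 1"
    and mod: "\<And>x y. real_of_ui x < real_of_ui y \<Longrightarrow> real_of_ui y - real_of_ui x \<le> 1 / real m \<Longrightarrow>
      norm (f y - f x) \<le> e * (real_of_ui y - real_of_ui x) powr \<beta>"
  shows "hoelder_norm \<beta> (\<lambda>x. interpolate m f x - f x) \<le> 3 * e"
proof -
  define h where "h = 1 / real m"
  have h: "0 < h" "h \<le> 1" using m by (auto simp: h_def)
  have mod': "norm (f y - f x) \<le> e * h powr \<beta>" if "\<bar>real_of_ui y - real_of_ui x\<bar> \<le> h" for x y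
  proof -
    have *: "norm (f y - f x) \<le> e * h powr \<beta>" if "real_of_ui x < real_of_ui y" "real_of_ui y - real_of_ui x \<le> h" for x y
    proof -
      have "norm (f y - f x) \<le> e * (real_of_ui y - real_of_ui x) powr \<beta>" using that by (intro mod) (auto simp: h_def)
      also have "\<dots> \<le> e * h powr \<beta>" using that e \<beta> by (intro mult_left_mono powr_mono2) auto
      finally show ?thesis .
    qed
    show ?thesis
      using *[of x y] *[of y x] that e by (cases "real_of_ui x" "real_of_ui y" rule: linorder_cases)
        (auto simp: norm_minus_commute real_of_ui_inject)
  qed
  have hb: "h powr \<beta> \<le> 1" using h \<beta> by (simp add: powr_le1)
  have sup: "norm (interpolate m f x - f x) \<le> e * h powr \<beta>" for x
  proof -
    obtain k t where kt: "k < m" "0 \<le> t" "t \<le> 1" "real_of_ui x = (real k + t) / real m"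
      and I: "interpolate m f x = (1 - t) *\<^sub>R f (grid_point m k) + t *\<^sub>R f (grid_point m (Suc k))"
      by (rule interpolate_cell[OF m])
    have 1: "norm (f (grid_point m k) - f x) \<le> e * h powr \<beta>"
      using kt m by (intro mod') (simp add: real_of_grid_point h_def field_simps)
    have 2: "norm (f (grid_point m (Suc k)) - f x) \<le> e * h powr \<beta>"
    proof (rule mod')
      have "real_of_ui (grid_point m (Suc k)) - real_of_ui x = (1 - t) / real m"
        using kt m by (simp add: real_of_grid_point diff_divide_distrib add_divide_distrib)
      thus "\<bar>real_of_ui (grid_point m (Suc k)) - real_of_ui x\<bar> \<le> h" using kt m by (simp add: h_def divide_right_mono)
    qed
    have "interpolate m f x - f x = (1 - t) *\<^sub>R (f (grid_point m k) - f x) + t *\<^sub>R (f (grid_point m (Suc k)) - f x)"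
      unfolding I by (simp add: algebra_simps)
    also have "norm \<dots> \<le> norm ((1 - t) *\<^sub>R (f (grid_point m k) - f x)) + norm (t *\<^sub>R (f (grid_point m (Suc k)) - f x))"
      by (rule norm_triangle_ineq)
    also have "\<dots> \<le> (1 - t) * (e * h powr \<beta>) + t * (e * h powr \<beta>)"
      using kt 1 2 by (intro add_mono) (auto intro!: mult_left_mono)
    also have "\<dots> = e * h powr \<beta>" by (simp add: algebra_simps)
    finally show ?thesis .
  qed
  have "hoelder_norm \<beta> (\<lambda>x. interpolate m f x - f x) \<le> e + 2 * e"
  proof (rule hoelder_enorm_le(2))
    show "norm (interpolate m f x - f x) \<le> e" for x
      using sup[of x] mult_left_mono[OF hb e] by simp
    fix x y assume xy: "real_of_ui x < real_of_ui y"
    define D where "D = real_of_ui y - real_of_ui x"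
    have D: "D > 0" using xy by (simp add: D_def)
    show "norm (interpolate m f y - f y - (interpolate m f x - f x)) \<le> 2 * e * (real_of_ui y - real_of_ui x) powr \<beta>"
    proof (cases "D \<ge> h")
      case True
      have "norm (interpolate m f y - f y - (interpolate m f x - f x)) \<le> e * h powr \<beta> + e * h powr \<beta>"
        by (intro order_trans[OF norm_triangle_ineq4] add_mono sup)
      also have "\<dots> \<le> e * D powr \<beta> + e * D powr \<beta>"
        using True e h \<beta> by (intro add_mono mult_left_mono powr_mono2) auto
      finally show ?thesis by (simp add: D_def)
    next
      case False
      have 1: "norm (f y - f x) \<le> e * D powr \<beta>" unfolding D_def using False xy by (intro mod) (auto simp: D_def h_def)
      \<comment> \<open>The share of grid cell \<open>i\<close> that lies between \<open>x\<close>
        and \<open>y\<close>; the shares sum to the distance in units of \<open>h\<close>.\<close>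
      define w where "w i = clamp01 (real m * real_of_ui y - real i) - clamp01 (real m * real_of_ui x - real i)" for i
      have w0: "w i \<ge> 0" for i unfolding w_def using xy m by (simp add: clamp01_mono)
      have ws: "(\<Sum>i<m. w i) = real m * D"
        unfolding w_def sum_subtractf
        by (subst (1 2) sum_clamp01_one) (auto simp: D_def right_diff_distrib mult_left_le)
      have "interpolate m f y - interpolate m f x = (\<Sum>i<m. w i *\<^sub>R (f (grid_point m (Suc i)) - f (grid_point m i)))"
        by (simp add: interpolate_alt w_def scaleR_left_diff_distrib sum_subtractf)
      also have "norm \<dots> \<le> (\<Sum>i<m. w i * (e * h powr \<beta>))"
      proof (intro order_trans[OF norm_sum] sum_mono)
        fix i assume "i \<in> {..<m}"
        hence "norm (f (grid_point m (Suc i)) - f (grid_point m i)) \<le> e * h powr \<beta>"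
          using m by (intro mod') (simp add: real_of_grid_point h_def flip: diff_divide_distrib)
        thus "norm (w i *\<^sub>R (f (grid_point m (Suc i)) - f (grid_point m i))) \<le> w i * (e * h powr \<beta>)"
          using w0 by (simp add: mult_left_mono)
      qed
      also have "\<dots> = real m * D * (e * h powr \<beta>)" by (simp add: ws flip: sum_distrib_right)
      also have "\<dots> = e * (D / h * h powr \<beta>)" by (simp add: h_def)
      also have "\<dots> \<le> e * D powr \<beta>"
      proof (rule mult_left_mono[OF _ e])
        have "D / h \<le> (D / h) powr \<beta>"
          using powr_mono'[of \<beta> 1 "D / h"] False D h \<beta> by simp
        hence "D / h * h powr \<beta> \<le> (D / h) powr \<beta> * h powr \<beta>" by (intro mult_right_mono) auto
        also have "\<dots> = D powr \<beta>" using D h by (simp flip: powr_mult)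
        finally show "D / h * h powr \<beta> \<le> D powr \<beta>" .
      qed
      finally have 2: "norm (interpolate m f y - interpolate m f x) \<le> e * D powr \<beta>" .
      have "interpolate m f y - f y - (interpolate m f x - f x) = (interpolate m f y - interpolate m f x) - (f y - f x)"
        by simp
      also have "norm \<dots> \<le> e * D powr \<beta> + e * D powr \<beta>"
        by (intro order_trans[OF norm_triangle_ineq4] add_mono 1 2)
      finally show ?thesis by (simp add: D_def)
    qed
  qed (use e in auto)
  thus ?thesis by simp
qed

text \<open>The vanishing modulus provides an arbitrarily small constant \<open>e\<close> at small
  scales. Finiteness of the Hoelder norm alone would only keep the error bounded.\<close>

lemma interpolate_tendsto:
  fixes f :: "unit_interval \<Rightarrow> 'b::real_normed_vector"
  assumes f: "f \<in> hoelder_space \<beta>" and \<beta>: "0 \<le> \<beta>" "\<beta> \<le> 1"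
  shows "(\<lambda>m. hoelder_norm \<beta> (\<lambda>x. interpolate (Suc m) f x - f x)) \<longlonglongrightarrow> 0"
proof (rule LIMSEQ_I)
  fix e :: real assume e: "e > 0"
  obtain \<delta> where \<delta>: "\<delta> > 0" "\<And>x y. real_of_ui x < real_of_ui y \<Longrightarrow> real_of_ui y - real_of_ui x < \<delta> \<Longrightarrow>
    norm (f y - f x) \<le> (e / 4) * (real_of_ui y - real_of_ui x) powr \<beta>"
    by (rule hoelder_space_modulus[OF f, of "e / 4"]) (use e in auto)
  obtain m0 :: nat where m0: "1 / \<delta> < real m0" using reals_Archimedean2 by blast
  show "\<exists>no. \<forall>n\<ge>no. norm (hoelder_norm \<beta> (\<lambda>x. interpolate (Suc n) f x - f x) - 0) < e"
  proof (intro exI[of _ m0] allI impI)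
    fix n assume "m0 \<le> n"
    hence "1 / \<delta> < real (Suc n)" using m0 by simp
    hence small: "1 / real (Suc n) < \<delta>" using \<delta>(1) by (simp add: field_simps)
    have "hoelder_norm \<beta> (\<lambda>x. interpolate (Suc n) f x - f x) \<le> 3 * (e / 4)"
      by (rule interpolate_error) (use e \<beta> \<delta>(2) small in auto)
    moreover have "0 \<le> hoelder_norm \<beta> (\<lambda>x. interpolate (Suc n) f x - f x)" by (simp add: hoelder_norm_def)
    ultimately show "norm (hoelder_norm \<beta> (\<lambda>x. interpolate (Suc n) f x - f x) - 0) < e" using e by simp
  qed
qed

section \<open>Measurability in Hoelder spaces\<close>

lemma space_borel_of_metric [simp]: "space (borel_of_metric S) = mspace S"
  unfolding borel_of_metric_def
  by (rule space_measure_of) (auto dest!: openin_subset simp: topspace_mtopology_of)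

lemma sets_borel_of_metric: "sets (borel_of_metric S) = sigma_sets (mspace S) {U. openin (mtopology_of S) U}"
  unfolding borel_of_metric_def
  by (rule sets_measure_of) (auto dest!: openin_subset simp: topspace_mtopology_of)

lemma measurable_borel_of_metricI:
  assumes "\<And>\<omega>. \<omega> \<in> space M \<Longrightarrow> X \<omega> \<in> mspace S"
    and "\<And>U. openin (mtopology_of S) U \<Longrightarrow> {\<omega> \<in> space M. X \<omega> \<in> U} \<in> sets M"
  shows "X \<in> measurable M (borel_of_metric S)"
  unfolding borel_of_metric_def
proof (rule measurable_measure_of)
  show "{U. openin (mtopology_of S) U} \<subseteq> Pow (mspace S)" by (auto dest!: openin_subset simp: topspace_mtopology_of)
  show "X \<in> space M \<rightarrow> mspace S" using assms(1) by auto
  fix U assume "U \<in> {U. openin (mtopology_of S) U}"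
  moreover have "X -` U \<inter> space M = {\<omega> \<in> space M. X \<omega> \<in> U}" by auto
  ultimately show "X -` U \<inter> space M \<in> sets M" using assms(2) by simp
qed

lemma openin_mtopology_of:
  "openin (mtopology_of S) U \<longleftrightarrow> U \<subseteq> mspace S \<and> (\<forall>x\<in>U. \<exists>r>0. \<forall>y\<in>mspace S. mdist S x y < r \<longrightarrow> y \<in> U)"
proof -
  interpret Metric_space "mspace S" "mdist S" by (rule Metric_space_mspace_mdist)
  show ?thesis
    unfolding mtopology_of_def openin_mtopology
  proof (intro conj_cong refl, intro iffI)
    assume *: "\<forall>x. x \<in> U \<longrightarrow> (\<exists>r>0. mball x r \<subseteq> U)" and "U \<subseteq> mspace S"
    thus "\<forall>x\<in>U. \<exists>r>0. \<forall>y\<in>mspace S. mdist S x y < r \<longrightarrow> y \<in> U"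
      unfolding mball_def subset_iff mem_Collect_eq by (metis subsetD)
  next
    assume *: "\<forall>x\<in>U. \<exists>r>0. \<forall>y\<in>mspace S. mdist S x y < r \<longrightarrow> y \<in> U" and "U \<subseteq> mspace S"
    thus "\<forall>x. x \<in> U \<longrightarrow> (\<exists>r>0. mball x r \<subseteq> U)"
      unfolding mball_def subset_iff mem_Collect_eq by metis
  qed
qed

text \<open>If \<open>Y \<omega>\<close> lies in \<open>U\<close>, it does so with a margin, and the
  approximations eventually lie in some \<open>G k\<close>; conversely, eventual membership in one
  \<open>G k\<close> forces the limit into \<open>U\<close>. This expresses the event by countable
  operations.\<close>

lemma measurable_mdist_limit:
  assumes Xn: "\<And>n. X n \<in> measurable M (borel_of_metric S)"
    and X: "\<And>\<omega>. \<omega> \<in> space M \<Longrightarrow> Y \<omega> \<in> mspace S"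
    and lim: "\<And>\<omega>. \<omega> \<in> space M \<Longrightarrow> (\<lambda>n. mdist S (X n \<omega>) (Y \<omega>)) \<longlonglongrightarrow> 0"
  shows "Y \<in> measurable M (borel_of_metric S)"
proof (rule measurable_borel_of_metricI[OF X])
  interpret Metric_space "mspace S" "mdist S" by (rule Metric_space_mspace_mdist)
  fix U assume U: "openin (mtopology_of S) U"
  \<comment> \<open>The open set \<open>G k\<close> stays at distance at least \<open>1 / (k + 1)\<close> from the complement of \<open>U\<close>.\<close>
  define G where "G k = {x \<in> mspace S. \<exists>r > 1 / real (Suc k). \<forall>y\<in>mspace S. mdist S x y < r \<longrightarrow> y \<in> U}" for k
  have G: "openin (mtopology_of S) (G k)" for k
    unfolding openin_mtopology_of
  proof (intro conjI ballI)
    fix x assume "x \<in> G k"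
    then obtain r where x: "x \<in> mspace S" and r: "r > 1 / real (Suc k)" "\<And>y. y \<in> mspace S \<Longrightarrow> mdist S x y < r \<Longrightarrow> y \<in> U"
      by (auto simp: G_def)
    define d where "d = (r - 1 / real (Suc k)) / 2"
    show "\<exists>r>0. \<forall>y\<in>mspace S. mdist S x y < r \<longrightarrow> y \<in> G k"
    proof (intro exI[of _ d] conjI ballI impI)
      show "d > 0" using r by (simp add: d_def)
      fix y assume y: "y \<in> mspace S" "mdist S x y < d"
      have "z \<in> U" if "z \<in> mspace S" "mdist S y z < r - d" for z
        using r(2)[OF that(1)] triangle[OF x y(1) that(1)] y that by simp
      moreover have "r - d > 1 / real (Suc k)"
      proof -
        have "r - (r - c) / 2 > c" if "r > c" for c using that by (simp add: field_simps)
        from this[OF r(1)] show ?thesis unfolding d_def .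
      qed
      ultimately show "y \<in> G k" using y unfolding G_def by blast
    qed
  qed (auto simp: G_def)
  have "{\<omega> \<in> space M. Y \<omega> \<in> U} = (\<Union>k. \<Union>n0. \<Inter>n\<in>{n0..}. {\<omega> \<in> space M. X n \<omega> \<in> G k})"
  proof (intro equalityI subsetI)
    fix \<omega> assume "\<omega> \<in> {\<omega> \<in> space M. Y \<omega> \<in> U}"
    hence w: "\<omega> \<in> space M" "Y \<omega> \<in> U" by auto
    then obtain r where r: "r > 0" "\<And>y. y \<in> mspace S \<Longrightarrow> mdist S (Y \<omega>) y < r \<Longrightarrow> y \<in> U"
      using U unfolding openin_mtopology_of by blast
    obtain k where k: "1 / real (Suc k) < r / 2" using r(1) nat_approx_posE[of "r / 2"] by auto
    have "eventually (\<lambda>n. mdist S (X n \<omega>) (Y \<omega>) < r / 2) sequentially"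
      by (rule order_tendstoD[OF lim[OF w(1)]]) (use r in simp)
    then obtain n0 where n0: "\<And>n. n \<ge> n0 \<Longrightarrow> mdist S (X n \<omega>) (Y \<omega>) < r / 2" by (auto simp: eventually_sequentially)
    have "X n \<omega> \<in> G k" if "n \<ge> n0" for n
    proof -
      have xn: "X n \<omega> \<in> mspace S" using measurable_space[OF Xn w(1)] by simp
      have "y \<in> U" if "y \<in> mspace S" "mdist S (X n \<omega>) y < r / 2" for y
        using r(2)[OF that(1)] triangle[OF X[OF w(1)] xn that(1)] n0[OF \<open>n \<ge> n0\<close>] that commute[of "X n \<omega>" "Y \<omega>"] by simp
      thus ?thesis unfolding G_def using k xn by blast
    qed
    thus "\<omega> \<in> (\<Union>k. \<Union>n0. \<Inter>n\<in>{n0..}. {\<omega> \<in> space M. X n \<omega> \<in> G k})" using w by auto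
  next
    fix \<omega> assume "\<omega> \<in> (\<Union>k. \<Union>n0. \<Inter>n\<in>{n0..}. {\<omega> \<in> space M. X n \<omega> \<in> G k})"
    then obtain k n0 where w: "\<omega> \<in> space M" and n0: "\<And>n. n \<ge> n0 \<Longrightarrow> X n \<omega> \<in> G k" by auto
    have "eventually (\<lambda>n. mdist S (X n \<omega>) (Y \<omega>) < 1 / real (Suc k)) sequentially"
      by (rule order_tendstoD[OF lim[OF w]]) simp
    then obtain n1 where n1: "\<And>n. n \<ge> n1 \<Longrightarrow> mdist S (X n \<omega>) (Y \<omega>) < 1 / real (Suc k)" by (auto simp: eventually_sequentially)
    define n where "n = max n0 n1"
    have "X n \<omega> \<in> G k" "mdist S (X n \<omega>) (Y \<omega>) < 1 / real (Suc k)" using n0[of n] n1[of n] by (auto simp: n_def)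
    then obtain r where "1 / real (Suc k) < r" "\<And>y. y \<in> mspace S \<Longrightarrow> mdist S (X n \<omega>) y < r \<Longrightarrow> y \<in> U"
      unfolding G_def by blast
    hence "Y \<omega> \<in> U" using X[OF w] \<open>mdist S (X n \<omega>) (Y \<omega>) < _\<close> by simp
    thus "\<omega> \<in> {\<omega> \<in> space M. Y \<omega> \<in> U}" using w by simp
  qed
  moreover have "{\<omega> \<in> space M. X n \<omega> \<in> G k} \<in> sets M" for n k
  proof -
    have "G k \<in> sets (borel_of_metric S)" using G by (auto simp: sets_borel_of_metric)
    from measurable_sets[OF Xn this] show ?thesis by (simp add: vimage_def Int_def conj_commute)
  qed
  hence "(\<Inter>n\<in>{n0..}. {\<omega> \<in> space M. X n \<omega> \<in> G k}) \<in> sets M" for k n0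
    by (intro sets.countable_INT') auto
  ultimately show "{\<omega> \<in> space M. Y \<omega> \<in> U} \<in> sets M" by auto
qed

text \<open>The function depends continuously, in the \<beta>-norm, on the vector of its
  coefficients, and for a countable index type Borel measurability into the space of vectors is
  coordinatewise.\<close>

lemma measurable_finite_combination:
  fixes \<phi> :: "'k::countable \<Rightarrow> unit_interval \<Rightarrow> 'b::real_normed_vector"
  assumes \<xi>: "\<And>k. \<xi> k \<in> borel_measurable M" and F: "finite F" and \<beta>: "0 \<le> \<beta>" "\<beta> < 1"
    and A: "\<And>k x. norm (\<phi> k x) \<le> A" and L: "\<And>k x y. norm (\<phi> k y - \<phi> k x) \<le> L * \<bar>real_of_ui y - real_of_ui x\<bar>"
    and nn: "A \<ge> 0" "L \<ge> 0"
  shows "(\<lambda>\<omega> x. \<Sum>k\<in>F. \<xi> k \<omega> *\<^sub>R \<phi> k x) \<in> measurable M (borel_of_metric (hoelder_metric \<beta>))"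
proof (rule measurable_borel_of_metricI)
  define \<Psi> where "\<Psi> w x = (\<Sum>k\<in>F. w k *\<^sub>R \<phi> k x)" for w :: "'k \<Rightarrow> real" and x
  have bd: "norm (\<Psi> w x) \<le> (\<Sum>k\<in>F. \<bar>w k\<bar>) * A" for w x
    unfolding \<Psi>_def sum_distrib_right
    by (intro order_trans[OF norm_sum] sum_mono) (auto intro!: mult_left_mono A)
  have lip: "norm (\<Psi> w y - \<Psi> w x) \<le> (\<Sum>k\<in>F. \<bar>w k\<bar>) * L * \<bar>real_of_ui y - real_of_ui x\<bar>" for w x y
  proof -
    have "\<Psi> w y - \<Psi> w x = (\<Sum>k\<in>F. w k *\<^sub>R (\<phi> k y - \<phi> k x))"
      by (simp add: \<Psi>_def sum_subtractf scaleR_diff_right)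
    also have "norm \<dots> \<le> (\<Sum>k\<in>F. \<bar>w k\<bar> * (L * \<bar>real_of_ui y - real_of_ui x\<bar>))"
      by (intro order_trans[OF norm_sum] sum_mono) (auto intro!: mult_left_mono L)
    finally show ?thesis by (simp add: sum_distrib_right mult.assoc)
  qed
  have sp: "\<Psi> w \<in> hoelder_space \<beta>" and nm: "hoelder_norm \<beta> (\<Psi> w) \<le> (\<Sum>k\<in>F. \<bar>w k\<bar>) * (A + L)" for w
    using lipschitz_hoelder[where f="\<Psi> w", OF bd lip _ _ \<beta>] nn
    by (simp_all add: distrib_left sum_nonneg)
  show "(\<lambda>x. \<Sum>k\<in>F. \<xi> k \<omega> *\<^sub>R \<phi> k x) \<in> mspace (hoelder_metric \<beta>)" for \<omega>
    using sp[of "\<lambda>k. \<xi> k \<omega>"] by (simp add: \<Psi>_def[abs_def])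
  fix U :: "(unit_interval \<Rightarrow> 'b) set" assume U: "openin (mtopology_of (hoelder_metric \<beta>)) U"
  define V where "V = {w. \<Psi> w \<in> U}"
  have "open V"
  proof (subst open_subopen, intro ballI)
    fix w assume w: "w \<in> V"
    then obtain r where r: "r > 0" "\<And>f. f \<in> hoelder_space \<beta> \<Longrightarrow> hoelder_norm \<beta> (\<lambda>x. \<Psi> w x - f x) < r \<Longrightarrow> f \<in> U"
      using U unfolding V_def openin_mtopology_of by auto
    define d where "d = r / ((real (card F) + 1) * (A + L + 1))"
    have d: "d > 0" using r nn by (auto simp: d_def intro!: divide_pos_pos mult_pos_pos add_nonneg_pos)
    define T where "T = (\<Inter>k\<in>F. (\<lambda>w'. w' k) -` {w k - d <..< w k + d})"
    have "open T" unfolding T_def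
      using F by (intro open_INT ballI open_vimage continuous_on_product_coordinates) auto
    moreover have "w \<in> T" using d by (simp add: T_def)
    moreover have "T \<subseteq> V"
    proof
      fix w' assume w': "w' \<in> T"
      have eq: "(\<lambda>x. \<Psi> w x - \<Psi> w' x) = \<Psi> (\<lambda>k. w k - w' k)"
        by (auto simp: \<Psi>_def sum_subtractf scaleR_left_diff_distrib)
      have "(\<Sum>k\<in>F. \<bar>w k - w' k\<bar>) \<le> (\<Sum>k\<in>F. d)"
        using w' by (intro sum_mono) (auto simp: T_def abs_le_iff less_imp_le)
      hence "hoelder_norm \<beta> (\<lambda>x. \<Psi> w x - \<Psi> w' x) \<le> (\<Sum>k\<in>F. d) * (A + L)"
        unfolding eq using nm[of "\<lambda>k. w k - w' k"] nn by (meson add_nonneg_nonneg mult_right_mono order_trans)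
      also have "\<dots> < (real (card F) + 1) * d * (A + L + 1)"
      proof -
        have "real (card F) * d * (A + L) \<le> real (card F) * d * (A + L + 1)"
          using d nn by (intro mult_left_mono) auto
        also have "\<dots> < (real (card F) + 1) * d * (A + L + 1)"
          using d nn by (intro mult_strict_right_mono) auto
        finally show ?thesis by simp
      qed
      also have "\<dots> = r" using nn by (simp add: d_def field_simps add_nonneg_eq_0_iff)
      finally show "w' \<in> V" unfolding V_def using r(2)[OF sp] by simp
    qed
    ultimately show "\<exists>T. open T \<and> w \<in> T \<and> T \<subseteq> V" by blast
  qed
  hence "V \<in> sets borel" by simp
  moreover have "(\<lambda>\<omega> k. \<xi> k \<omega>) \<in> borel_measurable M"
    by (rule measurable_coordinatewise_then_product) (rule \<xi>)
  ultimately have "(\<lambda>\<omega> k. \<xi> k \<omega>) -` V \<inter> space M \<in> sets M" by (intro measurable_sets)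
  moreover have "(\<lambda>\<omega> k. \<xi> k \<omega>) -` V \<inter> space M = {\<omega> \<in> space M. (\<lambda>x. \<Sum>k\<in>F. \<xi> k \<omega> *\<^sub>R \<phi> k x) \<in> U}"
    by (auto simp: V_def \<Psi>_def[abs_def])
  ultimately show "{\<omega> \<in> space M. (\<lambda>x. \<Sum>k\<in>F. \<xi> k \<omega> *\<^sub>R \<phi> k x) \<in> U} \<in> sets M" by simp
qed

section \<open>Measurability from point evaluations\<close>

text \<open>For \<beta> = 0 the vanishing modulus is uniform continuity. This makes the
  interpolation result available for uniform convergence in the space variable.\<close>

lemma continuous_in_hoelder_space_0:
  fixes f :: "unit_interval \<Rightarrow> 'b::real_normed_vector"
  assumes f: "continuous_on UNIV f" shows "f \<in> hoelder_space 0"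
proof -
  have "bounded (range f)"
    using compact_continuous_image[OF f compact_UNIV_unit_interval] by (rule compact_imp_bounded)
  then obtain A where A: "\<And>x. norm (f x) \<le> A" "A \<ge> 0"
    unfolding bounded_iff by (metis norm_ge_zero order_trans rangeI)
  have "hoelder_enorm 0 f \<le> ennreal (A + 2 * A)"
  proof (rule hoelder_enorm_le(1)[OF A(1)])
    fix x y assume "real_of_ui x < real_of_ui y"
    have "norm (f y - f x) \<le> A + A" by (intro order_trans[OF norm_triangle_ineq4] add_mono A)
    thus "norm (f y - f x) \<le> 2 * A * (real_of_ui y - real_of_ui x) powr 0" using \<open>_ < _\<close> by simp
  qed (use A in auto)
  hence fin: "hoelder_enorm 0 f < \<infinity>" by (metis ennreal_less_top infinity_ennreal_def le_less_trans)
  have "uniformly_continuous_on UNIV f"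
    by (rule compact_uniformly_continuous[OF f compact_UNIV_unit_interval])
  hence uc: "\<exists>d>0. \<forall>x y. dist x y < d \<longrightarrow> dist (f x) (f y) < e" if "e > 0" for e
    using that unfolding uniformly_continuous_on_def by (metis UNIV_I dist_commute)
  have "(hoelder_modulus 0 f \<longlongrightarrow> 0) (at_right 0)"
  proof (rule order_tendstoI)
    fix e :: ennreal assume e: "0 < e"
    obtain e' where e': "0 < e'" "ennreal e' < e"
    proof (cases e)
      case (real r)
      thus thesis using e that[of "r / 2"] by (auto simp: ennreal_less_iff)
    next
      case top
      thus thesis using that[of 1] by simp
    qed
    obtain d where d: "d > 0" "\<And>x y. dist x y < d \<Longrightarrow> dist (f x) (f y) < e'" using uc[OF e'(1)] by blast
    have "hoelder_modulus 0 f \<delta> < e" if \<delta>: "0 < \<delta>" "\<delta> < d" for \<delta>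
    proof -
      have "hoelder_modulus 0 f \<delta> \<le> ennreal e'"
        unfolding hoelder_modulus_def
      proof (rule SUP_least, clarsimp, rule ennreal_leI)
        fix x y assume xy: "real_of_ui x < real_of_ui y" "real_of_ui y \<le> real_of_ui x + \<delta>"
        show "norm (f y - f x) \<le> e'"
          using d(2)[of y x] xy \<delta> by (simp add: dist_norm dist_unit_interval_def)
      qed
      thus ?thesis using e' by simp
    qed
    thus "\<forall>\<^sub>F d in at_right 0. hoelder_modulus 0 f d < e"
      unfolding eventually_at_right_field using d by blast
  qed simp
  thus ?thesis using f fin by (simp add: hoelder_space_def)
qed

definition ramp_bcontfun :: "nat \<Rightarrow> nat \<Rightarrow> unit_interval \<Rightarrow>\<^sub>C real" where
  "ramp_bcontfun n j = Bcontfun (ramp n j)"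

lemma continuous_ramp: "continuous_on UNIV (ramp n j)"
  using lipschitz_hoelder(1)[of "ramp n j" 1 "real n" 0] ramp_bounds ramp_lipschitz[of n j]
  by (auto simp: hoelder_space_def)

lemma apply_Bcontfun_ui:
  fixes g :: "unit_interval \<Rightarrow> 'b::metric_space"
  assumes "continuous_on UNIV g"
  shows "apply_bcontfun (Bcontfun g) = g"
  using assms bcontfun_unit_interval by (intro Bcontfun_inverse) auto

lemma apply_ramp_bcontfun: "apply_bcontfun (ramp_bcontfun n j) = ramp n j"
  unfolding ramp_bcontfun_def by (rule apply_Bcontfun_ui[OF continuous_ramp])

lemma apply_bcontfun_sum: "apply_bcontfun (\<Sum>i\<in>I. f i) x = (\<Sum>i\<in>I. apply_bcontfun (f i) x)"
  by (induction I rule: infinite_finite_induct) (auto simp: plus_bcontfun.rep_eq zero_bcontfun.rep_eq)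

definition interpolate_bcontfun :: "nat \<Rightarrow> (unit_interval \<Rightarrow>\<^sub>C real) \<Rightarrow> unit_interval \<Rightarrow>\<^sub>C real" where
  "interpolate_bcontfun n e = (\<Sum>j\<le>n. ramp_coeff n (apply_bcontfun e) j *\<^sub>R ramp_bcontfun n j)"

lemma apply_interpolate_bcontfun:
  "apply_bcontfun (interpolate_bcontfun n e) = interpolate n (apply_bcontfun e)"
  by (auto simp: interpolate_bcontfun_def interpolate_def apply_bcontfun_sum apply_ramp_bcontfun scaleR_bcontfun.rep_eq mult.commute)

lemma interpolate_bcontfun_tendsto: "(\<lambda>n. norm (interpolate_bcontfun (Suc n) e - e)) \<longlonglongrightarrow> 0"
proof (rule Lim_null_comparison)
  have e: "apply_bcontfun e \<in> hoelder_space 0"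
    by (rule continuous_in_hoelder_space_0) simp
  show "(\<lambda>n. hoelder_norm 0 (\<lambda>x. interpolate (Suc n) (apply_bcontfun e) x - apply_bcontfun e x)) \<longlonglongrightarrow> 0"
    by (rule interpolate_tendsto[OF e]) auto
  show "\<forall>\<^sub>F n in sequentially. norm (norm (interpolate_bcontfun (Suc n) e - e))
      \<le> hoelder_norm 0 (\<lambda>x. interpolate (Suc n) (apply_bcontfun e) x - apply_bcontfun e x)"
  proof (intro always_eventually allI)
    fix n
    let ?g = "\<lambda>x. interpolate (Suc n) (apply_bcontfun e) x - apply_bcontfun e x"
    have g: "?g = apply_bcontfun (interpolate_bcontfun (Suc n) e - e)"
      by (auto simp: apply_interpolate_bcontfun minus_bcontfun.rep_eq)
    have "?g \<in> hoelder_space 0"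
      unfolding g by (rule continuous_in_hoelder_space_0, rule continuous_on_apply_bcontfun)
    hence "norm (?g x) \<le> hoelder_norm 0 ?g" for x
      by (intro hoelder_norm_bounds(1)) (simp add: hoelder_space_def)
    hence "norm (interpolate_bcontfun (Suc n) e - e) \<le> hoelder_norm 0 ?g"
      by (intro norm_bound) (simp add: apply_interpolate_bcontfun)
    thus "norm (norm (interpolate_bcontfun (Suc n) e - e)) \<le> hoelder_norm 0 ?g" by simp
  qed
qed

text \<open>Interpolation in time, and then of its finitely many coefficients in space, yields
  finite combinations of fixed functions whose real coefficients are linear in point evaluations.
  Two nested limits in the metric of the space lead back to \<open>X\<close>.\<close>

theorem measurable_hoelder:
  fixes X :: "'a \<Rightarrow> unit_interval \<Rightarrow> (unit_interval \<Rightarrow>\<^sub>C real)"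
  assumes X: "\<And>\<omega>. \<omega> \<in> space M \<Longrightarrow> X \<omega> \<in> hoelder_space \<beta>" and \<beta>: "0 \<le> \<beta>" "\<beta> < 1"
    and ev: "\<And>x s. (\<lambda>\<omega>. apply_bcontfun (X \<omega> x) s) \<in> borel_measurable M"
  shows "X \<in> measurable M (borel_of_metric (hoelder_metric \<beta>))"
proof (rule measurable_mdist_limit)
  have lipI: "(\<lambda>x. \<Sum>i\<le>m. ramp m i x *\<^sub>R d i) \<in> hoelder_space \<beta> \<and>
    hoelder_norm \<beta> (\<lambda>x. \<Sum>i\<le>m. ramp m i x *\<^sub>R d i) \<le> (1 + real m) * (\<Sum>i\<le>m. norm (d i))"
    for d :: "nat \<Rightarrow> unit_interval \<Rightarrow>\<^sub>C real" and m
  proof -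
    have 1: "norm (\<Sum>i\<le>m. ramp m i x *\<^sub>R d i) \<le> (\<Sum>i\<le>m. norm (d i))" for x
      by (intro order_trans[OF norm_sum] sum_mono) (use ramp_bounds in \<open>auto intro!: mult_left_le_one_le\<close>)
    have 2: "norm ((\<Sum>i\<le>m. ramp m i y *\<^sub>R d i) - (\<Sum>i\<le>m. ramp m i x *\<^sub>R d i)) \<le> (real m * (\<Sum>i\<le>m. norm (d i))) * \<bar>real_of_ui y - real_of_ui x\<bar>" for x y
    proof -
      have "(\<Sum>i\<le>m. ramp m i y *\<^sub>R d i) - (\<Sum>i\<le>m. ramp m i x *\<^sub>R d i) = (\<Sum>i\<le>m. (ramp m i y - ramp m i x) *\<^sub>R d i)"
        by (simp add: sum_subtractf scaleR_left_diff_distrib)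
      also have "norm \<dots> \<le> (\<Sum>i\<le>m. (real m * \<bar>real_of_ui y - real_of_ui x\<bar>) * norm (d i))"
        by (intro order_trans[OF norm_sum] sum_mono) (auto intro!: mult_right_mono ramp_lipschitz)
      finally show ?thesis by (simp add: sum_distrib_left mult_ac)
    qed
    show ?thesis
      using lipschitz_hoelder[OF 1 2 _ _ \<beta>] by (simp add: sum_nonneg distrib_right)
  qed
  show "\<And>\<omega>. \<omega> \<in> space M \<Longrightarrow> X \<omega> \<in> mspace (hoelder_metric \<beta>)" using X by simp
  show "(\<lambda>n. mdist (hoelder_metric \<beta>) (interpolate (Suc n) (X \<omega>)) (X \<omega>)) \<longlonglongrightarrow> 0" if "\<omega> \<in> space M" for \<omega>
    using interpolate_tendsto[OF X[OF that]] \<beta> by simp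
  show "(\<lambda>\<omega>. interpolate (Suc m) (X \<omega>)) \<in> measurable M (borel_of_metric (hoelder_metric \<beta>))" for m
  proof (rule measurable_mdist_limit)
    let ?m = "Suc m"
    let ?d = "\<lambda>\<omega> i. ramp_coeff ?m (X \<omega>) i"
    show "interpolate ?m (X \<omega>) \<in> mspace (hoelder_metric \<beta>)" for \<omega>
      using lipI[of ?m "?d \<omega>"] by (simp add: interpolate_def[abs_def])
    show "(\<lambda>n. mdist (hoelder_metric \<beta>) (\<lambda>x. \<Sum>i\<le>?m. ramp ?m i x *\<^sub>R interpolate_bcontfun (Suc n) (?d \<omega> i)) (interpolate ?m (X \<omega>))) \<longlonglongrightarrow> 0" for \<omega>
    proof (rule Lim_null_comparison)
      show "\<forall>\<^sub>F n in sequentially. norm (mdist (hoelder_metric \<beta>) (\<lambda>x. \<Sum>i\<le>?m. ramp ?m i x *\<^sub>R interpolate_bcontfun (Suc n) (?d \<omega> i)) (interpolate ?m (X \<omega>)))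
         \<le> (1 + real ?m) * (\<Sum>i\<le>?m. norm (interpolate_bcontfun (Suc n) (?d \<omega> i) - ?d \<omega> i))"
      proof (intro always_eventually allI)
        fix n
        have "(\<lambda>x. (\<Sum>i\<le>?m. ramp ?m i x *\<^sub>R interpolate_bcontfun (Suc n) (?d \<omega> i)) - interpolate ?m (X \<omega>) x)
          = (\<lambda>x. \<Sum>i\<le>?m. ramp ?m i x *\<^sub>R (interpolate_bcontfun (Suc n) (?d \<omega> i) - ?d \<omega> i))"
          unfolding interpolate_def sum_subtractf[symmetric] scaleR_diff_right ..
        moreover have "0 \<le> hoelder_norm \<beta> f" for f :: "unit_interval \<Rightarrow> unit_interval \<Rightarrow>\<^sub>C real" by (simp add: hoelder_norm_def)
        ultimately show "norm (mdist (hoelder_metric \<beta>) (\<lambda>x. \<Sum>i\<le>?m. ramp ?m i x *\<^sub>R interpolate_bcontfun (Suc n) (?d \<omega> i)) (interpolate ?m (X \<omega>)))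
         \<le> (1 + real ?m) * (\<Sum>i\<le>?m. norm (interpolate_bcontfun (Suc n) (?d \<omega> i) - ?d \<omega> i))"
          using lipI[of ?m "\<lambda>i. interpolate_bcontfun (Suc n) (?d \<omega> i) - ?d \<omega> i"] by simp
      qed
      have "(\<lambda>n. (1 + real ?m) * (\<Sum>i\<le>?m. norm (interpolate_bcontfun (Suc n) (?d \<omega> i) - ?d \<omega> i))) \<longlonglongrightarrow> (1 + real ?m) * (\<Sum>i\<le>?m. 0)"
        by (intro tendsto_intros interpolate_bcontfun_tendsto)
      thus "(\<lambda>n. (1 + real ?m) * (\<Sum>i\<le>?m. norm (interpolate_bcontfun (Suc n) (?d \<omega> i) - ?d \<omega> i))) \<longlonglongrightarrow> 0" by simp
    qed
    show "(\<lambda>\<omega> x. \<Sum>i\<le>?m. ramp ?m i x *\<^sub>R interpolate_bcontfun (Suc n) (?d \<omega> i)) \<in> measurable M (borel_of_metric (hoelder_metric \<beta>))" for n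
    proof -
      let ?n = "Suc n"
      define \<xi> where "\<xi> k \<omega> = ramp_coeff ?n (apply_bcontfun (?d \<omega> (fst k))) (snd k)" for k \<omega>
      define \<phi> where "\<phi> k x = ramp ?m (fst k) x *\<^sub>R ramp_bcontfun ?n (snd k)" for k x
      have eq: "(\<lambda>\<omega> x. \<Sum>i\<le>?m. ramp ?m i x *\<^sub>R interpolate_bcontfun ?n (?d \<omega> i))
        = (\<lambda>\<omega> x. \<Sum>k\<in>{..?m} \<times> {..?n}. \<xi> k \<omega> *\<^sub>R \<phi> k x)"
        by (intro ext) (simp add: interpolate_bcontfun_def scaleR_sum_right sum.cartesian_product case_prod_unfold \<xi>_def \<phi>_def mult.commute del: sum.atMost_Suc)
      show ?thesis
        unfolding eq
      proof (rule measurable_finite_combination)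
        have dm: "(\<lambda>\<omega>. apply_bcontfun (?d \<omega> i) s) \<in> borel_measurable M" for i s
          using ev by (cases i) (auto simp: ramp_coeff_def minus_bcontfun.rep_eq intro!: borel_measurable_diff)
        show "\<xi> k \<in> borel_measurable M" for k
          unfolding \<xi>_def[abs_def] using dm by (cases "snd k") (auto simp: ramp_coeff_def[of ?n] intro!: borel_measurable_diff)
        have nb: "norm (ramp_bcontfun ?n j) \<le> 1" for j
          by (rule norm_bound) (simp add: apply_ramp_bcontfun ramp_bounds)
        show "norm (\<phi> k x) \<le> 1" for k x
          unfolding \<phi>_def using nb[of "snd k"] ramp_bounds[of ?m "fst k" x] by (simp add: mult_le_one)
        show "norm (\<phi> k y - \<phi> k x) \<le> real ?m * \<bar>real_of_ui y - real_of_ui x\<bar>" for k x y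
        proof -
          have "norm (\<phi> k y - \<phi> k x) = \<bar>ramp ?m (fst k) y - ramp ?m (fst k) x\<bar> * norm (ramp_bcontfun ?n (snd k))"
            unfolding \<phi>_def by (simp flip: scaleR_left_diff_distrib)
          also have "\<dots> \<le> (real ?m * \<bar>real_of_ui y - real_of_ui x\<bar>) * 1"
            by (intro mult_mono ramp_lipschitz nb) auto
          finally show ?thesis by simp
        qed
      qed (use \<beta> in auto)
    qed
  qed
qed

section \<open>Weak convergence in Hoelder spaces\<close>

definition ui0 :: unit_interval where "ui0 = ui_of_real 0"

lemma real_of_ui0 [simp]: "real_of_ui ui0 = 0"
  by (simp add: ui0_def real_of_ui_of_real)

definition eval :: "(unit_interval \<Rightarrow> (unit_interval \<Rightarrow>\<^sub>C real)) \<Rightarrow> unit_interval \<times> unit_interval \<Rightarrow> real" where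
  "eval f = (\<lambda>(x, s). apply_bcontfun (f x) s)"

text \<open>Each condition is an equation or weak inequality in at most two values, so the set is
  closed under pointwise limits. Regularity is imposed separately in time and in space.\<close>

definition box_functions :: "real \<Rightarrow> real \<Rightarrow> real \<Rightarrow> (unit_interval \<times> unit_interval \<Rightarrow> real) set" where
  "box_functions \<theta> \<gamma> R = {g. (\<forall>s. g (ui0, s) = 0) \<and>
     (\<forall>x y s. \<bar>g (x, s) - g (y, s)\<bar> \<le> R * \<bar>real_of_ui x - real_of_ui y\<bar> powr \<theta>) \<and>
     (\<forall>x s t. \<bar>g (x, s) - g (x, t)\<bar> \<le> R * \<bar>real_of_ui s - real_of_ui t\<bar> powr \<gamma>)}"

definition hoelder_box :: "real \<Rightarrow> real \<Rightarrow> real \<Rightarrow> (unit_interval \<Rightarrow> (unit_interval \<Rightarrow>\<^sub>C real)) set" where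
  "hoelder_box \<theta> \<gamma> R = {f. eval f \<in> box_functions \<theta> \<gamma> R}"

lemma hoelder_boxD:
  assumes "f \<in> hoelder_box \<theta> \<gamma> R"
  shows "\<bar>apply_bcontfun (f x) s - apply_bcontfun (f y) s\<bar> \<le> R * \<bar>real_of_ui x - real_of_ui y\<bar> powr \<theta>"
    and "\<bar>apply_bcontfun (f x) s - apply_bcontfun (f x) t\<bar> \<le> R * \<bar>real_of_ui s - real_of_ui t\<bar> powr \<gamma>"
  using assms by (auto simp: hoelder_box_def box_functions_def eval_def)

lemma hoelder_box_norm:
  assumes "f \<in> hoelder_box \<theta> \<gamma> R"
  shows "norm (f x - f y) \<le> R * \<bar>real_of_ui x - real_of_ui y\<bar> powr \<theta>"
  by (rule norm_bound) (use hoelder_boxD(1)[OF assms] in \<open>simp add: minus_bcontfun.rep_eq\<close>)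

lemma hoelder_box_subset:
  assumes "0 \<le> \<beta>" "\<beta> < \<theta>" "R \<ge> 0" shows "hoelder_box \<theta> \<gamma> R \<subseteq> hoelder_space \<beta>"
proof
  fix f assume f: "f \<in> hoelder_box \<theta> \<gamma> R"
  show "f \<in> hoelder_space \<beta>"
  proof (rule hoelder_spaceI[OF _ assms(3,1,2)])
    fix x y assume "real_of_ui x < real_of_ui y"
    thus "norm (f y - f x) \<le> R * (real_of_ui y - real_of_ui x) powr \<theta>"
      using hoelder_box_norm[OF f, of y x] by simp
  qed
qed

lemma near_grid_point:
  assumes m: "m > 0"
  obtains i where "i \<le> m" "\<bar>real_of_ui x - real_of_ui (grid_point m i)\<bar> \<le> 1 / real m"
proof -
  define i where "i = nat \<lfloor>real m * real_of_ui x\<rfloor>"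
  have "0 \<le> real m * real_of_ui x" "real m * real_of_ui x \<le> real m" by (auto simp: mult_left_le)
  hence i: "real i \<le> real m * real_of_ui x" "real m * real_of_ui x < real i + 1" "real i \<le> real m"
    unfolding i_def by (simp_all) linarith
  have im: "i \<le> m" using i(3) by simp
  have "real_of_ui x - real i / real m = (real m * real_of_ui x - real i) / real m" using m by (simp add: field_simps)
  moreover have "\<bar>(real m * real_of_ui x - real i) / real m\<bar> \<le> 1 / real m"
    unfolding abs_divide using i m by (intro frac_le) auto
  ultimately show thesis using im m by (intro that[of i]) (auto simp: real_of_grid_point)
qed

lemma powr_small:
  fixes R e \<alpha> :: real
  assumes "e > 0" "\<alpha> > 0" obtains \<eta> where "\<eta> > 0" "\<And>u. 0 \<le> u \<Longrightarrow> u \<le> \<eta> \<Longrightarrow> R * u powr \<alpha> \<le> e"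
proof -
  define \<eta> where "\<eta> = (e / (\<bar>R\<bar> + 1)) powr (1 / \<alpha>)"
  have q: "e / (\<bar>R\<bar> + 1) > 0" using assms by (intro divide_pos_pos) auto
  have \<eta>: "\<eta> > 0" "\<eta> powr \<alpha> = e / (\<bar>R\<bar> + 1)"
    unfolding \<eta>_def using q assms by (simp_all add: powr_powr)
  show thesis
  proof (rule that[OF \<eta>(1)])
    fix u assume u: "0 \<le> u" "u \<le> \<eta>"
    have "R * u powr \<alpha> \<le> (\<bar>R\<bar> + 1) * \<eta> powr \<alpha>"
      using u assms by (intro mult_mono powr_mono2) auto
    also have "\<dots> = e" using \<eta> by simp
    finally show "R * u powr \<alpha> \<le> e" .
  qed
qed

text \<open>Long time increments are controlled by uniform closeness, short ones by the surplus
  \<theta> - \<beta> of regularity. Uniform closeness follows from closeness on a fine grid, since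
  both functions vary little between grid points.\<close>

lemma hoelder_box_close:
  assumes \<beta>: "0 \<le> \<beta>" "\<beta> < \<theta>" and \<gamma>: "\<gamma> > 0" and R: "R \<ge> 0" and e: "e > 0"
  shows "\<exists>F d. finite F \<and> d > 0 \<and> (\<forall>f\<in>hoelder_box \<theta> \<gamma> R. \<forall>g\<in>hoelder_box \<theta> \<gamma> R.
    (\<forall>p\<in>F. \<bar>eval f p - eval g p\<bar> < d) \<longrightarrow> hoelder_norm \<beta> (\<lambda>x. f x - g x) < e)"
proof -
  obtain \<eta> where \<eta>: "\<eta> > 0" "\<And>u. 0 \<le> u \<Longrightarrow> u \<le> \<eta> \<Longrightarrow> (2 * R) * u powr (\<theta> - \<beta>) \<le> e / 4"
    by (rule powr_small[of "e / 4" "\<theta> - \<beta>" "2 * R"]) (use e \<beta> in auto)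
  \<comment> \<open>Small enough for the uniform norm and, through
    \<open>2 * d0 \<le> e / 4 * \<eta> powr \<beta>\<close>, for increments over a distance of more
    than \<eta>. One third is allotted to the grid values and one third to the variation of each of
    the two functions.\<close>
  define d0 where "d0 = min (e / 4) (e * \<eta> powr \<beta> / 8)"
  have d0: "d0 > 0" "d0 \<le> e / 4" "2 * d0 \<le> (e / 4) * \<eta> powr \<beta>" using e \<eta> by (auto simp: d0_def min_def)
  obtain \<eta>1 where \<eta>1: "\<eta>1 > 0" "\<And>u. 0 \<le> u \<Longrightarrow> u \<le> \<eta>1 \<Longrightarrow> R * u powr \<theta> \<le> d0 / 6"
    by (rule powr_small[of "d0 / 6" \<theta> R]) (use d0 \<beta> in auto)
  obtain \<eta>2 where \<eta>2: "\<eta>2 > 0" "\<And>u. 0 \<le> u \<Longrightarrow> u \<le> \<eta>2 \<Longrightarrow> R * u powr \<gamma> \<le> d0 / 6"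
    by (rule powr_small[of "d0 / 6" \<gamma> R]) (use d0 \<gamma> in auto)
  obtain m :: nat where m: "m > 0" "1 / real m < min \<eta>1 \<eta>2"
    using real_arch_inverse[of "min \<eta>1 \<eta>2"] \<eta>1 \<eta>2 by (auto simp: inverse_eq_divide)
  define F where "F = (\<lambda>(i, j). (grid_point m i, grid_point m j)) ` ({..m} \<times> {..m})"
  show ?thesis
  proof (intro exI[of _ F] exI[of _ "d0 / 3"] conjI ballI impI)
    fix f g assume f: "f \<in> hoelder_box \<theta> \<gamma> R" and g: "g \<in> hoelder_box \<theta> \<gamma> R"
      and close: "\<forall>p\<in>F. \<bar>eval f p - eval g p\<bar> < d0 / 3"
    have near: "\<bar>apply_bcontfun (h x) s - apply_bcontfun (h y) t\<bar> \<le> d0 / 3"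
      if "h \<in> hoelder_box \<theta> \<gamma> R" "\<bar>real_of_ui x - real_of_ui y\<bar> \<le> 1 / real m" "\<bar>real_of_ui s - real_of_ui t\<bar> \<le> 1 / real m" for h x y s t
    proof -
      have "\<bar>apply_bcontfun (h x) s - apply_bcontfun (h y) s\<bar> \<le> d0 / 6"
        by (rule order_trans[OF hoelder_boxD(1)[OF that(1)] \<eta>1(2)]) (use that m in auto)
      moreover have "\<bar>apply_bcontfun (h y) s - apply_bcontfun (h y) t\<bar> \<le> d0 / 6"
        by (rule order_trans[OF hoelder_boxD(2)[OF that(1)] \<eta>2(2)]) (use that m in auto)
      ultimately show ?thesis by linarith
    qed
    have unif: "\<bar>apply_bcontfun (f x) s - apply_bcontfun (g x) s\<bar> \<le> d0" for x s
    proof -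
      obtain i where i: "i \<le> m" "\<bar>real_of_ui x - real_of_ui (grid_point m i)\<bar> \<le> 1 / real m" by (rule near_grid_point[OF m(1)])
      obtain j where j: "j \<le> m" "\<bar>real_of_ui s - real_of_ui (grid_point m j)\<bar> \<le> 1 / real m" by (rule near_grid_point[OF m(1)])
      have "(grid_point m i, grid_point m j) \<in> F" using i j by (auto simp: F_def)
      from close[rule_format, OF this] have "\<bar>apply_bcontfun (f (grid_point m i)) (grid_point m j) - apply_bcontfun (g (grid_point m i)) (grid_point m j)\<bar> < d0 / 3"
        by (simp add: eval_def)
      with near[OF f i(2) j(2)] near[OF g i(2) j(2)] show ?thesis by linarith
    qed
    have nrm: "norm (f x - g x) \<le> d0" for x
      by (rule norm_bound) (use unif in \<open>simp add: minus_bcontfun.rep_eq\<close>)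
    have "hoelder_norm \<beta> (\<lambda>x. f x - g x) \<le> d0 + e / 4"
    proof (rule hoelder_enorm_le(2))
      show "norm (f x - g x) \<le> d0" for x by (rule nrm)
      fix x y assume xy: "real_of_ui x < real_of_ui y"
      define D where "D = real_of_ui y - real_of_ui x"
      have D: "D > 0" using xy by (simp add: D_def)
      show "norm (f y - g y - (f x - g x)) \<le> e / 4 * (real_of_ui y - real_of_ui x) powr \<beta>"
      proof (cases "D \<le> \<eta>")
        case True
        have "norm (f y - g y - (f x - g x)) = norm ((f y - f x) - (g y - g x))" by (simp add: algebra_simps)
        also have "\<dots> \<le> R * D powr \<theta> + R * D powr \<theta>"
          using hoelder_box_norm[OF f, of y x] hoelder_box_norm[OF g, of y x] D
          by (intro order_trans[OF norm_triangle_ineq4[of "f y - f x" "g y - g x"] add_mono]) (auto simp: D_def)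
        also have "\<dots> = (2 * R) * D powr (\<theta> - \<beta>) * D powr \<beta>" by (simp add: mult.assoc flip: powr_add)
        also have "\<dots> \<le> e / 4 * D powr \<beta>" using True D by (intro mult_right_mono \<eta>(2)) auto
        finally show ?thesis by (simp add: D_def)
      next
        case False
        have "norm (f y - g y - (f x - g x)) \<le> d0 + d0"
          by (intro order_trans[OF norm_triangle_ineq4] add_mono nrm)
        also have "\<dots> \<le> (e / 4) * \<eta> powr \<beta>" using d0 by simp
        also have "\<dots> \<le> (e / 4) * D powr \<beta>" using False \<eta> e \<beta> by (intro mult_left_mono powr_mono2) auto
        finally show ?thesis by (simp add: D_def)
      qed
    qed (use d0 e in auto)
    thus "hoelder_norm \<beta> (\<lambda>x. f x - g x) < e" using d0 e by linarith
  qed (use d0 in \<open>auto simp: F_def\<close>)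
qed

lemma continuous_on_coord: "continuous_on UNIV (\<lambda>g. g p :: real)"
  by (rule continuous_on_product_coordinates)

text \<open>A closed subset of a product of intervals \<open>{-R..R}\<close>, compact by Tychonoff's
  theorem; the bound on the values is the time regularity measured from \<open>ui0\<close>.\<close>

lemma compact_box_functions:
  assumes R: "R \<ge> 0" and \<theta>: "\<theta> > 0"
  shows "compact (box_functions \<theta> \<gamma> R)"
proof -
  have "compactin (product_topology (\<lambda>_::unit_interval \<times> unit_interval. euclideanreal) UNIV) (PiE UNIV (\<lambda>_. {-R..R}))"
    by (simp add: compactin_PiE)
  hence comp: "compact (PiE UNIV (\<lambda>_::unit_interval \<times> unit_interval. {-R..R}))"
    by (simp add: euclidean_product_topology flip: compactin_euclidean_iff)
  have "closed (box_functions \<theta> \<gamma> R)"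
    unfolding box_functions_def
    by (intro closed_Collect_conj closed_Collect_all closed_Collect_le closed_Collect_eq continuous_intros continuous_on_coord)
  moreover have "box_functions \<theta> \<gamma> R \<subseteq> PiE UNIV (\<lambda>_. {-R..R})"
  proof
    fix g assume g: "g \<in> box_functions \<theta> \<gamma> R"
    have "\<bar>g (x, s)\<bar> \<le> R" for x s
    proof -
      have "\<bar>g (x, s) - g (ui0, s)\<bar> \<le> R * \<bar>real_of_ui x - real_of_ui ui0\<bar> powr \<theta>"
        using g unfolding box_functions_def by blast
      also have "\<dots> \<le> R * 1" using R \<theta> by (intro mult_left_mono) (auto simp: powr_le1)
      finally show ?thesis using g by (simp add: box_functions_def)
    qed
    thus "g \<in> PiE UNIV (\<lambda>_. {-R..R})" by (auto simp: abs_le_iff) (metis minus_le_iff)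
  qed
  ultimately show ?thesis using comp by (metis compact_Int_closed inf.absorb2)
qed

definition embed :: "(unit_interval \<times> unit_interval \<Rightarrow> real) \<Rightarrow> unit_interval \<Rightarrow> (unit_interval \<Rightarrow>\<^sub>C real)" where
  "embed g x = Bcontfun (\<lambda>s. g (x, s))"

lemma embed_eval: "embed (eval f) = f"
  by (rule ext) (simp add: embed_def eval_def apply_bcontfun_inverse)

lemma eval_embed:
  assumes g: "g \<in> box_functions \<theta> \<gamma> R" and R: "R \<ge> 0" "\<gamma> > 0"
  shows "eval (embed g) = g"
proof -
  have "(\<lambda>s. g (x, s)) \<in> hoelder_space 0" for x
  proof (rule hoelder_spaceI[where L=R and \<theta>=\<gamma>])
    fix s t assume st: "real_of_ui s < real_of_ui t"
    have "\<bar>g (x, t) - g (x, s)\<bar> \<le> R * \<bar>real_of_ui t - real_of_ui s\<bar> powr \<gamma>"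
      using g unfolding box_functions_def by blast
    thus "norm (g (x, t) - g (x, s)) \<le> R * (real_of_ui t - real_of_ui s) powr \<gamma>" using st by simp
  qed (use R in auto)
  hence "continuous_on UNIV (\<lambda>s. g (x, s))" for x by (simp add: hoelder_space_def)
  thus ?thesis by (auto simp: eval_def embed_def apply_Bcontfun_ui)
qed

text \<open>
  The product topology on \<open>'i \<Rightarrow> real\<close> is an instance of \<^class>\<open>t2_space\<close> in the library only for
  countable index types; a copy of the type carries the instance in general.
\<close>

typedef 'i coords = "UNIV :: ('i \<Rightarrow> real) set"
  morphisms coord_fun Coords ..

instantiation coords :: (type) t2_space
begin

definition open_coords :: "'a coords set \<Rightarrow> bool" where
  "open_coords U \<longleftrightarrow> open (Coords -` U)"

instance
proof
  show "open (UNIV :: 'a coords set)" by (simp add: open_coords_def)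
  show "open (S \<inter> T)" if "open S" "open T" for S T :: "'a coords set"
    using that by (simp add: open_coords_def open_Int)
  show "open (\<Union>\<S>)" if "\<forall>S\<in>\<S>. open S" for \<S> :: "'a coords set set"
    using that by (auto simp: open_coords_def vimage_Union)
  fix f g :: "'a coords" assume "f \<noteq> g"
  then obtain x where x: "coord_fun f x \<noteq> coord_fun g x" by (metis coord_fun_inject ext)
  obtain U V :: "real set" where UV: "open U" "open V" "coord_fun f x \<in> U" "coord_fun g x \<in> V" "U \<inter> V = {}"
    using hausdorff[OF x] by blast
  have o: "open ((\<lambda>h. coord_fun h x) -` W)" if "open W" for W :: "real set"
  proof -
    have "Coords -` ((\<lambda>h. coord_fun h x) -` W) = (\<lambda>h. h x) -` W" by (auto simp: Coords_inverse)
    thus ?thesis unfolding open_coords_def using open_vimage[OF that continuous_on_product_coordinates[of x]] by simp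
  qed
  show "\<exists>U V. open U \<and> open V \<and> f \<in> U \<and> g \<in> V \<and> U \<inter> V = {}"
    by (rule exI[of _ "(\<lambda>h. coord_fun h x) -` U"], rule exI[of _ "(\<lambda>h. coord_fun h x) -` V"]) (use UV o in auto)
qed

end

lemma continuous_Coords: "continuous_on UNIV Coords"
  by (simp add: continuous_on_open_vimage open_coords_def)

lemma continuous_coord_fun: "continuous_on UNIV coord_fun"
proof -
  have "Coords -` (coord_fun -` V) = V" for V :: "('a \<Rightarrow> real) set" by (auto simp: Coords_inverse)
  thus ?thesis by (simp add: continuous_on_open_vimage open_coords_def)
qed

section \<open>Trigonometric polynomials in finitely many values\<close>

text \<open>Products are not a generator but follow from the product-to-sum formulas. Inductions
  over this set thus meet only sines and cosines of single linear combinations, whose integrals are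
  read off characteristic functions.\<close>

inductive_set trig_polys :: "(('i \<Rightarrow> real) \<Rightarrow> real) set" where
  trig_cos: "(\<lambda>g. cos (lincomb xs g)) \<in> trig_polys"
| trig_sin: "(\<lambda>g. sin (lincomb xs g)) \<in> trig_polys"
| trig_add: "f \<in> trig_polys \<Longrightarrow> h \<in> trig_polys \<Longrightarrow> (\<lambda>g. f g + h g) \<in> trig_polys"
| trig_scale: "f \<in> trig_polys \<Longrightarrow> (\<lambda>g. c * f g) \<in> trig_polys"

lemma lincomb_neg: "lincomb (map (\<lambda>(a, t). (- a, t)) xs) g = - lincomb xs g"
  by (induction xs) auto

lemma trig_const: "(\<lambda>_. c) \<in> trig_polys"
  using trig_scale[OF trig_cos[of "[]"], of c] by simp

lemma trig_mult:
  assumes "f \<in> trig_polys" "h \<in> trig_polys" shows "(\<lambda>g. f g * h g) \<in> trig_polys"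
proof -
  have diff: "(\<lambda>g. u g - v g) \<in> trig_polys" if "u \<in> trig_polys" "v \<in> trig_polys" for u v :: "('i \<Rightarrow> real) \<Rightarrow> real"
    using trig_add[OF that(1) trig_scale[OF that(2), of "-1"]] by simp
  have half: "(\<lambda>g. u g / 2) \<in> trig_polys" if "u \<in> trig_polys" for u :: "('i \<Rightarrow> real) \<Rightarrow> real"
    using trig_scale[OF that, of "1/2"] by simp
  let ?m = "\<lambda>ys. map (\<lambda>(a, t). (- a, t)) ys"
  have m: "lincomb (xs @ ?m ys) g = lincomb xs g - lincomb ys g" for xs ys :: "(real \<times> 'i) list" and g
    by (simp add: lincomb_neg)
  have cc: "(\<lambda>g. cos (lincomb xs g) * cos (lincomb ys g)) \<in> trig_polys" for xs ys :: "(real \<times> 'i) list"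
    using half[OF trig_add[OF trig_cos[of "xs @ ?m ys"] trig_cos[of "xs @ ys"]]] by (simp add: m cos_times_cos lincomb_neg)
  have ss: "(\<lambda>g. sin (lincomb xs g) * sin (lincomb ys g)) \<in> trig_polys" for xs ys :: "(real \<times> 'i) list"
    using half[OF diff[OF trig_cos[of "xs @ ?m ys"] trig_cos[of "xs @ ys"]]] by (simp add: m sin_times_sin lincomb_neg)
  have sc: "(\<lambda>g. sin (lincomb xs g) * cos (lincomb ys g)) \<in> trig_polys" for xs ys :: "(real \<times> 'i) list"
    using half[OF trig_add[OF trig_sin[of "xs @ ys"] trig_sin[of "xs @ ?m ys"]]] by (simp add: m sin_times_cos lincomb_neg)
  have cs: "(\<lambda>g. cos (lincomb xs g) * sin (lincomb ys g)) \<in> trig_polys" for xs ys :: "(real \<times> 'i) list"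
    using sc[of ys xs] by (simp add: mult.commute)
  have c: "(\<lambda>g. cos (lincomb xs g) * h g) \<in> trig_polys" for xs
    using assms(2)
  proof induction
    case (trig_add u v)
    from trig_polys.trig_add[OF trig_add.IH] show ?case by (simp add: distrib_left)
  next
    case (trig_scale u c)
    from trig_polys.trig_scale[OF trig_scale.IH, of c] show ?case by (simp add: mult.left_commute)
  qed (rule cc cs)+
  have s: "(\<lambda>g. sin (lincomb xs g) * h g) \<in> trig_polys" for xs
    using assms(2)
  proof induction
    case (trig_add u v)
    from trig_polys.trig_add[OF trig_add.IH] show ?case by (simp add: distrib_left)
  next
    case (trig_scale u c)
    from trig_polys.trig_scale[OF trig_scale.IH, of c] show ?case by (simp add: mult.left_commute)
  qed (rule sc ss)+
  show ?thesis
    using assms(1)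
  proof induction
    case (trig_add u v)
    from trig_polys.trig_add[OF trig_add.IH] show ?case by (simp add: distrib_right)
  next
    case (trig_scale u c)
    from trig_polys.trig_scale[OF trig_scale.IH, of c] show ?case by (simp add: mult.assoc)
  qed (rule c s)+
qed

lemma trig_polynomial:
  assumes p: "real_polynomial_function p" and f: "f \<in> trig_polys"
  shows "(\<lambda>g. p (f g)) \<in> trig_polys"
  using p
proof (induction p rule: real_polynomial_function.induct)
  case (linear l)
  have "l x = l 1 * x" for x :: real
    using linear_scale[OF bounded_linear.linear[OF linear], of x 1] by (simp add: mult.commute)
  hence "(\<lambda>g. l (f g)) = (\<lambda>g. l 1 * f g)" by (rule ext)
  thus ?case using trig_scale[OF f, of "l 1"] by simp
next
  case (const c)
  show ?case by (rule trig_const)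
next
  case (add p q)
  show ?case by (rule trig_add[OF add.IH])
next
  case (mult p q)
  show ?case by (rule trig_mult[OF mult.IH])
qed

lemma trig_bounded:
  assumes "f \<in> trig_polys" shows "\<exists>B\<ge>0. \<forall>g. \<bar>f g\<bar> \<le> B"
  using assms
proof induction
  case (trig_cos xs)
  show ?case by (rule exI[of _ 1]) simp
next
  case (trig_sin xs)
  show ?case by (rule exI[of _ 1]) simp
next
  case (trig_add f h)
  obtain A where A: "A \<ge> 0" "\<And>g. \<bar>f g\<bar> \<le> A" using trig_add.IH(1) by blast
  obtain B where B: "B \<ge> 0" "\<And>g. \<bar>h g\<bar> \<le> B" using trig_add.IH(2) by blast
  have "\<bar>f g + h g\<bar> \<le> A + B" for g using A(2)[of g] B(2)[of g] by linarith
  thus ?case using A B by (intro exI[of _ "A + B"]) simp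
next
  case (trig_scale f c)
  obtain A where A: "A \<ge> 0" "\<And>g. \<bar>f g\<bar> \<le> A" using trig_scale.IH by blast
  have "\<bar>c * f g\<bar> \<le> \<bar>c\<bar> * A" for g unfolding abs_mult by (intro mult_left_mono A) simp
  thus ?case using A by (intro exI[of _ "\<bar>c\<bar> * A"]) simp
qed

lemma lincomb_continuous: "continuous_on UNIV (\<lambda>g. lincomb xs g)"
proof (induction xs)
  case (Cons p xs)
  obtain a t where "p = (a, t)" by (cases p)
  thus ?case using Cons by (auto intro!: continuous_intros continuous_on_product_coordinates)
qed simp

lemma trig_continuous: "f \<in> trig_polys \<Longrightarrow> continuous_on UNIV f"
proof (induction rule: trig_polys.induct)
  case (trig_cos xs)
  show ?case by (rule continuous_on_compose2[OF _ lincomb_continuous, of UNIV cos]) (auto intro!: continuous_intros)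
next
  case (trig_sin xs)
  show ?case by (rule continuous_on_compose2[OF _ lincomb_continuous, of UNIV sin]) (auto intro!: continuous_intros)
next
  case (trig_add f h)
  show ?case by (rule continuous_on_add[OF trig_add.IH])
next
  case (trig_scale f c)
  show ?case by (rule continuous_on_mult[OF continuous_on_const trig_scale.IH])
qed

lemma trig_measurable:
  assumes "f \<in> trig_polys" and X: "\<And>t. (\<lambda>\<omega>. X \<omega> t) \<in> borel_measurable M"
  shows "(\<lambda>\<omega>. f (X \<omega>)) \<in> borel_measurable M"
proof -
  have [measurable]: "(\<lambda>\<omega>. lincomb xs (X \<omega>)) \<in> borel_measurable M" for xs
    by (rule lincomb_measurable) (rule X)
  show ?thesis using assms(1) by induction auto
qed

lemma trig_integrable:
  assumes "prob_space M" "f \<in> trig_polys" "\<And>t. (\<lambda>\<omega>. X \<omega> t) \<in> borel_measurable M"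
  shows "integrable M (\<lambda>\<omega>. f (X \<omega>))"
proof -
  interpret prob_space M by fact
  obtain B where "\<And>g. \<bar>f g\<bar> \<le> B" using trig_bounded[OF assms(2)] by blast
  thus ?thesis
    by (intro integrable_const_bound[of _ B] trig_measurable[OF assms(2,3)]) auto
qed

lemma trig_expectation_tendsto:
  assumes M: "prob_space M" "prob_space M'" and f: "f \<in> trig_polys"
    and X: "\<And>n t. (\<lambda>\<omega>. X n \<omega> t) \<in> borel_measurable M" and Y: "\<And>t. (\<lambda>\<omega>. Y \<omega> t) \<in> borel_measurable M'"
    and lim: "\<And>xs. (\<lambda>n. integral\<^sup>L M (\<lambda>\<omega>. cis (lincomb xs (X n \<omega>)))) \<longlonglongrightarrow> integral\<^sup>L M' (\<lambda>\<omega>. cis (lincomb xs (Y \<omega>)))"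
  shows "(\<lambda>n. integral\<^sup>L M (\<lambda>\<omega>. f (X n \<omega>))) \<longlonglongrightarrow> integral\<^sup>L M' (\<lambda>\<omega>. f (Y \<omega>))"
proof -
  interpret M: prob_space M by fact
  interpret M': prob_space M' by fact
  have X' [measurable]: "(\<lambda>\<omega>. lincomb xs (X n \<omega>)) \<in> borel_measurable M" for xs n
    by (rule lincomb_measurable) (rule X)
  have Y' [measurable]: "(\<lambda>\<omega>. lincomb xs (Y \<omega>)) \<in> borel_measurable M'" for xs
    by (rule lincomb_measurable) (rule Y)
  have iX: "integrable M (\<lambda>\<omega>. cis (lincomb xs (X n \<omega>)))" for xs n
    by (rule M.integrable_const_bound[of _ 1]) (auto simp: cis_conv_exp)
  have iY: "integrable M' (\<lambda>\<omega>. cis (lincomb xs (Y \<omega>)))" for xs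
    by (rule M'.integrable_const_bound[of _ 1]) (auto simp: cis_conv_exp)
  show ?thesis
    using f
  proof induction
    case (trig_cos xs)
    have "(\<lambda>n. Re (integral\<^sup>L M (\<lambda>\<omega>. cis (lincomb xs (X n \<omega>))))) \<longlonglongrightarrow> Re (integral\<^sup>L M' (\<lambda>\<omega>. cis (lincomb xs (Y \<omega>))))"
      by (intro tendsto_Re lim)
    thus ?case by (simp add: iX iY flip: integral_Re)
  next
    case (trig_sin xs)
    have "(\<lambda>n. Im (integral\<^sup>L M (\<lambda>\<omega>. cis (lincomb xs (X n \<omega>))))) \<longlonglongrightarrow> Im (integral\<^sup>L M' (\<lambda>\<omega>. cis (lincomb xs (Y \<omega>))))"
      by (intro tendsto_Im lim)
    thus ?case by (simp add: iX iY flip: integral_Im)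
  next
    case (trig_add f h)
    have "integrable M (\<lambda>\<omega>. f (X n \<omega>))" "integrable M (\<lambda>\<omega>. h (X n \<omega>))" for n
      by (rule trig_integrable[OF M(1) _ X]; rule trig_add.hyps)+
    moreover have "integrable M' (\<lambda>\<omega>. f (Y \<omega>))" "integrable M' (\<lambda>\<omega>. h (Y \<omega>))"
      by (rule trig_integrable[OF M(2) _ Y]; rule trig_add.hyps)+
    ultimately show ?case using tendsto_add[OF trig_add.IH] by simp
  next
    case (trig_scale f c)
    show ?case using tendsto_mult_left[OF trig_scale.IH, of c] by simp
  qed
qed

lemma borel_measurable_continuous_map:
  assumes "continuous_map (mtopology_of S) euclideanreal \<Phi>"
  shows "\<Phi> \<in> borel_measurable (borel_of_metric S)"
proof (rule borel_measurableI)
  fix V :: "real set" assume "open V"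
  hence "openin (mtopology_of S) {x \<in> topspace (mtopology_of S). \<Phi> x \<in> V}"
    using assms by (intro openin_continuous_map_preimage) auto
  moreover have "{x \<in> topspace (mtopology_of S). \<Phi> x \<in> V} = \<Phi> -` V \<inter> space (borel_of_metric S)" by auto
  ultimately show "\<Phi> -` V \<inter> space (borel_of_metric S) \<in> sets (borel_of_metric S)"
    by (auto simp: sets_borel_of_metric)
qed

text \<open>An approximation on \<open>K\<close> may be huge elsewhere. Composition with a
  polynomial that approximates truncation at height \<open>B + \<eta>\<close> on the range of the
  first approximation bounds it everywhere by \<open>B + 2 * \<eta>\<close>; this keeps the
  contribution of the event outside the box small.\<close>

lemma trig_approximation:
  fixes \<Psi> :: "(unit_interval \<times> unit_interval \<Rightarrow> real) \<Rightarrow> real"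
  assumes K: "compact K" "K \<noteq> {}" and \<Psi>: "continuous_on K \<Psi>" and B: "\<And>g. g \<in> K \<Longrightarrow> \<bar>\<Psi> g\<bar> \<le> B" and \<eta>: "\<eta> > 0"
  shows "\<exists>P\<in>trig_polys. (\<forall>g\<in>K. \<bar>P g - \<Psi> g\<bar> \<le> 2 * \<eta>) \<and> (\<forall>g. \<bar>P g\<bar> \<le> B + 2 * \<eta>)"
proof -
  let ?R = "(\<lambda>f w. f (coord_fun w)) ` trig_polys"
  have separates: "\<exists>f\<in>trig_polys. f x \<noteq> f y" if xy: "x \<noteq> y" for x y :: "unit_interval \<times> unit_interval \<Rightarrow> real"
  proof -
      obtain p where p: "x p \<noteq> y p" using xy unfolding fun_eq_iff by blast
      define C where "C = \<bar>x p\<bar> + \<bar>y p\<bar> + 1"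
      \<comment> \<open>Scales both values into the open interval from \<open>-1\<close> to
        \<open>1\<close>, on which the sine is injective.\<close>
      define c where "c = 1 / C"
      have C: "C > 0" "\<bar>x p\<bar> < C" "\<bar>y p\<bar> < C" unfolding C_def by linarith+
      have c: "c > 0" using C by (simp add: c_def)
      have "\<bar>c * u\<bar> < 1" if "\<bar>u\<bar> < C" for u
        using that C(1) by (simp add: c_def abs_mult)
      from this[OF C(2)] this[OF C(3)] have b: "\<bar>c * x p\<bar> < 1" "\<bar>c * y p\<bar> < 1" .
      have "sin (c * x p) \<noteq> sin (c * y p)"
      proof
        assume eq: "sin (c * x p) = sin (c * y p)"
        have "c * x p = c * y p"
          by (rule sin_inj_pi[OF _ _ _ _ eq]) (use b pi_gt3 in \<open>auto simp: abs_less_iff\<close>)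
        thus False using c p by simp
      qed
      hence ne: "sin (lincomb [(c, p)] x) \<noteq> sin (lincomb [(c, p)] y)" by simp
      show ?thesis
        by (rule bexI[where x = "\<lambda>g. sin (lincomb [(c, p)] g)"], rule ne, rule trig_sin)
  qed
  interpret function_ring_on ?R "Coords ` K"
  proof
    show "compact (Coords ` K)"
      by (rule compact_continuous_image[OF continuous_on_subset[OF continuous_Coords] K(1)]) simp
    show "continuous_on (Coords ` K) f" if "f \<in> ?R" for f
    proof -
      obtain f0 where f0: "f0 \<in> trig_polys" "f = (\<lambda>w. f0 (coord_fun w))" using \<open>f \<in> ?R\<close> by blast
      have "continuous_on UNIV f"
        unfolding f0 by (rule continuous_on_compose2[OF trig_continuous[OF f0(1)] continuous_coord_fun]) simp
      thus ?thesis by (rule continuous_on_subset) simp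
    qed
    show "(\<lambda>x. f x + g x) \<in> ?R" "(\<lambda>x. f x * g x) \<in> ?R" if "f \<in> ?R" "g \<in> ?R" for f g
    proof -
      obtain u v where uv: "u \<in> trig_polys" "v \<in> trig_polys" "f = (\<lambda>w. u (coord_fun w))" "g = (\<lambda>w. v (coord_fun w))"
        using \<open>f \<in> ?R\<close> \<open>g \<in> ?R\<close> by blast
      show "(\<lambda>x. f x + g x) \<in> ?R" unfolding uv by (rule image_eqI[OF _ trig_add[OF uv(1,2)]]) simp
      show "(\<lambda>x. f x * g x) \<in> ?R" unfolding uv by (rule image_eqI[OF _ trig_mult[OF uv(1,2)]]) simp
    qed
    show "(\<lambda>_. c) \<in> ?R" for c by (rule image_eqI[OF _ trig_const[of c]]) simp
    show "\<exists>f\<in>?R. f x \<noteq> f y" if "x \<in> Coords ` K" "y \<in> Coords ` K" "x \<noteq> y" for x y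
    proof -
      have "coord_fun x \<noteq> coord_fun y" using that(3) by (simp only: coord_fun_inject not_False_eq_True)
      then obtain f where f: "f \<in> trig_polys" "f (coord_fun x) \<noteq> f (coord_fun y)" using separates by blast
      thus ?thesis by (intro bexI[of _ "\<lambda>w. f (coord_fun w)"] imageI)
    qed
  qed
  have "continuous_on (Coords ` K) (\<lambda>w. \<Psi> (coord_fun w))"
    by (rule continuous_on_compose2[OF \<Psi> continuous_on_subset[OF continuous_coord_fun]]) (auto simp: Coords_inverse)
  from Stone_Weierstrass[OF this] obtain F where F: "F \<in> UNIV \<rightarrow> ?R"
      "uniform_limit (Coords ` K) F (\<lambda>w. \<Psi> (coord_fun w)) sequentially" by blast
  obtain n where n: "\<And>w. w \<in> Coords ` K \<Longrightarrow> dist (F n w) (\<Psi> (coord_fun w)) < \<eta>"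
  proof -
    assume *: "\<And>n. (\<And>w. w \<in> Coords ` K \<Longrightarrow> dist (F n w) (\<Psi> (coord_fun w)) < \<eta>) \<Longrightarrow> thesis"
    have "\<forall>\<^sub>F n in sequentially. \<forall>w\<in>Coords ` K. dist (F n w) (\<Psi> (coord_fun w)) < \<eta>"
      by (rule uniform_limitD[OF F(2) \<eta>])
    then obtain n where "\<forall>w\<in>Coords ` K. dist (F n w) (\<Psi> (coord_fun w)) < \<eta>"
      unfolding eventually_sequentially by blast
    thus thesis by (intro *[of n]) (rule bspec)
  qed
  have "F n \<in> ?R" using F(1) by (rule Pi_mem) simp
  then obtain T where T: "T \<in> trig_polys" "F n = (\<lambda>w. T (coord_fun w))" by (elim imageE)
  obtain A where A: "\<And>g. \<bar>T g\<bar> \<le> A" using trig_bounded[OF T(1)] by blast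
  obtain g0 where "g0 \<in> K" using K(2) by blast
  from B[OF this] have B0: "B \<ge> 0" by linarith
  define c where "c t = max (- (B + \<eta>)) (min (B + \<eta>) t)" for t
  have "continuous_on {-A..A} c" unfolding c_def by (intro continuous_intros)
  then obtain p where p: "real_polynomial_function p" "\<And>t. t \<in> {-A..A} \<Longrightarrow> \<bar>c t - p t\<bar> < \<eta>"
    using Stone_Weierstrass_real_polynomial_function[of "{-A..A}" c \<eta>] \<eta> by auto
  show ?thesis
  proof (intro bexI[of _ "\<lambda>g. p (T g)"] conjI ballI allI)
    show "(\<lambda>g. p (T g)) \<in> trig_polys" by (rule trig_polynomial[OF p(1) T(1)])
    have pc: "\<bar>c (T g) - p (T g)\<bar> < \<eta>" for g using A[of g] by (intro p) (auto simp: abs_le_iff)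
    show "\<bar>p (T g) - \<Psi> g\<bar> \<le> 2 * \<eta>" if g: "g \<in> K" for g
    proof -
      have d: "\<bar>T g - \<Psi> g\<bar> < \<eta>" using n[of "Coords g"] g by (simp add: T(2) dist_real_def Coords_inverse)
      hence "c (T g) = T g" using B[OF g] by (auto simp: c_def)
      thus ?thesis using pc[of g] d by simp
    qed
    show "\<bar>p (T g)\<bar> \<le> B + 2 * \<eta>" for g
    proof -
      have "\<bar>c (T g)\<bar> \<le> B + \<eta>" using B0 \<eta> by (auto simp: c_def)
      thus ?thesis using pc[of g] by linarith
    qed
  qed
qed

section \<open>Weak convergence from tightness and characteristic functions\<close>

text \<open>Stated through a measurable exceptional set, because membership in the box consists of
  uncountably many conditions. \<open>R\<close> is uniform in \<open>n\<close>.\<close>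

definition hoelder_tight :: "real \<Rightarrow> real \<Rightarrow> 'a measure \<Rightarrow> (nat \<Rightarrow> 'a \<Rightarrow> unit_interval \<Rightarrow> (unit_interval \<Rightarrow>\<^sub>C real)) \<Rightarrow> bool" where
  "hoelder_tight \<theta> \<gamma> M X \<longleftrightarrow> (\<forall>\<eta>>0. \<exists>R\<ge>0. \<forall>n. \<exists>A\<in>sets M. measure M A \<le> \<eta> \<and>
     (\<forall>\<omega>\<in>space M - A. X n \<omega> \<in> hoelder_box \<theta> \<gamma> R))"

lemma hoelder_box_mono:
  assumes "R \<le> R'" shows "hoelder_box \<theta> \<gamma> R \<subseteq> hoelder_box \<theta> \<gamma> R'"
proof -
  have "R * u powr \<alpha> \<le> R' * u powr \<alpha>" for u \<alpha> :: real
    using assms by (simp add: mult_right_mono)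
  thus ?thesis
    unfolding hoelder_box_def box_functions_def using order_trans by blast
qed

text \<open>On the box the functional is replaced by a trigonometric polynomial with error
  \<open>2 * \<eta>\<close>. Off the box both are bounded in terms of \<open>B\<close>, and the
  probability is at most \<eta>. The replacement is uniform in \<open>n\<close> and also made for
  the limit, which leaves the convergence of trigonometric expectations.\<close>

theorem converges_in_distribution_hoelder:
  fixes X :: "nat \<Rightarrow> 'a \<Rightarrow> unit_interval \<Rightarrow> (unit_interval \<Rightarrow>\<^sub>C real)"
  assumes M: "prob_space M" "prob_space M'" and \<beta>: "0 \<le> \<beta>" "\<beta> < \<theta>" "\<beta> < 1" and \<gamma>: "\<gamma> > 0"
    and X: "\<And>n \<omega>. \<omega> \<in> space M \<Longrightarrow> X n \<omega> \<in> hoelder_space \<beta>"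
    and Xm: "\<And>n x s. (\<lambda>\<omega>. apply_bcontfun (X n \<omega> x) s) \<in> borel_measurable M"
    and Y: "Y \<in> measurable M' (borel_of_metric (hoelder_metric \<beta>))"
    and Ym: "\<And>x s. (\<lambda>\<omega>. apply_bcontfun (Y \<omega> x) s) \<in> borel_measurable M'"
    and tX: "hoelder_tight \<theta> \<gamma> M X" and tY: "hoelder_tight \<theta> \<gamma> M' (\<lambda>_. Y)"
    and lim: "\<And>xs. (\<lambda>n. integral\<^sup>L M (\<lambda>\<omega>. cis (lincomb xs (eval (X n \<omega>))))) \<longlonglongrightarrow> integral\<^sup>L M' (\<lambda>\<omega>. cis (lincomb xs (eval (Y \<omega>))))"
  shows "converges_in_distribution (hoelder_metric \<beta>) M X M' Y"
  unfolding converges_in_distribution_def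
proof (intro conjI allI impI)
  interpret M: prob_space M by fact
  interpret M': prob_space M' by fact
  have Xmeas: "X n \<in> measurable M (borel_of_metric (hoelder_metric \<beta>))" for n
    by (rule measurable_hoelder[OF X \<beta>(1,3) Xm])
  show "X n \<in> measurable M (borel_of_metric (hoelder_metric \<beta>))" for n by (rule Xmeas)
  show "Y \<in> measurable M' (borel_of_metric (hoelder_metric \<beta>))" by (rule Y)
  fix \<Phi> :: "(unit_interval \<Rightarrow> (unit_interval \<Rightarrow>\<^sub>C real)) \<Rightarrow> real"
  assume \<Phi>: "continuous_map (mtopology_of (hoelder_metric \<beta>)) euclideanreal \<Phi>"
    and "\<exists>B. \<forall>z\<in>mspace (hoelder_metric \<beta>). \<bar>\<Phi> z\<bar> \<le> B"
  then obtain B where "\<And>z. z \<in> hoelder_space \<beta> \<Longrightarrow> \<bar>\<Phi> z\<bar> \<le> B" by auto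
  hence B: "\<And>z. z \<in> hoelder_space \<beta> \<Longrightarrow> \<bar>\<Phi> z\<bar> \<le> \<bar>B\<bar>" by (meson abs_ge_self order_trans)
  note \<Phi>m = measurable_compose[OF _ borel_measurable_continuous_map[OF \<Phi>]]
  have evX: "(\<lambda>\<omega>. eval (X n \<omega>) t) \<in> borel_measurable M" for n t using Xm by (cases t) (simp add: eval_def)
  have evY: "(\<lambda>\<omega>. eval (Y \<omega>) t) \<in> borel_measurable M'" for t using Ym by (cases t) (simp add: eval_def)
  have Ysp: "Y \<omega> \<in> hoelder_space \<beta>" if "\<omega> \<in> space M'" for \<omega> using measurable_space[OF Y that] by simp
  show "(\<lambda>n. \<integral>\<omega>. \<Phi> (X n \<omega>) \<partial>M) \<longlonglongrightarrow> (\<integral>\<omega>. \<Phi> (Y \<omega>) \<partial>M')"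
  proof (rule LIMSEQ_I)
    fix e :: real assume e: "e > 0"
    \<comment> \<open>Each replacement costs at most
      \<open>(4 + 2 * \<bar>B\<bar>) * \<eta>\<close>, which this choice keeps below
      \<open>e / 8\<close>. The cap at \<open>1\<close> serves to bound
      \<open>2 * \<bar>B\<bar> + 2 * \<eta>\<close> by \<open>2 * \<bar>B\<bar> + 2\<close>.\<close>
    define \<eta> where "\<eta> = min 1 (e / (32 * (\<bar>B\<bar> + 1)))"
    have \<eta>: "\<eta> > 0" "\<eta> \<le> 1" using e by (auto simp: \<eta>_def)
    have \<eta>e: "(8 + 4 * \<bar>B\<bar>) * \<eta> \<le> e / 4"
    proof -
      have "(8 + 4 * \<bar>B\<bar>) * \<eta> \<le> (8 * (\<bar>B\<bar> + 1)) * (e / (32 * (\<bar>B\<bar> + 1)))"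
        using e by (intro mult_mono) (auto simp: \<eta>_def)
      also have "\<dots> = e / 4" by (simp add: field_simps add_nonneg_eq_0_iff)
      finally show ?thesis .
    qed
    obtain R1 where R1: "R1 \<ge> 0" "\<And>n. \<exists>A\<in>sets M. measure M A \<le> \<eta> \<and> (\<forall>\<omega>\<in>space M - A. X n \<omega> \<in> hoelder_box \<theta> \<gamma> R1)"
      using tX \<eta>(1) unfolding hoelder_tight_def by blast
    obtain R2 where R2: "R2 \<ge> 0" "\<exists>A\<in>sets M'. measure M' A \<le> \<eta> \<and> (\<forall>\<omega>\<in>space M' - A. Y \<omega> \<in> hoelder_box \<theta> \<gamma> R2)"
      using tY \<eta>(1) unfolding hoelder_tight_def by blast
    define R where "R = max R1 R2"
    have R: "R \<ge> 0" "R1 \<le> R" "R2 \<le> R" using R1 by (auto simp: R_def)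
    let ?K = "box_functions \<theta> \<gamma> R"
    have emb: "embed g \<in> hoelder_box \<theta> \<gamma> R" if "g \<in> ?K" for g
      using that eval_embed[OF that R(1) \<gamma>] by (simp add: hoelder_box_def)
    have boxsp: "hoelder_box \<theta> \<gamma> R \<subseteq> hoelder_space \<beta>" by (rule hoelder_box_subset[OF \<beta>(1,2) R(1)])
    \<comment> \<open>Continuity for the product topology: by \<open>hoelder_box_close\<close>,
      closeness at finitely many points already gives closeness in the \<beta>-norm, for which
      \<Phi> is continuous.\<close>
    have cont: "continuous_on ?K (\<lambda>g. \<Phi> (embed g))"
      unfolding continuous_on_topological
    proof (intro ballI allI impI)
      fix g and V :: "real set" assume g: "g \<in> ?K" and V: "open V" "\<Phi> (embed g) \<in> V"
      define U where "U = {z \<in> topspace (mtopology_of (hoelder_metric \<beta>)). \<Phi> z \<in> V}"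
      have "openin (mtopology_of (hoelder_metric \<beta>)) U"
        unfolding U_def using \<Phi> V by (intro openin_continuous_map_preimage) auto
      moreover have "embed g \<in> U" using emb[OF g] boxsp V by (auto simp: U_def)
      ultimately have "\<exists>r>0. \<forall>y\<in>mspace (hoelder_metric \<beta>). mdist (hoelder_metric \<beta>) (embed g) y < r \<longrightarrow> y \<in> U"
        unfolding openin_mtopology_of by blast
      then obtain r where r: "r > 0" "\<And>f. f \<in> hoelder_space \<beta> \<Longrightarrow> hoelder_norm \<beta> (\<lambda>x. embed g x - f x) < r \<Longrightarrow> \<Phi> f \<in> V"
        by (auto simp: U_def)
      obtain F d where F: "finite F" "d > 0" 
        "\<forall>f\<in>hoelder_box \<theta> \<gamma> R. \<forall>h\<in>hoelder_box \<theta> \<gamma> R.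
          (\<forall>p\<in>F. \<bar>eval f p - eval h p\<bar> < d) \<longrightarrow> hoelder_norm \<beta> (\<lambda>x. f x - h x) < r"
        using hoelder_box_close[OF \<beta>(1,2) \<gamma> R(1) r(1)] by blast
      define T where "T = (\<Inter>p\<in>F. (\<lambda>g'. g' p) -` {g p - d <..< g p + d})"
      have "open T" unfolding T_def
        using F by (intro open_INT ballI open_vimage continuous_on_product_coordinates) auto
      moreover have "g \<in> T" using F by (simp add: T_def)
      moreover have "\<Phi> (embed g') \<in> V" if "g' \<in> ?K" "g' \<in> T" for g'
      proof (rule r(2))
        show "embed g' \<in> hoelder_space \<beta>" using emb[OF that(1)] boxsp by blast
        show "hoelder_norm \<beta> (\<lambda>x. embed g x - embed g' x) < r"
          by (rule F(3)[rule_format, OF emb[OF g] emb[OF that(1)]])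
            (use that in \<open>auto simp: eval_embed[OF g R(1) \<gamma>] eval_embed[OF that(1) R(1) \<gamma>] T_def abs_less_iff\<close>)
      qed
      ultimately show "\<exists>A. open A \<and> g \<in> A \<and> (\<forall>y\<in>?K. y \<in> A \<longrightarrow> \<Phi> (embed y) \<in> V)" by blast
    qed
    have "(\<lambda>_. 0) \<in> ?K" using R by (simp add: box_functions_def)
    hence Kne: "?K \<noteq> {}" by blast
    have comp: "compact ?K" by (rule compact_box_functions) (use R \<beta> in auto)
    have KB: "\<bar>\<Phi> (embed g)\<bar> \<le> \<bar>B\<bar>" if "g \<in> ?K" for g using B emb[OF that] boxsp by blast
    obtain P where P: "P \<in> trig_polys" "\<And>g. g \<in> ?K \<Longrightarrow> \<bar>P g - \<Phi> (embed g)\<bar> \<le> 2 * \<eta>" "\<And>g. \<bar>P g\<bar> \<le> \<bar>B\<bar> + 2 * \<eta>"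
      using trig_approximation[OF comp Kne cont KB \<eta>(1)] by blast
    have close: "\<bar>(\<integral>\<omega>. \<Phi> (Z \<omega>) \<partial>L) - (\<integral>\<omega>. P (eval (Z \<omega>)) \<partial>L)\<bar> \<le> e / 8"
      if L: "prob_space L" and Z: "Z \<in> measurable L (borel_of_metric (hoelder_metric \<beta>))"
        and Zev: "\<And>t. (\<lambda>\<omega>. eval (Z \<omega>) t) \<in> borel_measurable L"
        and A: "A \<in> sets L" "measure L A \<le> \<eta>" "\<And>\<omega>. \<omega> \<in> space L - A \<Longrightarrow> Z \<omega> \<in> hoelder_box \<theta> \<gamma> R"
      for L :: "'c measure" and Z A
    proof -
      interpret L: prob_space L by fact
      have Zsp: "Z \<omega> \<in> hoelder_space \<beta>" if "\<omega> \<in> space L" for \<omega> using measurable_space[OF Z that] by simp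
      have i1: "integrable L (\<lambda>\<omega>. \<Phi> (Z \<omega>))"
        by (rule L.integrable_const_bound[of _ "\<bar>B\<bar>"]) (use B Zsp \<Phi>m[OF Z] in auto)
      have i2: "integrable L (\<lambda>\<omega>. P (eval (Z \<omega>)))" by (rule trig_integrable[OF L P(1) Zev])
      have bd: "norm (\<Phi> (Z \<omega>) - P (eval (Z \<omega>))) \<le> 2 * \<eta> + (2 * \<bar>B\<bar> + 2) * indicator A \<omega>" if w: "\<omega> \<in> space L" for \<omega>
      proof (cases "\<omega> \<in> A")
        case True
        have "\<bar>\<Phi> (Z \<omega>) - P (eval (Z \<omega>))\<bar> \<le> \<bar>B\<bar> + (\<bar>B\<bar> + 2 * \<eta>)"
          by (intro order_trans[OF abs_triangle_ineq4] add_mono B Zsp w P(3))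
        thus ?thesis using True \<eta> by simp
      next
        case False
        hence "eval (Z \<omega>) \<in> ?K" using A(3)[of \<omega>] w by (simp add: hoelder_box_def)
        from P(2)[OF this] show ?thesis using False by (simp add: embed_eval abs_minus_commute)
      qed
      have "integrable L (indicat_real A)"
        using A(1) by (intro integrable_real_indicator) (auto simp: L.emeasure_finite less_top[symmetric])
      hence iA: "integrable L (\<lambda>\<omega>. 2 * \<eta> + (2 * \<bar>B\<bar> + 2) * indicator A \<omega>)"
        by (intro Bochner_Integration.integrable_add integrable_mult_right L.integrable_const)
      have "\<bar>(\<integral>\<omega>. \<Phi> (Z \<omega>) \<partial>L) - (\<integral>\<omega>. P (eval (Z \<omega>)) \<partial>L)\<bar> = norm (\<integral>\<omega>. \<Phi> (Z \<omega>) - P (eval (Z \<omega>)) \<partial>L)"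
        using i1 i2 by simp
      also have "\<dots> \<le> (\<integral>\<omega>. 2 * \<eta> + (2 * \<bar>B\<bar> + 2) * indicator A \<omega> \<partial>L)"
        by (rule order_trans[OF integral_norm_bound integral_mono]) (use i1 i2 iA bd in auto)
      also have "\<dots> = 2 * \<eta> + (2 * \<bar>B\<bar> + 2) * measure L A"
        using A(1) \<open>integrable L (indicat_real A)\<close>
        by (subst Bochner_Integration.integral_add) (auto simp: L.prob_space intro!: integrable_mult_right)
      also have "\<dots> \<le> 2 * \<eta> + (2 * \<bar>B\<bar> + 2) * \<eta>" using A(2) by (intro add_left_mono mult_left_mono) auto
      also have "\<dots> = (8 + 4 * \<bar>B\<bar>) * \<eta> / 2" by (simp add: algebra_simps)
      also have "\<dots> \<le> e / 8" using \<eta>e by linarith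
      finally show ?thesis .
    qed
    have boxR: "hoelder_box \<theta> \<gamma> R1 \<subseteq> hoelder_box \<theta> \<gamma> R" "hoelder_box \<theta> \<gamma> R2 \<subseteq> hoelder_box \<theta> \<gamma> R"
      by (intro hoelder_box_mono R)+
    have cX: "\<bar>(\<integral>\<omega>. \<Phi> (X n \<omega>) \<partial>M) - (\<integral>\<omega>. P (eval (X n \<omega>)) \<partial>M)\<bar> \<le> e / 8" for n
    proof -
      obtain A where A: "A \<in> sets M" "measure M A \<le> \<eta>" "\<forall>\<omega>\<in>space M - A. X n \<omega> \<in> hoelder_box \<theta> \<gamma> R1"
        using R1(2)[of n] by blast
      show ?thesis by (rule close[OF M(1) Xmeas evX A(1,2)]) (use A(3) boxR in blast)
    qed
    have cY: "\<bar>(\<integral>\<omega>. \<Phi> (Y \<omega>) \<partial>M') - (\<integral>\<omega>. P (eval (Y \<omega>)) \<partial>M')\<bar> \<le> e / 8"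
    proof -
      obtain A where A: "A \<in> sets M'" "measure M' A \<le> \<eta>" "\<forall>\<omega>\<in>space M' - A. Y \<omega> \<in> hoelder_box \<theta> \<gamma> R2"
        using R2(2) by blast
      show ?thesis by (rule close[OF M(2) Y evY A(1,2)]) (use A(3) boxR in blast)
    qed
    have "(\<lambda>n. \<integral>\<omega>. P (eval (X n \<omega>)) \<partial>M) \<longlonglongrightarrow> (\<integral>\<omega>. P (eval (Y \<omega>)) \<partial>M')"
      by (rule trig_expectation_tendsto[OF M P(1) evX evY lim])
    then obtain n0 where n0: "\<And>n. n \<ge> n0 \<Longrightarrow> \<bar>(\<integral>\<omega>. P (eval (X n \<omega>)) \<partial>M) - (\<integral>\<omega>. P (eval (Y \<omega>)) \<partial>M')\<bar> < e / 8"
    proof -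
      assume *: "\<And>n0. (\<And>n. n \<ge> n0 \<Longrightarrow> \<bar>(\<integral>\<omega>. P (eval (X n \<omega>)) \<partial>M) - (\<integral>\<omega>. P (eval (Y \<omega>)) \<partial>M')\<bar> < e / 8) \<Longrightarrow> thesis"
        and lim': "(\<lambda>n. \<integral>\<omega>. P (eval (X n \<omega>)) \<partial>M) \<longlonglongrightarrow> (\<integral>\<omega>. P (eval (Y \<omega>)) \<partial>M')"
      have "\<exists>n0. \<forall>n\<ge>n0. norm ((\<integral>\<omega>. P (eval (X n \<omega>)) \<partial>M) - (\<integral>\<omega>. P (eval (Y \<omega>)) \<partial>M')) < e / 8"
        by (rule LIMSEQ_D[OF lim']) (use e in simp)
      thus thesis using * unfolding real_norm_def by blast
    qed
    show "\<exists>no. \<forall>n\<ge>no. norm ((\<integral>\<omega>. \<Phi> (X n \<omega>) \<partial>M) - (\<integral>\<omega>. \<Phi> (Y \<omega>) \<partial>M')) < e"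
    proof (intro exI[of _ n0] allI impI)
      fix n assume "n0 \<le> n"
      have tri: "norm (x - y) < e" if "\<bar>x - px\<bar> \<le> e / 8" "\<bar>y - py\<bar> \<le> e / 8" "\<bar>px - py\<bar> < e / 8" for x y px py :: real
        using that e unfolding real_norm_def by linarith
      show "norm ((\<integral>\<omega>. \<Phi> (X n \<omega>) \<partial>M) - (\<integral>\<omega>. \<Phi> (Y \<omega>) \<partial>M')) < e"
        by (rule tri[OF cX[of n] cY n0[OF \<open>n0 \<le> n\<close>]])
    qed
  qed
qed

section \<open>Tightness from moments of increments\<close>

lemma (in prob_space) prob_finite_union_le:
  fixes p :: real
  assumes "finite I" "\<And>i. i \<in> I \<Longrightarrow> A i \<in> sets M" "\<And>i. i \<in> I \<Longrightarrow> prob (A i) \<le> p"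
  shows "prob (\<Union>i\<in>I. A i) \<le> card I * p"
proof -
  have "prob (\<Union>i\<in>I. A i) \<le> (\<Sum>i\<in>I. prob (A i))"
    using assms(1,2) by (intro finite_measure_subadditive_finite) auto
  also have "\<dots> \<le> (\<Sum>i\<in>I. p)" by (intro sum_mono assms(3))
  finally show ?thesis by simp
qed

lemma (in prob_space) prob_geometric_union_le:
  assumes A: "\<And>i::nat. A i \<in> sets M" and le: "\<And>i. prob (A i) \<le> c * \<rho> ^ i" and \<rho>: "0 \<le> \<rho>" "\<rho> < 1"
  shows "prob (\<Union>i. A i) \<le> c / (1 - \<rho>)"
proof -
  have s: "summable (\<lambda>i. c * \<rho> ^ i)" using \<rho> by (intro summable_mult summable_geometric) auto
  have s': "summable (\<lambda>i. prob (A i))"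
    by (rule summable_comparison_test'[OF s, of 0]) (use le in auto)
  have "prob (\<Union>i. A i) \<le> (\<Sum>i. prob (A i))"
    using A s' by (intro finite_measure_subadditive_countably) auto
  also have "\<dots> \<le> (\<Sum>i. c * \<rho> ^ i)" by (rule suminf_le[OF le s' s])
  also have "\<dots> = c / (1 - \<rho>)" using \<rho> by (simp add: suminf_mult suminf_geometric summable_geometric)
  finally show ?thesis .
qed

lemma (in prob_space) markov_even_power:
  fixes V :: "'a \<Rightarrow> real"
  assumes V [measurable]: "V \<in> borel_measurable M" and i: "integrable M (\<lambda>\<omega>. V \<omega> ^ q)" and q: "even q" "q > 0"
    and E: "expectation (\<lambda>\<omega>. V \<omega> ^ q) \<le> c" and t: "t > 0"
  shows "{\<omega> \<in> space M. t < \<bar>V \<omega>\<bar>} \<in> sets M" "prob {\<omega> \<in> space M. t < \<bar>V \<omega>\<bar>} \<le> c / t ^ q"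
proof -
  show "{\<omega> \<in> space M. t < \<bar>V \<omega>\<bar>} \<in> sets M" by measurable
  have "prob {\<omega> \<in> space M. t < \<bar>V \<omega>\<bar>} \<le> prob {\<omega> \<in> space M. t ^ q \<le> V \<omega> ^ q}"
  proof (rule finite_measure_mono)
    show "{\<omega> \<in> space M. t < \<bar>V \<omega>\<bar>} \<subseteq> {\<omega> \<in> space M. t ^ q \<le> V \<omega> ^ q}"
    proof safe
      fix \<omega> assume "t < \<bar>V \<omega>\<bar>"
      hence "t ^ q \<le> \<bar>V \<omega>\<bar> ^ q" using t by (intro power_mono) auto
      thus "t ^ q \<le> V \<omega> ^ q" using q by (simp add: power_even_abs)
    qed
  qed measurable
  also have "\<dots> \<le> expectation (\<lambda>\<omega>. V \<omega> ^ q) / t ^ q"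
    by (rule integral_Markov_inequality_measure[OF i, of "space M", simplified]) (use t q in \<open>auto simp: zero_le_even_power\<close>)
  also have "\<dots> \<le> c / t ^ q" using E t by (simp add: divide_right_mono)
  finally show "prob {\<omega> \<in> space M. t < \<bar>V \<omega>\<bar>} \<le> c / t ^ q" .
qed

definition rect_incr :: "(real \<Rightarrow> real \<Rightarrow> real) \<Rightarrow> nat \<Rightarrow> nat \<Rightarrow> nat \<Rightarrow> nat \<Rightarrow> real" where
  "rect_incr g m i n j = (g (real (Suc i) / 2 ^ m) (real (Suc j) / 2 ^ n) - g (real i / 2 ^ m) (real (Suc j) / 2 ^ n))
          - (g (real (Suc i) / 2 ^ m) (real j / 2 ^ n) - g (real i / 2 ^ m) (real j / 2 ^ n))"

definition edge_incr :: "(real \<Rightarrow> real \<Rightarrow> real) \<Rightarrow> nat \<Rightarrow> nat \<Rightarrow> real" where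
  "edge_incr g m i = g (real (Suc i) / 2 ^ m) 0 - g (real i / 2 ^ m) 0"

text \<open>The quotient in Markov's inequality at level \<open>m\<close>, written as one geometric
  rate; used with \<alpha> = 1/2 in time and \<alpha> = r in space.\<close>

lemma level_bound:
  fixes q :: nat and C R \<alpha> \<theta> :: real
  assumes "R > 0"
  shows "(C * (2 powr - (real q * \<alpha>)) ^ m) / (R * (2 powr - \<theta>) ^ m) ^ q = C / R ^ q * (2 powr (real q * (\<theta> - \<alpha>))) ^ m"
proof -
  have Yq: "(2 powr - \<theta>) ^ q = 2 powr - (real q * \<theta>)"
    by (subst powr_realpow[symmetric]) (auto simp: powr_powr mult.commute)
  have "((2 powr - \<theta>) ^ m) ^ q = ((2 powr - \<theta>) ^ q) ^ m"
    by (simp only: power_mult[symmetric] mult.commute)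
  hence den: "(R * (2 powr - \<theta>) ^ m) ^ q = R ^ q * (2 powr - (real q * \<theta>)) ^ m"
    by (simp only: power_mult_distrib Yq)
  have "2 powr (real q * (\<theta> - \<alpha>)) = 2 powr (- (real q * \<alpha>) - - (real q * \<theta>))"
    by (simp add: right_diff_distrib)
  also have "\<dots> = 2 powr - (real q * \<alpha>) / 2 powr - (real q * \<theta>)" by (rule powr_diff)
  finally have rat: "2 powr (real q * (\<theta> - \<alpha>)) = 2 powr - (real q * \<alpha>) / 2 powr - (real q * \<theta>)" .
  show ?thesis unfolding den rat power_divide by simp
qed

text \<open>Markov's inequality for each increment, and a union over the \<open>2 ^ m\<close>
  intervals or \<open>2 ^ m * 2 ^ n\<close> rectangles of a level. The rates \<open>u\<close> and
  \<open>v\<close> include these counts, and the hypotheses on \<theta> and \<gamma> say precisely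
  that \<open>u < 1\<close> and \<open>v < 1\<close>. The constant adds a simple and a double
  geometric series.\<close>

lemma (in prob_space) dyadic_increments_event:
  fixes Z :: "'a \<Rightarrow> real \<Rightarrow> real \<Rightarrow> real" and q :: nat
  assumes q: "even q" "q > 0" and \<theta>: "real q * \<theta> < real q / 2 - 1" and \<gamma>: "real q * \<gamma> < real q * r - 1" and R: "R > 0"
    and Zm: "\<And>x s. x \<in> dyadics \<Longrightarrow> s \<in> dyadics \<Longrightarrow> (\<lambda>\<omega>. Z \<omega> x s) \<in> borel_measurable M"
    and edge: "\<And>m i. i < 2 ^ m \<Longrightarrow> integrable M (\<lambda>\<omega>. edge_incr (Z \<omega>) m i ^ q) \<and>
      expectation (\<lambda>\<omega>. edge_incr (Z \<omega>) m i ^ q) \<le> C * (2 powr - (real q * (1/2))) ^ m"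
    and rect: "\<And>m i n j. i < 2 ^ m \<Longrightarrow> j < 2 ^ n \<Longrightarrow> integrable M (\<lambda>\<omega>. rect_incr (Z \<omega>) m i n j ^ q) \<and>
      expectation (\<lambda>\<omega>. rect_incr (Z \<omega>) m i n j ^ q) \<le> C * (2 powr - (real q * (1/2))) ^ m * (2 powr - (real q * r)) ^ n"
  defines "u \<equiv> 2 * 2 powr (real q * (\<theta> - 1/2))" and "v \<equiv> 2 * 2 powr (real q * (\<gamma> - r))"
  shows "\<exists>A\<in>sets M. prob A \<le> (1 / (1 - u) + 1 / (1 - v) / (1 - u)) * C / R ^ q \<and>
    (\<forall>\<omega>\<in>space M - A. (\<forall>m. \<forall>i<2 ^ m. \<bar>edge_incr (Z \<omega>) m i\<bar> \<le> R * (2 powr - \<theta>) ^ m) \<and>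
      (\<forall>m n. \<forall>i<2 ^ m. \<forall>j<2 ^ n. \<bar>rect_incr (Z \<omega>) m i n j\<bar> \<le> R * (2 powr - \<theta>) ^ m * (2 powr - \<gamma>) ^ n))"
proof -
  have u: "0 < u" "u < 1"
  proof -
    have "real q * (\<theta> - 1/2) = real q * \<theta> - real q / 2" by (simp add: right_diff_distrib)
    hence neg: "1 + real q * (\<theta> - 1/2) < 0" using \<theta> by linarith
    have "u = 2 powr (1 + real q * (\<theta> - 1/2))" unfolding u_def powr_add by simp
    also have "\<dots> < 2 powr 0" by (rule powr_less_mono[OF neg]) simp
    finally show "u < 1" by simp
  qed (simp add: u_def)
  have v: "0 < v" "v < 1"
  proof -
    have "real q * (\<gamma> - r) = real q * \<gamma> - real q * r" by (rule right_diff_distrib)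
    hence neg: "1 + real q * (\<gamma> - r) < 0" using \<gamma> by linarith
    have "v = 2 powr (1 + real q * (\<gamma> - r))" unfolding v_def powr_add by simp
    also have "\<dots> < 2 powr 0" by (rule powr_less_mono[OF neg]) simp
    finally show "v < 1" by simp
  qed (simp add: v_def)
  have em: "(\<lambda>\<omega>. edge_incr (Z \<omega>) m i) \<in> borel_measurable M" if "i < 2 ^ m" for m i
    unfolding edge_incr_def using that by (intro borel_measurable_diff Zm dyadics_I) auto
  have rm: "(\<lambda>\<omega>. rect_incr (Z \<omega>) m i n j) \<in> borel_measurable M" if "i < 2 ^ m" "j < 2 ^ n" for m i n j
    unfolding rect_incr_def using that by (intro borel_measurable_diff Zm dyadics_I) auto
  define Ae where "Ae m = (\<Union>i\<in>{..<2 ^ m}. {\<omega> \<in> space M. R * (2 powr - \<theta>) ^ m < \<bar>edge_incr (Z \<omega>) m i\<bar>})" for m :: nat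
  define Ar where "Ar m n = (\<Union>p\<in>{..<2 ^ m} \<times> {..<2 ^ n}. {\<omega> \<in> space M. R * (2 powr - \<theta>) ^ m * (2 powr - \<gamma>) ^ n < \<bar>rect_incr (Z \<omega>) m (fst p) n (snd p)\<bar>})" for m n :: nat
  have Ae: "Ae m \<in> sets M \<and> prob (Ae m) \<le> C / R ^ q * u ^ m" for m
  proof -
    have 1: "{\<omega> \<in> space M. R * (2 powr - \<theta>) ^ m < \<bar>edge_incr (Z \<omega>) m i\<bar>} \<in> sets M \<and>
      prob {\<omega> \<in> space M. R * (2 powr - \<theta>) ^ m < \<bar>edge_incr (Z \<omega>) m i\<bar>} \<le> C / R ^ q * (2 powr (real q * (\<theta> - 1/2))) ^ m"
      if "i < 2 ^ m" for i
    proof -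
      have e: "integrable M (\<lambda>\<omega>. edge_incr (Z \<omega>) m i ^ q)"
        "expectation (\<lambda>\<omega>. edge_incr (Z \<omega>) m i ^ q) \<le> C * (2 powr - (real q * (1/2))) ^ m"
        using edge[OF that] by blast+
      have t: "R * (2 powr - \<theta>) ^ m > 0" using R by simp
      from markov_even_power[OF em[OF that] e(1) q e(2) t] show ?thesis
        unfolding level_bound[OF R] by (rule conjI)
    qed
    have "prob (Ae m) \<le> card {..<(2::nat) ^ m} * (C / R ^ q * (2 powr (real q * (\<theta> - 1/2))) ^ m)"
      unfolding Ae_def
    proof (rule prob_finite_union_le)
      fix i assume "i \<in> {..<(2::nat) ^ m}"
      hence i: "i < 2 ^ m" by simp
      from 1[OF i] show "{\<omega> \<in> space M. R * (2 powr - \<theta>) ^ m < \<bar>edge_incr (Z \<omega>) m i\<bar>} \<in> sets M"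
        "prob {\<omega> \<in> space M. R * (2 powr - \<theta>) ^ m < \<bar>edge_incr (Z \<omega>) m i\<bar>} \<le> C / R ^ q * (2 powr (real q * (\<theta> - 1/2))) ^ m"
        by blast+
    qed simp
    also have "real (card {..<(2::nat) ^ m}) = 2 ^ m" by simp
    also have "2 ^ m * (C / R ^ q * (2 powr (real q * (\<theta> - 1/2))) ^ m) = C / R ^ q * u ^ m"
      unfolding u_def power_mult_distrib by (rule mult.left_commute)
    finally have "prob (Ae m) \<le> C / R ^ q * u ^ m" .
    moreover have "Ae m \<in> sets M" unfolding Ae_def
    proof (rule sets.finite_UN)
      fix i assume "i \<in> {..<(2::nat) ^ m}"
      hence i: "i < 2 ^ m" by simp
      from 1[OF i] show "{\<omega> \<in> space M. R * (2 powr - \<theta>) ^ m < \<bar>edge_incr (Z \<omega>) m i\<bar>} \<in> sets M" by blast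
    qed simp
    ultimately show ?thesis by blast
  qed
  have Ar: "Ar m n \<in> sets M \<and> prob (Ar m n) \<le> C / R ^ q * u ^ m * v ^ n" for m n
  proof -
    have eq: "(C * (2 powr - (real q * (1/2))) ^ m * (2 powr - (real q * r)) ^ n) / (R * (2 powr - \<theta>) ^ m * (2 powr - \<gamma>) ^ n) ^ q
      = C / R ^ q * (2 powr (real q * (\<theta> - 1/2))) ^ m * (2 powr (real q * (\<gamma> - r))) ^ n"
    proof -
      have "(C * (2 powr - (real q * (1/2))) ^ m * (2 powr - (real q * r)) ^ n) / (R * (2 powr - \<theta>) ^ m * (2 powr - \<gamma>) ^ n) ^ q
        = ((C * (2 powr - (real q * (1/2))) ^ m) / (R * (2 powr - \<theta>) ^ m) ^ q) * ((1 * (2 powr - (real q * r)) ^ n) / (1 * (2 powr - \<gamma>) ^ n) ^ q)"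
      proof -
        have "(c * x * y) / (z * w) ^ q = ((c * x) / z ^ q) * ((1 * y) / (1 * w) ^ q)" for c x y z w :: real
          by (simp add: power_mult_distrib)
        thus ?thesis .
      qed
      also have "\<dots> = (C / R ^ q * (2 powr (real q * (\<theta> - 1/2))) ^ m) * (1 / 1 ^ q * (2 powr (real q * (\<gamma> - r))) ^ n)"
        by (rule arg_cong2[where f = "(*)", OF level_bound[OF R] level_bound[OF zero_less_one]])
      finally show ?thesis by (simp only: power_one div_by_1 mult_1)
    qed
    have 1: "{\<omega> \<in> space M. R * (2 powr - \<theta>) ^ m * (2 powr - \<gamma>) ^ n < \<bar>rect_incr (Z \<omega>) m i n j\<bar>} \<in> sets M \<and>
      prob {\<omega> \<in> space M. R * (2 powr - \<theta>) ^ m * (2 powr - \<gamma>) ^ n < \<bar>rect_incr (Z \<omega>) m i n j\<bar>}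
        \<le> C / R ^ q * (2 powr (real q * (\<theta> - 1/2))) ^ m * (2 powr (real q * (\<gamma> - r))) ^ n"
      if "i < 2 ^ m" "j < 2 ^ n" for i j
    proof -
      have e: "integrable M (\<lambda>\<omega>. rect_incr (Z \<omega>) m i n j ^ q)"
        "expectation (\<lambda>\<omega>. rect_incr (Z \<omega>) m i n j ^ q) \<le> C * (2 powr - (real q * (1/2))) ^ m * (2 powr - (real q * r)) ^ n"
        using rect[OF that] by blast+
      have t: "R * (2 powr - \<theta>) ^ m * (2 powr - \<gamma>) ^ n > 0" using R by simp
      from markov_even_power[OF rm[OF that] e(1) q e(2) t] show ?thesis
        unfolding eq by (rule conjI)
    qed
    have "prob (Ar m n) \<le> card ({..<(2::nat) ^ m} \<times> {..<(2::nat) ^ n}) * (C / R ^ q * (2 powr (real q * (\<theta> - 1/2))) ^ m * (2 powr (real q * (\<gamma> - r))) ^ n)"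
      unfolding Ar_def
    proof (rule prob_finite_union_le)
      fix p assume "p \<in> {..<(2::nat) ^ m} \<times> {..<(2::nat) ^ n}"
      hence p: "fst p < 2 ^ m" "snd p < 2 ^ n" unfolding mem_Times_iff lessThan_iff by blast+
      from 1[OF p] show "{\<omega> \<in> space M. R * (2 powr - \<theta>) ^ m * (2 powr - \<gamma>) ^ n < \<bar>rect_incr (Z \<omega>) m (fst p) n (snd p)\<bar>} \<in> sets M"
        "prob {\<omega> \<in> space M. R * (2 powr - \<theta>) ^ m * (2 powr - \<gamma>) ^ n < \<bar>rect_incr (Z \<omega>) m (fst p) n (snd p)\<bar>}
          \<le> C / R ^ q * (2 powr (real q * (\<theta> - 1/2))) ^ m * (2 powr (real q * (\<gamma> - r))) ^ n" by blast+
    qed simp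
    also have "real (card ({..<(2::nat) ^ m} \<times> {..<(2::nat) ^ n})) = 2 ^ m * 2 ^ n" by (simp add: card_cartesian_product)
    also have "2 ^ m * 2 ^ n * (C / R ^ q * (2 powr (real q * (\<theta> - 1/2))) ^ m * (2 powr (real q * (\<gamma> - r))) ^ n) = C / R ^ q * u ^ m * v ^ n"
      unfolding u_def v_def power_mult_distrib by (simp only: mult_ac)
    finally have "prob (Ar m n) \<le> C / R ^ q * u ^ m * v ^ n" .
    moreover have "Ar m n \<in> sets M" unfolding Ar_def
    proof (rule sets.finite_UN)
      fix p assume "p \<in> {..<(2::nat) ^ m} \<times> {..<(2::nat) ^ n}"
      hence p: "fst p < 2 ^ m" "snd p < 2 ^ n" unfolding mem_Times_iff lessThan_iff by blast+
      from 1[OF p] show "{\<omega> \<in> space M. R * (2 powr - \<theta>) ^ m * (2 powr - \<gamma>) ^ n < \<bar>rect_incr (Z \<omega>) m (fst p) n (snd p)\<bar>} \<in> sets M" by blast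
    qed simp
    ultimately show ?thesis by blast
  qed
  define Br where "Br m = (\<Union>n. Ar m n)" for m
  have Br: "Br m \<in> sets M \<and> prob (Br m) \<le> (C / R ^ q / (1 - v)) * u ^ m" for m
  proof
    show "Br m \<in> sets M" unfolding Br_def using Ar by (intro sets.countable_UN) auto
    have "prob (Br m) \<le> C / R ^ q * u ^ m / (1 - v)"
      unfolding Br_def by (rule prob_geometric_union_le) (use Ar v in auto)
    thus "prob (Br m) \<le> (C / R ^ q / (1 - v)) * u ^ m" by simp
  qed
  have 1: "prob (\<Union>m. Ae m) \<le> C / R ^ q / (1 - u)"
    by (rule prob_geometric_union_le) (use Ae u in auto)
  have 2: "prob (\<Union>m. Br m) \<le> C / R ^ q / (1 - v) / (1 - u)"
    by (rule prob_geometric_union_le) (use Br u in auto)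
  show ?thesis
  proof (intro bexI[of _ "(\<Union>m. Ae m) \<union> (\<Union>m. Br m)"] conjI ballI)
    have "prob ((\<Union>m. Ae m) \<union> (\<Union>m. Br m)) \<le> prob (\<Union>m. Ae m) + prob (\<Union>m. Br m)"
      using Ae Br by (intro measure_Un_le) auto
    also have "\<dots> \<le> C / R ^ q / (1 - u) + C / R ^ q / (1 - v) / (1 - u)" by (intro add_mono 1 2)
    also have "\<dots> = (1 / (1 - u) + 1 / (1 - v) / (1 - u)) * C / R ^ q" 
    proof -
      have "c / x + c / y / x = (1 / x + 1 / y / x) * c" for c x y :: real by (simp add: distrib_right)
      from this[of "C / R ^ q" "1 - u" "1 - v"] show ?thesis by (simp only: times_divide_eq_right)
    qed
    finally show "prob ((\<Union>m. Ae m) \<union> (\<Union>m. Br m)) \<le> (1 / (1 - u) + 1 / (1 - v) / (1 - u)) * C / R ^ q" .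
    fix \<omega> assume w: "\<omega> \<in> space M - ((\<Union>m. Ae m) \<union> (\<Union>m. Br m))"
    show "\<forall>m. \<forall>i<2 ^ m. \<bar>edge_incr (Z \<omega>) m i\<bar> \<le> R * (2 powr - \<theta>) ^ m"
    proof (intro allI impI)
      fix m i :: nat assume i: "i < 2 ^ m"
      have "\<omega> \<notin> Ae m" using w by blast
      thus "\<bar>edge_incr (Z \<omega>) m i\<bar> \<le> R * (2 powr - \<theta>) ^ m" using w i unfolding Ae_def by (simp add: not_less)
    qed
    show "\<forall>m n. \<forall>i<2 ^ m. \<forall>j<2 ^ n. \<bar>rect_incr (Z \<omega>) m i n j\<bar> \<le> R * (2 powr - \<theta>) ^ m * (2 powr - \<gamma>) ^ n"
    proof (intro allI impI)
      fix m n i j :: nat assume ij: "i < 2 ^ m" "j < 2 ^ n"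
      have "\<omega> \<notin> Ar m n" using w unfolding Br_def by blast
      hence "\<forall>p\<in>{..<2 ^ m} \<times> {..<2 ^ n}. \<not> R * (2 powr - \<theta>) ^ m * (2 powr - \<gamma>) ^ n < \<bar>rect_incr (Z \<omega>) m (fst p) n (snd p)\<bar>"
        using w unfolding Ar_def by blast
      from bspec[OF this, of "(i, j)"] ij
      show "\<bar>rect_incr (Z \<omega>) m i n j\<bar> \<le> R * (2 powr - \<theta>) ^ m * (2 powr - \<gamma>) ^ n" by (simp add: not_less)
    qed
  qed (use Ae Br in auto)
qed

section \<open>From dyadic points to the whole square\<close>

definition dyadic_box :: "real \<Rightarrow> real \<Rightarrow> real \<Rightarrow> (real \<Rightarrow> real \<Rightarrow> real) set" where
  "dyadic_box \<theta> \<gamma> R = {g. (\<forall>s\<in>dyadics. g 0 s = 0) \<and>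
     (\<forall>x\<in>dyadics. \<forall>y\<in>dyadics. \<forall>s\<in>dyadics. \<bar>g x s - g y s\<bar> \<le> R * \<bar>x - y\<bar> powr \<theta>) \<and>
     (\<forall>x\<in>dyadics. \<forall>s\<in>dyadics. \<forall>t\<in>dyadics. \<bar>g x s - g x t\<bar> \<le> R * \<bar>s - t\<bar> powr \<gamma>)}"

lemma dyadic_box_chaining:
  assumes "\<theta> > 0" "\<gamma> > 0"
  shows "\<exists>C\<ge>0. \<forall>g R. R \<ge> 0 \<longrightarrow> (\<forall>s\<in>dyadics. g 0 s = 0) \<longrightarrow> (\<forall>m. \<forall>i<2 ^ m. \<bar>edge_incr g m i\<bar> \<le> R * (2 powr - \<theta>) ^ m) \<longrightarrow>
    (\<forall>m n. \<forall>i<2 ^ m. \<forall>j<2 ^ n. \<bar>rect_incr g m i n j\<bar> \<le> R * (2 powr - \<theta>) ^ m * (2 powr - \<gamma>) ^ n) \<longrightarrow>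
    g \<in> dyadic_box \<theta> \<gamma> (C * R)"
proof (rule dyadic_chaining2[OF assms])
  fix C :: real
  assume C: "C \<ge> 0" and ch: "\<And>g :: real \<Rightarrow> real \<Rightarrow> real. \<And>R x y s t. R \<ge> 0 \<Longrightarrow>
      (\<And>s. s \<in> dyadics \<Longrightarrow> g 0 s = 0) \<Longrightarrow>
      (\<And>m i. i < 2 ^ m \<Longrightarrow> \<bar>g (real (Suc i) / 2 ^ m) 0 - g (real i / 2 ^ m) 0\<bar> \<le> R * (2 powr - \<theta>) ^ m) \<Longrightarrow>
      (\<And>m i n j. i < 2 ^ m \<Longrightarrow> j < 2 ^ n \<Longrightarrow>
         \<bar>(g (real (Suc i) / 2 ^ m) (real (Suc j) / 2 ^ n) - g (real i / 2 ^ m) (real (Suc j) / 2 ^ n))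
          - (g (real (Suc i) / 2 ^ m) (real j / 2 ^ n) - g (real i / 2 ^ m) (real j / 2 ^ n))\<bar>
         \<le> R * (2 powr - \<theta>) ^ m * (2 powr - \<gamma>) ^ n) \<Longrightarrow>
      x \<in> dyadics \<Longrightarrow> y \<in> dyadics \<Longrightarrow> s \<in> dyadics \<Longrightarrow> t \<in> dyadics \<Longrightarrow>
      \<bar>g x s - g y s\<bar> \<le> C * R * \<bar>x - y\<bar> powr \<theta> \<and> \<bar>g x s - g x t\<bar> \<le> C * R * \<bar>s - t\<bar> powr \<gamma>"
  show ?thesis
  proof (intro exI[of _ C] conjI allI impI C)
    fix g :: "real \<Rightarrow> real \<Rightarrow> real" and R :: real
    assume R: "0 \<le> R" and g0: "\<forall>s\<in>dyadics. g 0 s = 0" and e: "\<forall>m. \<forall>i<2 ^ m. \<bar>edge_incr g m i\<bar> \<le> R * (2 powr - \<theta>) ^ m"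
      and rc: "\<forall>m n. \<forall>i<2 ^ m. \<forall>j<2 ^ n. \<bar>rect_incr g m i n j\<bar> \<le> R * (2 powr - \<theta>) ^ m * (2 powr - \<gamma>) ^ n"
    have "\<bar>g x s - g y s\<bar> \<le> C * R * \<bar>x - y\<bar> powr \<theta> \<and> \<bar>g x s - g x t\<bar> \<le> C * R * \<bar>s - t\<bar> powr \<gamma>"
      if "x \<in> dyadics" "y \<in> dyadics" "s \<in> dyadics" "t \<in> dyadics" for x y s t
      by (rule ch[OF R _ _ _ that]) (use g0 e rc in \<open>auto simp: edge_incr_def rect_incr_def\<close>)
    thus "g \<in> dyadic_box \<theta> \<gamma> (C * R)" using g0 unfolding dyadic_box_def by blast
  qed
qed

lemma dyadic_floor_ui: "dyadic_floor n (real_of_ui x) \<in> dyadics"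
  by (rule dyadic_floor_in_dyadics) auto

text \<open>The values of \<open>g\<close> off the dyadics are arbitrary; on them it is uniformly continuous.\<close>

lemma extend_dyadic_box:
  assumes g: "g \<in> dyadic_box \<theta> \<gamma> R" and \<theta>: "\<theta> > 0" and \<gamma>: "\<gamma> > 0" and R: "R \<ge> 0"
  shows "\<exists>f\<in>hoelder_box \<theta> \<gamma> R. \<forall>x s. (\<lambda>n. g (dyadic_floor n (real_of_ui x)) (dyadic_floor n (real_of_ui s))) \<longlonglongrightarrow> apply_bcontfun (f x) s"
proof -
  let ?d = "\<lambda>n x. dyadic_floor n (real_of_ui x)"
  let ?h = "\<lambda>n x s. g (?d n x) (?d n s)"
  have gx: "\<bar>g x s - g y s\<bar> \<le> R * \<bar>x - y\<bar> powr \<theta>" if "x \<in> dyadics" "y \<in> dyadics" "s \<in> dyadics" for x y s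
    using g that unfolding dyadic_box_def by blast
  have gs: "\<bar>g x s - g x t\<bar> \<le> R * \<bar>s - t\<bar> powr \<gamma>" if "x \<in> dyadics" "s \<in> dyadics" "t \<in> dyadics" for x s t
    using g that unfolding dyadic_box_def by blast
  have lim_d: "(\<lambda>n. ?d n x) \<longlonglongrightarrow> real_of_ui x" for x by (rule dyadic_floor_tendsto) simp
  have "Cauchy (\<lambda>n. ?h n x s)" for x s
  proof (rule metric_CauchyI)
    fix e :: real assume e: "e > 0"
    obtain \<eta>1 where \<eta>1: "\<eta>1 > 0" "\<And>u. 0 \<le> u \<Longrightarrow> u \<le> \<eta>1 \<Longrightarrow> R * u powr \<theta> \<le> e / 3"
      by (rule powr_small[of "e / 3" \<theta> R]) (use e \<theta> in auto)
    obtain \<eta>2 where \<eta>2: "\<eta>2 > 0" "\<And>u. 0 \<le> u \<Longrightarrow> u \<le> \<eta>2 \<Longrightarrow> R * u powr \<gamma> \<le> e / 3"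
      by (rule powr_small[of "e / 3" \<gamma> R]) (use e \<gamma> in auto)
    have "Cauchy (\<lambda>n. ?d n x)" "Cauchy (\<lambda>n. ?d n s)" using lim_d LIMSEQ_imp_Cauchy by blast+
    then obtain N1 N2 where N1: "\<And>m n. m \<ge> N1 \<Longrightarrow> n \<ge> N1 \<Longrightarrow> dist (?d m x) (?d n x) < \<eta>1"
      and N2: "\<And>m n. m \<ge> N2 \<Longrightarrow> n \<ge> N2 \<Longrightarrow> dist (?d m s) (?d n s) < \<eta>2"
      using \<eta>1(1) \<eta>2(1) unfolding Cauchy_def by meson
    show "\<exists>N. \<forall>m\<ge>N. \<forall>n\<ge>N. dist (?h m x s) (?h n x s) < e"
    proof (intro exI[of _ "max N1 N2"] allI impI)
      fix m n assume mn: "max N1 N2 \<le> m" "max N1 N2 \<le> n"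
      have "\<bar>g (?d m x) (?d m s) - g (?d n x) (?d m s)\<bar> \<le> e / 3"
        by (rule order_trans[OF gx \<eta>1(2)]) (use N1[of m n] mn in \<open>auto simp: dyadic_floor_ui dist_real_def\<close>)
      moreover have "\<bar>g (?d n x) (?d m s) - g (?d n x) (?d n s)\<bar> \<le> e / 3"
        by (rule order_trans[OF gs \<eta>2(2)]) (use N2[of m n] mn in \<open>auto simp: dyadic_floor_ui dist_real_def\<close>)
      ultimately show "dist (?h m x s) (?h n x s) < e" using e unfolding dist_real_def by linarith
    qed
  qed
  hence "\<forall>x s. \<exists>l. (\<lambda>n. ?h n x s) \<longlonglongrightarrow> l" by (simp add: Cauchy_convergent_iff convergent_def)
  then obtain F where F: "\<And>x s. (\<lambda>n. ?h n x s) \<longlonglongrightarrow> F x s" by metis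
  have F0: "F ui0 s = 0" for s
  proof -
    have "?h n ui0 s = 0" for n
      using g dyadic_floor_ui[of n s] by (simp add: dyadic_box_def dyadic_floor_def[of n 0])
    thus ?thesis using F[of ui0 s] by (simp add: LIMSEQ_const_iff)
  qed
  have lim_powr: "(\<lambda>n. R * \<bar>?d n x - ?d n y\<bar> powr \<alpha>) \<longlonglongrightarrow> R * \<bar>real_of_ui x - real_of_ui y\<bar> powr \<alpha>" if "\<alpha> > 0" for x y \<alpha>
    by (intro tendsto_mult tendsto_const tendsto_powr' tendsto_rabs tendsto_diff lim_d) (use that in auto)
  have Fx: "\<bar>F x s - F y s\<bar> \<le> R * \<bar>real_of_ui x - real_of_ui y\<bar> powr \<theta>" for x y s
  proof (rule LIMSEQ_le[OF _ lim_powr[OF \<theta>]])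
    show "(\<lambda>n. \<bar>?h n x s - ?h n y s\<bar>) \<longlonglongrightarrow> \<bar>F x s - F y s\<bar>" by (intro tendsto_intros F)
  qed (use gx dyadic_floor_ui in blast)
  have Fs: "\<bar>F x s - F x t\<bar> \<le> R * \<bar>real_of_ui s - real_of_ui t\<bar> powr \<gamma>" for x s t
  proof (rule LIMSEQ_le[OF _ lim_powr[OF \<gamma>]])
    show "(\<lambda>n. \<bar>?h n x s - ?h n x t\<bar>) \<longlonglongrightarrow> \<bar>F x s - F x t\<bar>" by (intro tendsto_intros F)
  qed (use gs dyadic_floor_ui in blast)
  have box: "(\<lambda>(x, s). F x s) \<in> box_functions \<theta> \<gamma> R"
    unfolding box_functions_def using F0 Fx Fs by simp
  have ev: "eval (embed (\<lambda>(x, s). F x s)) = (\<lambda>(x, s). F x s)" by (rule eval_embed[OF box R \<gamma>])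
  have "apply_bcontfun (embed (\<lambda>(x, s). F x s) x) s = F x s" for x s
    using fun_cong[OF ev, of "(x, s)"] by (simp add: eval_def)
  thus ?thesis
    using box F ev by (intro bexI[of _ "embed (\<lambda>(x, s). F x s)"]) (auto simp: hoelder_box_def)
qed

text \<open>The extension of the dyadic values lies in the box, and by continuity of
  \<open>f\<close> it is \<open>f\<close> itself.\<close>

lemma hoelder_box_of_dyadic:
  assumes f: "continuous_on UNIV f" and \<theta>: "\<theta> > 0" and \<gamma>: "\<gamma> > 0" and R: "R \<ge> 0"
    and box: "(\<lambda>x s. apply_bcontfun (f (ui_of_real x)) (ui_of_real s)) \<in> dyadic_box \<theta> \<gamma> R"
  shows "f \<in> hoelder_box \<theta> \<gamma> R"
proof -
  let ?g = "\<lambda>x s. apply_bcontfun (f (ui_of_real x)) (ui_of_real s)"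
  let ?d = "\<lambda>n x. ui_of_real (dyadic_floor n (real_of_ui x))"
  obtain f' where f': "f' \<in> hoelder_box \<theta> \<gamma> R"
    "\<And>x s. (\<lambda>n. ?g (dyadic_floor n (real_of_ui x)) (dyadic_floor n (real_of_ui s))) \<longlonglongrightarrow> apply_bcontfun (f' x) s"
    using extend_dyadic_box[OF box \<theta> \<gamma> R] by blast
  have lim_d: "(\<lambda>n. ?d n x) \<longlonglongrightarrow> x" for x
  proof (rule metric_LIMSEQ_I)
    fix e :: real assume "e > 0"
    then obtain N where N: "\<And>n. n \<ge> N \<Longrightarrow> dist (dyadic_floor n (real_of_ui x)) (real_of_ui x) < e"
      using metric_LIMSEQ_D[OF dyadic_floor_tendsto[OF real_of_ui_bounds(1)] \<open>e > 0\<close>] by blast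
    have "dist (?d n x) x = dist (dyadic_floor n (real_of_ui x)) (real_of_ui x)" for n
      using dyadics_unit[OF dyadic_floor_ui[of n x]] by (simp add: dist_unit_interval_def dist_real_def real_of_ui_of_real)
    thus "\<exists>no. \<forall>n\<ge>no. dist (?d n x) x < e" using N by (intro exI[of _ N]) simp
  qed
  have "(\<lambda>n. ?g (dyadic_floor n (real_of_ui x)) (dyadic_floor n (real_of_ui s))) \<longlonglongrightarrow> apply_bcontfun (f x) s" for x s
  proof -
    have lf: "(\<lambda>n. f (?d n x)) \<longlonglongrightarrow> f x"
      by (rule continuous_on_tendsto_compose[OF f lim_d]) auto
    have l0: "(\<lambda>n. apply_bcontfun (f (?d n x)) (?d n s) - apply_bcontfun (f x) (?d n s)) \<longlonglongrightarrow> 0"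
    proof (rule Lim_null_comparison)
      show "\<forall>\<^sub>F n in sequentially. norm (apply_bcontfun (f (?d n x)) (?d n s) - apply_bcontfun (f x) (?d n s)) \<le> norm (f (?d n x) - f x)"
      proof (intro always_eventually allI)
        fix n
        show "norm (apply_bcontfun (f (?d n x)) (?d n s) - apply_bcontfun (f x) (?d n s)) \<le> norm (f (?d n x) - f x)"
          using norm_bounded[of "f (?d n x) - f x" "?d n s"] by (simp only: minus_bcontfun.rep_eq)
      qed
      show "(\<lambda>n. norm (f (?d n x) - f x)) \<longlonglongrightarrow> 0"
        using tendsto_norm[OF tendsto_diff[OF lf tendsto_const[of "f x"]]] by simp
    qed
    have l1: "(\<lambda>n. apply_bcontfun (f x) (?d n s)) \<longlonglongrightarrow> apply_bcontfun (f x) s"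
      by (rule continuous_on_tendsto_compose[of UNIV "apply_bcontfun (f x)", OF _ lim_d]) auto
    from tendsto_add[OF l0 l1] show ?thesis by simp
  qed
  hence "apply_bcontfun (f x) s = apply_bcontfun (f' x) s" for x s by (rule LIMSEQ_unique[OF _ f'(2)])
  hence "f = f'" by (intro ext bcontfun_eqI)
  thus ?thesis using f'(1) by simp
qed

lemma continuous_map_eval:
  "continuous_map (mtopology_of (hoelder_metric \<beta>)) euclideanreal (\<lambda>f. eval f t)"
  unfolding continuous_map
proof (intro conjI allI impI)
  fix V :: "real set" assume V: "openin euclideanreal V"
  show "openin (mtopology_of (hoelder_metric \<beta>)) {f \<in> topspace (mtopology_of (hoelder_metric \<beta>)). eval f t \<in> V}"
    unfolding openin_mtopology_of
  proof (intro conjI ballI)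
    fix f assume f: "f \<in> {f \<in> topspace (mtopology_of (hoelder_metric \<beta>)). eval f t \<in> V}"
    have "open V" using V by simp
    then obtain e where e: "e > 0" "\<And>y. dist y (eval f t) < e \<Longrightarrow> y \<in> V"
      using f unfolding open_dist by blast
    show "\<exists>r>0. \<forall>y\<in>mspace (hoelder_metric \<beta>). mdist (hoelder_metric \<beta>) f y < r \<longrightarrow> y \<in> {f \<in> topspace (mtopology_of (hoelder_metric \<beta>)). eval f t \<in> V}"
    proof (intro exI[of _ e] conjI ballI impI e(1))
      fix h assume h: "h \<in> mspace (hoelder_metric \<beta>)" "mdist (hoelder_metric \<beta>) f h < e"
      have fh: "f \<in> hoelder_space \<beta>" "h \<in> hoelder_space \<beta>" using f h by simp_all
      have "hoelder_enorm \<beta> f + hoelder_enorm \<beta> h < \<infinity>" using fh by (simp add: hoelder_space_def)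
      hence fin: "hoelder_enorm \<beta> (\<lambda>x. f x - h x) < \<infinity>"
        by (rule le_less_trans[OF hoelder_enorm_diff_le])
      obtain x s where t: "t = (x, s)" by (cases t)
      have "\<bar>eval f t - eval h t\<bar> \<le> norm (f x - h x)"
        using norm_bounded[of "f x - h x" s] by (simp add: t eval_def minus_bcontfun.rep_eq)
      also have "\<dots> \<le> hoelder_norm \<beta> (\<lambda>x. f x - h x)" by (rule hoelder_norm_bounds(1)[OF fin])
      also have "\<dots> < e" using h by simp
      finally have "eval h t \<in> V" by (intro e(2)) (simp add: dist_real_def abs_minus_commute)
      thus "h \<in> {f \<in> topspace (mtopology_of (hoelder_metric \<beta>)). eval f t \<in> V}" using fh by simp
    qed
  qed auto
qed auto

text \<open>Violation of a single condition is open, because point evaluations are continuous. The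
  complement serves as the measurable exceptional set under the law of the limit.\<close>

lemma openin_complement_hoelder_box:
  "openin (mtopology_of (hoelder_metric \<beta>)) {f \<in> hoelder_space \<beta>. f \<notin> hoelder_box \<theta> \<gamma> R}"
proof -
  let ?T = "mtopology_of (hoelder_metric \<beta> :: (unit_interval \<Rightarrow> (unit_interval \<Rightarrow>\<^sub>C real)) metric)"
  have o1: "openin ?T {f \<in> topspace ?T. eval f p \<in> - {0}}" for p
    by (rule openin_continuous_map_preimage[OF continuous_map_eval]) auto
  have o2: "openin ?T {f \<in> topspace ?T. \<bar>eval f p - eval f p'\<bar> \<in> {c<..}}" for p p' c
    by (rule openin_continuous_map_preimage[OF continuous_map_real_abs[OF continuous_map_diff[OF continuous_map_eval continuous_map_eval]]]) auto
  define \<U> where "\<U> = range (\<lambda>s. {f \<in> topspace ?T. eval f (ui0, s) \<in> - {0}})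
    \<union> range (\<lambda>(x, y, s). {f \<in> topspace ?T. \<bar>eval f (x, s) - eval f (y, s)\<bar> \<in> {R * \<bar>real_of_ui x - real_of_ui y\<bar> powr \<theta><..}})
    \<union> range (\<lambda>(x, s, t). {f \<in> topspace ?T. \<bar>eval f (x, s) - eval f (x, t)\<bar> \<in> {R * \<bar>real_of_ui s - real_of_ui t\<bar> powr \<gamma><..}})"
  have "openin ?T (\<Union>\<U>)"
    by (rule openin_Union) (auto simp: \<U>_def intro: o1 o2[simplified] o1[simplified])
  moreover have "\<Union>\<U> = {f \<in> hoelder_space \<beta>. f \<notin> hoelder_box \<theta> \<gamma> R}"
    unfolding \<U>_def hoelder_box_def box_functions_def by (auto simp: not_le)
  ultimately show ?thesis by simp
qed

lemma tendsto_lincomb: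
  assumes "\<And>t. t \<in> snd ` set xs \<Longrightarrow> ((\<lambda>n. h n t) \<longlongrightarrow> h' t) F"
  shows "((\<lambda>n. lincomb xs (h n)) \<longlongrightarrow> lincomb xs h') F"
  using assms
proof (induction xs)
  case (Cons p xs)
  obtain a t where p: "p = (a, t)" by (cases p)
  have 1: "((\<lambda>n. h n t) \<longlongrightarrow> h' t) F" using Cons.prems[of t] by (simp add: p)
  have 2: "((\<lambda>n. lincomb xs (h n)) \<longlongrightarrow> lincomb xs h') F" by (rule Cons.IH) (use Cons.prems in auto)
  show ?case using tendsto_add[OF tendsto_mult_left[OF 1, of a] 2] by (simp add: p)
qed simp

lemma quadform_lincomb: "quadform K xs = lincomb xs (\<lambda>s. lincomb xs (\<lambda>t. K s t))"
  unfolding quadform_def lincomb_def by (simp add: case_prod_unfold mult.assoc sum_list_const_mult)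

section \<open>Gaussian processes with Hoelder paths\<close>

text \<open>The mixed second difference in the format of \<open>lincomb\<close>, so that its
  variance under a Gaussian law is a value of \<open>quadform\<close>.\<close>

definition rect_list :: "unit_interval \<Rightarrow> unit_interval \<Rightarrow> unit_interval \<Rightarrow> unit_interval \<Rightarrow> (real \<times> unit_interval \<times> unit_interval) list" where
  "rect_list x y s t = [(1, (y, t)), (- 1, (x, t)), (- 1, (y, s)), (1, (x, s))]"

definition edge_list :: "unit_interval \<Rightarrow> unit_interval \<Rightarrow> (real \<times> unit_interval \<times> unit_interval) list" where
  "edge_list x y = [(1, (y, ui0)), (- 1, (x, ui0))]"

definition dyadic_ui :: "nat \<Rightarrow> nat \<Rightarrow> unit_interval" where
  "dyadic_ui m i = ui_of_real (real i / 2 ^ m)"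

lemma real_of_dyadic_ui: "i \<le> 2 ^ m \<Longrightarrow> real_of_ui (dyadic_ui m i) = real i / 2 ^ m"
  unfolding dyadic_ui_def using dyadics_unit[OF dyadics_I[of i m]] by (simp add: real_of_ui_of_real)

definition on_reals :: "(unit_interval \<times> unit_interval \<Rightarrow> real) \<Rightarrow> real \<Rightarrow> real \<Rightarrow> real" where
  "on_reals G x s = G (ui_of_real x, ui_of_real s)"

lemma rect_incr_on_reals:
  "rect_incr (on_reals G) m i n j = lincomb (rect_list (dyadic_ui m i) (dyadic_ui m (Suc i)) (dyadic_ui n j) (dyadic_ui n (Suc j))) G"
  by (simp add: rect_incr_def on_reals_def rect_list_def dyadic_ui_def)

lemma edge_incr_on_reals:
  "edge_incr (on_reals G) m i = lincomb (edge_list (dyadic_ui m i) (dyadic_ui m (Suc i))) G"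
  by (simp add: edge_incr_def on_reals_def edge_list_def dyadic_ui_def ui0_def)

lemma dyadic_ui_diff:
  assumes "i < 2 ^ m" shows "real_of_ui (dyadic_ui m (Suc i)) - real_of_ui (dyadic_ui m i) = (1/2) ^ m"
proof -
  have "Suc i \<le> 2 ^ m" "i \<le> 2 ^ m" using assms by auto
  thus ?thesis by (simp only: real_of_dyadic_ui) (simp add: power_one_over field_simps)
qed

lemma half_power_powr: "((1/2) ^ m) powr \<alpha> = (2 powr - \<alpha>) ^ m" for \<alpha> :: real
proof -
  have "((1/2::real) ^ m) powr \<alpha> = ((1/2) powr real m) powr \<alpha>" by (simp add: powr_realpow)
  also have "\<dots> = ((1/2) powr \<alpha>) powr real m" by (simp add: powr_powr mult.commute)
  also have "(1/2) powr \<alpha> = 2 powr - \<alpha>" by (simp add: powr_minus powr_divide inverse_eq_divide)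
  also have "(2 powr - \<alpha>) powr real m = (2 powr - \<alpha>) ^ m" by (simp add: powr_realpow)
  finally show ?thesis .
qed

definition increments_event :: "real \<Rightarrow> real \<Rightarrow> real \<Rightarrow> (real \<Rightarrow> real \<Rightarrow> real) \<Rightarrow> bool" where
  "increments_event \<theta> \<gamma> R g \<longleftrightarrow> (\<forall>m. \<forall>i<2 ^ m. \<bar>edge_incr g m i\<bar> \<le> R * (2 powr - \<theta>) ^ m) \<and>
      (\<forall>m n. \<forall>i<2 ^ m. \<forall>j<2 ^ n. \<bar>rect_incr g m i n j\<bar> \<le> R * (2 powr - \<theta>) ^ m * (2 powr - \<gamma>) ^ n)"

definition power_moment_le :: "'a measure \<Rightarrow> nat \<Rightarrow> ('a \<Rightarrow> real) \<Rightarrow> real \<Rightarrow> bool" where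
  "power_moment_le M q f D \<longleftrightarrow> integrable M (\<lambda>\<omega>. f \<omega> ^ q) \<and> integral\<^sup>L M (\<lambda>\<omega>. f \<omega> ^ q) \<le> D"

definition dyadic_moments :: "'a measure \<Rightarrow> nat \<Rightarrow> real \<Rightarrow> real \<Rightarrow> ('a \<Rightarrow> unit_interval \<times> unit_interval \<Rightarrow> real) \<Rightarrow> bool" where
  "dyadic_moments M q r C Z \<longleftrightarrow>
    (\<forall>m. \<forall>i<2 ^ m. power_moment_le M q (\<lambda>\<omega>. lincomb (edge_list (dyadic_ui m i) (dyadic_ui m (Suc i))) (Z \<omega>))
      (C * (2 powr - (real q * (1/2))) ^ m)) \<and>
    (\<forall>m n. \<forall>i<2 ^ m. \<forall>j<2 ^ n. power_moment_le M q
      (\<lambda>\<omega>. lincomb (rect_list (dyadic_ui m i) (dyadic_ui m (Suc i)) (dyadic_ui n j) (dyadic_ui n (Suc j))) (Z \<omega>))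
      (C * (2 powr - (real q * (1/2))) ^ m * (2 powr - (real q * r)) ^ n))"

text \<open>The factor produced by the two series of \<open>dyadic_increments_event\<close>. The
  maximum with \<open>0\<close> makes nonnegativity independent of conditions on the
  exponents.\<close>

definition increments_const :: "nat \<Rightarrow> real \<Rightarrow> real \<Rightarrow> real \<Rightarrow> real" where
  "increments_const q r \<theta> \<gamma> = max 0 (1 / (1 - 2 * 2 powr (real q * (\<theta> - 1/2))) +
     1 / (1 - 2 * 2 powr (real q * (\<gamma> - r))) / (1 - 2 * 2 powr (real q * (\<theta> - 1/2))))"

lemma increments_const_nonneg: "0 \<le> increments_const q r \<theta> \<gamma>"
  by (simp add: increments_const_def)

lemma increments_event_prob:
  fixes q :: nat and C R r \<theta> \<gamma> :: real and Z :: "'a \<Rightarrow> unit_interval \<times> unit_interval \<Rightarrow> real"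
  assumes q: "even q" "q > 0" and \<theta>: "real q * \<theta> < real q / 2 - 1" and \<gamma>: "real q * \<gamma> < real q * r - 1"
    and M: "prob_space M" and R: "R > 0" and C: "C \<ge> 0"
    and Zm: "\<And>t. (\<lambda>\<omega>. Z \<omega> t) \<in> borel_measurable M" and mom: "dyadic_moments M q r C Z"
  shows "\<exists>A\<in>sets M. measure M A \<le> increments_const q r \<theta> \<gamma> * C / R ^ q \<and>
    (\<forall>\<omega>\<in>space M - A. increments_event \<theta> \<gamma> R (on_reals (Z \<omega>)))"
proof -
  define S where "S = 1 / (1 - 2 * 2 powr (real q * (\<theta> - 1/2))) +
     1 / (1 - 2 * 2 powr (real q * (\<gamma> - r))) / (1 - 2 * 2 powr (real q * (\<theta> - 1/2)))"
  interpret prob_space M by fact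
  note m = mom[unfolded dyadic_moments_def power_moment_le_def]
  have "\<exists>A\<in>sets M. measure M A \<le> S * C / R ^ q \<and> (\<forall>\<omega>\<in>space M - A. increments_event \<theta> \<gamma> R (on_reals (Z \<omega>)))"
    unfolding S_def increments_event_def
  proof (rule dyadic_increments_event[OF q \<theta> \<gamma> R])
    show "(\<lambda>\<omega>. on_reals (Z \<omega>) x s) \<in> borel_measurable M" for x s
      unfolding on_reals_def by (rule Zm)
  qed (unfold edge_incr_on_reals rect_incr_on_reals,
      rule conjunct1[OF m, rule_format], assumption, rule conjunct2[OF m, rule_format])
  then obtain A where A: "A \<in> sets M" "measure M A \<le> S * C / R ^ q" "\<forall>\<omega>\<in>space M - A. increments_event \<theta> \<gamma> R (on_reals (Z \<omega>))"
    by blast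
  have "S * C / R ^ q \<le> increments_const q r \<theta> \<gamma> * C / R ^ q"
    using C R unfolding increments_const_def S_def[symmetric] by (intro divide_right_mono mult_right_mono) auto
  with A(2) have "measure M A \<le> increments_const q r \<theta> \<gamma> * C / R ^ q" by linarith
  with A(1,3) show ?thesis by blast
qed

lemma increments_event_box:
  assumes "\<theta> > 0" "\<gamma> > 0"
  shows "\<exists>C\<ge>0. \<forall>g R. R \<ge> 0 \<longrightarrow> (\<forall>s\<in>dyadics. g 0 s = 0) \<longrightarrow> increments_event \<theta> \<gamma> R g \<longrightarrow> g \<in> dyadic_box \<theta> \<gamma> (C * R)"
  using dyadic_box_chaining[OF assms] unfolding increments_event_def by blast

lemma exists_power_ge:
  fixes c \<eta> :: real
  assumes "c \<ge> 0" "\<eta> > 0" "q > (0::nat)" obtains R where "R > 0" "c / R ^ q \<le> \<eta>"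
proof (rule that[of "c / \<eta> + 1"])
  have R: "c / \<eta> + 1 \<ge> 1" using assms by simp
  thus "c / \<eta> + 1 > 0" by linarith
  have "(c / \<eta> + 1) ^ 1 \<le> (c / \<eta> + 1) ^ q" using R assms by (intro power_increasing) auto
  hence "\<eta> * (c / \<eta> + 1) \<le> \<eta> * (c / \<eta> + 1) ^ q" using assms(2) by (intro mult_left_mono) auto
  moreover have "\<eta> * (c / \<eta> + 1) = c + \<eta>" using assms(2) by (simp add: distrib_left)
  ultimately have "c \<le> \<eta> * (c / \<eta> + 1) ^ q" using assms(2) by linarith
  thus "c / (c / \<eta> + 1) ^ q \<le> \<eta>" using R by (simp add: pos_divide_le_eq)
qed

text \<open>A construction of Kolmogorov-Chentsov type. Bounds on the quadratic form are bounds on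
  variances, and for centred normal variables the moment of order \<open>2 * k\<close> is a constant
  times the \<open>k\<close>-th power of the variance. The law is placed on the function space
  itself, with the identity as the process.\<close>

theorem exists_hoelder_gaussian:
  fixes K :: "unit_interval \<times> unit_interval \<Rightarrow> unit_interval \<times> unit_interval \<Rightarrow> real" and k :: nat
  assumes K: "psd_kernel K" and Kc: "continuous_on UNIV (\<lambda>(t, u). K t u)"
    and k: "k > 0" and \<theta>: "real (2 * k) * \<theta> < real (2 * k) / 2 - 1" "\<theta> > 0" and \<gamma>: "real (2 * k) * \<gamma> < real (2 * k) * r - 1" "\<gamma> > 0"
    and \<beta>: "0 \<le> \<beta>" "\<beta> < \<theta>" "\<beta> < 1" and C: "C \<ge> 0"
    and K0: "\<And>s. K (ui0, s) (ui0, s) = 0"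
    and edge: "\<And>x y. real_of_ui x < real_of_ui y \<Longrightarrow> quadform K (edge_list x y) \<le> C * (real_of_ui y - real_of_ui x)"
    and rect: "\<And>x y s t. real_of_ui x < real_of_ui y \<Longrightarrow> real_of_ui s < real_of_ui t \<Longrightarrow>
      quadform K (rect_list x y s t) \<le> C * (real_of_ui y - real_of_ui x) * (real_of_ui t - real_of_ui s) powr (2 * r)"
  obtains M' :: "(unit_interval \<Rightarrow> (unit_interval \<Rightarrow>\<^sub>C real)) measure"
    where "prob_space M'" "(\<lambda>f. f) \<in> measurable M' (borel_of_metric (hoelder_metric \<beta>))"
      "\<And>t. (\<lambda>f. eval f t) \<in> borel_measurable M'"
      "\<And>xs. integral\<^sup>L M' (\<lambda>f. cis (lincomb xs (eval f))) = exp (- quadform K xs / 2)"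
      "hoelder_tight \<theta> \<gamma> M' (\<lambda>_ f. f)"
proof -
  let ?pt = "\<lambda>(x, s). (ui_of_real x, ui_of_real s)"
  define T where "T = ?pt ` (dyadics \<times> dyadics)"
  have cT: "countable T" unfolding T_def using countable_dyadics by auto
  obtain G :: "unit_interval \<times> unit_interval \<Rightarrow> (nat \<Rightarrow> real) \<Rightarrow> real" where
    Gm: "\<And>t. G t \<in> borel_measurable gauss_seq" and
    Gcis: "\<And>xs. snd ` set xs \<subseteq> T \<Longrightarrow> integral\<^sup>L gauss_seq (\<lambda>\<omega>. cis (lincomb xs (\<lambda>t. G t \<omega>))) = exp (- quadform K xs / 2)"
    using exists_gaussian_countable[OF K cT] by blast
  interpret P: prob_space gauss_seq by (rule prob_space_gauss_seq)
  note [measurable] = Gm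
  define Z where "Z \<omega> t = G t \<omega>" for \<omega> t
  have Zm [measurable]: "(\<lambda>\<omega>. Z \<omega> t) \<in> borel_measurable gauss_seq" for t unfolding Z_def by (rule Gm)
  have Lm [measurable]: "(\<lambda>\<omega>. lincomb xs (Z \<omega>)) \<in> borel_measurable gauss_seq" for xs
    by (rule lincomb_measurable) (rule Zm)
  have law: "quadform K xs \<ge> 0" "distr gauss_seq borel (\<lambda>\<omega>. lincomb xs (Z \<omega>)) = normal_law 0 (quadform K xs)"
    if xs: "snd ` set xs \<subseteq> T" for xs
  proof -
    have "integral\<^sup>L gauss_seq (\<lambda>\<omega>. cis (u * lincomb xs (Z \<omega>))) = exp (- (u\<^sup>2 * quadform K xs) / 2)" for u
    proof -
      have "snd ` set (map (\<lambda>(a, t). (u * a, t)) xs) \<subseteq> T" using xs by (auto simp: image_iff)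
      from Gcis[OF this] show ?thesis by (simp add: lincomb_map_scale quadform_scale Z_def[abs_def])
    qed
    from P.normal_law_of_cis[OF Lm this]
    show "quadform K xs \<ge> 0" "distr gauss_seq borel (\<lambda>\<omega>. lincomb xs (Z \<omega>)) = normal_law 0 (quadform K xs)" by auto
  qed
  \<comment> \<open>The moment of order \<open>2 * k\<close> of the standard normal law.\<close>
  define c where "c = fact (2 * k) / (2 ^ k * fact k :: real)"
  have c0: "c \<ge> 0" by (simp add: c_def)
  have mom: "integrable gauss_seq (\<lambda>\<omega>. lincomb xs (Z \<omega>) ^ (2 * k))"
    "integral\<^sup>L gauss_seq (\<lambda>\<omega>. lincomb xs (Z \<omega>) ^ (2 * k)) \<le> c * D ^ k"
    if xs: "snd ` set xs \<subseteq> T" and D: "quadform K xs \<le> D" for xs D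
  proof -
    note nm = P.normal_law_moments[OF Lm law(2)[OF xs] law(1)[OF xs]]
    show "integrable gauss_seq (\<lambda>\<omega>. lincomb xs (Z \<omega>) ^ (2 * k))" by (rule nm(1))
    have "integral\<^sup>L gauss_seq (\<lambda>\<omega>. lincomb xs (Z \<omega>) ^ (2 * k)) = c * quadform K xs ^ k"
      using nm(3)[of k] by (simp add: c_def)
    also have "\<dots> \<le> c * D ^ k" using D law(1)[OF xs] c0 by (intro mult_left_mono power_mono) auto
    finally show "integral\<^sup>L gauss_seq (\<lambda>\<omega>. lincomb xs (Z \<omega>) ^ (2 * k)) \<le> c * D ^ k" .
  qed
  have dT: "(dyadic_ui m i, dyadic_ui n j) \<in> T" if "i \<le> 2 ^ m" "j \<le> 2 ^ n" for m i n j
    unfolding T_def dyadic_ui_def using dyadics_I[OF that(1)] dyadics_I[OF that(2)]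
    by (intro image_eqI[of _ _ "(real i / 2 ^ m, real j / 2 ^ n)"]) auto
  have d0: "(dyadic_ui m i, ui0) \<in> T" if "i \<le> 2 ^ m" for m i
    using dT[OF that, of 0 0] by (simp add: dyadic_ui_def[of 0 0] ui0_def)
  have pw: "(2 powr - \<alpha>) ^ k = 2 powr - (real (2 * k) * (\<alpha> / 2))" for \<alpha> :: real
    by (subst powr_realpow[symmetric]) (auto simp: powr_powr mult.commute)
  have swap: "(x ^ m) ^ k = (x ^ k) ^ m" for x :: real and m
    by (simp only: power_mult[symmetric] mult.commute)
  have eb: "power_moment_le gauss_seq (2 * k) (\<lambda>\<omega>. lincomb (edge_list (dyadic_ui m i) (dyadic_ui m (Suc i))) (Z \<omega>))
      ((c * C ^ k) * (2 powr - (real (2 * k) * (1/2))) ^ m)" if i: "i < 2 ^ m" for m i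
  proof -
    let ?xs = "edge_list (dyadic_ui m i) (dyadic_ui m (Suc i))"
    have xs: "snd ` set ?xs \<subseteq> T" using i d0[of i m] d0[of "Suc i" m] by (simp add: edge_list_def)
    have diff: "real_of_ui (dyadic_ui m (Suc i)) - real_of_ui (dyadic_ui m i) = (1/2) ^ m" by (rule dyadic_ui_diff[OF i])
    have "(0::real) < (1/2) ^ m" by simp
    hence lt: "real_of_ui (dyadic_ui m i) < real_of_ui (dyadic_ui m (Suc i))" using diff by linarith
    have D: "quadform K ?xs \<le> C * (2 powr - 1) ^ m"
      using edge[OF lt] unfolding diff using half_power_powr[of m 1] by simp
    have e: "c * (C * (2 powr - 1) ^ m) ^ k = (c * C ^ k) * (2 powr - (real (2 * k) * (1/2))) ^ m"
      unfolding power_mult_distrib swap pw by simp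
    show ?thesis using mom(1)[OF xs D] mom(2)[OF xs D] unfolding e power_moment_le_def by (rule conjI)
  qed
  have rb: "power_moment_le gauss_seq (2 * k)
      (\<lambda>\<omega>. lincomb (rect_list (dyadic_ui m i) (dyadic_ui m (Suc i)) (dyadic_ui n j) (dyadic_ui n (Suc j))) (Z \<omega>))
      ((c * C ^ k) * (2 powr - (real (2 * k) * (1/2))) ^ m * (2 powr - (real (2 * k) * r)) ^ n)" if i: "i < 2 ^ m" "j < 2 ^ n" for m i n j
  proof -
    let ?xs = "rect_list (dyadic_ui m i) (dyadic_ui m (Suc i)) (dyadic_ui n j) (dyadic_ui n (Suc j))"
    have xs: "snd ` set ?xs \<subseteq> T" using i dT[of i m j n] dT[of "Suc i" m j n] dT[of i m "Suc j" n] dT[of "Suc i" m "Suc j" n]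
      by (simp add: rect_list_def)
    have diff: "real_of_ui (dyadic_ui m (Suc i)) - real_of_ui (dyadic_ui m i) = (1/2) ^ m"
      "real_of_ui (dyadic_ui n (Suc j)) - real_of_ui (dyadic_ui n j) = (1/2) ^ n" by (rule dyadic_ui_diff[OF i(1)], rule dyadic_ui_diff[OF i(2)])
    have pos: "(0::real) < (1/2) ^ m" for m by simp
    have lt: "real_of_ui (dyadic_ui m i) < real_of_ui (dyadic_ui m (Suc i))" "real_of_ui (dyadic_ui n j) < real_of_ui (dyadic_ui n (Suc j))"
      using diff pos[of m] pos[of n] by linarith+
    have D: "quadform K ?xs \<le> C * (2 powr - 1) ^ m * (2 powr - (2 * r)) ^ n"
      using rect[OF lt] unfolding diff half_power_powr using half_power_powr[of m 1] by simp
    have e: "c * (C * (2 powr - 1) ^ m * (2 powr - (2 * r)) ^ n) ^ k = (c * C ^ k) * (2 powr - (real (2 * k) * (1/2))) ^ m * (2 powr - (real (2 * k) * r)) ^ n"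
      unfolding power_mult_distrib swap pw by simp
    show ?thesis using mom(1)[OF xs D] mom(2)[OF xs D] unfolding e power_moment_le_def by (rule conjI)
  qed
  obtain B where B: "B \<ge> 0" and box': "\<forall>g R. R \<ge> 0 \<longrightarrow> (\<forall>s\<in>dyadics. g 0 s = 0) \<longrightarrow> increments_event \<theta> \<gamma> R g \<longrightarrow> g \<in> dyadic_box \<theta> \<gamma> (B * R)"
    using increments_event_box[OF \<theta>(2) \<gamma>(2)] by blast
  note box = box'[rule_format]
  \<comment> \<open>The row \<open>x = 0\<close> vanishes almost surely because its variance does.\<close>
  define N0 where "N0 = (\<Union>s\<in>dyadics. {\<omega> \<in> space gauss_seq. Z \<omega> (ui0, ui_of_real s) \<noteq> 0})"
  have N0: "N0 \<in> sets gauss_seq" "measure gauss_seq N0 = 0"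
  proof -
    have s1: "{\<omega> \<in> space gauss_seq. Z \<omega> (ui0, ui_of_real s) \<noteq> 0} \<in> null_sets gauss_seq" if s: "s \<in> dyadics" for s
    proof -
      let ?xs = "[(1, (ui0, ui_of_real s))]"
      have xs: "snd ` set ?xs \<subseteq> T"
        unfolding T_def using s by (auto intro!: image_eqI[of _ _ "(0, s)"] simp: ui0_def)
      have q0: "quadform K ?xs = 0" by (simp add: quadform_def K0)
      note nm = P.normal_law_moments[OF Lm law(2)[OF xs] law(1)[OF xs]]
      have "integral\<^sup>L gauss_seq (\<lambda>\<omega>. lincomb ?xs (Z \<omega>) ^ (2 * 1)) = 0" unfolding nm(3) q0 by simp
      hence i0: "integral\<^sup>L gauss_seq (\<lambda>\<omega>. (Z \<omega> (ui0, ui_of_real s))\<^sup>2) = 0" by simp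
      have "integrable gauss_seq (\<lambda>\<omega>. (Z \<omega> (ui0, ui_of_real s))\<^sup>2)" using nm(1)[of 2] by simp
      hence "AE \<omega> in gauss_seq. (Z \<omega> (ui0, ui_of_real s))\<^sup>2 = 0"
        using i0 by (subst (asm) integral_nonneg_eq_0_iff_AE) auto
      thus ?thesis by (intro AE_iff_null_sets[THEN iffD2]) (auto elim: eventually_mono)
    qed
    have "N0 \<in> null_sets gauss_seq" unfolding N0_def by (rule null_sets_UN'[OF countable_dyadics s1])
    thus "N0 \<in> sets gauss_seq" "measure gauss_seq N0 = 0" by (auto simp: measure_def)
  qed
  have dm: "dyadic_moments gauss_seq (2 * k) r (c * C ^ k) Z"
    unfolding dyadic_moments_def by (intro conjI allI impI eb rb)
  define S where "S = increments_const (2 * k) r \<theta> \<gamma>"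
  have S: "S \<ge> 0" unfolding S_def by (rule increments_const_nonneg)
  have ev: "\<exists>A\<in>sets gauss_seq. measure gauss_seq A \<le> S * (c * C ^ k) / R ^ (2 * k) \<and>
    (\<forall>\<omega>\<in>space gauss_seq - A. increments_event \<theta> \<gamma> R (on_reals (Z \<omega>)))" if "R > 0" for R
    unfolding S_def
    by (rule increments_event_prob[OF _ _ \<theta>(1) \<gamma>(1) prob_space_gauss_seq that _ Zm dm]) (use k c0 C in auto)
  \<comment> \<open>The paths whose dyadic increments are bounded with constant \<open>n\<close>.
    Each event is given by countably many conditions on values of \<open>Z\<close>, hence
    measurable; the union over \<open>n\<close> has full probability.\<close>
  define good where "good n = {\<omega> \<in> space gauss_seq - N0. increments_event \<theta> \<gamma> (real n) (on_reals (Z \<omega>))}" for n :: nat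
  have good_meas: "good n \<in> sets gauss_seq" for n
  proof -
    have "good n = (space gauss_seq - N0) \<inter> {\<omega> \<in> space gauss_seq. increments_event \<theta> \<gamma> (real n) (on_reals (Z \<omega>))}"
      by (auto simp: good_def)
    moreover have "{\<omega> \<in> space gauss_seq. increments_event \<theta> \<gamma> (real n) (on_reals (Z \<omega>))} \<in> sets gauss_seq"
      unfolding increments_event_def edge_incr_on_reals rect_incr_on_reals by measurable
    ultimately show ?thesis using N0 by auto
  qed
  have g0: "on_reals (Z \<omega>) 0 s = 0" if "\<omega> \<in> good n" "s \<in> dyadics" for \<omega> n s
    using that by (auto simp: good_def N0_def on_reals_def ui0_def)
  have good_box: "on_reals (Z \<omega>) \<in> dyadic_box \<theta> \<gamma> (B * real n)" if "\<omega> \<in> good n" for \<omega> n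
    by (rule box) (use that g0 in \<open>auto simp: good_def\<close>)
  \<comment> \<open>The continuous extension of the dyadic values, in the box of the least
    admissible constant, and the zero function off the good events. All its values are limits of
    values of \<open>Z\<close>, so the choice operator does not affect measurability.\<close>
  define W where "W \<omega> = (if \<exists>n. \<omega> \<in> good n then
     (SOME f. f \<in> hoelder_box \<theta> \<gamma> (B * real (LEAST n. \<omega> \<in> good n)) \<and>
       (\<forall>x s. (\<lambda>n. on_reals (Z \<omega>) (dyadic_floor n (real_of_ui x)) (dyadic_floor n (real_of_ui s))) \<longlonglongrightarrow> apply_bcontfun (f x) s))
     else (\<lambda>_. 0))" for \<omega>
  have W: "W \<omega> \<in> hoelder_box \<theta> \<gamma> (B * real (LEAST n. \<omega> \<in> good n)) \<and>
       (\<forall>x s. (\<lambda>n. on_reals (Z \<omega>) (dyadic_floor n (real_of_ui x)) (dyadic_floor n (real_of_ui s))) \<longlonglongrightarrow> apply_bcontfun (W \<omega> x) s)"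
    if "\<omega> \<in> good n" for \<omega> n
  proof -
    have ex: "\<exists>n. \<omega> \<in> good n" using that by blast
    have "\<omega> \<in> good (LEAST n. \<omega> \<in> good n)" by (rule LeastI[of "\<lambda>n. \<omega> \<in> good n"]) (rule that)
    from extend_dyadic_box[OF good_box[OF this] \<theta>(2) \<gamma>(2)] B
    have "\<exists>f. f \<in> hoelder_box \<theta> \<gamma> (B * real (LEAST n. \<omega> \<in> good n)) \<and>
       (\<forall>x s. (\<lambda>n. on_reals (Z \<omega>) (dyadic_floor n (real_of_ui x)) (dyadic_floor n (real_of_ui s))) \<longlonglongrightarrow> apply_bcontfun (f x) s)"
      by auto
    from someI_ex[OF this] show ?thesis using ex by (simp add: W_def)
  qed
  have Wbox: "W \<omega> \<in> hoelder_box \<theta> \<gamma> (B * real n)" if "\<omega> \<in> good n" for \<omega> n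
  proof -
    have "(LEAST n. \<omega> \<in> good n) \<le> n" using that by (rule Least_le)
    hence "B * real (LEAST n. \<omega> \<in> good n) \<le> B * real n" using B by (intro mult_left_mono) auto
    thus ?thesis using W[OF that] hoelder_box_mono by blast
  qed
  have zero_sp: "(\<lambda>_. 0) \<in> hoelder_space \<beta>"
    by (rule hoelder_spaceI[where L=0 and \<theta>=\<theta>]) (use \<beta> in auto)
  have Wsp: "W \<omega> \<in> hoelder_space \<beta>" for \<omega>
  proof (cases "\<exists>n. \<omega> \<in> good n")
    case True
    then obtain n where "\<omega> \<in> good n" ..
    from Wbox[OF this] show ?thesis using hoelder_box_subset[OF \<beta>(1,2), of "B * real n" \<gamma>] B by auto
  qed (simp add: W_def zero_sp)
  define GG where "GG = (\<Union>n. good n)"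
  have GG: "GG \<in> sets gauss_seq" unfolding GG_def using good_meas by auto
  have Wev: "(\<lambda>\<omega>. apply_bcontfun (W \<omega> x) s) \<in> borel_measurable gauss_seq" for x s
  proof (rule borel_measurable_LIMSEQ_real)
    fix \<omega>
    show "(\<lambda>n. indicator GG \<omega> * on_reals (Z \<omega>) (dyadic_floor n (real_of_ui x)) (dyadic_floor n (real_of_ui s))) \<longlonglongrightarrow> apply_bcontfun (W \<omega> x) s"
    proof (cases "\<omega> \<in> GG")
      case True
      then obtain n where "\<omega> \<in> good n" by (auto simp: GG_def)
      from W[OF this] show ?thesis using True by simp
    next
      case False
      thus ?thesis by (simp add: W_def GG_def)
    qed
  next
    fix n
    show "(\<lambda>\<omega>. indicator GG \<omega> * on_reals (Z \<omega>) (dyadic_floor n (real_of_ui x)) (dyadic_floor n (real_of_ui s))) \<in> borel_measurable gauss_seq"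
      unfolding on_reals_def using GG by measurable
  qed
  have Wm: "W \<in> measurable gauss_seq (borel_of_metric (hoelder_metric \<beta>))"
    by (rule measurable_hoelder[OF Wsp \<beta>(1,3) Wev])
  have tight: "\<exists>n. \<exists>A\<in>sets gauss_seq. measure gauss_seq A \<le> \<eta> \<and> space gauss_seq - A \<subseteq> good n" if \<eta>: "\<eta> > 0" for \<eta>
  proof -
    obtain R where R: "R > 0" "S * (c * C ^ k) / R ^ (2 * k) \<le> \<eta>"
      by (rule exists_power_ge[of "S * (c * C ^ k)" \<eta> "2 * k"]) (use S c0 C k \<eta> in auto)
    define n where "n = nat \<lceil>R\<rceil>"
    have n: "R \<le> real n" unfolding n_def by linarith
    obtain A where A: "A \<in> sets gauss_seq" "measure gauss_seq A \<le> S * (c * C ^ k) / R ^ (2 * k)"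
      "\<forall>\<omega>\<in>space gauss_seq - A. increments_event \<theta> \<gamma> R (on_reals (Z \<omega>))" using ev[OF R(1)] by blast
    have mono: "increments_event \<theta> \<gamma> (real n) g" if "increments_event \<theta> \<gamma> R g" for g
    proof -
      have 1: "R * (2 powr - \<theta>) ^ m \<le> real n * (2 powr - \<theta>) ^ m" for m :: nat
        by (rule mult_right_mono[OF n]) simp
      have 2: "R * (2 powr - \<theta>) ^ m * (2 powr - \<gamma>) ^ l \<le> real n * (2 powr - \<theta>) ^ m * (2 powr - \<gamma>) ^ l" for m l :: nat
        by (rule mult_right_mono[OF 1]) simp
      show ?thesis unfolding increments_event_def
        using that[unfolded increments_event_def] order_trans[OF _ 1] order_trans[OF _ 2] by blast
    qed
    have "measure gauss_seq (A \<union> N0) \<le> measure gauss_seq A + measure gauss_seq N0"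
      by (rule measure_Un_le[OF A(1) N0(1)])
    hence "measure gauss_seq (A \<union> N0) \<le> \<eta>" using A(2) R(2) N0(2) by linarith
    moreover have "space gauss_seq - (A \<union> N0) \<subseteq> good n" using A(3) mono by (auto simp: good_def)
    moreover have "A \<union> N0 \<in> sets gauss_seq" using A(1) N0(1) by auto
    ultimately show ?thesis by blast
  qed
  have AE_GG: "AE \<omega> in gauss_seq. \<omega> \<in> GG"
  proof -
    have "measure gauss_seq (space gauss_seq - GG) \<le> 0 + \<eta>" if eta: "\<eta> > 0" for \<eta>
    proof -
      obtain n A where A: "A \<in> sets gauss_seq" "measure gauss_seq A \<le> \<eta>" "space gauss_seq - A \<subseteq> good n" using tight[OF eta] by blast
      have "measure gauss_seq (space gauss_seq - GG) \<le> measure gauss_seq A"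
        by (rule P.finite_measure_mono[OF _ A(1)]) (use A(3) in \<open>auto simp: GG_def\<close>)
      thus ?thesis using A(2) by simp
    qed
    hence "measure gauss_seq (space gauss_seq - GG) \<le> 0" by (rule field_le_epsilon)
    hence "measure gauss_seq (space gauss_seq - GG) = 0" by (simp add: measure_le_0_iff)
    hence "emeasure gauss_seq (space gauss_seq - GG) = 0" by (simp add: P.emeasure_eq_measure)
    hence "space gauss_seq - GG \<in> null_sets gauss_seq" using GG by auto
    thus ?thesis by (rule AE_I'[of "space gauss_seq - GG"]) auto
  qed
  \<comment> \<open>Finite-dimensional laws are known at dyadic points; continuity of
    \<open>K\<close> and of the paths, with dominated convergence, carries them to all
    points.\<close>
  have Wcis: "integral\<^sup>L gauss_seq (\<lambda>\<omega>. cis (lincomb xs (eval (W \<omega>)))) = exp (- quadform K xs / 2)" for xs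
  proof -
    define f where "f n = (\<lambda>(x, s). (ui_of_real (dyadic_floor n (real_of_ui x)), ui_of_real (dyadic_floor n (real_of_ui s))))" for n
    define ys where "ys n = map (\<lambda>(a, t). (a, f n t)) xs" for n
    have fT: "f n t \<in> T" for n t
    proof (cases t)
      case (Pair x s)
      thus ?thesis unfolding T_def f_def
        by (auto intro!: image_eqI[of _ _ "(dyadic_floor n (real_of_ui x), dyadic_floor n (real_of_ui s))"] simp: dyadic_floor_ui)
    qed
    have ysT: "snd ` set (ys n) \<subseteq> T" for n using fT by (auto simp: ys_def)
    have lcf: "lincomb (ys n) g = lincomb xs (\<lambda>t. g (f n t))" for n g
      unfolding ys_def by (induction xs) auto
    have lim_f: "(\<lambda>n. f n t) \<longlonglongrightarrow> t" for t
    proof -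
      have "(\<lambda>n. ui_of_real (dyadic_floor n (real_of_ui x))) \<longlonglongrightarrow> x" for x
      proof (rule metric_LIMSEQ_I)
        fix e :: real assume "e > 0"
        then obtain N where N: "\<And>n. n \<ge> N \<Longrightarrow> dist (dyadic_floor n (real_of_ui x)) (real_of_ui x) < e"
          using metric_LIMSEQ_D[OF dyadic_floor_tendsto[OF real_of_ui_bounds(1)] \<open>e > 0\<close>] by blast
        have "dist (ui_of_real (dyadic_floor n (real_of_ui x))) x = dist (dyadic_floor n (real_of_ui x)) (real_of_ui x)" for n
          using dyadics_unit[OF dyadic_floor_ui[of n x]] by (simp add: dist_unit_interval_def dist_real_def real_of_ui_of_real)
        thus "\<exists>no. \<forall>n\<ge>no. dist (ui_of_real (dyadic_floor n (real_of_ui x))) x < e" using N by (intro exI[of _ N]) simp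
      qed
      thus ?thesis by (cases t) (auto simp: f_def intro: tendsto_Pair)
    qed
    have Klim: "(\<lambda>n. K (f n s) (f n t)) \<longlonglongrightarrow> K s t" for s t
      using continuous_on_tendsto_compose[OF Kc tendsto_Pair[OF lim_f[of s] lim_f[of t]]] by simp
    have "(\<lambda>n. quadform K (ys n)) \<longlonglongrightarrow> quadform K xs"
      unfolding quadform_lincomb lcf by (intro tendsto_lincomb Klim)
    hence "(\<lambda>n. complex_of_real (exp (- quadform K (ys n) / 2))) \<longlonglongrightarrow> complex_of_real (exp (- quadform K xs / 2))"
      by (intro tendsto_of_real tendsto_exp tendsto_divide tendsto_minus tendsto_const) auto
    moreover have "(\<lambda>n. integral\<^sup>L gauss_seq (\<lambda>\<omega>. cis (lincomb (ys n) (Z \<omega>)))) \<longlonglongrightarrow> integral\<^sup>L gauss_seq (\<lambda>\<omega>. cis (lincomb xs (eval (W \<omega>))))"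
    proof (rule integral_dominated_convergence[where w = "\<lambda>_. 1"])
      have m1: "(\<lambda>\<omega>. lincomb xs (eval (W \<omega>))) \<in> borel_measurable gauss_seq"
        by (rule lincomb_measurable) (use Wev in \<open>auto simp: eval_def\<close>)
      show "(\<lambda>\<omega>. cis (lincomb xs (eval (W \<omega>)))) \<in> borel_measurable gauss_seq"
        unfolding cis_conv_exp using m1 by measurable
      show "(\<lambda>\<omega>. cis (lincomb (ys n) (Z \<omega>))) \<in> borel_measurable gauss_seq" for n
        unfolding cis_conv_exp by measurable
      show "AE \<omega> in gauss_seq. (\<lambda>n. cis (lincomb (ys n) (Z \<omega>))) \<longlonglongrightarrow> cis (lincomb xs (eval (W \<omega>)))"
        using AE_GG
      proof (rule eventually_mono)
        fix \<omega> assume "\<omega> \<in> GG"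
        then obtain n where "\<omega> \<in> good n" by (auto simp: GG_def)
        from conjunct2[OF W[OF this]] have "(\<lambda>n. Z \<omega> (f n t)) \<longlonglongrightarrow> eval (W \<omega>) t" for t
          by (cases t) (simp add: on_reals_def f_def eval_def)
        hence "(\<lambda>n. lincomb (ys n) (Z \<omega>)) \<longlonglongrightarrow> lincomb xs (eval (W \<omega>))" unfolding lcf by (intro tendsto_lincomb)
        thus "(\<lambda>n. cis (lincomb (ys n) (Z \<omega>))) \<longlonglongrightarrow> cis (lincomb xs (eval (W \<omega>)))"
          unfolding cis_conv_exp by (intro tendsto_exp tendsto_mult tendsto_const tendsto_of_real)
      qed
    qed auto
    moreover have "integral\<^sup>L gauss_seq (\<lambda>\<omega>. cis (lincomb (ys n) (Z \<omega>))) = exp (- quadform K (ys n) / 2)" for n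
      using Gcis[OF ysT[of n]] by (simp add: Z_def[abs_def])
    ultimately show ?thesis using LIMSEQ_unique by force
  qed
  define M' where "M' = distr gauss_seq (borel_of_metric (hoelder_metric \<beta>)) W"
  have spM': "space M' = hoelder_space \<beta>" by (simp add: M'_def)
  show thesis
  proof (rule that[of M'])
    show "prob_space M'" unfolding M'_def by (rule P.prob_space_distr[OF Wm])
    show "(\<lambda>f. f) \<in> measurable M' (borel_of_metric (hoelder_metric \<beta>))" by (simp add: M'_def)
    have evc: "(\<lambda>f. eval f t) \<in> borel_measurable (borel_of_metric (hoelder_metric \<beta>))" for t
      by (rule borel_measurable_continuous_map[OF continuous_map_eval])
    show evM: "(\<lambda>f. eval f t) \<in> borel_measurable M'" for t
      using evc by (simp add: M'_def)
    show "integral\<^sup>L M' (\<lambda>f. cis (lincomb xs (eval f))) = exp (- quadform K xs / 2)" for xs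
    proof -
      have "(\<lambda>f. lincomb xs (eval f)) \<in> borel_measurable (borel_of_metric (hoelder_metric \<beta>))"
        by (rule lincomb_measurable) (rule evc)
      hence "(\<lambda>f. cis (lincomb xs (eval f))) \<in> borel_measurable (borel_of_metric (hoelder_metric \<beta>))"
        unfolding cis_conv_exp by measurable
      from integral_distr[OF Wm this] show ?thesis unfolding M'_def Wcis by simp
    qed
    show "hoelder_tight \<theta> \<gamma> M' (\<lambda>_ f. f)"
      unfolding hoelder_tight_def
    proof (intro allI impI)
      fix \<eta> :: real assume \<eta>: "\<eta> > 0"
      obtain n A where A: "A \<in> sets gauss_seq" "measure gauss_seq A \<le> \<eta>" "space gauss_seq - A \<subseteq> good n" using tight[OF \<eta>] by blast
      define R where "R = B * real n"
      have R: "R \<ge> 0" using B by (simp add: R_def)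
      define F where "F = {f \<in> hoelder_space \<beta>. f \<notin> hoelder_box \<theta> \<gamma> R}"
      have F: "F \<in> sets (borel_of_metric (hoelder_metric \<beta>))"
        using openin_complement_hoelder_box[of \<beta> \<theta> \<gamma> R] unfolding F_def by (auto simp: sets_borel_of_metric)
      have "measure M' F = measure gauss_seq (W -` F \<inter> space gauss_seq)"
        unfolding M'_def by (rule measure_distr[OF Wm F])
      also have "\<dots> \<le> measure gauss_seq A"
        by (rule P.finite_measure_mono[OF _ A(1)]) (use A(3) Wbox in \<open>auto simp: F_def R_def\<close>)
      also have "\<dots> \<le> \<eta>" by (rule A(2))
      finally have "measure M' F \<le> \<eta>" .
      moreover have "\<forall>f\<in>space M' - F. f \<in> hoelder_box \<theta> \<gamma> R" by (auto simp: spM' F_def)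
      ultimately show "\<exists>R\<ge>0. \<forall>n. \<exists>A\<in>sets M'. measure M' A \<le> \<eta> \<and> (\<forall>\<omega>\<in>space M' - A. \<omega> \<in> hoelder_box \<theta> \<gamma> R)"
        using R F by (intro exI[of _ R]) (auto simp: M'_def intro!: bexI[of _ F])
    qed
  qed
qed

section \<open>Partial sum processes of mixing arrays\<close>

text \<open>The series starts at time \<open>1\<close> while summands are indexed from
  \<open>0\<close>: here \<open>k\<close> stands for time \<open>Suc k\<close>, and likewise in
  \<open>future\<close>.\<close>

definition past :: "'a measure \<Rightarrow> (nat \<Rightarrow> 'a \<Rightarrow> 'b::topological_space) \<Rightarrow> nat \<Rightarrow> 'a measure" where
  "past M X k = sigma (space M) (\<Union>i\<in>{1..Suc k}. {X i -` A \<inter> space M | A. A \<in> sets borel})"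

definition future :: "'a measure \<Rightarrow> (nat \<Rightarrow> 'a \<Rightarrow> 'b::topological_space) \<Rightarrow> nat \<Rightarrow> 'a measure" where
  "future M X k = sigma (space M) (\<Union>i\<in>{Suc k..}. {X i -` A \<inter> space M | A. A \<in> sets borel})"

lemma sets_past: "sets (past M X k) = generated_events M X {1..Suc k}"
  unfolding past_def generated_events_def by (rule sets_measure_of) auto

lemma sets_future: "sets (future M X k) = generated_events M X {Suc k..}"
  unfolding future_def generated_events_def by (rule sets_measure_of) auto

lemma space_past [simp]: "space (past M X k) = space M"
  unfolding past_def by (rule space_measure_of) auto

lemma space_future [simp]: "space (future M X k) = space M"
  unfolding future_def by (rule space_measure_of) auto

lemma generated_events_mono: "I \<subseteq> J \<Longrightarrow> generated_events M X I \<subseteq> generated_events M X J"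
  unfolding generated_events_def by (intro sigma_sets_subseteq) blast

lemma generated_events_sets:
  assumes "\<And>i. i \<in> I \<Longrightarrow> X i \<in> measurable M borel" shows "generated_events M X I \<subseteq> sets M"
  unfolding generated_events_def
  by (rule sets.sigma_sets_subset) (use assms in \<open>auto intro: measurable_sets\<close>)

lemma measurable_past: "1 \<le> i \<Longrightarrow> i \<le> Suc k \<Longrightarrow> X i \<in> measurable (past M X k) borel"
proof (rule measurableI)
  fix A :: "'b set" assume i: "1 \<le> i" "i \<le> Suc k" and A: "A \<in> sets borel"
  have "X i -` A \<inter> space M \<in> generated_events M X {1..Suc k}"
    unfolding generated_events_def using i A by (intro sigma_sets.Basic UN_I[of i]) auto
  thus "X i -` A \<inter> space (past M X k) \<in> sets (past M X k)" by (simp add: sets_past)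
qed simp

lemma measurable_future: "Suc k \<le> i \<Longrightarrow> X i \<in> measurable (future M X k) borel"
proof (rule measurableI)
  fix A :: "'b set" assume i: "Suc k \<le> i" and A: "A \<in> sets borel"
  have "X i -` A \<inter> space M \<in> generated_events M X {Suc k..}"
    unfolding generated_events_def using i A by (intro sigma_sets.Basic UN_I[of i]) auto
  thus "X i -` A \<inter> space (future M X k) \<in> sets (future M X k)" by (simp add: sets_future)
qed simp

lemma (in prob_space) abs_cov_events_le_1: "\<bar>prob (A \<inter> B) - prob A * prob B\<bar> \<le> 1"
proof -
  have "0 \<le> prob A * prob B" "prob A * prob B \<le> 1" by (auto intro: mult_le_one)
  moreover have "0 \<le> prob (A \<inter> B)" "prob (A \<inter> B) \<le> 1" by auto
  ultimately show ?thesis by linarith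
qed

text \<open>A supremum of reals bounds the members of the family only if they are bounded above,
  which \<open>abs_cov_events_le_1\<close> guarantees.\<close>

lemma (in prob_space) cov_events_le_alpha:
  assumes "k \<ge> 1" "A \<in> generated_events M X {1..k}" "B \<in> generated_events M X {k + n..}"
  shows "\<bar>prob (A \<inter> B) - prob A * prob B\<bar> \<le> alpha_mixing_coeff M X n"
  unfolding alpha_mixing_coeff_def
  by (rule cSUP_upper2[of _ _ "(k, A, B)"])
    (use assms in \<open>auto intro!: bdd_aboveI2[where M = 1] abs_cov_events_le_1\<close>)

text \<open>The coefficient condition concerns lags \<open>n \<ge> 1\<close>. At lag
  \<open>0\<close> the trivial bound \<open>1\<close> is used instead, whence the constant
  \<open>max a 1\<close>.\<close>

lemma mixing_array_of_coeff:
  assumes "prob_space M" and X: "\<And>N n. n \<ge> 1 \<Longrightarrow> X N n \<in> measurable M borel"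
    and ab: "a > 0" "0 < b" "b < 1" and mix: "\<And>N n. n \<ge> 1 \<Longrightarrow> alpha_mixing_coeff M (X N) n \<le> a * b ^ n"
  shows "mixing_array M (\<lambda>N. past M (X N)) (\<lambda>N. future M (X N)) (max a 1) b"
proof -
  interpret prob_space M by fact
  show ?thesis
  proof
    show "subalgebra M (past M (X N) k)" for N k
      unfolding subalgebra_def sets_past using generated_events_sets[of "{1..Suc k}" "X N" M] X by auto
    show "subalgebra M (future M (X N) k)" for N k
      unfolding subalgebra_def sets_future using generated_events_sets[of "{Suc k..}" "X N" M] X by auto
    show "sets (past M (X N) k) \<subseteq> sets (past M (X N) l)" if "k \<le> l" for N k l
      unfolding sets_past using that by (intro generated_events_mono) auto
    show "sets (future M (X N) l) \<subseteq> sets (future M (X N) k)" if "k \<le> l" for N k l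
      unfolding sets_future using that by (intro generated_events_mono) auto
    fix A B N k n assume A: "A \<in> sets (past M (X N) k)" and B: "B \<in> sets (future M (X N) (k + n))"
    show "\<bar>prob (A \<inter> B) - prob A * prob B\<bar> \<le> max a 1 * b ^ n"
    proof (cases "n = 0")
      case True
      thus ?thesis using abs_cov_events_le_1[of A B] by simp
    next
      case False
      have "\<bar>prob (A \<inter> B) - prob A * prob B\<bar> \<le> alpha_mixing_coeff M (X N) n"
        by (rule cov_events_le_alpha[of "Suc k"]) (use A B in \<open>auto simp: sets_past sets_future\<close>)
      also have "\<dots> \<le> a * b ^ n" using False by (intro mix) auto
      also have "\<dots> \<le> max a 1 * b ^ n" using ab by (intro mult_right_mono) auto
      finally show ?thesis .
    qed
  qed (use ab in auto)
qed

lemma integrable_of_nn_integral_le: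
  fixes f :: "'a \<Rightarrow> real"
  assumes [measurable]: "f \<in> borel_measurable M" and f: "\<And>\<omega>. 0 \<le> f \<omega>" and le: "(\<integral>\<^sup>+\<omega>. ennreal (f \<omega>) \<partial>M) \<le> ennreal c" and c: "c \<ge> 0"
  shows "integrable M f" "integral\<^sup>L M f \<le> c"
proof -
  show i: "integrable M f"
    by (rule integrableI_nonneg) (use f le in \<open>auto intro: le_less_trans[OF _ ennreal_less_top]\<close>)
  have "ennreal (integral\<^sup>L M f) \<le> ennreal c"
    using nn_integral_eq_integral[OF i] f le by simp
  thus "integral\<^sup>L M f \<le> c" using c by simp
qed

lemma apply_bcontfun_measurable: "(\<lambda>e :: unit_interval \<Rightarrow>\<^sub>C real. apply_bcontfun e s) \<in> borel_measurable borel"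
  for s :: unit_interval
proof (rule borel_measurable_continuous_onI)
  show "continuous_on UNIV (\<lambda>e :: unit_interval \<Rightarrow>\<^sub>C real. apply_bcontfun e s)"
    unfolding continuous_on_iff
    by (auto intro!: exI intro: le_less_trans[OF dist_bounded])
qed

text \<open>The seminorm sees only interior points; boundary points are approached from inside, and
  continuity carries the bound over.\<close>

lemma hoelder_seminorm_bound:
  assumes fin: "hoelder_seminorm r e < \<infinity>" and r: "r > 0"
  shows "\<bar>apply_bcontfun e s - apply_bcontfun e t\<bar> \<le> enn2real (hoelder_seminorm r e) * \<bar>real_of_ui s - real_of_ui t\<bar> powr r"
proof -
  define L where "L = enn2real (hoelder_seminorm r e)"
  have L: "ennreal L = hoelder_seminorm r e" "L \<ge> 0" using fin by (auto simp: L_def less_top)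
  have inner: "\<bar>apply_bcontfun e s - apply_bcontfun e t\<bar> \<le> L * \<bar>real_of_ui s - real_of_ui t\<bar> powr r"
    if "0 < real_of_ui s" "real_of_ui s < 1" "0 < real_of_ui t" "real_of_ui t < 1" for s t
  proof -
    have *: "\<bar>apply_bcontfun e s - apply_bcontfun e t\<bar> \<le> L * \<bar>real_of_ui s - real_of_ui t\<bar> powr r"
      if "0 < real_of_ui s" "real_of_ui s < real_of_ui t" "real_of_ui t < 1" for s t
    proof -
      have "ennreal (\<bar>apply_bcontfun e s - apply_bcontfun e t\<bar> / \<bar>real_of_ui s - real_of_ui t\<bar> powr r) \<le> ennreal L"
        unfolding L(1) hoelder_seminorm_def by (rule SUP_upper2[of "(s, t)"]) (use that in auto)
      hence "\<bar>apply_bcontfun e s - apply_bcontfun e t\<bar> / \<bar>real_of_ui s - real_of_ui t\<bar> powr r \<le> L" using L(2) by simp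
      thus ?thesis using that by (simp add: pos_divide_le_eq)
    qed
    show ?thesis using *[of s t] *[of t s] that L(2)
      by (cases "real_of_ui s" "real_of_ui t" rule: linorder_cases) (auto simp: abs_minus_commute real_of_ui_inject)
  qed
  \<comment> \<open>The convex combination with the midpoint \<open>1/2\<close>, of weight
    \<open>1 / real (n + 3)\<close>, moves every point into the interior.\<close>
  define \<tau> where "\<tau> n s = ui_of_real ((1 - 1 / real (n + 3)) * real_of_ui s + 1 / real (n + 3) * (1/2))" for n :: nat and s
  have \<tau>val: "real_of_ui (\<tau> n s) = (1 - 1 / real (n + 3)) * real_of_ui s + 1 / real (n + 3) * (1/2)"
    and \<tau>in: "0 < real_of_ui (\<tau> n s)" "real_of_ui (\<tau> n s) < 1" for n s
  proof -
    define z where "z = (1::real) / real (n + 3)"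
    have z: "0 < z" "z < 1" by (auto simp: z_def)
    have 1: "0 \<le> (1 - z) * real_of_ui s" "(1 - z) * real_of_ui s \<le> (1 - z) * 1"
      using z by (auto intro!: mult_left_mono)
    have "(1 - z) * real_of_ui s + z * (1/2) \<le> 1 - z + z * (1/2)" using 1(2) by simp
    hence 2: "0 < (1 - z) * real_of_ui s + z * (1/2)" "(1 - z) * real_of_ui s + z * (1/2) < 1"
      using 1(1) z(1) by auto
    show v: "real_of_ui (\<tau> n s) = (1 - 1 / real (n + 3)) * real_of_ui s + 1 / real (n + 3) * (1/2)"
      unfolding \<tau>_def z_def[symmetric] using 2 by (intro real_of_ui_of_real) auto
    show "0 < real_of_ui (\<tau> n s)" "real_of_ui (\<tau> n s) < 1" unfolding v z_def[symmetric] by (rule 2)+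
  qed
  have z0: "(\<lambda>n. 1 / real (n + 3)) \<longlonglongrightarrow> 0"
    using LIMSEQ_ignore_initial_segment[OF lim_1_over_n, of 3] by simp
  have lim_r: "(\<lambda>n. real_of_ui (\<tau> n s)) \<longlonglongrightarrow> real_of_ui s" for s
  proof -
    have "(\<lambda>n. (1 - 1 / real (n + 3)) * real_of_ui s + 1 / real (n + 3) * (1/2)) \<longlonglongrightarrow> (1 - 0) * real_of_ui s + 0 * (1/2)"
      by (intro tendsto_intros z0)
    thus ?thesis unfolding \<tau>val by simp
  qed
  have lim: "(\<lambda>n. \<tau> n s) \<longlonglongrightarrow> s" for s
    using lim_r[of s] unfolding lim_sequentially by (simp add: dist_unit_interval_def dist_real_def)
  have lime: "(\<lambda>n. apply_bcontfun e (\<tau> n s)) \<longlonglongrightarrow> apply_bcontfun e s" for s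
    by (rule continuous_on_tendsto_compose[of UNIV "apply_bcontfun e", OF _ lim]) auto
  show ?thesis
    unfolding L_def[symmetric]
  proof (rule LIMSEQ_le)
    show "(\<lambda>n. \<bar>apply_bcontfun e (\<tau> n s) - apply_bcontfun e (\<tau> n t)\<bar>) \<longlonglongrightarrow> \<bar>apply_bcontfun e s - apply_bcontfun e t\<bar>"
      by (intro tendsto_intros lime)
    show "(\<lambda>n. L * \<bar>real_of_ui (\<tau> n s) - real_of_ui (\<tau> n t)\<bar> powr r) \<longlonglongrightarrow> L * \<bar>real_of_ui s - real_of_ui t\<bar> powr r"
      by (intro tendsto_mult tendsto_const tendsto_powr' tendsto_rabs tendsto_diff lim_r) (use r in auto)
    show "\<exists>N. \<forall>n\<ge>N. \<bar>apply_bcontfun e (\<tau> n s) - apply_bcontfun e (\<tau> n t)\<bar> \<le> L * \<bar>real_of_ui (\<tau> n s) - real_of_ui (\<tau> n t)\<bar> powr r"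
      using inner \<tau>in by blast
  qed
qed

text \<open>In this form \<open>x\<close> enters only through the weights and the index set is
  fixed, so increments in time are weighted sums. At the right endpoint the term with
  \<open>e (N + 1)\<close> has weight \<open>0\<close> and disappears.\<close>

lemma partial_sum_process_clamp:
  "partial_sum_process N e x = (\<Sum>i<N. ((1 / sqrt N) * clamp01 (real N * real_of_ui x - real i)) *\<^sub>R e (Suc i))"
proof (cases "N = 0")
  case True
  thus ?thesis by (simp add: partial_sum_process_def)
next
  case False
  define y where "y = real N * real_of_ui x"
  have y: "0 \<le> y" "y \<le> real N" by (auto simp: y_def mult_left_le)
  define k where "k = nat \<lfloor>y\<rfloor>"
  have pw: "real N powr (-1/2) = 1 / sqrt N"
    using False by (simp add: powr_minus_divide powr_half_sqrt[symmetric] minus_divide_left[symmetric])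
  have yk: "\<lfloor>y\<rfloor> = int k" using y by (simp add: k_def)
  have last: "(y - of_int \<lfloor>y\<rfloor>) *\<^sub>R e (k + 1) = (if k < N then (y - real k) *\<^sub>R e (Suc k) else 0)"
  proof (cases "k < N")
    case False
    have "real k \<le> y" using y by (simp add: k_def)
    hence "y = real k" using False y by (simp add: not_less)
    thus ?thesis using False yk by simp
  qed (simp add: yk)
  have "partial_sum_process N e x = (1 / sqrt N) *\<^sub>R ((\<Sum>i=1..k. e i) + (y - of_int \<lfloor>y\<rfloor>) *\<^sub>R e (k + 1))"
    unfolding partial_sum_process_def pw y_def[symmetric] k_def by (simp add: scaleR_add_right y_def mult.commute)
  also have "(\<Sum>i=1..k. e i) = (\<Sum>i<k. e (Suc i))"
    by (rule sum.reindex_bij_witness[of _ Suc "\<lambda>i. i - 1"]) auto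
  also have "(\<Sum>i<k. e (Suc i)) + (y - of_int \<lfloor>y\<rfloor>) *\<^sub>R e (k + 1) = (\<Sum>i<N. clamp01 (y - real i) *\<^sub>R e (Suc i))"
    unfolding last by (rule sum_clamp01[OF y k_def, symmetric])
  finally show ?thesis by (simp add: scaleR_sum_right y_def)
qed

lemma partial_sum_process_hoelder:
  fixes e :: "nat \<Rightarrow> 'b::real_normed_vector"
  assumes "0 \<le> \<beta>" "\<beta> < 1" shows "partial_sum_process N e \<in> hoelder_space \<beta>"
proof -
  define A where "A = (\<Sum>i<N. (1 / sqrt N) * norm (e (Suc i)))"
  have A: "A \<ge> 0" by (auto simp: A_def intro!: sum_nonneg)
  show ?thesis
  proof (rule lipschitz_hoelder(1)[OF _ _ A _ assms])
    show "norm (partial_sum_process N e x) \<le> A" for x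
      unfolding partial_sum_process_clamp A_def
      by (intro order_trans[OF norm_sum] sum_mono)
        (auto simp: clamp01_bounds intro!: mult_left_le_one_le divide_right_mono)
    show "norm (partial_sum_process N e y - partial_sum_process N e x) \<le> (A * real N) * \<bar>real_of_ui y - real_of_ui x\<bar>" for x y
    proof -
      have "partial_sum_process N e y - partial_sum_process N e x
        = (\<Sum>i<N. ((1 / sqrt N) * (clamp01 (real N * real_of_ui y - real i) - clamp01 (real N * real_of_ui x - real i))) *\<^sub>R e (Suc i))"
        unfolding partial_sum_process_clamp sum_subtractf[symmetric] scaleR_left_diff_distrib[symmetric] right_diff_distrib ..
      also have "norm \<dots> \<le> (\<Sum>i<N. ((1 / sqrt N) * (real N * \<bar>real_of_ui y - real_of_ui x\<bar>)) * norm (e (Suc i)))"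
      proof (intro order_trans[OF norm_sum] sum_mono)
        fix i
        have "\<bar>clamp01 (real N * real_of_ui y - real i) - clamp01 (real N * real_of_ui x - real i)\<bar> \<le> real N * \<bar>real_of_ui y - real_of_ui x\<bar>"
          by (rule order_trans[OF clamp01_lipschitz]) (simp add: abs_mult flip: right_diff_distrib)
        hence "\<bar>(1 / sqrt N) * (clamp01 (real N * real_of_ui y - real i) - clamp01 (real N * real_of_ui x - real i))\<bar>
           \<le> (1 / sqrt N) * (real N * \<bar>real_of_ui y - real_of_ui x\<bar>)"
          unfolding abs_mult by (intro mult_mono) auto
        thus "norm (((1 / sqrt N) * (clamp01 (real N * real_of_ui y - real i) - clamp01 (real N * real_of_ui x - real i))) *\<^sub>R e (Suc i))
          \<le> ((1 / sqrt N) * (real N * \<bar>real_of_ui y - real_of_ui x\<bar>)) * norm (e (Suc i))"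
          unfolding norm_scaleR by (intro mult_right_mono) auto
      qed
      finally show ?thesis by (simp add: A_def sum_distrib_left sum_distrib_right mult_ac)
    qed
  qed (use A in auto)
qed

lemma eval_partial_sum_process:
  "eval (partial_sum_process N e) (x, s) = (\<Sum>i<N. clamp01 (real N * real_of_ui x - real i) * apply_bcontfun (e (Suc i)) s) / sqrt N"
  unfolding eval_def partial_sum_process_clamp
  by (simp add: apply_bcontfun_sum scaleR_bcontfun.rep_eq sum_divide_distrib)

lemma card_nat_between:
  fixes u v :: real assumes "u \<le> v"
  shows "finite {i::nat. u < real i \<and> real i < v}" "real (card {i::nat. u < real i \<and> real i < v}) \<le> v - u + 1"
proof -
  let ?S = "{i::nat. u < real i \<and> real i < v}"
  have sub: "int ` ?S \<subseteq> {\<lfloor>u\<rfloor> + 1..\<lceil>v\<rceil> - 1}"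
  proof safe
    fix i :: nat assume i: "u < real i" "real i < v"
    have "\<lfloor>u\<rfloor> < int i" using i by (simp add: floor_less_iff)
    moreover have "int i < \<lceil>v\<rceil>" using i by (simp add: less_ceiling_iff)
    ultimately show "int i \<in> {\<lfloor>u\<rfloor> + 1..\<lceil>v\<rceil> - 1}" by simp
  qed
  have fin: "finite (int ` ?S)" by (rule finite_subset[OF sub]) simp
  thus "finite ?S" by (rule finite_imageD) simp
  have "card ?S = card (int ` ?S)" by (simp add: card_image)
  also have "\<dots> \<le> card {\<lfloor>u\<rfloor> + 1..\<lceil>v\<rceil> - 1}" by (rule card_mono[OF _ sub]) simp
  finally have "card ?S \<le> nat (\<lceil>v\<rceil> - 1 - \<lfloor>u\<rfloor>)" by simp
  hence "real (card ?S) \<le> real (nat (\<lceil>v\<rceil> - 1 - \<lfloor>u\<rfloor>))" by (rule of_nat_mono)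
  also have "real (nat (\<lceil>v\<rceil> - 1 - \<lfloor>u\<rfloor>)) = max 0 (real_of_int (\<lceil>v\<rceil> - 1 - \<lfloor>u\<rfloor>))" by simp
  also have "\<dots> \<le> v - u + 1" using assms ceiling_correct[of v] floor_correct[of u] by simp linarith
  finally show "real (card ?S) \<le> v - u + 1" .
qed

section \<open>Moments of weighted increments\<close>

context mixing_array
begin

lemma moments_le_mult:
  assumes Y: "moments_le p \<kappa> Y" and w: "\<And>i. \<bar>w i\<bar> \<le> l" and l: "l \<ge> 0" and \<kappa>: "\<kappa> > 0" and p: "p > 0"
  shows "moments_le p (l * \<kappa>) (\<lambda>i \<omega>. w i * Y i \<omega>)"
  unfolding moments_le_def
proof (intro allI conjI)
  fix i
  have eq: "\<bar>w i * Y i \<omega>\<bar> powr p = \<bar>w i\<bar> powr p * \<bar>Y i \<omega>\<bar> powr p" for \<omega> by (simp add: abs_mult powr_mult)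
  have Yi: "integrable M (\<lambda>\<omega>. \<bar>Y i \<omega>\<bar> powr p)" "expectation (\<lambda>\<omega>. \<bar>Y i \<omega>\<bar> powr p) \<le> \<kappa> powr p" "expectation (Y i) = 0"
    using Y by (auto simp: moments_le_def)
  show "integrable M (\<lambda>\<omega>. \<bar>w i * Y i \<omega>\<bar> powr p)" unfolding eq using Yi by simp
  have "expectation (\<lambda>\<omega>. \<bar>w i * Y i \<omega>\<bar> powr p) = \<bar>w i\<bar> powr p * expectation (\<lambda>\<omega>. \<bar>Y i \<omega>\<bar> powr p)" unfolding eq by simp
  also have "\<dots> \<le> l powr p * \<kappa> powr p"
    using Yi w[of i] p by (intro mult_mono powr_mono2) auto
  also have "\<dots> = (l * \<kappa>) powr p" using l \<kappa> by (simp add: powr_mult)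
  finally show "expectation (\<lambda>\<omega>. \<bar>w i * Y i \<omega>\<bar> powr p) \<le> (l * \<kappa>) powr p" .
  show "expectation (\<lambda>\<omega>. w i * Y i \<omega>) = 0" using Yi by simp
qed

lemma adapted_weighted: "adapted N Y \<Longrightarrow> adapted N (\<lambda>i \<omega>. w i * Y i \<omega>)"
  unfolding adapted_def by (intro allI conjI borel_measurable_times borel_measurable_const) auto

text \<open>With \<open>D\<close> the length of the time interval, the weights are at most
  \<open>l = min 1 (n * D)\<close> and vanish off at most \<open>n * D + 2\<close> indices. The
  moment is governed by \<open>l\<^sup>2 * card I \<le> 3 * (n * D)\<close>: if
  \<open>n * D \<ge> 1\<close>, the count is at most \<open>3 * (n * D)\<close>; otherwise it is at
  most \<open>3\<close> and \<open>l\<^sup>2 \<le> l \<le> n * D\<close>.\<close>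

lemma increment_moment:
  assumes p: "real (2 * k) < p" and k: "k > 0"
  shows "\<exists>C\<ge>0. \<forall>N Y \<kappa> (n::nat) x y. adapted N Y \<longrightarrow> moments_le p \<kappa> Y \<longrightarrow> \<kappa> > 0 \<longrightarrow> n > 0 \<longrightarrow> real_of_ui x < real_of_ui y \<longrightarrow>
    integrable M (\<lambda>\<omega>. ((\<Sum>i<n. (clamp01 (real n * real_of_ui y - real i) - clamp01 (real n * real_of_ui x - real i)) * Y i \<omega>) / sqrt n) ^ (2 * k)) \<and>
    expectation (\<lambda>\<omega>. ((\<Sum>i<n. (clamp01 (real n * real_of_ui y - real i) - clamp01 (real n * real_of_ui x - real i)) * Y i \<omega>) / sqrt n) ^ (2 * k))
      \<le> C * \<kappa> ^ (2 * k) * (real_of_ui y - real_of_ui x) ^ k"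
proof -
  obtain C where C: "C \<ge> 0" and mom: "\<And>N Y I \<kappa>. adapted N Y \<Longrightarrow> moments_le p \<kappa> Y \<Longrightarrow> \<kappa> > 0 \<Longrightarrow> finite I \<Longrightarrow>
      integrable M (\<lambda>\<omega>. (\<Sum>i\<in>I. Y i \<omega>) ^ (2 * k)) \<and>
      expectation (\<lambda>\<omega>. (\<Sum>i\<in>I. Y i \<omega>) ^ (2 * k)) \<le> C * \<kappa> ^ (2 * k) * real (card I) ^ ((2 * k) div 2)"
    by (rule moment_sum_le[OF p]) blast
  show ?thesis
  proof (intro exI[of _ "C * 3 ^ k"] conjI allI impI)
    show "0 \<le> C * 3 ^ k" using C by simp
    fix N Y \<kappa> x y and n :: nat
    assume Y: "adapted N Y" "moments_le p \<kappa> Y" "\<kappa> > 0" and n: "n > 0" and xy: "real_of_ui x < real_of_ui y"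
    define D where "D = real_of_ui y - real_of_ui x"
    have D: "D > 0" using xy by (simp add: D_def)
    define w where "w i = clamp01 (real n * real_of_ui y - real i) - clamp01 (real n * real_of_ui x - real i)" for i
    have w0: "w i \<ge> 0" for i unfolding w_def using xy n by (simp add: clamp01_mono)
    have w1: "w i \<le> 1" for i unfolding w_def using clamp01_bounds[of "real n * real_of_ui y - real i"] clamp01_bounds[of "real n * real_of_ui x - real i"] by linarith
    have wD: "w i \<le> real n * D" for i
      using clamp01_lipschitz[of "real n * real_of_ui y - real i" "real n * real_of_ui x - real i"] xy n
      unfolding w_def D_def by (simp add: abs_le_iff right_diff_distrib)
    define l where "l = min 1 (real n * D)"
    have l: "l > 0" "l \<le> 1" "l \<le> real n * D" using n D by (auto simp: l_def)
    have wl: "\<bar>w i\<bar> \<le> l" for i using w0[of i] w1[of i] wD[of i] by (simp add: l_def)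
    define I where "I = {i::nat. real n * real_of_ui x - 1 < real i \<and> real i < real n * real_of_ui y}"
    have le: "real n * real_of_ui x - 1 \<le> real n * real_of_ui y" using xy n by (simp add: mult_left_mono add_increasing2 less_imp_le diff_le_eq)
    have I: "finite I" "real (card I) \<le> real n * D + 2"
      using card_nat_between[OF le] by (auto simp: I_def D_def right_diff_distrib)
    have In: "I \<subseteq> {..<n}"
    proof
      fix i assume "i \<in> I"
      hence "real i < real n * real_of_ui y" by (simp add: I_def)
      also have "\<dots> \<le> real n" by (simp add: mult_left_le)
      finally show "i \<in> {..<n}" by simp
    qed
    have wI: "w i = 0" if "i \<notin> I" for i
    proof (cases "real i < real n * real_of_ui y")
      case True
      hence "real i \<le> real n * real_of_ui x - 1" using that by (auto simp: I_def)
      moreover have "real n * real_of_ui x \<le> real n * real_of_ui y" using xy by (simp add: mult_left_mono)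
      ultimately show ?thesis by (simp add: w_def clamp01_def)
    next
      case False
      moreover have "real n * real_of_ui x \<le> real n * real_of_ui y" using xy by (simp add: mult_left_mono)
      ultimately show ?thesis by (simp add: w_def clamp01_def)
    qed
    have sumI: "(\<Sum>i<n. w i * Y i \<omega>) = (\<Sum>i\<in>I. w i * Y i \<omega>)" for \<omega>
      using In wI by (intro sum.mono_neutral_right) auto
    have p0: "p > 0" using p by linarith
    have m: "integrable M (\<lambda>\<omega>. (\<Sum>i\<in>I. w i * Y i \<omega>) ^ (2 * k))"
      "expectation (\<lambda>\<omega>. (\<Sum>i\<in>I. w i * Y i \<omega>) ^ (2 * k)) \<le> C * (l * \<kappa>) ^ (2 * k) * real (card I) ^ k"
      using mom[OF adapted_weighted[OF Y(1)] moments_le_mult[OF Y(2) wl _ Y(3) p0] _ I(1)] l Y(3) by auto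
    have pow: "(v / sqrt n) ^ (2 * k) = v ^ (2 * k) / real n ^ k" for v
      by (simp add: power_divide power_mult)
    have card: "l ^ (2 * k) * real (card I) ^ k \<le> 3 ^ k * (real n * D) ^ k"
    proof -
      have "l\<^sup>2 * real (card I) \<le> 3 * (real n * D)"
      proof (cases "real n * D \<ge> 1")
        case True
        have "l\<^sup>2 * real (card I) \<le> 1 * (real n * D + 2)" using l I by (intro mult_mono) (auto simp: power_le_one)
        thus ?thesis using True by simp
      next
        case False
        have "l\<^sup>2 * real (card I) \<le> l\<^sup>2 * 3" using I False by (intro mult_left_mono) auto
        also have "l\<^sup>2 \<le> l * 1" unfolding power2_eq_square using l by (intro mult_left_mono) auto
        finally show ?thesis using l by simp
      qed
      hence "(l\<^sup>2 * real (card I)) ^ k \<le> (3 * (real n * D)) ^ k" using l by (intro power_mono) auto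
      thus ?thesis by (simp add: power_mult_distrib power_mult)
    qed
    have "expectation (\<lambda>\<omega>. ((\<Sum>i<n. w i * Y i \<omega>) / sqrt n) ^ (2 * k)) = expectation (\<lambda>\<omega>. (\<Sum>i\<in>I. w i * Y i \<omega>) ^ (2 * k)) / real n ^ k"
      unfolding sumI pow by simp
    also have "\<dots> \<le> (C * (l * \<kappa>) ^ (2 * k) * real (card I) ^ k) / real n ^ k" by (intro divide_right_mono m) simp
    also have "\<dots> = (C * \<kappa> ^ (2 * k)) * (l ^ (2 * k) * real (card I) ^ k) / real n ^ k" by (simp add: power_mult_distrib)
    also have "\<dots> \<le> (C * \<kappa> ^ (2 * k)) * (3 ^ k * (real n * D) ^ k) / real n ^ k"
      using C Y(3) by (intro divide_right_mono mult_left_mono card) auto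
    also have "\<dots> = C * 3 ^ k * \<kappa> ^ (2 * k) * D ^ k" using n by (simp add: power_mult_distrib)
    finally show "expectation (\<lambda>\<omega>. ((\<Sum>i<n. (clamp01 (real n * real_of_ui y - real i) - clamp01 (real n * real_of_ui x - real i)) * Y i \<omega>) / sqrt n) ^ (2 * k))
      \<le> C * 3 ^ k * \<kappa> ^ (2 * k) * (real_of_ui y - real_of_ui x) ^ k" unfolding w_def D_def .
    have "integrable M (\<lambda>\<omega>. ((\<Sum>i<n. w i * Y i \<omega>) / sqrt n) ^ (2 * k))" unfolding sumI pow using m(1) by simp
    thus "integrable M (\<lambda>\<omega>. ((\<Sum>i<n. (clamp01 (real n * real_of_ui y - real i) - clamp01 (real n * real_of_ui x - real i)) * Y i \<omega>) / sqrt n) ^ (2 * k))"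
      unfolding w_def .
  qed
qed

end

section \<open>Convergence of the partial sum process\<close>

lemma integral_lincomb:
  assumes "\<And>t. t \<in> snd ` set xs \<Longrightarrow> integrable M (\<lambda>\<omega>. g \<omega> t)"
  shows "integrable M (\<lambda>\<omega>. lincomb xs (g \<omega>))" "integral\<^sup>L M (\<lambda>\<omega>. lincomb xs (g \<omega>)) = lincomb xs (\<lambda>t. integral\<^sup>L M (\<lambda>\<omega>. g \<omega> t))"
proof -
  have "integrable M (\<lambda>\<omega>. lincomb xs (g \<omega>)) \<and> integral\<^sup>L M (\<lambda>\<omega>. lincomb xs (g \<omega>)) = lincomb xs (\<lambda>t. integral\<^sup>L M (\<lambda>\<omega>. g \<omega> t))"
    using assms
  proof (induction xs)
    case (Cons p xs)
    obtain a t where p: "p = (a, t)" by (cases p)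
    have "integrable M (\<lambda>\<omega>. g \<omega> t)" using Cons.prems[of t] by (simp add: p)
    moreover have "integrable M (\<lambda>\<omega>. lincomb xs (g \<omega>)) \<and> integral\<^sup>L M (\<lambda>\<omega>. lincomb xs (g \<omega>)) = lincomb xs (\<lambda>t. integral\<^sup>L M (\<lambda>\<omega>. g \<omega> t))"
      by (rule Cons.IH) (use Cons.prems in auto)
    ultimately show ?case by (simp add: p)
  qed simp
  thus "integrable M (\<lambda>\<omega>. lincomb xs (g \<omega>))" "integral\<^sup>L M (\<lambda>\<omega>. lincomb xs (g \<omega>)) = lincomb xs (\<lambda>t. integral\<^sup>L M (\<lambda>\<omega>. g \<omega> t))" by auto
qed

lemma abs_lincomb_le: "(\<And>t. \<bar>g t\<bar> \<le> B) \<Longrightarrow> \<bar>lincomb xs g\<bar> \<le> (\<Sum>(a, t)\<leftarrow>xs. \<bar>a\<bar>) * B"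
proof (induction xs)
  case (Cons p xs)
  obtain a t where p: "p = (a, t)" by (cases p)
  have "\<bar>a * g t + lincomb xs g\<bar> \<le> \<bar>a\<bar> * \<bar>g t\<bar> + \<bar>lincomb xs g\<bar>"
    by (rule order_trans[OF abs_triangle_ineq]) (simp add: abs_mult)
  also have "\<dots> \<le> \<bar>a\<bar> * B + (\<Sum>(a, t)\<leftarrow>xs. \<bar>a\<bar>) * B"
    using Cons by (intro add_mono mult_left_mono) auto
  finally show ?case by (simp add: p distrib_right)
qed simp

lemma lincomb_mult_right: "lincomb xs g * c = lincomb xs (\<lambda>t. g t * c)"
  by (induction xs) (auto simp: algebra_simps)

lemma lincomb_square: "(lincomb xs g)\<^sup>2 = quadform (\<lambda>s t. g s * g t) xs"
proof -
  have "quadform (\<lambda>s t. g s * g t) xs = lincomb xs (\<lambda>s. lincomb xs (\<lambda>t. g t * g s))"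
    unfolding quadform_lincomb by (simp add: mult.commute)
  also have "\<dots> = lincomb xs (\<lambda>s. g s * lincomb xs g)"
  proof (rule lincomb_cong)
    fix s
    show "lincomb xs (\<lambda>t. g t * g s) = g s * lincomb xs g"
      by (subst mult.commute) (rule lincomb_mult_right[symmetric])
  qed
  also have "\<dots> = (lincomb xs g)\<^sup>2" by (simp only: power2_eq_square lincomb_mult_right)
  finally show ?thesis ..
qed

lemma psd_kernel_of_quadform:
  assumes sym: "\<And>s t. K s t = K t s" and nonneg: "\<And>xs. 0 \<le> quadform K xs"
  shows "psd_kernel K"
  unfolding psd_kernel_def
proof (intro conjI allI impI)
  fix F :: "'a set" and a :: "'a \<Rightarrow> real" assume "finite F"
  then obtain l where l: "set l = F" "distinct l" using finite_distinct_list by blast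
  have "(\<Sum>s\<in>F. \<Sum>t\<in>F. a s * a t * K s t) = quadform K (map (\<lambda>t. (a t, t)) l)"
    unfolding quadform_lincomb lincomb_eq_sum[OF l(2)] l(1) by (simp add: sum_distrib_left mult.assoc)
  thus "0 \<le> (\<Sum>s\<in>F. \<Sum>t\<in>F. a s * a t * K s t)" using nonneg by simp
qed (rule sym)

definition process_moments :: "'a measure \<Rightarrow> nat \<Rightarrow> real \<Rightarrow> real \<Rightarrow> ('a \<Rightarrow> unit_interval \<times> unit_interval \<Rightarrow> real) \<Rightarrow> bool" where
  "process_moments M k r C Z \<longleftrightarrow> (\<forall>x y s t. real_of_ui x < real_of_ui y \<longrightarrow>
    power_moment_le M (2 * k) (\<lambda>\<omega>. lincomb (edge_list x y) (Z \<omega>)) (C * (real_of_ui y - real_of_ui x) ^ k) \<and>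
    (real_of_ui s < real_of_ui t \<longrightarrow> power_moment_le M (2 * k) (\<lambda>\<omega>. lincomb (rect_list x y s t) (Z \<omega>))
      (C * (real_of_ui y - real_of_ui x) ^ k * (real_of_ui t - real_of_ui s) powr (real (2 * k) * r))))"

lemma process_moments_dyadic:
  assumes "process_moments M k r C Z" shows "dyadic_moments M (2 * k) r C Z"
proof -
  have swap: "((1/2::real) ^ m) ^ k = (2 powr - (real (2 * k) * (1/2))) ^ m" for m
  proof -
    have "((1/2::real) ^ m) ^ k = ((1/2) ^ m) powr real k" by (rule powr_realpow[symmetric]) simp
    also have "\<dots> = (2 powr - real k) ^ m" by (rule half_power_powr)
    finally show ?thesis by simp
  qed
  have lt: "real_of_ui (dyadic_ui m i) < real_of_ui (dyadic_ui m (Suc i))" if "i < 2 ^ m" for m i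
    using dyadic_ui_diff[OF that] zero_less_power[of "1/2::real" m] by linarith
  note mom = assms[unfolded process_moments_def, rule_format]
  show ?thesis
    unfolding dyadic_moments_def
  proof (intro conjI allI impI)
    fix m n i j :: nat assume i: "i < 2 ^ m"
    show "power_moment_le M (2 * k) (\<lambda>\<omega>. lincomb (edge_list (dyadic_ui m i) (dyadic_ui m (Suc i))) (Z \<omega>))
      (C * (2 powr - (real (2 * k) * (1/2))) ^ m)"
      using conjunct1[OF mom[OF lt[OF i]]] unfolding dyadic_ui_diff[OF i] swap .
    assume j: "j < 2 ^ n"
    show "power_moment_le M (2 * k)
      (\<lambda>\<omega>. lincomb (rect_list (dyadic_ui m i) (dyadic_ui m (Suc i)) (dyadic_ui n j) (dyadic_ui n (Suc j))) (Z \<omega>))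
      (C * (2 powr - (real (2 * k) * (1/2))) ^ m * (2 powr - (real (2 * k) * r)) ^ n)"
      using conjunct2[OF assms[unfolded process_moments_def, THEN spec, THEN spec, THEN spec, THEN spec, THEN mp, OF lt[OF i]], THEN mp, OF lt[OF j]]
      unfolding dyadic_ui_diff[OF i] dyadic_ui_diff[OF j] swap half_power_powr .
  qed
qed

section \<open>The setting of the theorem\<close>

text \<open>Both suprema of moments are replaced by one real bound \<open>H\<close>, and all rows
  are treated alike. The condition \<open>p > 4\<close> makes fourth moments of blocks available to
  the limit theorem.\<close>

locale hoelder_mixing = prob_space M for M :: "'a measure" +
  fixes X :: "nat \<Rightarrow> nat \<Rightarrow> 'a \<Rightarrow> (unit_interval \<Rightarrow>\<^sub>C real)" and p r a b H :: real
  assumes X_meas: "\<And>N n. n \<ge> 1 \<Longrightarrow> X N n \<in> measurable M borel"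
    and X_centered: "\<And>N n s. n \<ge> 1 \<Longrightarrow> (\<integral>\<omega>. apply_bcontfun (X N n \<omega>) s \<partial>M) = 0"
    and p: "p > 4" and r: "r > 0" and H: "H > 0"
    and norm_moment: "\<And>N n. n \<ge> 1 \<Longrightarrow> (\<integral>\<^sup>+\<omega>. ennreal (norm (X N n \<omega>) powr p) \<partial>M) \<le> ennreal H"
    and seminorm_moment: "\<And>N n. n \<ge> 1 \<Longrightarrow> (\<integral>\<^sup>+\<omega>. enn_powr (hoelder_seminorm r (X N n \<omega>)) p \<partial>M) \<le> ennreal H"
    and ab: "a > 0" "0 < b" "b < 1"
    and X_mixing: "\<And>N n. n \<ge> 1 \<Longrightarrow> alpha_mixing_coeff M (X N) n \<le> a * b ^ n"

sublocale hoelder_mixing \<subseteq> mix: mixing_array M "\<lambda>N. past M (X N)" "\<lambda>N. future M (X N)" "max a 1" b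
  by (rule mixing_array_of_coeff[OF prob_space_axioms X_meas ab X_mixing])

context hoelder_mixing
begin

abbreviation "P N \<omega> \<equiv> partial_sum_process N (\<lambda>n. X N n \<omega>)"

definition "\<kappa> = H powr (1 / p)"

lemma \<kappa>: "\<kappa> > 0" "\<kappa> powr p = H"
  using H p by (auto simp: \<kappa>_def powr_powr)

lemma adapted_coord:
  assumes "\<And>i. f i \<in> borel_measurable borel" shows "mix.adapted N (\<lambda>i \<omega>. f i (X N (Suc i) \<omega>))"
  unfolding mix.adapted_def
proof (intro allI conjI)
  fix i
  show "(\<lambda>\<omega>. f i (X N (Suc i) \<omega>)) \<in> borel_measurable (past M (X N) i)"
    by (rule measurable_compose[OF measurable_past assms]) auto
  show "(\<lambda>\<omega>. f i (X N (Suc i) \<omega>)) \<in> borel_measurable (future M (X N) i)"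
    by (rule measurable_compose[OF measurable_future assms]) auto
qed

lemma coord_measurable: "f \<in> borel_measurable borel \<Longrightarrow> (\<lambda>\<omega>. f (X N (Suc i) \<omega>)) \<in> borel_measurable M"
  by (rule measurable_compose[OF X_meas]) auto

lemma moments_coord:
  assumes f: "\<And>i. f i \<in> borel_measurable borel" and A: "A > 0" and le: "\<And>i e. \<bar>f i e\<bar> \<le> A * norm e"
    and zero: "\<And>i. expectation (\<lambda>\<omega>. f i (X N (Suc i) \<omega>)) = 0"
  shows "mix.moments_le p (A * \<kappa>) (\<lambda>i \<omega>. f i (X N (Suc i) \<omega>))"
  unfolding mix.moments_le_def
proof (intro allI conjI)
  fix i
  have m: "(\<lambda>\<omega>. \<bar>f i (X N (Suc i) \<omega>)\<bar> powr p) \<in> borel_measurable M"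
    using coord_measurable[OF f] by measurable
  have Am: "(A * \<kappa>) powr p = A powr p * H" using A \<kappa> by (simp add: powr_mult)
  have "(\<integral>\<^sup>+\<omega>. ennreal (\<bar>f i (X N (Suc i) \<omega>)\<bar> powr p) \<partial>M) \<le> (\<integral>\<^sup>+\<omega>. ennreal (A powr p) * ennreal (norm (X N (Suc i) \<omega>) powr p) \<partial>M)"
  proof (rule nn_integral_mono)
    fix \<omega>
    have "\<bar>f i (X N (Suc i) \<omega>)\<bar> powr p \<le> (A * norm (X N (Suc i) \<omega>)) powr p"
      using le p by (intro powr_mono2) auto
    also have "\<dots> = A powr p * norm (X N (Suc i) \<omega>) powr p" using A by (simp add: powr_mult)
    finally show "ennreal (\<bar>f i (X N (Suc i) \<omega>)\<bar> powr p) \<le> ennreal (A powr p) * ennreal (norm (X N (Suc i) \<omega>) powr p)"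
      by (simp add: ennreal_mult'[symmetric])
  qed
  also have "\<dots> = ennreal (A powr p) * (\<integral>\<^sup>+\<omega>. ennreal (norm (X N (Suc i) \<omega>) powr p) \<partial>M)"
  proof (rule nn_integral_cmult)
    have "(\<lambda>\<omega>. norm (X N (Suc i) \<omega>)) \<in> borel_measurable M"
      by (rule measurable_compose[OF X_meas borel_measurable_norm]) simp
    thus "(\<lambda>\<omega>. ennreal (norm (X N (Suc i) \<omega>) powr p)) \<in> borel_measurable M" by measurable
  qed
  also have "\<dots> \<le> ennreal (A powr p) * ennreal H" by (intro mult_left_mono norm_moment) auto
  finally have 1: "(\<integral>\<^sup>+\<omega>. ennreal (\<bar>f i (X N (Suc i) \<omega>)\<bar> powr p) \<partial>M) \<le> ennreal ((A * \<kappa>) powr p)"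
    unfolding Am by (simp add: ennreal_mult')
  show "integrable M (\<lambda>\<omega>. \<bar>f i (X N (Suc i) \<omega>)\<bar> powr p)"
    "expectation (\<lambda>\<omega>. \<bar>f i (X N (Suc i) \<omega>)\<bar> powr p) \<le> (A * \<kappa>) powr p"
    using integrable_of_nn_integral_le[OF m _ 1] by auto
  show "expectation (\<lambda>\<omega>. f i (X N (Suc i) \<omega>)) = 0" by (rule zero)
qed

lemma apply_bcontfun_le_norm: "\<bar>apply_bcontfun e s\<bar> \<le> norm e" for e :: "unit_interval \<Rightarrow>\<^sub>C real"
  using norm_bounded[of e s] by simp

lemma adapted_value: "mix.adapted N (\<lambda>i \<omega>. apply_bcontfun (X N (Suc i) \<omega>) s)"
  by (rule adapted_coord) (rule apply_bcontfun_measurable)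

lemma moments_value: "mix.moments_le p \<kappa> (\<lambda>i \<omega>. apply_bcontfun (X N (Suc i) \<omega>) s)"
  using moments_coord[of "\<lambda>i e. apply_bcontfun e s" 1 N]
  by (simp add: apply_bcontfun_measurable apply_bcontfun_le_norm X_centered)

lemma integrable_value: "integrable M (\<lambda>\<omega>. apply_bcontfun (X N (Suc i) \<omega>) s)"
  using mix.moments_le_integrable[OF adapted_value moments_value] p by simp

lemma adapted_diff: "mix.adapted N (\<lambda>i \<omega>. apply_bcontfun (X N (Suc i) \<omega>) t - apply_bcontfun (X N (Suc i) \<omega>) s)"
  by (rule adapted_coord[of "\<lambda>i e. apply_bcontfun e t - apply_bcontfun e s"])
    (intro borel_measurable_diff apply_bcontfun_measurable)

text \<open>Differences in space form a centred array of their own, with \<open>p\<close>-norm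
  reduced by \<open>\<bar>real_of_ui t - real_of_ui s\<bar> powr r\<close>. Rectangle increments of
  the process are time increments of this array.\<close>

lemma moments_diff:
  assumes st: "s \<noteq> t"
  shows "mix.moments_le p (\<kappa> * \<bar>real_of_ui t - real_of_ui s\<bar> powr r) (\<lambda>i \<omega>. apply_bcontfun (X N (Suc i) \<omega>) t - apply_bcontfun (X N (Suc i) \<omega>) s)"
  unfolding mix.moments_le_def
proof (intro allI conjI)
  fix i
  define d where "d = \<bar>real_of_ui t - real_of_ui s\<bar> powr r"
  have d: "d > 0" using st by (auto simp: d_def real_of_ui_inject)
  let ?f = "\<lambda>e :: unit_interval \<Rightarrow>\<^sub>C real. apply_bcontfun e t - apply_bcontfun e s"
  have f: "?f \<in> borel_measurable borel" by (intro borel_measurable_diff apply_bcontfun_measurable)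
  have m: "(\<lambda>\<omega>. \<bar>?f (X N (Suc i) \<omega>)\<bar> powr p) \<in> borel_measurable M"
    using coord_measurable[OF f] by measurable
  have Am: "(\<kappa> * d) powr p = d powr p * H" using d \<kappa> by (simp add: powr_mult mult.commute)
  have mult: "ennreal (\<bar>?f (X N (Suc i) \<omega>)\<bar> powr p) = ennreal (d powr p) * ennreal (\<bar>?f (X N (Suc i) \<omega>) / d\<bar> powr p)" for \<omega>
  proof -
    have "\<bar>?f (X N (Suc i) \<omega>)\<bar> = d * \<bar>?f (X N (Suc i) \<omega>) / d\<bar>" using d by (simp add: abs_divide)
    hence "\<bar>?f (X N (Suc i) \<omega>)\<bar> powr p = d powr p * \<bar>?f (X N (Suc i) \<omega>) / d\<bar> powr p"
      using d by (metis abs_ge_zero less_imp_le powr_mult)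
    thus ?thesis by (simp add: ennreal_mult')
  qed
  have "(\<integral>\<^sup>+\<omega>. ennreal (\<bar>?f (X N (Suc i) \<omega>)\<bar> powr p) \<partial>M) = ennreal (d powr p) * (\<integral>\<^sup>+\<omega>. ennreal (\<bar>?f (X N (Suc i) \<omega>) / d\<bar> powr p) \<partial>M)"
    unfolding mult by (rule nn_integral_cmult) (use coord_measurable[OF f] in measurable)
  also have "(\<integral>\<^sup>+\<omega>. ennreal (\<bar>?f (X N (Suc i) \<omega>) / d\<bar> powr p) \<partial>M) \<le> (\<integral>\<^sup>+\<omega>. enn_powr (hoelder_seminorm r (X N (Suc i) \<omega>)) p \<partial>M)"
  proof (rule nn_integral_mono)
    fix \<omega>
    let ?e = "X N (Suc i) \<omega>"
    show "ennreal (\<bar>?f ?e / d\<bar> powr p) \<le> enn_powr (hoelder_seminorm r ?e) p"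
    proof (cases "hoelder_seminorm r ?e = \<infinity>")
      case False
      hence "hoelder_seminorm r ?e < \<infinity>" by (simp add: less_top)
      from hoelder_seminorm_bound[OF this r, of t s]
      have "\<bar>?f ?e / d\<bar> \<le> enn2real (hoelder_seminorm r ?e)" using d by (simp add: d_def[symmetric] abs_divide pos_divide_le_eq)
      hence "\<bar>?f ?e / d\<bar> powr p \<le> enn2real (hoelder_seminorm r ?e) powr p" using p by (intro powr_mono2) auto
      thus ?thesis using False by (simp add: enn_powr_def ennreal_leI)
    qed (simp add: enn_powr_def)
  qed
  also have "\<dots> \<le> ennreal H" by (rule seminorm_moment) simp
  finally have 1: "(\<integral>\<^sup>+\<omega>. ennreal (\<bar>?f (X N (Suc i) \<omega>)\<bar> powr p) \<partial>M) \<le> ennreal ((\<kappa> * d) powr p)"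
    unfolding Am by (simp add: ennreal_mult' mult_left_mono)
  show "integrable M (\<lambda>\<omega>. \<bar>?f (X N (Suc i) \<omega>)\<bar> powr p)"
    "expectation (\<lambda>\<omega>. \<bar>?f (X N (Suc i) \<omega>)\<bar> powr p) \<le> (\<kappa> * \<bar>real_of_ui t - real_of_ui s\<bar> powr r) powr p"
    using integrable_of_nn_integral_le[OF m _ 1] by (auto simp: d_def)
  show "expectation (\<lambda>\<omega>. ?f (X N (Suc i) \<omega>)) = 0"
    using integrable_value X_centered[of "Suc i"] by simp
qed

lemma edge_partial_sum:
  "lincomb (edge_list x y) (eval (P N \<omega>)) =
    (\<Sum>i<N. (clamp01 (real N * real_of_ui y - real i) - clamp01 (real N * real_of_ui x - real i)) * apply_bcontfun (X N (Suc i) \<omega>) ui0) / sqrt N"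
  by (simp add: edge_list_def eval_partial_sum_process left_diff_distrib sum_subtractf diff_divide_distrib)

lemma rect_partial_sum:
  "lincomb (rect_list x y s t) (eval (P N \<omega>)) =
    (\<Sum>i<N. (clamp01 (real N * real_of_ui y - real i) - clamp01 (real N * real_of_ui x - real i)) *
      (apply_bcontfun (X N (Suc i) \<omega>) t - apply_bcontfun (X N (Suc i) \<omega>) s)) / sqrt N"
  by (simp add: rect_list_def eval_partial_sum_process left_diff_distrib right_diff_distrib sum_subtractf diff_divide_distrib)

text \<open>One bound on time increments is applied twice: to the values at \<open>ui0\<close> with
  constant \<kappa>, and to the differences in space with \<kappa> reduced by the space increment.
  Row \<open>0\<close> is separate, its process being zero.\<close>

lemma partial_sum_moments:
  assumes k: "k > 0" "real (2 * k) < p"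
  shows "\<exists>C\<ge>0. \<forall>N. process_moments M k r C (\<lambda>\<omega>. eval (P N \<omega>))"
proof -
  from mix.increment_moment[OF k(2,1)] obtain C where C: "C \<ge> 0" and inc: "\<forall>N Y \<kappa> (n::nat) x y. mix.adapted N Y \<longrightarrow> mix.moments_le p \<kappa> Y \<longrightarrow> \<kappa> > 0 \<longrightarrow> n > 0 \<longrightarrow> real_of_ui x < real_of_ui y \<longrightarrow>
    power_moment_le M (2 * k) (\<lambda>\<omega>. (\<Sum>i<n. (clamp01 (real n * real_of_ui y - real i) - clamp01 (real n * real_of_ui x - real i)) * Y i \<omega>) / sqrt n)
      (C * \<kappa> ^ (2 * k) * (real_of_ui y - real_of_ui x) ^ k)" unfolding power_moment_le_def by blast
  have C': "0 \<le> C * \<kappa> ^ (2 * k)" using C by simp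
  have zero: "power_moment_le M (2 * k) (\<lambda>\<omega>. v / sqrt (real 0)) D" if "D \<ge> 0" for v D
    using that k by (simp add: power_moment_le_def power_0_left)
  show ?thesis
    unfolding process_moments_def
  proof (intro exI[of _ "C * \<kappa> ^ (2 * k)"] conjI allI impI C')
    fix N x y s t assume xy: "real_of_ui x < real_of_ui y"
    have pos: "0 \<le> C * \<kappa> ^ (2 * k) * (real_of_ui y - real_of_ui x) ^ k"
      by (rule mult_nonneg_nonneg[OF C']) (use xy in simp)
    show "power_moment_le M (2 * k) (\<lambda>\<omega>. lincomb (edge_list x y) (eval (P N \<omega>))) (C * \<kappa> ^ (2 * k) * (real_of_ui y - real_of_ui x) ^ k)"
    proof (cases "N = 0")
      case True
      thus ?thesis unfolding edge_partial_sum using zero[OF pos, of 0] by simp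
    next
      case False
      hence "N > 0" by simp
      from inc[rule_format, OF adapted_value moments_value \<kappa>(1) this xy] show ?thesis unfolding edge_partial_sum .
    qed
    assume st: "real_of_ui s < real_of_ui t"
    hence "s \<noteq> t" by auto
    note md = moments_diff[OF this]
    have \<kappa>d: "\<kappa> * \<bar>real_of_ui t - real_of_ui s\<bar> powr r > 0" using \<kappa>(1) st by simp
    have pw: "C * (\<kappa> * \<bar>real_of_ui t - real_of_ui s\<bar> powr r) ^ (2 * k) * (real_of_ui y - real_of_ui x) ^ k
      = C * \<kappa> ^ (2 * k) * (real_of_ui y - real_of_ui x) ^ k * (real_of_ui t - real_of_ui s) powr (real (2 * k) * r)"
    proof -
      have "(\<bar>real_of_ui t - real_of_ui s\<bar> powr r) ^ (2 * k) = (\<bar>real_of_ui t - real_of_ui s\<bar> powr r) powr real (2 * k)"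
        by (rule powr_realpow[symmetric]) (use st in simp)
      also have "\<dots> = (real_of_ui t - real_of_ui s) powr (real (2 * k) * r)"
        using st by (simp add: powr_powr mult.commute)
      finally show ?thesis by (simp only: power_mult_distrib mult_ac)
    qed
    show "power_moment_le M (2 * k) (\<lambda>\<omega>. lincomb (rect_list x y s t) (eval (P N \<omega>)))
       (C * \<kappa> ^ (2 * k) * (real_of_ui y - real_of_ui x) ^ k * (real_of_ui t - real_of_ui s) powr (real (2 * k) * r))"
    proof (cases "N = 0")
      case True
      thus ?thesis unfolding rect_partial_sum using zero[OF mult_nonneg_nonneg[OF pos powr_ge_zero], of 0] by simp
    next
      case False
      hence "N > 0" by simp
      from inc[rule_format, OF adapted_diff md \<kappa>d this xy] show ?thesis unfolding rect_partial_sum pw .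
    qed
  qed
qed

text \<open>The total contribution of one element to a linear combination of values of the process,
  before division by \<open>sqrt N\<close>. The weights depend on \<open>N\<close>, so a triangular
  array arises even from a single time series.\<close>

definition summand :: "(real \<times> unit_interval \<times> unit_interval) list \<Rightarrow> nat \<Rightarrow> nat \<Rightarrow> (unit_interval \<Rightarrow>\<^sub>C real) \<Rightarrow> real" where
  "summand xs N i e = lincomb xs (\<lambda>(x, s). clamp01 (real N * real_of_ui x - real i) * apply_bcontfun e s)"

lemma lincomb_partial_sum: "lincomb xs (eval (P N \<omega>)) = (\<Sum>i<N. summand xs N i (X N (Suc i) \<omega>)) / sqrt N"
proof (induction xs)
  case (Cons p xs)
  obtain a x s where p: "p = (a, x, s)" by (cases p)
  show ?case unfolding p lincomb_simps Cons eval_partial_sum_process summand_def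
    by (simp add: sum.distrib sum_distrib_left add_divide_distrib mult.assoc)
qed (simp add: summand_def)

lemma summand_measurable: "summand xs N i \<in> borel_measurable borel"
  unfolding summand_def[abs_def]
proof (rule lincomb_measurable)
  fix z :: "unit_interval \<times> unit_interval"
  show "(\<lambda>e. case z of (x, s) \<Rightarrow> clamp01 (real N * real_of_ui x - real i) * apply_bcontfun e s) \<in> borel_measurable borel"
    by (cases z) (simp add: borel_measurable_times apply_bcontfun_measurable)
qed

lemma summand_adapted: "mix.adapted N (\<lambda>i \<omega>. summand xs N i (X N (Suc i) \<omega>))"
  by (rule adapted_coord) (rule summand_measurable)

lemma summand_moments:
  "mix.moments_le p (((\<Sum>(a, t)\<leftarrow>xs. \<bar>a\<bar>) + 1) * \<kappa>) (\<lambda>i \<omega>. summand xs N i (X N (Suc i) \<omega>))"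
proof (rule moments_coord[OF summand_measurable])
  have A: "0 \<le> (\<Sum>(a, t)\<leftarrow>xs. \<bar>a\<bar>)" by (rule sum_list_nonneg) auto
  thus "0 < (\<Sum>(a, t)\<leftarrow>xs. \<bar>a\<bar>) + 1" by linarith
  fix i :: nat
  show "\<bar>summand xs N i e\<bar> \<le> ((\<Sum>(a, t)\<leftarrow>xs. \<bar>a\<bar>) + 1) * norm e" for e
  proof -
    have "\<bar>case z of (x, s) \<Rightarrow> clamp01 (real N * real_of_ui x - real i) * apply_bcontfun e s\<bar> \<le> norm e" for z
    proof (cases z)
      case (Pair x s)
      have "\<bar>clamp01 (real N * real_of_ui x - real i) * apply_bcontfun e s\<bar> \<le> 1 * norm e"
        unfolding abs_mult by (intro mult_mono apply_bcontfun_le_norm) (auto simp: clamp01_bounds)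
      thus ?thesis by (simp add: Pair)
    qed
    from abs_lincomb_le[OF this] have "\<bar>summand xs N i e\<bar> \<le> (\<Sum>(a, t)\<leftarrow>xs. \<bar>a\<bar>) * norm e" unfolding summand_def .
    thus ?thesis by (simp add: distrib_right add_increasing2)
  qed
  have "integrable M (\<lambda>\<omega>. case z of (x, s) \<Rightarrow> clamp01 (real N * real_of_ui x - real i) * apply_bcontfun (X N (Suc i) \<omega>) s)" for z
    using integrable_value by (cases z) simp
  hence "expectation (\<lambda>\<omega>. summand xs N i (X N (Suc i) \<omega>)) = lincomb xs (\<lambda>z. expectation (\<lambda>\<omega>. case z of (x, s) \<Rightarrow> clamp01 (real N * real_of_ui x - real i) * apply_bcontfun (X N (Suc i) \<omega>) s))"
    unfolding summand_def by (rule integral_lincomb(2))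
  also have "\<dots> = lincomb xs (\<lambda>z. 0)"
    by (rule lincomb_cong) (auto simp: X_centered)
  also have "\<dots> = 0" by (induction xs) auto
  finally show "expectation (\<lambda>\<omega>. summand xs N i (X N (Suc i) \<omega>)) = 0" .
qed

lemma summand_const_pos: "0 < ((\<Sum>(a, t)\<leftarrow>xs. \<bar>a\<bar>) + 1) * \<kappa>"
proof -
  have "0 \<le> (\<Sum>(a, t)\<leftarrow>xs. \<bar>a\<bar>)" by (rule sum_list_nonneg) auto
  thus ?thesis using \<kappa> by simp
qed

lemma partial_sum_measurable: "(\<lambda>\<omega>. eval (P N \<omega>) z) \<in> borel_measurable M"
proof -
  have "(\<lambda>\<omega>. (\<Sum>i<N. summand [(1, z)] N i (X N (Suc i) \<omega>)) / sqrt N) \<in> borel_measurable M"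
    using coord_measurable[OF summand_measurable] by measurable
  thus ?thesis unfolding lincomb_partial_sum[symmetric] by simp
qed

lemma integrable_lincomb_square: "integrable M (\<lambda>\<omega>. (lincomb xs (eval (P N \<omega>)))\<^sup>2)"
proof -
  have "real 2 < p" using p by simp
  then obtain C where "\<And>N Y I \<kappa>. mix.adapted N Y \<Longrightarrow> mix.moments_le p \<kappa> Y \<Longrightarrow> \<kappa> > 0 \<Longrightarrow> finite I \<Longrightarrow>
      integrable M (\<lambda>\<omega>. (\<Sum>i\<in>I. Y i \<omega>)\<^sup>2) \<and>
      expectation (\<lambda>\<omega>. (\<Sum>i\<in>I. Y i \<omega>)\<^sup>2) \<le> C * \<kappa>\<^sup>2 * real (card I) ^ (2 div 2)"
    by (rule mix.moment_sum_le) blast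
  from this[OF summand_adapted summand_moments summand_const_pos, of "{..<N}" xs N]
  show ?thesis unfolding lincomb_partial_sum by (simp add: power_divide)
qed

text \<open>Polarisation, from the squares of linear combinations.\<close>

lemma integrable_product: "integrable M (\<lambda>\<omega>. eval (P N \<omega>) s * eval (P N \<omega>) t)"
proof -
  have "integrable M (\<lambda>\<omega>. (eval (P N \<omega>) s + eval (P N \<omega>) t)\<^sup>2 / 2 - (eval (P N \<omega>) s)\<^sup>2 / 2 - (eval (P N \<omega>) t)\<^sup>2 / 2)"
    using integrable_lincomb_square[of "[(1, s), (1, t)]" N] integrable_lincomb_square[of "[(1, s)]" N] integrable_lincomb_square[of "[(1, t)]" N]
    by simp
  moreover have "(u + v)\<^sup>2 / 2 - u\<^sup>2 / 2 - v\<^sup>2 / 2 = u * v" for u v :: real by (simp add: power2_eq_square algebra_simps)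
  ultimately show ?thesis by simp
qed

text \<open>Off the exceptional event all dyadic increments are bounded. Chaining bounds the values
  at dyadic points, and continuity of the piecewise linear paths extends this to the whole
  square.\<close>

lemma partial_sum_tight:
  assumes k: "k > 0" "real (2 * k) < p" and \<theta>: "real (2 * k) * \<theta> < real (2 * k) / 2 - 1" "\<theta> > 0" 
    and \<gamma>: "real (2 * k) * \<gamma> < real (2 * k) * r - 1" "\<gamma> > 0"
  shows "hoelder_tight \<theta> \<gamma> M P"
proof -
  from partial_sum_moments[OF k] obtain C where C: "C \<ge> 0" and mom: "\<forall>N. process_moments M k r C (\<lambda>\<omega>. eval (P N \<omega>))" by blast
  obtain B where B: "B \<ge> 0" and box': "\<forall>g R. R \<ge> 0 \<longrightarrow> (\<forall>s\<in>dyadics. g 0 s = 0) \<longrightarrow> increments_event \<theta> \<gamma> R g \<longrightarrow> g \<in> dyadic_box \<theta> \<gamma> (B * R)"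
    using increments_event_box[OF \<theta>(2) \<gamma>(2)] by blast
  define S where "S = increments_const (2 * k) r \<theta> \<gamma>"
  have S: "S \<ge> 0" unfolding S_def by (rule increments_const_nonneg)
  have ev: "\<exists>A\<in>sets M. prob A \<le> S * C / R ^ (2 * k) \<and>
    (\<forall>\<omega>\<in>space M - A. increments_event \<theta> \<gamma> R (on_reals (eval (P N \<omega>))))" if "R > 0" for R N
    unfolding S_def
    by (rule increments_event_prob[OF _ _ \<theta>(1) \<gamma>(1) prob_space_axioms that C partial_sum_measurable
          process_moments_dyadic[OF mom[rule_format]]]) (use k in auto)
  show ?thesis
    unfolding hoelder_tight_def
  proof (intro allI impI)
    fix \<eta> :: real assume \<eta>: "\<eta> > 0"
    obtain R where R: "R > 0" "S * C / R ^ (2 * k) \<le> \<eta>"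
      by (rule exists_power_ge[of "S * C" \<eta> "2 * k"]) (use S C k \<eta> in auto)
    show "\<exists>R\<ge>0. \<forall>n. \<exists>A\<in>sets M. prob A \<le> \<eta> \<and> (\<forall>\<omega>\<in>space M - A. P n \<omega> \<in> hoelder_box \<theta> \<gamma> R)"
    proof (intro exI[of _ "B * R"] conjI allI)
      show BR: "0 \<le> B * R" using B R by simp
      fix N
      obtain A where A: "A \<in> sets M" "prob A \<le> S * C / R ^ (2 * k)" "\<forall>\<omega>\<in>space M - A. increments_event \<theta> \<gamma> R (on_reals (eval (P N \<omega>)))"
        using ev[OF R(1)] by blast
      show "\<exists>A\<in>sets M. prob A \<le> \<eta> \<and> (\<forall>\<omega>\<in>space M - A. P N \<omega> \<in> hoelder_box \<theta> \<gamma> (B * R))"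
      proof (intro bexI[of _ A] conjI ballI A(1))
        show "prob A \<le> \<eta>" using A(2) R(2) by linarith
        fix \<omega> assume w: "\<omega> \<in> space M - A"
        have "P N \<omega> \<in> hoelder_space 0" by (rule partial_sum_process_hoelder) auto
        hence cont: "continuous_on UNIV (P N \<omega>)" by (simp add: hoelder_space_def)
        have z: "\<forall>s\<in>dyadics. on_reals (eval (P N \<omega>)) 0 s = 0"
        proof
          fix s :: real assume "s \<in> dyadics"
          have "real_of_ui (ui_of_real 0) = 0" by (rule real_of_ui_of_real) auto
          hence "clamp01 (real N * real_of_ui (ui_of_real 0) - real i) = 0" for i by (simp add: clamp01_def)
          thus "on_reals (eval (P N \<omega>)) 0 s = 0" by (simp add: on_reals_def eval_partial_sum_process)
        qed
        have "on_reals (eval (P N \<omega>)) \<in> dyadic_box \<theta> \<gamma> (B * R)"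
          by (rule box'[rule_format]) (use R(1) z A(3) w in auto)
        hence "(\<lambda>x s. apply_bcontfun (P N \<omega> (ui_of_real x)) (ui_of_real s)) \<in> dyadic_box \<theta> \<gamma> (B * R)"
          by (simp add: on_reals_def[abs_def] eval_def)
        from hoelder_box_of_dyadic[OF cont \<theta>(2) \<gamma>(2) BR this] show "P N \<omega> \<in> hoelder_box \<theta> \<gamma> (B * R)" .
      qed
    qed
  qed
qed

context
  fixes K :: "unit_interval \<times> unit_interval \<Rightarrow> unit_interval \<times> unit_interval \<Rightarrow> real"
  assumes cov_lim: "\<And>s t. (\<lambda>N. expectation (\<lambda>\<omega>. eval (P N \<omega>) s * eval (P N \<omega>) t)) \<longlonglongrightarrow> K s t"
begin

lemma variance_lim: "(\<lambda>N. expectation (\<lambda>\<omega>. (lincomb xs (eval (P N \<omega>)))\<^sup>2)) \<longlonglongrightarrow> quadform K xs"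
proof -
  have "expectation (\<lambda>\<omega>. (lincomb xs (eval (P N \<omega>)))\<^sup>2)
      = lincomb xs (\<lambda>s. lincomb xs (\<lambda>t. expectation (\<lambda>\<omega>. eval (P N \<omega>) s * eval (P N \<omega>) t)))" for N
  proof -
    have 1: "integrable M (\<lambda>\<omega>. lincomb xs (\<lambda>t. eval (P N \<omega>) s * eval (P N \<omega>) t))" for s
      by (rule integral_lincomb(1)) (rule integrable_product)
    have 2: "expectation (\<lambda>\<omega>. lincomb xs (\<lambda>t. eval (P N \<omega>) s * eval (P N \<omega>) t)) = lincomb xs (\<lambda>t. expectation (\<lambda>\<omega>. eval (P N \<omega>) s * eval (P N \<omega>) t))" for s
      by (rule integral_lincomb(2)) (rule integrable_product)
    show ?thesis unfolding lincomb_square quadform_lincomb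
      by (subst integral_lincomb(2)[OF 1]) (simp only: 2)
  qed
  thus ?thesis unfolding quadform_lincomb by (simp only:) (intro tendsto_lincomb cov_lim)
qed

text \<open>Quadratic forms of \<open>K\<close> are limits of second moments of linear
  combinations.\<close>

lemma psd_limit: "psd_kernel K"
proof (rule psd_kernel_of_quadform)
  show "K s t = K t s" for s t
    using LIMSEQ_unique[OF cov_lim[of s t] cov_lim[of t s, unfolded mult.commute[of "eval _ t"]]] .
  show "0 \<le> quadform K xs" for xs
    by (rule LIMSEQ_le_const[OF variance_lim]) auto
qed

lemma cis_lim: "(\<lambda>N. expectation (\<lambda>\<omega>. cis (lincomb xs (eval (P N \<omega>))))) \<longlonglongrightarrow> exp (- quadform K xs / 2)"
  unfolding lincomb_partial_sum
  by (rule mix.central_limit_mixing[of "\<lambda>n. n", OF summand_adapted summand_moments p summand_const_pos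
        variance_lim[unfolded lincomb_partial_sum]])

text \<open>The bounds of second moments of the partial sums, the case \<open>k = 1\<close>, pass to
  the limit kernel; higher moments of the Gaussian limit then come from normality. Tightness of the
  partial sums uses moments of the given order \<open>2 * k\<close>.\<close>

lemma limit_process:
  assumes k: "k > 0" "real (2 * k) < p" and \<theta>: "real (2 * k) * \<theta> < real (2 * k) / 2 - 1" "\<theta> > 0" 
    and \<gamma>: "real (2 * k) * \<gamma> < real (2 * k) * r - 1" "\<gamma> > 0" and \<beta>: "0 \<le> \<beta>" "\<beta> < \<theta>" "\<beta> < 1"
    and Kc: "continuous_on UNIV (\<lambda>(t, u). K t u)"
  shows "\<exists>M' :: (unit_interval \<Rightarrow> (unit_interval \<Rightarrow>\<^sub>C real)) measure. prob_space M' \<and>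
    centered_gaussian_process_with_covariance M' (\<lambda>t f. eval f t) K \<and>
    converges_in_distribution (hoelder_metric \<beta>) M P M' (\<lambda>f. f)"
proof -
  have "real (2 * 1) < p" using p by simp
  from partial_sum_moments[OF zero_less_one this] obtain C where C: "C \<ge> 0"
    and mom: "\<forall>N. process_moments M 1 r C (\<lambda>\<omega>. eval (P N \<omega>))" by blast
  have edge: "quadform K (edge_list x y) \<le> C * (real_of_ui y - real_of_ui x)" if "real_of_ui x < real_of_ui y" for x y
    by (rule LIMSEQ_le_const2[OF variance_lim]) (use mom that in \<open>auto simp: process_moments_def power_moment_le_def\<close>)
  have rect: "quadform K (rect_list x y s t) \<le> C * (real_of_ui y - real_of_ui x) * (real_of_ui t - real_of_ui s) powr (2 * r)"
    if "real_of_ui x < real_of_ui y" "real_of_ui s < real_of_ui t" for x y s t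
    by (rule LIMSEQ_le_const2[OF variance_lim]) (use mom that in \<open>auto simp: process_moments_def power_moment_le_def\<close>)
  have K0: "K (ui0, s) (ui0, s) = 0" for s
  proof -
    have "real_of_ui ui0 = 0" unfolding ui0_def by (rule real_of_ui_of_real) auto
    hence "clamp01 (real N * real_of_ui ui0 - real i) = 0" for i N by (simp add: clamp01_def)
    hence "(\<lambda>N. expectation (\<lambda>\<omega>. eval (P N \<omega>) (ui0, s) * eval (P N \<omega>) (ui0, s))) = (\<lambda>_. 0)"
      by (simp add: eval_partial_sum_process)
    thus ?thesis using cov_lim[of "(ui0, s)" "(ui0, s)"] by (simp add: LIMSEQ_const_iff)
  qed
  obtain M' :: "(unit_interval \<Rightarrow> (unit_interval \<Rightarrow>\<^sub>C real)) measure"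
    where M': "prob_space M'" "(\<lambda>f. f) \<in> measurable M' (borel_of_metric (hoelder_metric \<beta>))"
      "\<And>t. (\<lambda>f. eval f t) \<in> borel_measurable M'"
      "\<And>xs. integral\<^sup>L M' (\<lambda>f. cis (lincomb xs (eval f))) = exp (- quadform K xs / 2)"
      "hoelder_tight \<theta> \<gamma> M' (\<lambda>_ f. f)"
    using exists_hoelder_gaussian[OF psd_limit Kc k(1) \<theta> \<gamma> \<beta> C K0 edge rect] by blast
  interpret M': prob_space M' by (rule M'(1))
  show ?thesis
  proof (intro exI[of _ M'] conjI M'(1))
    show "centered_gaussian_process_with_covariance M' (\<lambda>t f. eval f t) K"
      by (rule M'.centered_gaussian_of_cis)
        (use M'(3,4) psd_limit in \<open>auto simp: psd_kernel_def\<close>)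
    show "converges_in_distribution (hoelder_metric \<beta>) M P M' (\<lambda>f. f)"
    proof (rule converges_in_distribution_hoelder[OF prob_space_axioms M'(1) \<beta> \<gamma>(2) _ _ M'(2) _ partial_sum_tight[OF k \<theta> \<gamma>] M'(5)])
      show "P N \<omega> \<in> hoelder_space \<beta>" for N \<omega> by (rule partial_sum_process_hoelder[OF \<beta>(1,3)])
      show "(\<lambda>\<omega>. apply_bcontfun (P N \<omega> x) s) \<in> borel_measurable M" for N x s
        using partial_sum_measurable[of N "(x, s)"] by (simp add: eval_def)
      show "(\<lambda>f. apply_bcontfun (f x) s) \<in> borel_measurable M'" for x s
        using M'(3)[of "(x, s)"] by (simp add: eval_def)
      show "(\<lambda>n. expectation (\<lambda>\<omega>. cis (lincomb xs (eval (P n \<omega>))))) \<longlonglongrightarrow> integral\<^sup>L M' (\<lambda>f. cis (lincomb xs (eval f)))" for xs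
        unfolding M'(4) by (rule cis_lim)
    qed
  qed
qed

end

end

theorem theorem2p10:
  fixes M :: "'a measure"
    and \<epsilon> :: "nat \<Rightarrow> nat \<Rightarrow> 'a \<Rightarrow> (unit_interval \<Rightarrow>\<^sub>C real)"
      (* \<epsilon> N n is the n-th element of the N-th row; a single time series is the
         case where it does not depend on N *)
    and q :: nat and p r a b \<beta> :: real
    and c :: "unit_interval \<Rightarrow> unit_interval \<Rightarrow> unit_interval \<Rightarrow> unit_interval \<Rightarrow> real"
  assumes prob: "prob_space M"
    and random_elements: "\<And>N n. N \<ge> 1 \<Longrightarrow> n \<ge> 1 \<Longrightarrow> \<epsilon> N n \<in> measurable M borel"
    and centered: "\<And>N n s. N \<ge> 1 \<Longrightarrow> n \<ge> 1 \<Longrightarrow> (\<integral>\<omega>. apply_bcontfun (\<epsilon> N n \<omega>) s \<partial>M) = 0"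
    and q_even: "even q"
    and p_gt_q: "p > real q"
    and r: "0 < r" "r < 1/2"
    and q_gt_r: "real q > 1 + 1 / r"
    and moment:
      "(SUP N\<in>{1..}. SUP n\<in>{1..}. \<integral>\<^sup>+\<omega>. ennreal (norm (\<epsilon> N n \<omega>) powr p) \<partial>M) < \<infinity>"
    and hoelder_moment:
      "(SUP N\<in>{1..}. SUP n\<in>{1..}. \<integral>\<^sup>+\<omega>. enn_powr (hoelder_seminorm r (\<epsilon> N n \<omega>)) p \<partial>M) < \<infinity>"
    and ab: "a > 0" "0 < b" "b < 1"
    and mixing: "\<And>N n. N \<ge> 1 \<Longrightarrow> n \<ge> 1 \<Longrightarrow> alpha_mixing_coeff M (\<epsilon> N) n \<le> a * b ^ n"
    and c_cont: "continuous_on UNIV (\<lambda>(x, y, s, t). c x y s t)"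
    and cov_lim: "\<And>x y s t.
      (\<lambda>N. \<integral>\<omega>. apply_bcontfun (partial_sum_process N (\<lambda>n. \<epsilon> N n \<omega>) x) s *
               apply_bcontfun (partial_sum_process N (\<lambda>n. \<epsilon> N n \<omega>) y) t \<partial>M)
        \<longlonglongrightarrow> c x y s t"
    and \<beta>: "0 \<le> \<beta>" "\<beta> < 1/2"
    and q_gt_\<beta>: "real q > 1 / (1/2 - \<beta>)"
  shows "\<exists>(M' :: (unit_interval \<Rightarrow> (unit_interval \<Rightarrow>\<^sub>C real)) measure) W.
    prob_space M' \<and>
    centered_gaussian_process_with_covariance M'
      (\<lambda>(x, s) \<omega>. apply_bcontfun (W \<omega> x) s) (\<lambda>(x, s) (y, t). c x y s t) \<and>
    converges_in_distribution (hoelder_metric \<beta>)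
      M (\<lambda>N \<omega>. partial_sum_process N (\<lambda>n. \<epsilon> N n \<omega>)) M' W"
proof -
  \<comment> \<open>The hypotheses concern rows \<open>N \<ge> 1\<close>. Row \<open>0\<close> is
    replaced by row \<open>1\<close>, which leaves the partial sum process unchanged because it is
    zero for \<open>N = 0\<close>.\<close>
  define X where "X N = \<epsilon> (max 1 N)" for N
  define S where "S = (SUP N\<in>{1..}. SUP n\<in>{1..}. \<integral>\<^sup>+\<omega>. ennreal (norm (\<epsilon> N n \<omega>) powr p) \<partial>M)"
  define S' where "S' = (SUP N\<in>{1..}. SUP n\<in>{1..}. \<integral>\<^sup>+\<omega>. enn_powr (hoelder_seminorm r (\<epsilon> N n \<omega>)) p \<partial>M)"
  \<comment> \<open>A common bound for both suprema; the added one makes it positive.\<close>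
  define H where "H = enn2real S + enn2real S' + 1"
  have S: "S \<le> ennreal H" "S' \<le> ennreal H"
  proof -
    have "S = ennreal (enn2real S)" "S' = ennreal (enn2real S')"
      using moment hoelder_moment by (simp_all add: S_def S'_def less_top)
    moreover have "ennreal (enn2real S) \<le> ennreal H" "ennreal (enn2real S') \<le> ennreal H"
      by (auto intro!: ennreal_leI simp: H_def)
    ultimately show "S \<le> ennreal H" "S' \<le> ennreal H" by simp_all
  qed
  \<comment> \<open>From \<open>r < 1/2\<close>; being even, \<open>q\<close> is then at least
    \<open>4\<close>, which yields \<open>p > 4\<close>.\<close>
  have q: "real q > 3"
  proof -
    have "1 / r > 2" using r by (simp add: pos_less_divide_eq)
    thus ?thesis using q_gt_r by linarith
  qed
  obtain k where k: "q = 2 * k" using q_even by (auto elim: evenE)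
  have k2: "k \<ge> 2" using q k by linarith
  interpret hoelder_mixing M X p r a b H
  proof (intro hoelder_mixing.intro[OF prob] hoelder_mixing_axioms.intro)
    show "X N n \<in> measurable M borel" if "n \<ge> 1" for N n using random_elements that by (simp add: X_def)
    show "(\<integral>\<omega>. apply_bcontfun (X N n \<omega>) s \<partial>M) = 0" if "n \<ge> 1" for N n s using centered that by (simp add: X_def)
    show "p > 4" using p_gt_q k k2 by simp
    show "H > 0" by (simp add: H_def add_nonneg_pos)
    have "(\<integral>\<^sup>+\<omega>. ennreal (norm (X N n \<omega>) powr p) \<partial>M) \<le> S" if "n \<ge> 1" for N n
      unfolding S_def X_def by (rule SUP_upper2[of "max 1 N"]) (use that in \<open>auto intro!: SUP_upper2[of n]\<close>)
    thus "(\<integral>\<^sup>+\<omega>. ennreal (norm (X N n \<omega>) powr p) \<partial>M) \<le> ennreal H" if "n \<ge> 1" for N n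
      using S(1) that by (blast intro: order_trans)
    have "(\<integral>\<^sup>+\<omega>. enn_powr (hoelder_seminorm r (X N n \<omega>)) p \<partial>M) \<le> S'" if "n \<ge> 1" for N n
      unfolding S'_def X_def by (rule SUP_upper2[of "max 1 N"]) (use that in \<open>auto intro!: SUP_upper2[of n]\<close>)
    thus "(\<integral>\<^sup>+\<omega>. enn_powr (hoelder_seminorm r (X N n \<omega>)) p \<partial>M) \<le> ennreal H" if "n \<ge> 1" for N n
      using S(2) that by (blast intro: order_trans)
    show "alpha_mixing_coeff M (X N) n \<le> a * b ^ n" if "n \<ge> 1" for N n using mixing that by (simp add: X_def)
  qed (rule r ab)+
  have PX: "partial_sum_process N (\<lambda>n. \<epsilon> N n \<omega>) = P N \<omega>" for N \<omega>
    by (cases "N = 0") (auto simp: partial_sum_process_def X_def max_def)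
  let ?K = "\<lambda>(x, s) (y, t). c x y s t"
  have Klim: "(\<lambda>N. expectation (\<lambda>\<omega>. eval (P N \<omega>) s * eval (P N \<omega>) t)) \<longlonglongrightarrow> ?K s t" for s t
    using cov_lim unfolding PX by (cases s; cases t) (simp add: eval_def)
  have Kc: "continuous_on UNIV (\<lambda>(t, u). ?K t u)"
  proof -
    have "continuous_on UNIV (\<lambda>z :: (unit_interval \<times> unit_interval) \<times> unit_interval \<times> unit_interval.
        (\<lambda>(x, y, s, t). c x y s t) (fst (fst z), fst (snd z), snd (fst z), snd (snd z)))"
      by (rule continuous_on_compose2[OF c_cont]) (auto intro!: continuous_intros)
    thus ?thesis by (simp add: case_prod_unfold)
  qed
  \<comment> \<open>The midpoint between \<beta> and \<open>1/2 - 1 / real q\<close>, in this order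
    by the hypothesis \<open>q_gt_\<beta>\<close>. Likewise \<gamma> is the midpoint between
    \<open>0\<close> and \<open>r - 1 / real q\<close>, positive by \<open>q_gt_r\<close>.\<close>
  define \<theta> where "\<theta> = (\<beta> + (1/2 - 1 / real q)) / 2"
  define \<gamma> where "\<gamma> = (r - 1 / real q) / 2"
  have q0: "real q > 0" using q by simp
  have b1: "\<beta> < 1/2 - 1 / real q"
  proof -
    have "1 < real q * (1/2 - \<beta>)" using q_gt_\<beta> \<beta>(2) by (simp add: pos_divide_less_eq)
    hence "1 / real q < 1/2 - \<beta>" using q0 by (simp add: pos_divide_less_eq mult.commute)
    thus ?thesis by linarith
  qed
  have r1: "1 / real q < r"
  proof -
    have "1 / r < real q" using q_gt_r by linarith
    hence "1 < real q * r" using r by (simp add: pos_divide_less_eq)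
    thus ?thesis using q0 by (simp add: pos_divide_less_eq mult.commute)
  qed
  have \<theta>: "\<theta> < 1/2 - 1 / real q" "\<beta> < \<theta>" using b1 by (simp_all add: \<theta>_def)
  have \<gamma>: "\<gamma> < r - 1 / real q" "\<gamma> > 0" using r1 by (simp_all add: \<gamma>_def)
  have "real q * \<theta> < real q * (1/2 - 1 / real q)" using \<theta>(1) q0 by (rule mult_strict_left_mono)
  hence t: "real (2 * k) * \<theta> < real (2 * k) / 2 - 1" using q0 unfolding k by (simp add: right_diff_distrib)
  have "real q * \<gamma> < real q * (r - 1 / real q)" using \<gamma>(1) q0 by (rule mult_strict_left_mono)
  hence g: "real (2 * k) * \<gamma> < real (2 * k) * r - 1" using q0 unfolding k by (simp add: right_diff_distrib)
  have kp: "k > 0" "real (2 * k) < p" using k2 p_gt_q k by auto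
  have "\<theta> > 0" "\<beta> < 1" using \<theta>(2) \<beta> by linarith+
  from limit_process[OF Klim kp t this(1) g \<gamma>(2) \<beta>(1) \<theta>(2) this(2) Kc]
  obtain M' :: "(unit_interval \<Rightarrow> (unit_interval \<Rightarrow>\<^sub>C real)) measure" where M': "prob_space M'"
    "centered_gaussian_process_with_covariance M' (\<lambda>t f. eval f t) ?K"
    "converges_in_distribution (hoelder_metric \<beta>) M P M' (\<lambda>f. f)" by blast
  have ev: "(\<lambda>t f. eval f t) = (\<lambda>(x, s) f. apply_bcontfun (f x) s)" by (auto simp: eval_def fun_eq_iff)
  show ?thesis
    unfolding PX using M'(1) M'(2)[unfolded ev] M'(3) by (intro exI[of _ M'] exI[of _ "\<lambda>f. f"]) blast
qed

end
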